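(* For the Segre variety $\operatorname{Seg}\mathcal{T}_3^2\subseteq\mathcal{T}_3^2=\mathbb{C}^2\otimes\mathbb{C}^2\otimes\mathbb{C}^2$ of rank one $2\times2\times2$ tensors there hold $$\operatorname{vHDdeg}(\operatorname{Seg}\mathcal{T}_3^2)=8\qquad\text{and}\qquad\{4,6,8\}\subseteq\operatorname{HDdeg}(\operatorname{Seg}\mathcal{T}_3^2)\subseteq\{2,4,6,8\}.$$
   Context: $\mathcal{T}_3^2=\mathbb{C}^2\otimes\mathbb{C}^2\otimes\mathbb{C}^2\simeq\mathbb{C}^8$ carries the canonical Hermitian inner product, and $\operatorname{Seg}\mathcal{T}_3^2$ is the affine cone $\{\mathbf{z}^{(1)}\otimes\mathbf{z}^{(2)}\otimes\mathbf{z}^{(3)}:\mathbf{z}^{(k)}\in\mathbb{C}^2\}$. Hermitian Distance degree. For an algebraic variety $X\subseteq\mathbb{V}=\mathbb{C}^N$ and $\mathbf{u}\in\mathbb{V}$, a critical point of $q_{\mathbf{u}}\colon X\to\mathbb{R}$, $q_{\mathbf{u}}(\mathbf{z})=\|\mathbf{u}-\mathbf{z}\|_{\mathbb{C}}^2$, is a regular point $\mathbf{z}\in X$ such that $\mathbf{u}-\mathbf{z}$ is Hermitian-orthogonal to $T_{\mathbf{z}}X$. $\operatorname{HDdeg}(X)\subseteq\mathbb{N}$ is the set of all $m$ for which there is a nonempty Euclidean-open subset of $\mathbb{V}$ such that $q_{\mathbf{u}}$ has exactly $m$ critical points for every $\mathbf{u}$ in it. Virtual Hermitian Distance degree. Let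 $I_X=\langle f_1,\dots,f_s\rangle\subseteq\mathbb{C}[\mathbf{z}]$ be the ideal of $X$, $c$ the codimension of $X$, $J_{\mathbf{z}}(f)$ the $s\times N$ Jacobian matrix, $I_{X_{\mathrm{sing}}}=I_X+\langle c\text{-minors of }J_{\mathbf{z}}(f)\rangle$. Take further variables $\mathbf{w},\mathbf{u},\mathbf{v}$ ($N$ each) and let $\ast$ be the conjugate-linear ring involution of $\mathbb{C}[\mathbf{z},\mathbf{w},\mathbf{u},\mathbf{v}]$ exchanging $z_k\leftrightarrow w_k$, $u_k\leftrightarrow v_k$ and conjugating constants. Let $I_X'$ be the ideal of $(c+1)$-minors of the matrix obtained by stacking the row $\mathbf{v}-\mathbf{w}$ on top of $J_{\mathbf{z}}(f)$. The Hermitian critical ideal is the saturation $$\left(I_X+(I_X)^{\ast}+I_X'+(I_X')^{\ast}\right)\colon\left(I_{X_{\mathrm{sing}}}\cdot(I_{X_{\mathrm{sing}}})^{\ast}\right)^{\infty}.$$ For fixed $(\mathbf{u},\mathbf{v})\in\mathbb{V}^2$ it is viewed as an ideal in $\mathbb{C}[\mathbf{z},\mathbf{w}]$. $\operatorname{vHDdeg}(X)$ is the number of its solutions $(\mathbf{z},\mathbf{w})$, which is constant for $(\mathbf{u},\mathbf{v})$ in a nonempty Zariski-open subset of $\mathbb{V}^2$. *)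

theory Defs
  imports
    "HOL-Analysis.Analysis"
    "HOL-Library.Poly_Mapping"
    "Jordan_Normal_Form.Determinant"
begin

no_notation Matrix.vec_index  (infixl "$" 100)


section \<open>Polynomials in several variables\<close>

text \<open>Exponent vectors are mapped to coefficients, so this is the ring $\mathbb{C}[x_v : v \in 'v]$.\<close>

type_synonym 'v cpoly = "('v \<Rightarrow>\<^sub>0 nat) \<Rightarrow>\<^sub>0 complex"

definition Var :: "'v \<Rightarrow> 'v cpoly" where
  "Var v = Poly_Mapping.single (Poly_Mapping.single v 1) 1"

definition Const :: "complex \<Rightarrow> 'v cpoly" where
  "Const a = Poly_Mapping.single 0 a"

text \<open>The ring homomorphism that acts as \<open>\<phi>\<close> on constants and sends the variable \<open>v\<close> to \<open>x v\<close>;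
  \<open>\<phi>\<close> is always a ring homomorphism below.\<close>

definition cpoly_hom :: "(complex \<Rightarrow> 'r) \<Rightarrow> ('v \<Rightarrow> 'r) \<Rightarrow> 'v cpoly \<Rightarrow> 'r :: comm_ring_1" where
  "cpoly_hom \<phi> x p =
     (\<Sum>m \<in> Poly_Mapping.keys p. \<phi> (Poly_Mapping.lookup p m) *
        (\<Prod>v \<in> Poly_Mapping.keys m. x v ^ Poly_Mapping.lookup m v))"

abbreviation cpoly_eval :: "('v \<Rightarrow> complex) \<Rightarrow> 'v cpoly \<Rightarrow> complex" where
  "cpoly_eval \<equiv> cpoly_hom (\<lambda>a. a)"

abbreviation rename :: "('v \<Rightarrow> 'w) \<Rightarrow> 'v cpoly \<Rightarrow> 'w cpoly" where
  "rename \<sigma> \<equiv> cpoly_hom Const (\<lambda>v. Var (\<sigma> v))"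

text \<open>The subtraction of exponent vectors truncates only in terms whose coefficient is zero.\<close>

definition partial :: "'v \<Rightarrow> 'v cpoly \<Rightarrow> 'v cpoly" where
  "partial k p = (\<Sum>m \<in> Poly_Mapping.keys p.
     Poly_Mapping.single (m - Poly_Mapping.single k 1)
       (of_nat (Poly_Mapping.lookup m k) * Poly_Mapping.lookup p m))"


section \<open>Ideals and minors\<close>

definition ideal_gen :: "'r set \<Rightarrow> 'r :: comm_ring_1 set" where
  "ideal_gen S = module.span (*) S"

definition ideal_sum :: "'r set \<Rightarrow> 'r set \<Rightarrow> 'r :: comm_ring_1 set" (infixl "\<oplus>\<^sub>i" 65) where
  "I \<oplus>\<^sub>i J = {a + b | a b. a \<in> I \<and> b \<in> J}"

definition ideal_mult :: "'r set \<Rightarrow> 'r set \<Rightarrow> 'r :: comm_ring_1 set" (infixl "\<otimes>\<^sub>i" 70) where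
  "I \<otimes>\<^sub>i J = ideal_gen {a * b | a b. a \<in> I \<and> b \<in> J}"

primrec ideal_power :: "'r :: comm_ring_1 set \<Rightarrow> nat \<Rightarrow> 'r set" where
  "ideal_power I 0 = UNIV"
| "ideal_power I (Suc n) = I \<otimes>\<^sub>i ideal_power I n"

definition saturation :: "'r set \<Rightarrow> 'r set \<Rightarrow> 'r :: comm_ring_1 set" where
  "saturation I J = {f. \<exists>n. \<forall>g \<in> ideal_power J n. f * g \<in> I}"

text \<open>The \<open>m\<close>-minors of a matrix \<open>A\<close> with rows \<open>0, \<dots>, s - 1\<close> and columns indexed by the type
  \<open>'n\<close>.  As \<open>'n\<close> carries no order, each minor also occurs with its rows and columns permuted,
  i.e. up to sign, which does not affect the ideal they generate.\<close>

definition minors :: "nat \<Rightarrow> nat \<Rightarrow> (nat \<Rightarrow> 'n \<Rightarrow> 'r) \<Rightarrow> 'r :: comm_ring_1 set" where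
  "minors m s A = {Determinant.det (Matrix.mat m m (\<lambda>(i, j). A (\<rho> i) (\<kappa> j))) | \<rho> \<kappa>.
     inj_on \<rho> {..<m} \<and> \<rho> ` {..<m} \<subseteq> {..<s} \<and> inj_on \<kappa> {..<m}}"


section \<open>Affine varieties\<close>

definition zero_locus :: "'n cpoly set \<Rightarrow> (complex ^ 'n) set" where
  "zero_locus F = {z. \<forall>f \<in> F. cpoly_eval (($) z) f = 0}"

definition zariski_closed :: "(complex ^ 'n) set \<Rightarrow> bool" where
  "zariski_closed Y \<longleftrightarrow> (\<exists>F. Y = zero_locus F)"

definition irreducible_closed :: "(complex ^ 'n) set \<Rightarrow> bool" where
  "irreducible_closed Y \<longleftrightarrow> zariski_closed Y \<and> Y \<noteq> {} \<and>
     (\<forall>A B. zariski_closed A \<and> zariski_closed B \<and> Y = A \<union> B \<longrightarrow> Y = A \<or> Y = B)"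

text \<open>Krull dimension: the greatest length \<open>d\<close> of a chain
  $Y_0 \subset \dots \subset Y_d$ of irreducible closed subsets.\<close>

definition variety_dim :: "(complex ^ 'n) set \<Rightarrow> nat" where
  "variety_dim X = Sup {d. \<exists>Y :: nat \<Rightarrow> (complex ^ 'n) set.
     (\<forall>i \<le> d. irreducible_closed (Y i) \<and> Y i \<subseteq> X) \<and> (\<forall>i < d. Y i \<subset> Y (Suc i))}"

definition codim :: "(complex ^ 'n :: finite) set \<Rightarrow> nat" where
  "codim X = CARD('n) - variety_dim X"

definition vanishing_ideal :: "(complex ^ 'n :: finite) set \<Rightarrow> 'n cpoly set" where
  "vanishing_ideal X = {f. \<forall>z \<in> X. cpoly_eval (($) z) f = 0}"

text \<open>Fixed generators $f_1, \dots, f_s$ of the ideal of \<open>X\<close>; they exist by Hilbert's basis theorem.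
  The singular and critical ideals below do not depend on the choice: expressing one list of
  generators through another turns the minors into combinations of the other minors, modulo the
  ideal of \<open>X\<close>.\<close>

definition ideal_gens :: "(complex ^ 'n :: finite) set \<Rightarrow> 'n cpoly list" where
  "ideal_gens X = (SOME fs. ideal_gen (set fs) = vanishing_ideal X)"

definition jacobian :: "'n cpoly list \<Rightarrow> nat \<Rightarrow> 'n \<Rightarrow> 'n cpoly" where
  "jacobian fs i k = partial k (fs ! i)"

definition singular_ideal :: "(complex ^ 'n :: finite) set \<Rightarrow> 'n cpoly set" where
  "singular_ideal X = vanishing_ideal X \<oplus>\<^sub>i
     ideal_gen (minors (codim X) (length (ideal_gens X)) (jacobian (ideal_gens X)))"

definition regular_points :: "(complex ^ 'n :: finite) set \<Rightarrow> (complex ^ 'n) set" where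
  "regular_points X = X - zero_locus (singular_ideal X)"

definition tangent_space :: "(complex ^ 'n :: finite) set \<Rightarrow> complex ^ 'n \<Rightarrow> (complex ^ 'n) set" where
  "tangent_space X z = {t. \<forall>f \<in> vanishing_ideal X.
     (\<Sum>k \<in> UNIV. cpoly_eval (($) z) (partial k f) * t $ k) = 0}"


section \<open>Hermitian Distance degree\<close>

definition hinner :: "complex ^ 'n :: finite \<Rightarrow> complex ^ 'n \<Rightarrow> complex" where
  "hinner x y = (\<Sum>k \<in> UNIV. x $ k * cnj (y $ k))"

definition critical_points :: "(complex ^ 'n :: finite) set \<Rightarrow> complex ^ 'n \<Rightarrow> (complex ^ 'n) set" where
  "critical_points X u = {z \<in> regular_points X. \<forall>t \<in> tangent_space X z. hinner (u - z) t = 0}"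

definition HDdeg :: "(complex ^ 'n :: finite) set \<Rightarrow> nat set" where
  "HDdeg X = {m. \<exists>\<U>. open \<U> \<and> \<U> \<noteq> {} \<and>
     (\<forall>u \<in> \<U>. finite (critical_points X u) \<and> card (critical_points X u) = m)}"


section \<open>Virtual Hermitian Distance degree\<close>

text \<open>The variables $z_k, w_k, u_k, v_k$.\<close>

datatype 'n hvar = Zv 'n | Wv 'n | Uv 'n | Vv 'n

fun swap_hvar :: "'n hvar \<Rightarrow> 'n hvar" where
  "swap_hvar (Zv k) = Wv k"
| "swap_hvar (Wv k) = Zv k"
| "swap_hvar (Uv k) = Vv k"
| "swap_hvar (Vv k) = Uv k"

definition star :: "'n hvar cpoly \<Rightarrow> 'n hvar cpoly" where
  "star = cpoly_hom (\<lambda>a. Const (cnj a)) (\<lambda>x. Var (swap_hvar x))"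

text \<open>The ideal of $\mathbb{C}[z,w,u,v]$ generated by an ideal of $\mathbb{C}[z]$.\<close>

definition extend_ideal :: "'n cpoly set \<Rightarrow> 'n hvar cpoly set" where
  "extend_ideal I = ideal_gen (rename Zv ` I)"

definition stacked_jacobian :: "'n cpoly list \<Rightarrow> nat \<Rightarrow> 'n \<Rightarrow> 'n hvar cpoly" where
  "stacked_jacobian fs i k =
     (case i of 0 \<Rightarrow> Var (Vv k) - Var (Wv k) | Suc j \<Rightarrow> rename Zv (jacobian fs j k))"

definition critical_minors_ideal :: "(complex ^ 'n :: finite) set \<Rightarrow> 'n hvar cpoly set" where
  "critical_minors_ideal X = ideal_gen
     (minors (codim X + 1) (length (ideal_gens X) + 1) (stacked_jacobian (ideal_gens X)))"

definition hermitian_critical_ideal :: "(complex ^ 'n :: finite) set \<Rightarrow> 'n hvar cpoly set" where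
  "hermitian_critical_ideal X =
    (let I = extend_ideal (vanishing_ideal X);
         I' = critical_minors_ideal X;
         S = extend_ideal (singular_ideal X)
     in saturation (I \<oplus>\<^sub>i star ` I \<oplus>\<^sub>i I' \<oplus>\<^sub>i star ` I') (S \<otimes>\<^sub>i star ` S))"

fun hvar_assign ::
  "complex ^ 'n \<Rightarrow> complex ^ 'n \<Rightarrow> complex ^ 'n \<Rightarrow> complex ^ 'n \<Rightarrow> 'n hvar \<Rightarrow> complex" where
  "hvar_assign z w u v (Zv k) = z $ k"
| "hvar_assign z w u v (Wv k) = w $ k"
| "hvar_assign z w u v (Uv k) = u $ k"
| "hvar_assign z w u v (Vv k) = v $ k"

text \<open>The zeros of the ideal of $\mathbb{C}[z,w]$ obtained from the Hermitian critical ideal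
  (saturated in $\mathbb{C}[z,w,u,v]$) by specializing \<open>u\<close> and \<open>v\<close> to the given vectors.\<close>

definition critical_solutions ::
  "(complex ^ 'n :: finite) set \<Rightarrow> complex ^ 'n \<Rightarrow> complex ^ 'n \<Rightarrow> ((complex ^ 'n) \<times> (complex ^ 'n)) set" where
  "critical_solutions X u v =
     {(z, w). \<forall>g \<in> hermitian_critical_ideal X. cpoly_eval (hvar_assign z w u v) g = 0}"

definition zariski_open_pairs :: "((complex ^ 'n :: finite) \<times> (complex ^ 'n)) set \<Rightarrow> bool" where
  "zariski_open_pairs \<U> \<longleftrightarrow> (\<exists>F :: ('n + 'n) cpoly set.
     \<U> = {(u, v). \<exists>f \<in> F. cpoly_eval (case_sum (($) u) (($) v)) f \<noteq> 0})"

definition vHDdeg :: "(complex ^ 'n :: finite) set \<Rightarrow> nat" where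
  "vHDdeg X = (THE m. \<exists>\<U>. zariski_open_pairs \<U> \<and> \<U> \<noteq> {} \<and>
     (\<forall>(u, v) \<in> \<U>. finite (critical_solutions X u v) \<and> card (critical_solutions X u v) = m))"


section \<open>Rank one tensors\<close>

definition tensor3 :: "complex ^ 2 \<Rightarrow> complex ^ 2 \<Rightarrow> complex ^ 2 \<Rightarrow> complex ^ (2 \<times> 2 \<times> 2)" where
  "tensor3 x y z = (\<chi> l. case l of (i, j, k) \<Rightarrow> x $ i * y $ j * z $ k)"

definition Segre222 :: "(complex ^ (2 \<times> 2 \<times> 2)) set" where
  "Segre222 = {tensor3 x y z | x y z. True}"

end

(* Off the origin, (z, w) solves the Hermitian critical ideal iff z and w are nonzero rank one tensors
   and v - w, u - z annihilate the tangent spaces at z and w; this set is equivariant under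
   GL_2 x GL_2 x GL_2.  A generic v has two rank one summands, so v may be taken to be
   e1 e1 e1 + e2 e2 e2.  Writing z, w on the affine chart, the equations eliminate to a polynomial of
   degree 8 in one variable with simple roots, so there are 8 solutions for generic (u, v).

   For v = cnj u the map (z, w) -> (cnj w, cnj z) is an involution of the solutions whose fixed points
   are the critical points of the distance function, so their number has the parity of 8; it is
   positive because a nearest rank one tensor exists.  For the three remaining numbers, symmetric real
   tensors are chosen for which all 8 solutions are explicit and nondegenerate; these persist under
   small perturbations, and so does the number of those fixed by the involution. *)

theory Submission
  imports Defs
    "HOL-Computational_Algebra.Fundamental_Theorem_Algebra"
begin

section \<open>Polynomials as functions\<close>

text \<open>The definitions speak of an arbitrary list of generators, of Krull dimension and of a
  saturation taken before specialization, so the ideal of the cone, its dimension and the behaviour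
  over its singular point 0 must be known exactly. Two obstacles shape the rest. First, solutions
  with \<open>z = 0\<close> or \<open>w = 0\<close> have to be excluded after specialization: the
  hyperdeterminants of \<open>v - w\<close> and \<open>u - z\<close> lie in the saturation, so they
  vanish at every solution, which keeps solutions off the origin as soon as \<open>hdet v\<close>
  and \<open>hdet u\<close> are nonzero. Second, splitting \<open>v\<close> into two rank one
  summands needs a square root of \<open>hdet v\<close>. Genericity is therefore a polynomial in
  \<open>u\<close>, \<open>v\<close> and that root; its norm is a polynomial in \<open>u\<close> and
  \<open>v\<close>, and it is nonzero once one explicit pair is good for both roots. This is why two
  sample tensors are certified. The generic condition carries over to Hermitian distances because
  the pairs \<open>(u, cnjv u)\<close> are Zariski dense near every point.\<close>

definition monom_value :: "('v \<Rightarrow> 'r) \<Rightarrow> ('v \<Rightarrow>\<^sub>0 nat) \<Rightarrow> 'r :: comm_ring_1" where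
  "monom_value x m = (\<Prod>v \<in> Poly_Mapping.keys m. x v ^ Poly_Mapping.lookup m v)"

lemma monom_value_superset:
  assumes "finite V" "Poly_Mapping.keys m \<subseteq> V"
  shows "monom_value x m = (\<Prod>v \<in> V. x v ^ Poly_Mapping.lookup m v)"
  unfolding monom_value_def using assms
  by (intro prod.mono_neutral_left) (auto simp: in_keys_iff)

lemma monom_value_0 [simp]: "monom_value x 0 = 1"
  by (simp add: monom_value_def)

lemma monom_value_single: "monom_value x (Poly_Mapping.single v k) = x v ^ k"
  by (cases "k = 0") (simp_all add: monom_value_def)

lemma monom_value_add: "monom_value x (m + n) = monom_value x m * monom_value x n"
proof -
  define V where "V = Poly_Mapping.keys m \<union> Poly_Mapping.keys n"
  have V: "finite V" "Poly_Mapping.keys m \<subseteq> V" "Poly_Mapping.keys n \<subseteq> V"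
    "Poly_Mapping.keys (m + n) \<subseteq> V"
    using keys_add[of m n] by (auto simp: V_def)
  show ?thesis
    unfolding monom_value_superset[OF V(1,2)] monom_value_superset[OF V(1,3)]
      monom_value_superset[OF V(1,4)]
    by (simp add: lookup_add power_add prod.distrib)
qed

lemma cpoly_hom_superset:
  assumes "\<phi> 0 = 0" "finite M" "Poly_Mapping.keys p \<subseteq> M"
  shows "cpoly_hom \<phi> x p = (\<Sum>m\<in>M. \<phi> (Poly_Mapping.lookup p m) * monom_value x m)"
  unfolding cpoly_hom_def monom_value_def using assms
  by (intro sum.mono_neutral_left) (auto simp: in_keys_iff)

lemma cpoly_hom_single:
  assumes "\<phi> 0 = 0"
  shows "cpoly_hom \<phi> x (Poly_Mapping.single m a) = \<phi> a * monom_value x m"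
  by (subst cpoly_hom_superset[where M = "{m}"]) (auto simp: assms)

lemma poly_mapping_add_induct [case_names single add]:
  fixes p :: "'a \<Rightarrow>\<^sub>0 'b :: comm_monoid_add"
  assumes single: "\<And>m a. P (Poly_Mapping.single m a)"
    and add: "\<And>p q. P p \<Longrightarrow> P q \<Longrightarrow> P (p + q)"
  shows "P p"
proof (induction p rule: update_induct)
  case const
  show ?case using single[of undefined 0] by simp
next
  case (update p k a)
  have "Poly_Mapping.update k a p = p + Poly_Mapping.single k a"
    using update(1) by (intro poly_mapping_eqI)
      (auto simp: lookup_update lookup_add lookup_single when_def in_keys_iff)
  then show ?case using add[OF update(3) single] by simp
qed

context
  fixes \<phi> :: "complex \<Rightarrow> 'r :: comm_ring_1"
  assumes \<phi>: "comm_ring_hom \<phi>"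
begin

interpretation \<phi>: comm_ring_hom \<phi> by (rule \<phi>)

lemma cpoly_hom_add: "cpoly_hom \<phi> x (p + q) = cpoly_hom \<phi> x p + cpoly_hom \<phi> x q"
proof -
  define M where "M = Poly_Mapping.keys p \<union> Poly_Mapping.keys q"
  have M: "finite M" "Poly_Mapping.keys p \<subseteq> M" "Poly_Mapping.keys q \<subseteq> M"
    "Poly_Mapping.keys (p + q) \<subseteq> M"
    using keys_add[of p q] by (auto simp: M_def)
  show ?thesis
    unfolding cpoly_hom_superset[of \<phi>, OF \<phi>.hom_zero M(1,2)] cpoly_hom_superset[of \<phi>, OF \<phi>.hom_zero M(1,3)]
      cpoly_hom_superset[of \<phi>, OF \<phi>.hom_zero M(1,4)]
    by (simp add: lookup_add \<phi>.hom_add distrib_right sum.distrib)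
qed

lemma cpoly_hom_mult: "cpoly_hom \<phi> x (p * q) = cpoly_hom \<phi> x p * cpoly_hom \<phi> x q"
proof (induction p rule: poly_mapping_add_induct)
  case (single m a)
  show ?case
  proof (induction q rule: poly_mapping_add_induct)
    case (single n b)
    show ?case
      by (simp add: mult_single cpoly_hom_single \<phi>.hom_mult monom_value_add)
  next
    case (add p q)
    then show ?case by (simp add: distrib_left cpoly_hom_add)
  qed
next
  case (add p q)
  then show ?case by (simp add: distrib_right cpoly_hom_add)
qed

lemma cpoly_hom_Const [simp]: "cpoly_hom \<phi> x (Const a) = \<phi> a"
  by (simp add: Const_def cpoly_hom_single)

lemma cpoly_hom_Var [simp]: "cpoly_hom \<phi> x (Var v) = x v"
  by (simp add: Var_def cpoly_hom_single monom_value_single)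

lemma cpoly_hom_comm_ring_hom: "comm_ring_hom (cpoly_hom \<phi> x)"
proof
  show "cpoly_hom \<phi> x 1 = 1"
    using cpoly_hom_Const[of x 1] by (simp add: Const_def single_one)
  show "cpoly_hom \<phi> x 0 = 0"
    using cpoly_hom_Const[of x 0] by (simp add: Const_def)
qed (simp_all add: cpoly_hom_add cpoly_hom_mult)

lemma cpoly_hom_ring_simps:
  "cpoly_hom \<phi> x 0 = 0" "cpoly_hom \<phi> x 1 = 1" "cpoly_hom \<phi> x (- p) = - cpoly_hom \<phi> x p"
  "cpoly_hom \<phi> x (p - q) = cpoly_hom \<phi> x p - cpoly_hom \<phi> x q"
  "cpoly_hom \<phi> x (p + q) = cpoly_hom \<phi> x p + cpoly_hom \<phi> x q"
  "cpoly_hom \<phi> x (p * q) = cpoly_hom \<phi> x p * cpoly_hom \<phi> x q"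
  "cpoly_hom \<phi> x (p ^ n) = cpoly_hom \<phi> x p ^ n"
  "cpoly_hom \<phi> x (sum f A) = (\<Sum>a\<in>A. cpoly_hom \<phi> x (f a))"
  "cpoly_hom \<phi> x (Const c) = \<phi> c" "cpoly_hom \<phi> x (Var v) = x v"
proof -
  interpret h: comm_ring_hom "cpoly_hom \<phi> x" by (rule cpoly_hom_comm_ring_hom)
  show "cpoly_hom \<phi> x 0 = 0" "cpoly_hom \<phi> x 1 = 1" "cpoly_hom \<phi> x (- p) = - cpoly_hom \<phi> x p"
    "cpoly_hom \<phi> x (p - q) = cpoly_hom \<phi> x p - cpoly_hom \<phi> x q"
    "cpoly_hom \<phi> x (p + q) = cpoly_hom \<phi> x p + cpoly_hom \<phi> x q"
    "cpoly_hom \<phi> x (p * q) = cpoly_hom \<phi> x p * cpoly_hom \<phi> x q"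
    "cpoly_hom \<phi> x (p ^ n) = cpoly_hom \<phi> x p ^ n"
    "cpoly_hom \<phi> x (sum f A) = (\<Sum>a\<in>A. cpoly_hom \<phi> x (f a))"
    by (rule h.hom_zero h.hom_one h.hom_uminus h.hom_minus h.hom_add h.hom_mult h.hom_power h.hom_sum)+
qed simp_all

end

lemma comm_ring_hom_Const: "comm_ring_hom (Const :: complex \<Rightarrow> 'v cpoly)"
  by unfold_locales (simp_all add: Const_def single_add mult_single single_one)

lemma comm_ring_hom_Const_cnj: "comm_ring_hom (\<lambda>a. Const (cnj a) :: 'v cpoly)"
  by unfold_locales (simp_all add: Const_def single_add mult_single single_one)

lemma comm_ring_hom_ident: "comm_ring_hom (\<lambda>a :: complex. a)"
  by unfold_locales auto

lemma comm_ring_hom_const_poly: "comm_ring_hom (\<lambda>a :: complex. [:a:])"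
  by unfold_locales auto

lemma cpoly_induct [case_names Const Var add mult]:
  fixes p :: "'v cpoly"
  assumes Const: "\<And>a. P (Const a)" and Var: "\<And>v. P (Var v)"
    and add: "\<And>p q. P p \<Longrightarrow> P q \<Longrightarrow> P (p + q)" and mult: "\<And>p q. P p \<Longrightarrow> P q \<Longrightarrow> P (p * q)"
  shows "P p"
proof (induction p rule: poly_mapping_add_induct)
  case (single m a)
  have one: "P 1" using Const[of 1] by (simp add: Const_def single_one)
  have pow: "P (q ^ k)" if "P q" for q k
    using that by (induction k) (auto intro: one mult)
  have "P (Poly_Mapping.single m 1)"
  proof (induction m rule: poly_mapping_add_induct)
    case (single v k)
    have "Poly_Mapping.single (Poly_Mapping.single v k) 1 = (Var v ^ k :: 'v cpoly)"
    proof (induction k)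
      case (Suc k)
      have "Poly_Mapping.single v (Suc k) = Poly_Mapping.single v 1 + Poly_Mapping.single v k"
        by (simp flip: single_add)
      then show ?case using Suc by (metis Var_def mult_single mult_1 power_Suc)
    qed (simp add: single_one)
    then show ?case using pow[OF Var] by metis
  next
    case (add m n)
    then show ?case using mult by (metis mult_single mult_1)
  qed
  moreover have "Poly_Mapping.single m a = Const a * Poly_Mapping.single m 1"
    by (simp add: Const_def mult_single)
  ultimately show ?case using mult Const by metis
next
  case (add p q) then show ?case by (rule assms(3))
qed

lemmas cpoly_eval_simps [simp] = cpoly_hom_ring_simps[OF comm_ring_hom_ident]
lemmas rename_simps [simp] = cpoly_hom_ring_simps[OF comm_ring_hom_Const]
lemmas curve_poly_simps [simp] = cpoly_hom_ring_simps[OF comm_ring_hom_const_poly]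

text \<open>Substituting univariate polynomials turns vanishing along a parametrized curve into the
  vanishing of one polynomial; lines, joining curves and the Kronecker curve are all handled this
  way.\<close>

lemma cpoly_eval_curve:
  "cpoly_eval (\<lambda>v. poly (c v) \<tau>) p = poly (cpoly_hom (\<lambda>a. [:a:]) c p) \<tau>"
  by (induction p rule: cpoly_induct) simp_all

lemma cpoly_eval_rename: "cpoly_eval x (rename \<sigma> p) = cpoly_eval (\<lambda>v. x (\<sigma> v)) p"
  by (induction p rule: cpoly_induct) simp_all

section \<open>Derivatives\<close>

lemma partial_superset:
  assumes "finite M" "Poly_Mapping.keys p \<subseteq> M"
  shows "partial k p = (\<Sum>m\<in>M. Poly_Mapping.single (m - Poly_Mapping.single k 1)
       (of_nat (Poly_Mapping.lookup m k) * Poly_Mapping.lookup p m))"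
  unfolding partial_def using assms
  by (intro sum.mono_neutral_left) (auto simp: in_keys_iff)

lemma partial_single:
  "partial k (Poly_Mapping.single m a) =
     Poly_Mapping.single (m - Poly_Mapping.single k 1) (of_nat (Poly_Mapping.lookup m k) * a)"
  by (subst partial_superset[of "{m}"]) auto

lemma partial_add: "partial k (p + q) = partial k p + partial k q"
proof -
  define M where "M = Poly_Mapping.keys p \<union> Poly_Mapping.keys q"
  have M: "finite M" "Poly_Mapping.keys p \<subseteq> M" "Poly_Mapping.keys q \<subseteq> M"
    "Poly_Mapping.keys (p + q) \<subseteq> M"
    using keys_add[of p q] by (auto simp: M_def)
  show ?thesis
    unfolding partial_superset[OF M(1,2)] partial_superset[OF M(1,3)] partial_superset[OF M(1,4)]
    by (simp add: lookup_add distrib_left single_add sum.distrib)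
qed

lemma partial_Const [simp]: "partial k (Const a) = 0"
  by (simp add: Const_def partial_single)

lemma partial_Var [simp]: "partial k (Var v) = (if k = v then 1 else 0)"
  by (simp add: Var_def partial_single lookup_single single_one when_def)

lemma partial_mult: "partial k (p * q) = partial k p * q + p * partial k q"
proof (induction p rule: poly_mapping_add_induct)
  case (single m a)
  show ?case
  proof (induction q rule: poly_mapping_add_induct)
    case (single n b)
    let ?e = "Poly_Mapping.single k (1::nat)"
    \<comment> \<open>Truncated subtraction moves across a sum only if \<open>k\<close> occurs in
      the monomial; otherwise the factor \<open>lookup m' k\<close> makes the term zero.\<close>
    have shift: "(m' - ?e) + n' = m' + n' - ?e" if "Poly_Mapping.lookup m' k \<noteq> 0" for m' n'
      using that by (intro poly_mapping_eqI) (auto simp: lookup_add lookup_minus lookup_single when_def)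
    have 1: "Poly_Mapping.single (m - ?e + n) (of_nat (Poly_Mapping.lookup m k) * a * b) =
        Poly_Mapping.single (m + n - ?e) (of_nat (Poly_Mapping.lookup m k) * a * b)"
      using shift[of m n] by (cases "Poly_Mapping.lookup m k = 0") auto
    have 2: "Poly_Mapping.single (m + (n - ?e)) (a * (of_nat (Poly_Mapping.lookup n k) * b)) =
        Poly_Mapping.single (m + n - ?e) (a * (of_nat (Poly_Mapping.lookup n k) * b))"
      using shift[of n m] by (cases "Poly_Mapping.lookup n k = 0") (auto simp: add.commute)
    have "partial k (Poly_Mapping.single m a * Poly_Mapping.single n b) =
        Poly_Mapping.single (m + n - ?e) (of_nat (Poly_Mapping.lookup m k) * a * b)
        + Poly_Mapping.single (m + n - ?e) (a * (of_nat (Poly_Mapping.lookup n k) * b))"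
      by (simp add: mult_single partial_single lookup_add algebra_simps flip: single_add)
    then show ?case
      by (simp only: mult_single partial_single 1 2)
  next
    case (add p q)
    then show ?case by (simp add: distrib_left partial_add algebra_simps)
  qed
next
  case (add p q)
  then show ?case by (simp add: distrib_right partial_add algebra_simps)
qed

definition dir_deriv :: "('v::finite \<Rightarrow> complex) \<Rightarrow> ('v \<Rightarrow> complex) \<Rightarrow> 'v cpoly \<Rightarrow> complex" where
  "dir_deriv x t p = (\<Sum>k\<in>UNIV. cpoly_eval x (partial k p) * t k)"

lemma dir_deriv_simps [simp]:
  "dir_deriv x t (p + q) = dir_deriv x t p + dir_deriv x t q"
  "dir_deriv x t (p * q) = dir_deriv x t p * cpoly_eval x q + cpoly_eval x p * dir_deriv x t q"
  "dir_deriv x t (Const a) = 0"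
  "dir_deriv x t (Var v) = t v"
proof -
  have "(\<Sum>k\<in>UNIV. cpoly_eval x (if k = v then 1 else 0) * t k) = (\<Sum>k\<in>UNIV. if k = v then t k else 0)"
    by (intro sum.cong) auto
  then show "dir_deriv x t (Var v) = t v" by (simp add: dir_deriv_def)
qed (simp_all add: dir_deriv_def partial_add partial_mult algebra_simps sum.distrib
       sum_distrib_left sum_distrib_right)

text \<open>On the line \<open>x + \<tau> t\<close> the polynomial becomes univariate. Its value and
  its derivative at 0 are computed together, since the product rule needs both.\<close>

lemma dir_deriv_eq_0:
  assumes "\<And>\<tau>. cpoly_eval (\<lambda>v. x v + \<tau> * t v) p = 0"
  shows "dir_deriv x t p = 0"
proof -
  define h where "h = cpoly_hom (\<lambda>a. [:a:]) (\<lambda>v. [:x v, t v:])"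
  have "poly (h p) 0 = cpoly_eval x p \<and> poly (pderiv (h p)) 0 = dir_deriv x t p"
    unfolding h_def
    by (induction p rule: cpoly_induct) (simp_all add: pderiv_add pderiv_mult pderiv_pCons algebra_simps)
  moreover have "poly (h p) \<tau> = 0" for \<tau>
    using assms[of \<tau>] cpoly_eval_curve[of "\<lambda>v. [:x v, t v:]" \<tau> p] by (simp add: h_def)
  then have "h p = 0" using poly_all_0_iff_0 by blast
  ultimately show ?thesis by simp
qed

section \<open>Ideals\<close>

definition is_ideal :: "'r :: comm_ring_1 set \<Rightarrow> bool" where
  "is_ideal I \<longleftrightarrow> 0 \<in> I \<and> (\<forall>a\<in>I. \<forall>b\<in>I. a + b \<in> I) \<and> (\<forall>a\<in>I. \<forall>r. r * a \<in> I)"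

lemma is_idealD:
  assumes "is_ideal I"
  shows "0 \<in> I" "a \<in> I \<Longrightarrow> b \<in> I \<Longrightarrow> a + b \<in> I" "a \<in> I \<Longrightarrow> r * a \<in> I" "a \<in> I \<Longrightarrow> a * r \<in> I"
    "a \<in> I \<Longrightarrow> - a \<in> I" "a \<in> I \<Longrightarrow> b \<in> I \<Longrightarrow> a - b \<in> I"
proof -
  show mult: "r * a \<in> I" if "a \<in> I" for a r using assms that by (auto simp: is_ideal_def)
  show add: "a + b \<in> I" if "a \<in> I" "b \<in> I" for a b using assms that by (auto simp: is_ideal_def)
  show "0 \<in> I" using assms by (auto simp: is_ideal_def)
  show "a * r \<in> I" if "a \<in> I" for a using mult[OF that, of r] by (simp add: mult.commute)
  show uminus: "- a \<in> I" if "a \<in> I" for a using mult[OF that, of "-1"] by simp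
  show "a - b \<in> I" if "a \<in> I" "b \<in> I" using add[OF that(1) uminus[OF that(2)]] by simp
qed

lemma is_ideal_sum:
  assumes "is_ideal I" "\<And>i. i \<in> A \<Longrightarrow> f i \<in> I"
  shows "sum f A \<in> I"
  using assms(2) by (induction A rule: infinite_finite_induct) (auto intro: is_idealD[OF assms(1)])

lemma module_mult: "Modules.module ((*) :: 'r :: comm_ring_1 \<Rightarrow> 'r \<Rightarrow> 'r)"
  by unfold_locales (auto simp: algebra_simps)

lemma is_ideal_ideal_gen: "is_ideal (ideal_gen S)"
  unfolding is_ideal_def ideal_gen_def
  using Modules.module.span_zero[OF module_mult] Modules.module.span_add[OF module_mult]
    Modules.module.span_scale[OF module_mult] by blast

lemma ideal_gen_superset: "S \<subseteq> ideal_gen S"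
  unfolding ideal_gen_def using Modules.module.span_superset[OF module_mult] .

lemma ideal_gen_minimal:
  assumes "is_ideal I" "S \<subseteq> I"
  shows "ideal_gen S \<subseteq> I"
proof -
  have "Modules.module.subspace (*) I"
    using assms(1) unfolding Modules.module.subspace_def[OF module_mult] is_ideal_def by blast
  then show ?thesis unfolding ideal_gen_def using Modules.module.span_minimal[OF module_mult assms(2)] by blast
qed

lemma is_ideal_ideal_sum:
  assumes I: "is_ideal I" and J: "is_ideal J"
  shows "is_ideal (I \<oplus>\<^sub>i J)"
  unfolding is_ideal_def
proof (intro conjI ballI allI)
  show "0 \<in> I \<oplus>\<^sub>i J"
    unfolding ideal_sum_def using is_idealD(1)[OF I] is_idealD(1)[OF J] by force
  fix x assume "x \<in> I \<oplus>\<^sub>i J"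
  then obtain a b where ab: "x = a + b" "a \<in> I" "b \<in> J" by (auto simp: ideal_sum_def)
  show "r * x \<in> I \<oplus>\<^sub>i J" for r
  proof -
    have "r * x = r * a + r * b" by (simp add: ab(1) distrib_left)
    then show ?thesis
      unfolding ideal_sum_def using is_idealD(3)[OF I ab(2)] is_idealD(3)[OF J ab(3)] by blast
  qed
  fix y assume "y \<in> I \<oplus>\<^sub>i J"
  then obtain c d where cd: "y = c + d" "c \<in> I" "d \<in> J" by (auto simp: ideal_sum_def)
  have "x + y = (a + c) + (b + d)" by (simp add: ab(1) cd(1))
  then show "x + y \<in> I \<oplus>\<^sub>i J"
    unfolding ideal_sum_def using is_idealD(2)[OF I ab(2) cd(2)] is_idealD(2)[OF J ab(3) cd(3)] by blast
qed

lemma ideal_sum_superset: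
  assumes "is_ideal I" "is_ideal J"
  shows "I \<subseteq> I \<oplus>\<^sub>i J" "J \<subseteq> I \<oplus>\<^sub>i J"
  using is_idealD(1)[OF assms(1)] is_idealD(1)[OF assms(2)] unfolding ideal_sum_def by force+

lemma ideal_sum_minimal:
  assumes "is_ideal L" "I \<subseteq> L" "J \<subseteq> L"
  shows "I \<oplus>\<^sub>i J \<subseteq> L"
  using assms(2,3) is_idealD(2)[OF assms(1)] unfolding ideal_sum_def by blast

text \<open>Colon ideals, like the preimages below, reduce a claim about all elements of a generated
  ideal to its generators through \<open>ideal_gen_minimal\<close>.\<close>

lemma is_ideal_quotient: "is_ideal I \<Longrightarrow> is_ideal {f. d * f \<in> I}"
  unfolding is_ideal_def
  by (auto simp: distrib_left mult.left_commute)

lemma is_ideal_vimage: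
  assumes "comm_ring_hom h" "is_ideal I"
  shows "is_ideal {f. h f \<in> I}"
proof -
  interpret comm_ring_hom h by (rule assms(1))
  show ?thesis using assms(2) unfolding is_ideal_def by (auto simp: hom_add hom_mult)
qed

lemma is_ideal_image:
  assumes "comm_ring_hom h" "surj h" "is_ideal I"
  shows "is_ideal (h ` I)"
proof -
  interpret comm_ring_hom h by (rule assms(1))
  show ?thesis unfolding is_ideal_def
  proof (intro conjI ballI allI)
    show "0 \<in> h ` I" using is_idealD(1)[OF assms(3)] hom_zero by force
    show "a + b \<in> h ` I" if "a \<in> h ` I" "b \<in> h ` I" for a b
      using that is_idealD(2)[OF assms(3)] by (auto simp flip: hom_add)
    show "r * a \<in> h ` I" if "a \<in> h ` I" for a r
    proof -
      obtain s where "r = h s" using assms(2) by blast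
      then show ?thesis using that is_idealD(3)[OF assms(3)] by (auto simp flip: hom_mult)
    qed
  qed
qed

lemma is_ideal_zeros: "is_ideal {f. cpoly_eval x f = 0}"
  by (simp add: is_ideal_def)

lemma is_ideal_vanishing_ideal: "is_ideal (vanishing_ideal X)"
  by (simp add: is_ideal_def vanishing_ideal_def)


section \<open>The ideal of the Segre variety\<close>

type_synonym idx = "2 \<times> 2 \<times> 2"

datatype tfactor = S1 | S2 | S3

fun slot :: "tfactor \<Rightarrow> idx \<Rightarrow> 2" where
  "slot S1 (i, j, k) = i" | "slot S2 (i, j, k) = j" | "slot S3 (i, j, k) = k"

fun upd :: "tfactor \<Rightarrow> idx \<Rightarrow> 2 \<Rightarrow> idx" where
  "upd S1 (i, j, k) x = (x, j, k)" | "upd S2 (i, j, k) x = (i, x, k)" | "upd S3 (i, j, k) x = (i, j, x)"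

lemma slot_upd: "slot s (upd t p x) = (if s = t then x else slot s p)"
  by (cases s; cases t; cases p) simp_all

lemma upd_slot [simp]: "upd s p (slot s p) = p"
  by (cases s; cases p) simp_all

lemma upd_upd [simp]: "upd s (upd s p x) y = upd s p y"
  by (cases s; cases p) simp_all

text \<open>The 2x2 minors of the three flattenings: \<open>p\<close> and \<open>q\<close> exchange
  their entries in slot \<open>s\<close>.\<close>

definition quadric :: "tfactor \<Rightarrow> idx \<Rightarrow> idx \<Rightarrow> idx cpoly" where
  "quadric s p q = Var p * Var q - Var (upd s p (slot s q)) * Var (upd s q (slot s p))"

definition quadrics :: "idx cpoly set" where
  "quadrics = (\<lambda>(s, p, q). quadric s p q) ` ({S1, S2, S3} \<times> UNIV \<times> UNIV)"

lemma finite_quadrics: "finite quadrics"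
  unfolding quadrics_def by (intro finite_imageI finite_cartesian_product) auto

lemma quadric_in_quadrics: "quadric s p q \<in> quadrics"
  unfolding quadrics_def using tfactor.exhaust[of s] by (intro image_eqI[of _ _ "(s, p, q)"]) auto

lemma tensor3_nth [simp]: "tensor3 a b c $ (i, j, k) = a $ i * b $ j * c $ k"
  by (simp add: tensor3_def)

lemma tensor3_in_Segre222 [simp]: "tensor3 a b c \<in> Segre222"
  by (auto simp: Segre222_def)

lemma Segre222E:
  assumes "z \<in> Segre222"
  obtains a b c where "z = tensor3 a b c"
  using assms by (auto simp: Segre222_def)

lemma quadrics_vanish: "ideal_gen quadrics \<subseteq> vanishing_ideal Segre222"
proof (rule ideal_gen_minimal[OF is_ideal_vanishing_ideal])
  have "cpoly_eval (($) (tensor3 a b c)) (quadric s p q) = 0" for a b c s p q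
    by (cases s; cases p; cases q) (simp_all add: quadric_def)
  then show "quadrics \<subseteq> vanishing_ideal Segre222"
    by (auto simp: quadrics_def vanishing_ideal_def elim!: Segre222E)
qed

text \<open>A nonzero entry \<open>(a, b, c)\<close> serves as base point. Two exchanges express any
  entry through the entries that differ from the base point in one slot only, so the three lines
  through it determine the tensor.\<close>

lemma Segre222_if_quadrics:
  assumes "\<And>s p q. z $ p * z $ q = z $ upd s p (slot s q) * z $ upd s q (slot s p)"
  shows "z \<in> Segre222"
proof (cases "\<exists>p. z $ p \<noteq> 0")
  case True
  then obtain a b c where nz: "z $ (a, b, c) \<noteq> 0" by auto
  have "z = tensor3 (\<chi> i. z $ (i, b, c)) (\<chi> j. z $ (a, j, c) / z $ (a, b, c)) (\<chi> k. z $ (a, b, k) / z $ (a, b, c))"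
  proof (subst Finite_Cartesian_Product.vec_eq_iff, intro allI)
    fix p :: idx obtain i j k where p: "p = (i, j, k)" by (cases p)
    have 1: "z $ (i, j, k) * z $ (a, b, c) = z $ (a, j, k) * z $ (i, b, c)"
      using assms[of "(i, j, k)" "(a, b, c)" S1] by simp
    have 2: "z $ (a, j, k) * z $ (a, b, c) = z $ (a, b, k) * z $ (a, j, c)"
      using assms[of "(a, j, k)" "(a, b, c)" S2] by simp
    have "z $ (i, j, k) = z $ (a, j, k) * z $ (i, b, c) / z $ (a, b, c)"
      using 1 nz by (simp add: field_simps)
    also have "z $ (a, j, k) = z $ (a, b, k) * z $ (a, j, c) / z $ (a, b, c)"
      using 2 nz by (simp add: field_simps)
    finally show "z $ p = tensor3 (\<chi> i. z $ (i, b, c)) (\<chi> j. z $ (a, j, c) / z $ (a, b, c))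
        (\<chi> k. z $ (a, b, k) / z $ (a, b, c)) $ p"
      using nz by (simp add: p field_simps)
  qed
  then show ?thesis by (metis tensor3_in_Segre222)
next
  case False
  then have "z = tensor3 0 0 0" by (auto simp: Finite_Cartesian_Product.vec_eq_iff)
  then show ?thesis by simp
qed

lemma zero_locus_quadrics: "zero_locus quadrics = Segre222"
proof
  show "zero_locus quadrics \<subseteq> Segre222"
  proof
    fix z assume "z \<in> zero_locus quadrics"
    then have "cpoly_eval (($) z) (quadric s p q) = 0" for s p q
      using quadric_in_quadrics by (auto simp: zero_locus_def)
    then show "z \<in> Segre222" by (intro Segre222_if_quadrics) (simp add: quadric_def)
  qed
  show "Segre222 \<subseteq> zero_locus quadrics"
    using quadrics_vanish ideal_gen_superset[of quadrics]
    by (fastforce simp: zero_locus_def vanishing_ideal_def)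
qed

section \<open>Multidegrees, and monomials modulo the quadrics\<close>

definition mdeg :: "(idx \<Rightarrow>\<^sub>0 nat) \<Rightarrow> nat" where
  "mdeg m = (\<Sum>p\<in>UNIV. Poly_Mapping.lookup m p)"

definition cnt :: "tfactor \<Rightarrow> 2 \<Rightarrow> (idx \<Rightarrow>\<^sub>0 nat) \<Rightarrow> nat" where
  "cnt s x m = (\<Sum>p\<in>UNIV. if slot s p = x then Poly_Mapping.lookup m p else 0)"

lemma mdeg_add: "mdeg (m + n) = mdeg m + mdeg n"
  by (simp add: mdeg_def lookup_add sum.distrib)

lemma cnt_add: "cnt s x (m + n) = cnt s x m + cnt s x n"
  by (auto simp: cnt_def lookup_add simp flip: sum.distrib intro!: sum.cong)

lemma mdeg_single: "mdeg (Poly_Mapping.single p k) = k"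
  by (simp add: mdeg_def lookup_single when_def)

lemma cnt_single: "cnt s x (Poly_Mapping.single p k) = (if slot s p = x then k else 0)"
proof -
  have "cnt s x (Poly_Mapping.single p k) = (\<Sum>q\<in>UNIV. if p = q then (if slot s p = x then k else 0) else 0)"
    unfolding cnt_def by (intro sum.cong) (auto simp: lookup_single when_def)
  then show ?thesis by simp
qed

lemma mdeg_eq_cnt: "mdeg m = cnt s 1 m + cnt s 2 m"
  unfolding mdeg_def cnt_def sum.distrib[symmetric]
proof (intro sum.cong refl)
  fix p :: idx
  show "Poly_Mapping.lookup m p = (if slot s p = 1 then Poly_Mapping.lookup m p else 0) +
      (if slot s p = 2 then Poly_Mapping.lookup m p else 0)"
    using exhaust_2[of "slot s p"] by auto
qed

lemma cnt_pos_iff: "cnt s x m > 0 \<longleftrightarrow> (\<exists>p \<in> Poly_Mapping.keys m. slot s p = x)"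
proof -
  have "cnt s x m = 0 \<longleftrightarrow> (\<forall>p. slot s p = x \<longrightarrow> Poly_Mapping.lookup m p = 0)"
    unfolding cnt_def by (subst sum_eq_0_iff) auto
  then show ?thesis by (auto simp: in_keys_iff)
qed

lemma mdeg_eq_0_iff: "mdeg m = 0 \<longleftrightarrow> m = 0"
proof
  assume "mdeg m = 0"
  then have "Poly_Mapping.lookup m p = 0" for p by (cases p) (simp add: mdeg_def)
  then show "m = 0" by (intro poly_mapping_eqI) simp
qed (simp add: mdeg_def)

lemma add_single_minus:
  fixes m :: "'v \<Rightarrow>\<^sub>0 nat"
  assumes "p \<in> Poly_Mapping.keys m"
  shows "m - Poly_Mapping.single p 1 + Poly_Mapping.single p 1 = m"
  using assms
  by (intro poly_mapping_eqI) (auto simp: lookup_add lookup_minus lookup_single when_def in_keys_iff)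

text \<open>Equality of multidegrees: both monomials have the same pullback under
  \<open>tensor3\<close>.\<close>

definition same_counts :: "(idx \<Rightarrow>\<^sub>0 nat) \<Rightarrow> (idx \<Rightarrow>\<^sub>0 nat) \<Rightarrow> bool" where
  "same_counts m n \<longleftrightarrow> (\<forall>s x. cnt s x m = cnt s x n)"

abbreviation (input) mon :: "('v \<Rightarrow>\<^sub>0 nat) \<Rightarrow> 'v cpoly" where
  "mon m \<equiv> Poly_Mapping.single m 1"

text \<open>One quadric times the complementary monomial performs the exchange of slot
  \<open>s\<close> between \<open>q\<close> and \<open>r\<close>. The case \<open>q = r\<close> is
  separate, because the monomial may contain that variable only once.\<close>

lemma exchange:
  assumes q: "q \<in> Poly_Mapping.keys m" and r: "r \<in> Poly_Mapping.keys m"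
  obtains m' where "same_counts m m'" "mon m - mon m' \<in> ideal_gen quadrics"
    "upd s q (slot s r) \<in> Poly_Mapping.keys m'"
proof (cases "q = r")
  case True
  show ?thesis
    by (rule that[of m])
      (use True q in \<open>auto simp: same_counts_def is_idealD(1)[OF is_ideal_ideal_gen]\<close>)
next
  case False
  define m0 where "m0 = m - Poly_Mapping.single q 1 - Poly_Mapping.single r 1"
  define m' where "m' = m0 + (Poly_Mapping.single (upd s q (slot s r)) 1 + Poly_Mapping.single (upd s r (slot s q)) 1)"
  have "r \<in> Poly_Mapping.keys (m - Poly_Mapping.single q 1)"
    using r False by (simp add: in_keys_iff lookup_minus lookup_single when_def)
  then have m: "m = m0 + (Poly_Mapping.single q 1 + Poly_Mapping.single r 1)"
    using add_single_minus[OF q] add_single_minus[of r "m - Poly_Mapping.single q 1"]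
    by (simp add: m0_def add.assoc add.commute)
  have "same_counts m m'"
    unfolding same_counts_def
  proof (intro allI)
    fix t x
    show "cnt t x m = cnt t x m'"
      unfolding m m'_def cnt_add cnt_single slot_upd by (cases "s = t") auto
  qed
  moreover have "mon m - mon m' = mon m0 * quadric s q r"
    unfolding m m'_def quadric_def Var_def by (simp add: mult_single right_diff_distrib)
  then have "mon m - mon m' \<in> ideal_gen quadrics"
    using is_idealD(3)[OF is_ideal_ideal_gen, of "quadric s q r"] quadric_in_quadrics ideal_gen_superset
    by (metis subsetD)
  moreover have "upd s q (slot s r) \<in> Poly_Mapping.keys m'"
    by (simp add: m'_def in_keys_iff lookup_add)
  ultimately show ?thesis using that by blast
qed

lemma ideal_diff_trans:
  assumes "is_ideal I" "a - b \<in> I" "b - c \<in> I"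
  shows "a - c \<in> I"
  using is_idealD(2)[OF assms] by simp

text \<open>Induction on the degree. Every entry of an index \<open>p\<close> of \<open>m\<close>
  occurs in its slot somewhere in \<open>n\<close>, so three exchanges, one per slot, produce the
  variable \<open>p\<close> in a monomial congruent to \<open>n\<close>; then \<open>p\<close> is
  cancelled from both sides.\<close>

lemma mon_congruent:
  "same_counts m n \<Longrightarrow> mon m - mon n \<in> ideal_gen quadrics"
proof (induction "mdeg m" arbitrary: m n)
  case 0
  have "mdeg n = mdeg m" using 0(2) mdeg_eq_cnt[of m S1] mdeg_eq_cnt[of n S1] by (simp add: same_counts_def)
  then have "m = n" using 0 mdeg_eq_0_iff by metis
  then show ?case by (simp add: is_idealD(1)[OF is_ideal_ideal_gen])
next
  case (Suc d)
  then have "m \<noteq> 0" by (metis Zero_not_Suc mdeg_eq_0_iff)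
  then obtain p where p: "p \<in> Poly_Mapping.keys m" by (metis all_not_in_conv keys_eq_empty)
  have meets: "\<exists>r \<in> Poly_Mapping.keys n'. slot s r = slot s p" if "same_counts m n'" for n' s
    using that p cnt_pos_iff unfolding same_counts_def by metis
  have step: "\<exists>n''. same_counts m n'' \<and> mon n - mon n'' \<in> ideal_gen quadrics \<and>
      upd s q (slot s p) \<in> Poly_Mapping.keys n''"
    if st: "same_counts m n'" "mon n - mon n' \<in> ideal_gen quadrics" "q \<in> Poly_Mapping.keys n'" for n' s q
  proof -
    obtain r where r: "r \<in> Poly_Mapping.keys n'" "slot s r = slot s p" using meets[OF st(1)] by blast
    obtain n'' where n'': "same_counts n' n''" "mon n' - mon n'' \<in> ideal_gen quadrics"
      "upd s q (slot s r) \<in> Poly_Mapping.keys n''"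
      using exchange[OF st(3) r(1)] by blast
    have "same_counts m n''" using st(1) n''(1) by (simp add: same_counts_def)
    moreover have "mon n - mon n'' \<in> ideal_gen quadrics"
      by (rule ideal_diff_trans[OF is_ideal_ideal_gen st(2) n''(2)])
    ultimately show ?thesis using n''(3) r(2) by auto
  qed
  have 0: "mon n - mon n \<in> ideal_gen quadrics" by (simp add: is_idealD(1)[OF is_ideal_ideal_gen])
  obtain r where r: "r \<in> Poly_Mapping.keys n" using meets[OF Suc(3)] by blast
  obtain n1 where n1: "same_counts m n1" "mon n - mon n1 \<in> ideal_gen quadrics"
      "upd S1 r (slot S1 p) \<in> Poly_Mapping.keys n1"
    using step[OF Suc(3) 0 r] by blast
  obtain n2 where n2: "same_counts m n2" "mon n - mon n2 \<in> ideal_gen quadrics"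
      "upd S2 (upd S1 r (slot S1 p)) (slot S2 p) \<in> Poly_Mapping.keys n2"
    using step[OF n1] by blast
  obtain n3 where n3: "same_counts m n3" "mon n - mon n3 \<in> ideal_gen quadrics"
      "upd S3 (upd S2 (upd S1 r (slot S1 p)) (slot S2 p)) (slot S3 p) \<in> Poly_Mapping.keys n3"
    using step[OF n2] by blast
  have p3: "p \<in> Poly_Mapping.keys n3" using n3(3) by (cases p; cases r) simp
  define m0 n0 where "m0 = m - Poly_Mapping.single p 1" and "n0 = n3 - Poly_Mapping.single p 1"
  have m: "m = m0 + Poly_Mapping.single p 1" and n: "n3 = n0 + Poly_Mapping.single p 1"
    using add_single_minus[OF p] add_single_minus[OF p3] by (simp_all add: m0_def n0_def)
  have "mdeg m0 = d" using Suc(2) unfolding m by (simp add: mdeg_add mdeg_single)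
  moreover have "same_counts m0 n0" using n3(1) unfolding m n by (simp add: same_counts_def cnt_add)
  ultimately have "mon m0 - mon n0 \<in> ideal_gen quadrics" using Suc(1) by blast
  then have "mon (Poly_Mapping.single p 1) * (mon m0 - mon n0) \<in> ideal_gen quadrics"
    by (rule is_idealD(3)[OF is_ideal_ideal_gen])
  then have "mon m - mon n3 \<in> ideal_gen quadrics"
    unfolding m n by (simp add: right_diff_distrib mult_single add.commute)
  moreover have "mon n3 - mon n \<in> ideal_gen quadrics"
    using is_idealD(5)[OF is_ideal_ideal_gen n3(2)] by simp
  ultimately show ?case by (rule ideal_diff_trans[OF is_ideal_ideal_gen])
qed

text \<open>Kronecker substitution: the monomial curve through the Segre variety whose exponents in
  base \<open>N\<close> record the degree and the slot counts of a monomial.\<close>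

definition kron_exp :: "nat \<Rightarrow> idx \<Rightarrow> nat" where
  "kron_exp N p = 1 + N * of_bool (slot S1 p = 1) + N^2 * of_bool (slot S2 p = 1) + N^3 * of_bool (slot S3 p = 1)"

definition kron :: "nat \<Rightarrow> idx cpoly \<Rightarrow> complex poly" where
  "kron N = cpoly_hom (\<lambda>a. [:a:]) (\<lambda>p. monom 1 (kron_exp N p))"

definition kron_code :: "nat \<Rightarrow> (idx \<Rightarrow>\<^sub>0 nat) \<Rightarrow> nat" where
  "kron_code N m = mdeg m + N * cnt S1 1 m + N^2 * cnt S2 1 m + N^3 * cnt S3 1 m"

lemma kron_single: "kron N (Poly_Mapping.single m a) = monom a (kron_code N m)"
proof -
  have "monom_value (\<lambda>p. monom (1::complex) (kron_exp N p)) m = (\<Prod>p\<in>UNIV. monom 1 (kron_exp N p) ^ Poly_Mapping.lookup m p)"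
    by (rule monom_value_superset) auto
  also have "\<dots> = (\<Prod>p\<in>UNIV. monom 1 (kron_exp N p * Poly_Mapping.lookup m p))"
    by (simp add: monom_power)
  also have "\<dots> = monom 1 (\<Sum>p\<in>UNIV. kron_exp N p * Poly_Mapping.lookup m p)"
  proof -
    have "(\<Prod>p\<in>A. monom (1::complex) (h p)) = monom 1 (\<Sum>p\<in>A. h p)" for A and h :: "idx \<Rightarrow> nat"
      by (induction A rule: infinite_finite_induct) (auto simp: mult_monom)
    then show ?thesis .
  qed
  also have "(\<Sum>p\<in>UNIV. kron_exp N p * Poly_Mapping.lookup m p) = kron_code N m"
    unfolding kron_code_def kron_exp_def mdeg_def cnt_def sum_distrib_left sum.distrib[symmetric]
    by (intro sum.cong) (auto simp: of_bool_def algebra_simps)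
  finally show ?thesis
    by (simp add: kron_def cpoly_hom_single smult_monom)
qed

lemma kron_sum: "kron N (sum f A) = (\<Sum>a\<in>A. kron N (f a))"
  by (simp add: kron_def)

text \<open>The curve lies in the variety because its exponents are sums of contributions of the
  single slots; the common factor \<open>y\<close>, which records the degree, is put into the first
  vector.\<close>

lemma kron_eq_0_if_vanishing:
  assumes "f \<in> vanishing_ideal Segre222"
  shows "kron N f = 0"
proof -
  have "poly (kron N f) y = 0" for y
  proof -
    let ?a = "\<lambda>e. (\<chi> i. if i = 1 then y ^ e else 1) :: complex ^ 2"
    have "(\<lambda>p. poly (monom 1 (kron_exp N p)) y) = ($) (tensor3 (\<chi> i. y * ?a N $ i) (?a (N^2)) (?a (N^3)))"
    proof
      fix p :: idx obtain i j k where p: "p = (i, j, k)" by (cases p)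
      show "poly (monom 1 (kron_exp N p)) y = tensor3 (\<chi> i. y * ?a N $ i) (?a (N^2)) (?a (N^3)) $ p"
        by (simp add: p poly_monom kron_exp_def power_add)
    qed
    then show ?thesis
      using assms tensor3_in_Segre222 unfolding kron_def cpoly_eval_curve[symmetric] vanishing_ideal_def
      by simp
  qed
  then show ?thesis using poly_all_0_iff_0 by blast
qed

lemma digits_eq:
  fixes d \<alpha> \<beta> \<gamma> :: nat
  assumes "d + N * \<alpha> + N^2 * \<beta> + N^3 * \<gamma> = d' + N * \<alpha>' + N^2 * \<beta>' + N^3 * \<gamma>'"
    and "d < N" "\<alpha> < N" "\<beta> < N" "d' < N" "\<alpha>' < N" "\<beta>' < N"
  shows "d = d' \<and> \<alpha> = \<alpha>' \<and> \<beta> = \<beta>' \<and> \<gamma> = \<gamma>'"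
proof -
  have dig: "x = x' \<and> y = y'" if "x + N * y = x' + N * y'" "x < N" "x' < N" for x y x' y'
  proof -
    have "x = (x + N * y) mod N" "y = (x + N * y) div N" using that(2) by auto
    moreover have "x' = (x' + N * y') mod N" "y' = (x' + N * y') div N" using that(3) by auto
    ultimately show ?thesis using that(1) by metis
  qed
  have e: "d + N * (\<alpha> + N * (\<beta> + N * \<gamma>)) = d' + N * (\<alpha>' + N * (\<beta>' + N * \<gamma>'))"
    using assms(1) by (simp add: algebra_simps power2_eq_square power3_eq_cube)
  show ?thesis using dig[OF e] dig[of \<alpha> "\<beta> + N * \<gamma>"] dig[of \<beta> \<gamma>] assms(2-) by metis
qed

lemma same_counts_if_kron_code:
  assumes "kron_code N m = kron_code N n" "mdeg m < N" "mdeg n < N"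
  shows "same_counts m n"
proof -
  have le: "cnt s 1 m \<le> mdeg m" "cnt s 1 n \<le> mdeg n" for s by (simp_all add: mdeg_eq_cnt[of _ s])
  have *: "mdeg m = mdeg n \<and> cnt S1 1 m = cnt S1 1 n \<and> cnt S2 1 m = cnt S2 1 n \<and> cnt S3 1 m = cnt S3 1 n"
    using assms(1) unfolding kron_code_def
    by (rule digits_eq) (use assms(2,3) le in \<open>auto intro: le_less_trans\<close>)
  then have 1: "cnt s 1 m = cnt s 1 n" for s by (cases s) auto
  have 2: "cnt s 2 m = cnt s 2 n" for s
    using 1[of s] * mdeg_eq_cnt[of m s] mdeg_eq_cnt[of n s] by linarith
  show ?thesis unfolding same_counts_def using 1 2 by (metis exhaust_2)
qed

definition deg_le :: "nat \<Rightarrow> idx cpoly \<Rightarrow> bool" where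
  "deg_le n f \<longleftrightarrow> (\<forall>m \<in> Poly_Mapping.keys f. mdeg m \<le> n)"

lemma poly_mapping_sum_single: "f = (\<Sum>m\<in>Poly_Mapping.keys f. Poly_Mapping.single m (Poly_Mapping.lookup f m))"
  for f :: "'a \<Rightarrow>\<^sub>0 'b :: comm_monoid_add"
proof (intro poly_mapping_eqI)
  fix k
  show "Poly_Mapping.lookup f k =
      Poly_Mapping.lookup (\<Sum>m\<in>Poly_Mapping.keys f. Poly_Mapping.single m (Poly_Mapping.lookup f m)) k"
    by (simp add: lookup_sum lookup_single when_def in_keys_iff)
qed

text \<open>Below degree \<open>N\<close> the codes separate multidegrees. The monomials of
  \<open>f\<close> are grouped by code: in each group the coefficients sum to 0 and the monomials
  are congruent modulo the quadrics, so the group lies in the ideal.\<close>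

lemma kron_injective:
  assumes deg: "deg_le n f" "n < N" and zero: "kron N f = 0"
  shows "f \<in> ideal_gen quadrics"
proof -
  define K c where "K = Poly_Mapping.keys f" and "c = Poly_Mapping.lookup f"
  have f: "f = (\<Sum>m\<in>K. Poly_Mapping.single m (c m))"
    unfolding K_def c_def by (rule poly_mapping_sum_single)
  then have "kron N f = kron N (\<Sum>m\<in>K. Poly_Mapping.single m (c m))" by (rule arg_cong)
  also have "\<dots> = (\<Sum>m\<in>K. monom (c m) (kron_code N m))"
    by (simp add: kron_sum kron_single)
  finally have "(\<Sum>m\<in>K. monom (c m) (kron_code N m)) = 0" using zero by simp
  then have "coeff (\<Sum>m\<in>K. monom (c m) (kron_code N m)) e = 0" for e by simp
  then have coeff: "(\<Sum>m\<in>{m\<in>K. kron_code N m = e}. c m) = 0" for e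
    by (simp add: coeff_sum K_def sum.If_cases Int_def)
  have "(\<Sum>m\<in>K. Poly_Mapping.single m (c m)) = (\<Sum>e\<in>kron_code N ` K. \<Sum>m\<in>{m\<in>K. kron_code N m = e}. Poly_Mapping.single m (c m))"
    by (rule sum.image_gen) (simp add: K_def)
  also have "\<dots> \<in> ideal_gen quadrics"
  proof (rule is_ideal_sum[OF is_ideal_ideal_gen])
    fix e assume "e \<in> kron_code N ` K"
    then obtain m0 where m0: "m0 \<in> K" "kron_code N m0 = e" by blast
    let ?A = "{m\<in>K. kron_code N m = e}"
    have "(\<Sum>m\<in>?A. Poly_Mapping.single m (c m)) =
        (\<Sum>m\<in>?A. Poly_Mapping.single m (c m) - Poly_Mapping.single m0 (c m)) + (\<Sum>m\<in>?A. Poly_Mapping.single m0 (c m))"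
      by (simp flip: sum.distrib)
    also have "(\<Sum>m\<in>?A. Poly_Mapping.single m0 (c m)) = Poly_Mapping.single m0 (\<Sum>m\<in>?A. c m)"
    proof -
      have "(\<Sum>m\<in>A. Poly_Mapping.single m0 (c m)) = Poly_Mapping.single m0 (\<Sum>m\<in>A. c m)" for A
        by (induction A rule: infinite_finite_induct) (auto simp: single_add)
      then show ?thesis .
    qed
    also have "\<dots> = 0" using coeff[of e] by simp
    finally have eq: "(\<Sum>m\<in>?A. Poly_Mapping.single m (c m)) =
      (\<Sum>m\<in>?A. Poly_Mapping.single m (c m) - Poly_Mapping.single m0 (c m))" by simp
    show "(\<Sum>m\<in>?A. Poly_Mapping.single m (c m)) \<in> ideal_gen quadrics"
      unfolding eq
    proof (rule is_ideal_sum[OF is_ideal_ideal_gen])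
      fix m assume m: "m \<in> ?A"
      have "same_counts m m0"
        using m m0 deg by (intro same_counts_if_kron_code[of N]) (auto simp: deg_le_def K_def intro: le_less_trans)
      then have "Const (c m) * (mon m - mon m0) \<in> ideal_gen quadrics"
        by (intro is_idealD(3)[OF is_ideal_ideal_gen] mon_congruent)
      then show "Poly_Mapping.single m (c m) - Poly_Mapping.single m0 (c m) \<in> ideal_gen quadrics"
        by (simp add: Const_def right_diff_distrib mult_single)
    qed
  qed
  finally have "(\<Sum>m\<in>K. Poly_Mapping.single m (c m)) \<in> ideal_gen quadrics" .
  then show ?thesis by (simp flip: f)
qed

lemma deg_le_exists: "\<exists>n. deg_le n f"
proof
  show "deg_le (\<Sum>m\<in>Poly_Mapping.keys f. mdeg m) f"
    unfolding deg_le_def by (auto intro: member_le_sum)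
qed

lemma vanishing_ideal_Segre222: "vanishing_ideal Segre222 = ideal_gen quadrics"
proof
  show "vanishing_ideal Segre222 \<subseteq> ideal_gen quadrics"
  proof
    fix f assume f: "f \<in> vanishing_ideal Segre222"
    obtain n where "deg_le n f" using deg_le_exists by blast
    then show "f \<in> ideal_gen quadrics"
      by (rule kron_injective[OF _ lessI kron_eq_0_if_vanishing[OF f]])
  qed
qed (rule quadrics_vanish)

text \<open>A finite generating list has to be exhibited before the choice in
  \<open>ideal_gens\<close> can be trusted; afterwards only this equation is used about the chosen
  list.\<close>

lemma ideal_gens_Segre222: "ideal_gen (set (ideal_gens Segre222)) = vanishing_ideal Segre222"
proof -
  obtain fs where "set fs = quadrics" using finite_list[OF finite_quadrics] by blast
  then have "ideal_gen (set fs) = vanishing_ideal Segre222" by (simp add: vanishing_ideal_Segre222)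
  then show ?thesis unfolding ideal_gens_def by (rule someI)
qed

section \<open>The dimension of the Segre variety\<close>

lemma subset_zero_locus: "Y \<subseteq> zero_locus (vanishing_ideal Y)"
  by (auto simp: zero_locus_def vanishing_ideal_def)

lemma zero_locus_vanishing_ideal:
  assumes "zariski_closed Y"
  shows "zero_locus (vanishing_ideal Y) = Y"
proof -
  obtain F where F: "Y = zero_locus F" using assms by (auto simp: zariski_closed_def)
  then have "F \<subseteq> vanishing_ideal Y" by (auto simp: zero_locus_def vanishing_ideal_def)
  then show ?thesis using subset_zero_locus[of Y] unfolding F by (auto simp: zero_locus_def)
qed

lemma zariski_closed_Int: "zariski_closed A \<Longrightarrow> zariski_closed B \<Longrightarrow> zariski_closed (A \<inter> B)"
proof -
  assume "zariski_closed A" "zariski_closed B"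
  then obtain F G where "A = zero_locus F" "B = zero_locus G" by (auto simp: zariski_closed_def)
  then have "A \<inter> B = zero_locus (F \<union> G)" by (auto simp: zero_locus_def)
  then show ?thesis by (auto simp: zariski_closed_def)
qed

lemma zariski_closed_zero_locus [simp]: "zariski_closed (zero_locus F)"
  by (auto simp: zariski_closed_def)

lemma zariski_closed_Segre222: "zariski_closed Segre222"
  using zero_locus_quadrics by (auto simp: zariski_closed_def)

lemma irreducible_vanishing_ideal_prime:
  assumes "irreducible_closed Y" "f * g \<in> vanishing_ideal Y" "g \<notin> vanishing_ideal Y"
  shows "f \<in> vanishing_ideal Y"
proof -
  have Y: "zariski_closed Y"
    and irr: "\<And>A B. zariski_closed A \<Longrightarrow> zariski_closed B \<Longrightarrow> Y = A \<union> B \<Longrightarrow> Y = A \<or> Y = B"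
    using assms(1) by (auto simp: irreducible_closed_def)
  have "Y = (Y \<inter> zero_locus {f}) \<union> (Y \<inter> zero_locus {g})"
    using assms(2) by (auto simp: zero_locus_def vanishing_ideal_def)
  then have "Y = Y \<inter> zero_locus {f} \<or> Y = Y \<inter> zero_locus {g}"
    by (intro irr zariski_closed_Int Y zariski_closed_zero_locus)
  then show ?thesis using assms(3) by (auto simp: zero_locus_def vanishing_ideal_def)
qed

text \<open>If \<open>Y\<close> were covered by two proper closed subsets, equations
  \<open>f\<close> and \<open>g\<close> of them, nonzero at \<open>p\<close> and \<open>q\<close>
  respectively, would have a product vanishing along the joining curve, so one of them would vanish
  on the whole curve.\<close>

lemma irreducible_closed_if_curves:
  assumes "zariski_closed Y" "Y \<noteq> {}"
    and curve: "\<And>p q. p \<in> Y \<Longrightarrow> q \<in> Y \<Longrightarrow>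
      \<exists>c. (\<forall>\<tau>. (\<chi> i. poly (c i) \<tau>) \<in> Y) \<and> (\<chi> i. poly (c i) 0) = p \<and> (\<chi> i. poly (c i) 1) = q"
  shows "irreducible_closed Y"
  unfolding irreducible_closed_def
proof (intro conjI allI impI)
  fix A B assume AB: "zariski_closed A \<and> zariski_closed B \<and> Y = A \<union> B"
  show "Y = A \<or> Y = B"
  proof (rule ccontr)
    assume "\<not> (Y = A \<or> Y = B)"
    then obtain p q where p: "p \<in> Y" "p \<notin> A" and q: "q \<in> Y" "q \<notin> B" using AB by blast
    obtain F G where FG: "A = zero_locus F" "B = zero_locus G" using AB by (auto simp: zariski_closed_def)
    obtain f where f: "f \<in> F" "cpoly_eval (($) p) f \<noteq> 0" using p FG by (auto simp: zero_locus_def)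
    obtain g where g: "g \<in> G" "cpoly_eval (($) q) g \<noteq> 0" using q FG by (auto simp: zero_locus_def)
    obtain c where c: "\<And>\<tau>. (\<chi> i. poly (c i) \<tau>) \<in> Y" "(\<chi> i. poly (c i) 0) = p" "(\<chi> i. poly (c i) 1) = q"
      using curve[OF p(1) q(1)] by blast
    define h where "h = cpoly_hom (\<lambda>a. [:a:]) c"
    have ev: "cpoly_eval (($) (\<chi> i. poly (c i) \<tau>)) r = poly (h r) \<tau>" for r \<tau>
    proof -
      have "($) (\<chi> i. poly (c i) \<tau>) = (\<lambda>v. poly (c v) \<tau>)" by (intro ext) simp
      then show ?thesis unfolding h_def cpoly_eval_curve[symmetric] by (rule arg_cong)
    qed
    have "poly (h f * h g) \<tau> = 0" for \<tau>
      using c(1)[of \<tau>] f(1) g(1) AB unfolding FG by (auto simp: zero_locus_def ev)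
    then have "h f * h g = 0" using poly_all_0_iff_0 by blast
    then have "h f = 0 \<or> h g = 0" by simp
    then show False using f(2) g(2) c(2,3) ev[of 0 f] ev[of 1 g] by auto
  qed
qed (use assms in auto)

lemma irreducible_closed_tensor3:
  assumes closed: "zariski_closed Y"
    and Y: "Y = (\<lambda>(a, b, c). tensor3 a b c) ` (A \<times> B \<times> C)"
    and lines: "\<And>a a' t. a \<in> A \<Longrightarrow> a' \<in> A \<Longrightarrow> a + t *s (a' - a) \<in> A"
      "\<And>a a' t. a \<in> B \<Longrightarrow> a' \<in> B \<Longrightarrow> a + t *s (a' - a) \<in> B"
      "\<And>a a' t. a \<in> C \<Longrightarrow> a' \<in> C \<Longrightarrow> a + t *s (a' - a) \<in> C"
    and ne: "A \<noteq> {}" "B \<noteq> {}" "C \<noteq> {}"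
  shows "irreducible_closed Y"
proof (rule irreducible_closed_if_curves[OF closed])
  show "Y \<noteq> {}" using ne unfolding Y by auto
  fix p q assume "p \<in> Y" "q \<in> Y"
  then obtain a b c a' b' c' where p: "p = tensor3 a b c" "a \<in> A" "b \<in> B" "c \<in> C"
    and q: "q = tensor3 a' b' c'" "a' \<in> A" "b' \<in> B" "c' \<in> C" unfolding Y by auto
  define l :: "complex ^ 2 \<Rightarrow> complex ^ 2 \<Rightarrow> 2 \<Rightarrow> complex poly"
    where "l x y i = [:x $ i, (y - x) $ i:]" for x y i
  define cv :: "idx \<Rightarrow> complex poly" where "cv = (\<lambda>(i, j, k). l a a' i * l b b' j * l c c' k)"
  have l: "poly (l x y i) \<tau> = (x + \<tau> *s (y - x)) $ i" for x y i \<tau>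
    by (simp add: l_def algebra_simps)
  have eq: "(\<chi> i. poly (cv i) \<tau>) = tensor3 (a + \<tau> *s (a' - a)) (b + \<tau> *s (b' - b)) (c + \<tau> *s (c' - c))" for \<tau>
    by (simp add: Finite_Cartesian_Product.vec_eq_iff cv_def l del: vector_add_component vector_smult_component)
  show "\<exists>cv. (\<forall>\<tau>. (\<chi> i. poly (cv i) \<tau>) \<in> Y) \<and> (\<chi> i. poly (cv i) 0) = p \<and> (\<chi> i. poly (cv i) 1) = q"
  proof (intro exI[of _ cv] conjI allI)
    show "(\<chi> i. poly (cv i) \<tau>) \<in> Y" for \<tau>
      unfolding eq Y
      by (rule image_eqI[where x = "(a + \<tau> *s (a' - a), b + \<tau> *s (b' - b), c + \<tau> *s (c' - c))"])
        (simp only: prod.case, intro SigmaI lines p q)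
    show "(\<chi> i. poly (cv i) 0) = p" "(\<chi> i. poly (cv i) 1) = q"
      unfolding eq p(1) q(1) by (simp_all add: algebra_simps)
  qed
qed

section \<open>A chain of length four\<close>

definition e1 :: "complex ^ 2" where "e1 = axis 1 1"
definition e2 :: "complex ^ 2" where "e2 = axis 2 1"

lemma e_nth [simp]: "e1 $ 1 = 1" "e1 $ 2 = 0" "e2 $ 1 = 0" "e2 $ 2 = 1"
  by (simp_all add: e1_def e2_def axis_def)

lemma vec2_eq_iff: "(x :: complex ^ 2) = y \<longleftrightarrow> x $ 1 = y $ 1 \<and> x $ 2 = y $ 2"
  by (simp add: Finite_Cartesian_Product.vec_eq_iff forall_2)

lemma tensor3_scale: "tensor3 (r *s a) b c = r *s tensor3 a b c" "tensor3 a (r *s b) c = r *s tensor3 a b c"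
  "tensor3 a b (r *s c) = r *s tensor3 a b c"
  by (simp_all add: Finite_Cartesian_Product.vec_eq_iff algebra_simps)

lemma tensor3_eq_0_iff: "tensor3 a b c = 0 \<longleftrightarrow> a = 0 \<or> b = 0 \<or> c = 0"
  by (auto simp: Finite_Cartesian_Product.vec_eq_iff forall_2)

lemma Segre222_chain:
  "\<exists>Y. (\<forall>i \<le> 4. irreducible_closed (Y i) \<and> Y i \<subseteq> Segre222) \<and> (\<forall>i < 4. Y i \<subset> Y (Suc i))"
proof -
  let ?T = "\<lambda>A B C. (\<lambda>(a, b, c). tensor3 a b c) ` (A \<times> B \<times> C)"
  define L where "L = {x :: complex ^ 2. x $ 2 = 0}"
  have cut: "zariski_closed {z \<in> Segre222. \<forall>p\<in>P. z $ p = 0}" for P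
  proof -
    have "{z \<in> Segre222. \<forall>p\<in>P. z $ p = 0} = Segre222 \<inter> zero_locus (Var ` P)"
      by (auto simp: zero_locus_def)
    then show ?thesis using zariski_closed_Int[OF zariski_closed_Segre222] by simp
  qed
  have mem: "x \<in> L \<longleftrightarrow> x $ 2 = 0" for x by (simp add: L_def)
  have e: "e1 \<in> L" "e2 \<notin> L" by (auto simp: L_def)
  have z0: "(0::complex^2) \<in> L" by (simp add: L_def)
  have T4: "?T UNIV UNIV UNIV = Segre222" by (fastforce simp: Segre222_def image_iff)
  \<comment> \<open>Closedness of the members of the chain: each is cut out by coordinates. A tensor
    in the cut whose factor lies outside \<open>L\<close> is 0, and 0 is rewritten with factors in
    \<open>L\<close>.\<close>
  have T3: "?T UNIV UNIV L = {z \<in> Segre222. \<forall>p\<in>{p. slot S3 p = 2}. z $ p = 0}" (is "_ = ?C3")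
  proof (intro equalityI subsetI)
    fix z assume "z \<in> ?C3"
    then obtain a b c where z: "z = tensor3 a b c" and 0: "\<And>i j. a $ i * b $ j * c $ 2 = 0"
      by (auto elim!: Segre222E)
    show "z \<in> ?T UNIV UNIV L"
    proof (cases "c $ 2 = 0")
      case True then show ?thesis using z by (intro image_eqI[of _ _ "(a, b, c)"]) (simp_all add: L_def)
    next
      case False
      then have "a $ i = 0 \<or> b $ j = 0" for i j using 0[of i j] by auto
      then have "z = tensor3 0 0 0"
        by (auto simp: z Finite_Cartesian_Product.vec_eq_iff) 
      then show ?thesis using z0 by (intro image_eqI[of _ _ "(0, 0, 0)"]) simp_all
    qed
  qed (auto simp: L_def)
  have T2: "?T UNIV L L = {z \<in> Segre222. \<forall>p\<in>{p. slot S2 p = 2 \<or> slot S3 p = 2}. z $ p = 0}" (is "_ = ?C2")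
  proof (intro equalityI subsetI)
    fix z assume "z \<in> ?C2"
    then have "z \<in> ?T UNIV UNIV L" unfolding T3 by auto
    then obtain a b c where z: "z = tensor3 a b c" "c \<in> L" by auto
    have 0: "a $ i * b $ 2 * c $ k = 0" for i k using \<open>z \<in> ?C2\<close> unfolding z(1) by auto
    show "z \<in> ?T UNIV L L"
    proof (cases "b $ 2 = 0")
      case True then show ?thesis using z by (intro image_eqI[of _ _ "(a, b, c)"]) (simp_all add: L_def)
    next
      case False
      then have "a $ i = 0 \<or> c $ j = 0" for i j using 0[of i j] by auto
      then have "z = tensor3 0 0 0"
        by (auto simp: z Finite_Cartesian_Product.vec_eq_iff) 
      then show ?thesis using z0 by (intro image_eqI[of _ _ "(0, 0, 0)"]) simp_all
    qed
  qed (auto simp: L_def)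
  have T1: "?T L L L = {z \<in> Segre222. \<forall>p\<in>{p. slot S1 p = 2 \<or> slot S2 p = 2 \<or> slot S3 p = 2}. z $ p = 0}" (is "_ = ?C1")
  proof (intro equalityI subsetI)
    fix z assume "z \<in> ?C1"
    then have "z \<in> ?T UNIV L L" unfolding T2 by auto
    then obtain a b c where z: "z = tensor3 a b c" "b \<in> L" "c \<in> L" by auto
    have 0: "a $ 2 * b $ j * c $ k = 0" for j k using \<open>z \<in> ?C1\<close> unfolding z(1) by auto
    show "z \<in> ?T L L L"
    proof (cases "a $ 2 = 0")
      case True then show ?thesis using z by (intro image_eqI[of _ _ "(a, b, c)"]) (simp_all add: L_def)
    next
      case False
      then have "b $ i = 0 \<or> c $ j = 0" for i j using 0[of i j] by auto
      then have "z = tensor3 0 0 0"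
        by (auto simp: z Finite_Cartesian_Product.vec_eq_iff) 
      then show ?thesis using z0 by (intro image_eqI[of _ _ "(0, 0, 0)"]) simp_all
    qed
  qed (auto simp: L_def)
  have T0: "?T {0} {0} {0} = {z \<in> Segre222. \<forall>p\<in>UNIV. z $ p = 0}" (is "_ = ?C0")
  proof -
    have "?T {0} {0} {0} = {0}" by (auto simp: tensor3_eq_0_iff)
    moreover have "?C0 = {0}"
      by (auto simp: Finite_Cartesian_Product.vec_eq_iff intro: Segre222_if_quadrics)
    ultimately show ?thesis by simp
  qed
  define Y where "Y = (\<lambda>i::nat. if i = 0 then ?T {0} {0} {0} else if i = 1 then ?T L L L else
    if i = 2 then ?T UNIV L L else if i = 3 then ?T UNIV UNIV L else ?T UNIV UNIV UNIV)"
  have lines: "a + t *s (a' - a) \<in> L" if "a \<in> L" "a' \<in> L" for a a' t using that by (simp add: L_def)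
  have closed: "zariski_closed (?T {0} {0} {0})" "zariski_closed (?T L L L)" "zariski_closed (?T UNIV L L)"
     "zariski_closed (?T UNIV UNIV L)" "zariski_closed (?T UNIV UNIV UNIV)"
    unfolding T0 T1 T2 T3 T4 by (rule cut zariski_closed_Segre222)+
  have irr: "irreducible_closed (?T {0} {0} {0})" "irreducible_closed (?T L L L)" "irreducible_closed (?T UNIV L L)"
     "irreducible_closed (?T UNIV UNIV L)" "irreducible_closed (?T UNIV UNIV UNIV)"
  proof -
    have l0: "\<And>a a' t. a \<in> {0 :: complex ^ 2} \<Longrightarrow> a' \<in> {0} \<Longrightarrow> a + t *s (a' - a) \<in> {0}"
      and lU: "\<And>a a' t. a \<in> UNIV \<Longrightarrow> a' \<in> UNIV \<Longrightarrow> a + t *s (a' - a) \<in> (UNIV :: (complex ^ 2) set)"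
      and ne: "L \<noteq> {}" using z0 by auto
    show "irreducible_closed (?T {0} {0} {0})"
      by (rule irreducible_closed_tensor3[OF closed(1) refl l0 l0 l0]) simp_all
    show "irreducible_closed (?T L L L)"
      by (rule irreducible_closed_tensor3[OF closed(2) refl lines lines lines ne ne ne]) 
    show "irreducible_closed (?T UNIV L L)"
      by (rule irreducible_closed_tensor3[OF closed(3) refl lU lines lines UNIV_not_empty ne ne])
    show "irreducible_closed (?T UNIV UNIV L)"
      by (rule irreducible_closed_tensor3[OF closed(4) refl lU lU lines UNIV_not_empty UNIV_not_empty ne])
    show "irreducible_closed (?T UNIV UNIV UNIV)"
      by (rule irreducible_closed_tensor3[OF closed(5) refl lU lU lU UNIV_not_empty UNIV_not_empty UNIV_not_empty])
  qed
  have sub: "?T A B C \<subseteq> Segre222" for A B C by auto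
  have ne: "tensor3 e1 e1 e1 \<notin> ?T {0} {0} {0}" "tensor3 e2 e1 e1 \<notin> ?T L L L" 
     "tensor3 e1 e2 e1 \<notin> ?T UNIV L L" "tensor3 e1 e1 e2 \<notin> ?T UNIV UNIV L"
  proof -
    show "tensor3 e1 e1 e1 \<notin> ?T {0} {0} {0}" unfolding T0
      by (intro notI, drule CollectD, drule conjunct2, drule bspec[of _ _ "(1, 1, 1)"]) simp_all
    show "tensor3 e2 e1 e1 \<notin> ?T L L L" unfolding T1
      by (intro notI, drule CollectD, drule conjunct2, drule bspec[of _ _ "(2, 1, 1)"]) simp_all
    show "tensor3 e1 e2 e1 \<notin> ?T UNIV L L" unfolding T2
      by (intro notI, drule CollectD, drule conjunct2, drule bspec[of _ _ "(1, 2, 1)"]) simp_all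
    show "tensor3 e1 e1 e2 \<notin> ?T UNIV UNIV L" unfolding T3
      by (intro notI, drule CollectD, drule conjunct2, drule bspec[of _ _ "(1, 1, 2)"]) simp_all
  qed
  have strict: "?T {0} {0} {0} \<subset> ?T L L L" "?T L L L \<subset> ?T UNIV L L" "?T UNIV L L \<subset> ?T UNIV UNIV L"
     "?T UNIV UNIV L \<subset> ?T UNIV UNIV UNIV"
  proof -
    have mono: "?T A B C \<subset> ?T A' B' C'"
      if "A \<subseteq> A'" "B \<subseteq> B'" "C \<subseteq> C'" "tensor3 a b c \<notin> ?T A B C" "a \<in> A'" "b \<in> B'" "c \<in> C'"
      for A A' B B' C C' a b c
    proof (rule psubsetI)
      show "?T A B C \<subseteq> ?T A' B' C'" using that by (intro image_mono Sigma_mono)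
      have "tensor3 a b c \<in> ?T A' B' C'"
        by (rule image_eqI[of _ _ "(a, b, c)"]) (use that in auto)
      then show "?T A B C \<noteq> ?T A' B' C'" using that(4) by metis
    qed
    show "?T {0} {0} {0} \<subset> ?T L L L" by (rule mono[OF _ _ _ ne(1)]) (use e z0 in auto)
    show "?T L L L \<subset> ?T UNIV L L" by (rule mono[OF _ _ _ ne(2)]) (use e z0 in auto)
    show "?T UNIV L L \<subset> ?T UNIV UNIV L" by (rule mono[OF _ _ _ ne(3)]) (use e z0 in auto)
    show "?T UNIV UNIV L \<subset> ?T UNIV UNIV UNIV" by (rule mono[OF _ _ _ ne(4)]) auto
  qed
  have "irreducible_closed (Y i) \<and> Y i \<subseteq> Segre222" for i unfolding Y_def using irr sub by auto
  moreover have "Y i \<subset> Y (Suc i)" if i: "i < 4" for i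
  proof -
    consider "i = 0" | "i = 1" | "i = 2" | "i = 3" using i by linarith
    then show ?thesis unfolding Y_def using strict by cases simp_all
  qed
  ultimately show ?thesis by blast
qed

text \<open>In the step from \<open>d\<close>, restriction to \<open>Y d\<close> kills
  \<open>f d\<close> and leaves the terms free of it, which vanish by induction; the other terms are
  divisible by \<open>f d\<close>, and primality on \<open>Y (Suc d)\<close> allows the division.
  Thus functions that become nonzero one at a time along a chain are algebraically independent on
  its top.\<close>

lemma independent_monomials_on_chain:
  assumes "\<And>i. i \<le> d \<Longrightarrow> irreducible_closed (Y i)"
    and "\<And>i. i < d \<Longrightarrow> Y i \<subseteq> Y (Suc i) \<and> f i \<in> vanishing_ideal (Y i) \<and> f i \<notin> vanishing_ideal (Y (Suc i))"
    and "finite A" "A \<subseteq> extensional {..<d}"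
    and "(\<Sum>\<alpha>\<in>A. Const (c \<alpha>) * (\<Prod>i<d. f i ^ \<alpha> i)) \<in> vanishing_ideal (Y d)"
    and "\<alpha> \<in> A"
  shows "c \<alpha> = (0 :: complex)"
  using assms
proof (induction d arbitrary: A c \<alpha>)
  case 0
  have und: "x i = undefined" if "x \<in> A" for x i
    using 0(4) that by (auto simp: extensional_def)
  have "x = \<alpha>" if "x \<in> A" for x
    by (intro ext) (metis und that 0(6))
  then have A: "A = {\<alpha>}" using 0(6) by blast
  obtain y where "y \<in> Y 0" using 0(1)[of 0] by (auto simp: irreducible_closed_def)
  then show ?case using 0(5) by (auto simp: A vanishing_ideal_def)
next
  case (Suc d)
  let ?X = "\<lambda>\<alpha>. (\<Prod>i<d. f i ^ \<alpha> i)"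
  show ?case
    using Suc.prems(3-6)
  \<comment> \<open>The inner induction measures the exponents of \<open>f d\<close>; the measure
    drops when \<open>f d\<close> is divided out, even if the number of terms stays the
    same.\<close>
  proof (induction "\<Sum>\<alpha>\<in>A. \<alpha> d + 1" arbitrary: A c \<alpha> rule: less_induct)
    case less
    have A: "finite A" "A \<subseteq> extensional {..<Suc d}" by fact+
    define A0 A1 where "A0 = {\<alpha>\<in>A. \<alpha> d = 0}" and "A1 = {\<alpha>\<in>A. \<alpha> d \<noteq> 0}"
    \<comment> \<open>\<open>res\<close> forgets the exponent of \<open>f d\<close>, as
      extensionality on \<open>{..<d}\<close> demands; \<open>low\<close> lowers it by one.\<close>
    define res where "res \<alpha> = \<alpha>(d := undefined)" for \<alpha> :: "nat \<Rightarrow> nat"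
    define low where "low \<alpha> = \<alpha>(d := \<alpha> d - 1)" for \<alpha> :: "nat \<Rightarrow> nat"
    have fin: "finite A0" "finite A1" and AA: "A = A0 \<union> A1" "A0 \<inter> A1 = {}"
      using A by (auto simp: A0_def A1_def)
    have inj0: "inj_on res A0"
      by (rule inj_on_inverseI[where g = "\<lambda>\<gamma>. \<gamma>(d := 0)"]) (simp add: A0_def res_def fun_upd_idem)
    have inj1: "inj_on low A1"
      by (rule inj_on_inverseI[where g = "\<lambda>\<gamma>. \<gamma>(d := \<gamma> d + 1)"]) (simp add: A1_def low_def fun_upd_idem)
    have Xres: "?X (res \<alpha>) = ?X \<alpha>" "?X (low \<alpha>) = ?X \<alpha>" for \<alpha>
      by (auto simp: res_def low_def intro!: prod.cong)
    have sum1: "(\<Sum>\<alpha>\<in>A1. Const (c \<alpha>) * (\<Prod>i<Suc d. f i ^ \<alpha> i)) =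
        f d * (\<Sum>\<alpha>\<in>A1. Const (c \<alpha>) * (\<Prod>i<Suc d. f i ^ low \<alpha> i))"
      unfolding sum_distrib_left
    proof (intro sum.cong refl)
      fix \<alpha> assume "\<alpha> \<in> A1"
      then have "\<alpha> d = Suc (low \<alpha> d)" by (auto simp: A1_def low_def)
      then show "Const (c \<alpha>) * (\<Prod>i<Suc d. f i ^ \<alpha> i) = f d * (Const (c \<alpha>) * (\<Prod>i<Suc d. f i ^ low \<alpha> i))"
        by (simp add: Xres mult_ac)
    qed
    have sum0: "(\<Sum>\<alpha>\<in>A0. Const (c \<alpha>) * (\<Prod>i<Suc d. f i ^ \<alpha> i)) = (\<Sum>\<alpha>\<in>A0. Const (c \<alpha>) * ?X \<alpha>)"
      by (intro sum.cong) (auto simp: A0_def)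
    have split: "(\<Sum>\<alpha>\<in>A. Const (c \<alpha>) * (\<Prod>i<Suc d. f i ^ \<alpha> i)) =
        (\<Sum>\<alpha>\<in>A0. Const (c \<alpha>) * ?X \<alpha>) + f d * (\<Sum>\<alpha>\<in>A1. Const (c \<alpha>) * (\<Prod>i<Suc d. f i ^ low \<alpha> i))"
      unfolding AA(1) using fin AA(2) by (simp only: sum.union_disjoint sum0 sum1)
    have Yd: "Y d \<subseteq> Y (Suc d)" using Suc.prems(2) by simp
    have "(\<Sum>\<alpha>\<in>A0. Const (c \<alpha>) * ?X \<alpha>) \<in> vanishing_ideal (Y d)"
    proof -
      have mono: "vanishing_ideal (Y (Suc d)) \<subseteq> vanishing_ideal (Y d)"
        using Yd by (auto simp: vanishing_ideal_def)
      have "f d \<in> vanishing_ideal (Y d)" using Suc.prems(2)[of d] by simp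
      note * = is_idealD(4)[OF is_ideal_vanishing_ideal this]
      show ?thesis
        using is_idealD(6)[OF is_ideal_vanishing_ideal subsetD[OF mono less.prems(3)[unfolded split]] *]
        by (metis (no_types, lifting) add_diff_cancel_right')
    qed
    then have v0: "(\<Sum>\<alpha>\<in>res ` A0. Const (c (\<alpha>(d := 0))) * ?X \<alpha>) \<in> vanishing_ideal (Y d)"
    proof -
      have "(\<Sum>\<alpha>\<in>res ` A0. Const (c (\<alpha>(d := 0))) * ?X \<alpha>) = (\<Sum>\<alpha>\<in>A0. Const (c ((res \<alpha>)(d := 0))) * ?X \<alpha>)"
        by (simp add: sum.reindex[OF inj0] Xres)
      also have "\<dots> = (\<Sum>\<alpha>\<in>A0. Const (c \<alpha>) * ?X \<alpha>)"
        by (intro sum.cong refl) (auto simp: A0_def res_def fun_upd_idem)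
      finally show ?thesis using \<open>_ \<in> vanishing_ideal (Y d)\<close> by simp
    qed
    have c0: "c \<beta> = 0" if "\<beta> \<in> A0" for \<beta>
    proof -
      have "c ((res \<beta>)(d := 0)) = 0"
      proof (rule Suc.IH[OF _ _ _ _ v0])
        show "res ` A0 \<subseteq> extensional {..<d}"
          using A by (auto simp: A0_def res_def extensional_def)
      qed (use Suc.prems(1,2) fin that in auto)
      then show ?thesis using that by (auto simp: A0_def res_def fun_upd_idem)
    qed
    show ?case
    proof (cases "\<alpha> \<in> A0")
      case True then show ?thesis using c0 by blast
    next
      case False
      then have a1: "\<alpha> \<in> A1" using less.prems AA by auto
      have "f d * (\<Sum>\<alpha>\<in>A1. Const (c \<alpha>) * (\<Prod>i<Suc d. f i ^ low \<alpha> i)) \<in> vanishing_ideal (Y (Suc d))"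
      proof -
        have "(\<Sum>\<alpha>\<in>A0. Const (c \<alpha>) * ?X \<alpha>) = 0"
          by (intro sum.neutral) (simp add: c0 Const_def)
        then show ?thesis using less.prems(3) unfolding split by (simp only: add_0_left)
      qed
      then have "(\<Sum>\<alpha>\<in>A1. Const (c \<alpha>) * (\<Prod>i<Suc d. f i ^ low \<alpha> i)) * f d \<in> vanishing_ideal (Y (Suc d))"
        by (subst mult.commute)
      from irreducible_vanishing_ideal_prime[OF Suc.prems(1)[OF order_refl] this]
      have "(\<Sum>\<alpha>\<in>A1. Const (c \<alpha>) * (\<Prod>i<Suc d. f i ^ low \<alpha> i)) \<in> vanishing_ideal (Y (Suc d))"
        using Suc.prems(2)[OF lessI] by blast
      moreover define up where "up \<alpha> = \<alpha>(d := \<alpha> d + 1)" for \<alpha> :: "nat \<Rightarrow> nat"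
      have up: "up (low \<beta>) = \<beta>" if "\<beta> \<in> A1" for \<beta> using that by (auto simp: up_def low_def A1_def)
      have "(\<Sum>\<alpha>\<in>A1. Const (c \<alpha>) * (\<Prod>i<Suc d. f i ^ low \<alpha> i)) =
          (\<Sum>\<alpha>\<in>low ` A1. Const (c (up \<alpha>)) * (\<Prod>i<Suc d. f i ^ \<alpha> i))"
        by (subst sum.reindex[OF inj1]) (auto intro!: sum.cong simp: up)
      ultimately have v1: "(\<Sum>\<alpha>\<in>low ` A1. Const (c (up \<alpha>)) * (\<Prod>i<Suc d. f i ^ \<alpha> i)) \<in> vanishing_ideal (Y (Suc d))"
        by simp
      have "(\<Sum>\<alpha>\<in>low ` A1. \<alpha> d + 1) < (\<Sum>\<alpha>\<in>A. \<alpha> d + 1)"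
      proof -
        have "(\<Sum>\<alpha>\<in>low ` A1. \<alpha> d + 1) = (\<Sum>\<alpha>\<in>A1. low \<alpha> d + 1)" by (simp add: sum.reindex[OF inj1])
        also have "\<dots> < (\<Sum>\<alpha>\<in>A1. \<alpha> d + 1)"
          using fin a1 by (intro sum_strict_mono) (auto simp: A1_def low_def)
        also have "\<dots> \<le> (\<Sum>\<alpha>\<in>A. \<alpha> d + 1)" using A AA by (intro sum_mono2) auto
        finally show ?thesis .
      qed
      then have "c (up (low \<alpha>)) = 0"
        by (rule less.hyps[OF _ _ _ v1]) (use A a1 fin in \<open>auto simp: A1_def low_def extensional_def\<close>)
      then show ?thesis using up[OF a1] by simp
    qed
  qed
qed

text \<open>Gaussian elimination: a vector with nonzero last coordinate is the pivot by which the
  others are reduced. It serves the dimension count as well as the rank arguments for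
  minors.\<close>

lemma exists_linear_dependence:
  fixes g :: "'a \<Rightarrow> nat \<Rightarrow> 'b :: field"
  assumes "finite A" "m < card A"
  obtains c where "\<exists>a\<in>A. c a \<noteq> 0" "\<And>j. j < m \<Longrightarrow> (\<Sum>a\<in>A. c a * g a j) = 0"
proof -
  have "\<exists>c. (\<exists>a\<in>A. c a \<noteq> 0) \<and> (\<forall>j<m. (\<Sum>a\<in>A. c a * g a j) = 0)"
    using assms
  proof (induction m arbitrary: A g)
    case 0
    then have "A \<noteq> {}" by auto
    then show ?case by (intro exI[of _ "\<lambda>_. 1"]) auto
  next
    case (Suc m)
    show ?case
    proof (cases "\<exists>a0\<in>A. g a0 m \<noteq> 0")
      case False
      obtain c where "\<exists>a\<in>A. c a \<noteq> 0" "\<forall>j<m. (\<Sum>a\<in>A. c a * g a j) = 0"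
        using Suc.IH[of A g] Suc.prems by auto
      then show ?thesis using False by (intro exI[of _ c]) (auto simp: less_Suc_eq)
    next
      case True
      then obtain a0 where a0: "a0 \<in> A" "g a0 m \<noteq> 0" by blast
      let ?B = "A - {a0}"
      obtain c where c: "\<exists>a\<in>?B. c a \<noteq> 0"
        "\<forall>j<m. (\<Sum>a\<in>?B. c a * (g a j - g a m / g a0 m * g a0 j)) = 0"
      proof -
        have "finite ?B" "m < card ?B" using Suc.prems a0 by simp_all
        from Suc.IH[OF this, of "\<lambda>a j. g a j - g a m / g a0 m * g a0 j"] show ?thesis using that by blast
      qed
      define s where "s = - (\<Sum>a\<in>?B. c a * g a m / g a0 m)"
      have sum: "(\<Sum>a\<in>A. (c(a0 := s)) a * g a j) = (\<Sum>a\<in>?B. c a * (g a j - g a m / g a0 m * g a0 j))" for j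
      proof -
        have "(\<Sum>a\<in>A. (c(a0 := s)) a * g a j) = s * g a0 j + (\<Sum>a\<in>?B. c a * g a j)"
          using Suc.prems(1) a0 by (subst sum.remove[of A a0]) (auto intro!: sum.cong)
        also have "\<dots> = (\<Sum>a\<in>?B. c a * (g a j - g a m / g a0 m * g a0 j))"
          by (simp add: s_def sum_distrib_right right_diff_distrib sum_subtractf mult.assoc)
        finally show ?thesis .
      qed
      have "(\<Sum>a\<in>A. (c(a0 := s)) a * g a j) = 0" if "j < Suc m" for j
        unfolding sum using c(2) a0(2) that by (auto simp: less_Suc_eq)
      moreover have "\<exists>a\<in>A. (c(a0 := s)) a \<noteq> 0" using c(1) by auto
      ultimately show ?thesis by blast
    qed
  qed
  then show thesis using that by blast
qed

section \<open>Degree bounds and the growth of functions on the variety\<close>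

lemma deg_le_mono: "deg_le m f \<Longrightarrow> m \<le> n \<Longrightarrow> deg_le n f"
  by (auto simp: deg_le_def)

lemma deg_le_mult: "deg_le m f \<Longrightarrow> deg_le n g \<Longrightarrow> deg_le (m + n) (f * g)"
  using keys_mult[of f g] by (fastforce simp: deg_le_def mdeg_add intro: add_mono)

lemma deg_le_Const: "deg_le n (Const c)"
  by (auto simp: deg_le_def Const_def mdeg_def split: if_splits)

lemma deg_le_power: "deg_le m f \<Longrightarrow> deg_le (k * m) (f ^ k)"
proof (induction k)
  case 0
  then show ?case using deg_le_Const[of 0 1] by (simp add: Const_def)
qed (auto dest: deg_le_mult)

lemma deg_le_prod:
  assumes "\<And>a. a \<in> A \<Longrightarrow> deg_le m (f a)"
  shows "deg_le (card A * m) (prod f A)"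
  using assms
proof (induction A rule: infinite_finite_induct)
  case (insert a A)
  then have "deg_le (m + card A * m) (f a * prod f A)" by (intro deg_le_mult) auto
  then show ?case using insert by simp
qed (use deg_le_Const[of 0 1] in \<open>simp_all add: Const_def\<close>)

lemma deg_le_sum:
  assumes "\<And>a. a \<in> A \<Longrightarrow> deg_le m (f a)"
  shows "deg_le m (sum f A)"
  using keys_sum[of f A] assms unfolding deg_le_def by blast

text \<open>Codes of monomials of degree at most \<open>n\<close> have four digits in base
  \<open>n + 1\<close>, so \<open>(n + 1)^4\<close> coefficients on the Kronecker curve determine
  such a function on the variety.\<close>

lemma coeff_kron_eq_0:
  assumes "deg_le n f" "(Suc n)^4 \<le> j"
  shows "coeff (kron (Suc n) f) j = 0"
proof -
  have code: "kron_code (Suc n) m < (Suc n)^4" if "m \<in> Poly_Mapping.keys f" for m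
  proof -
    have d: "mdeg m \<le> n" using that assms(1) by (auto simp: deg_le_def)
    then have c: "cnt s 1 m \<le> n" for s using mdeg_eq_cnt[of m s] by linarith
    have "kron_code (Suc n) m \<le> n + Suc n * n + (Suc n)^2 * n + (Suc n)^3 * n"
      unfolding kron_code_def by (intro add_mono mult_mono d c) auto
    also have "\<dots> < (Suc n)^4" by (simp add: power2_eq_square power3_eq_cube power4_eq_xxxx algebra_simps)
    finally show ?thesis .
  qed
  have "kron (Suc n) f = kron (Suc n) (\<Sum>m\<in>Poly_Mapping.keys f. Poly_Mapping.single m (Poly_Mapping.lookup f m))"
    by (rule arg_cong[OF poly_mapping_sum_single])
  then have "coeff (kron (Suc n) f) j = (\<Sum>m\<in>Poly_Mapping.keys f. coeff (monom (Poly_Mapping.lookup f m) (kron_code (Suc n) m)) j)"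
    by (simp add: kron_sum kron_single coeff_sum)
  also have "\<dots> = 0" using code assms(2) by (intro sum.neutral) fastforce
  finally show ?thesis .
qed

text \<open>Along a chain of length 5 one obtains \<open>(M + 1)^5\<close> independent functions of degree \<open>O(M)\<close>,
  while the functions of degree at most \<open>D\<close> span a space of dimension at most \<open>(D + 1)^4\<close>.\<close>

lemma Segre222_no_long_chain:
  assumes "\<And>i. i \<le> 5 \<Longrightarrow> irreducible_closed (Y i) \<and> Y i \<subseteq> Segre222"
    and "\<And>i. i < 5 \<Longrightarrow> Y i \<subset> Y (Suc i)"
  shows False
proof -
  have "\<exists>f. f \<in> vanishing_ideal (Y i) \<and> f \<notin> vanishing_ideal (Y (Suc i))" if "i < 5" for i
  proof (rule ccontr)
    assume "\<not> ?thesis"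
    then have "vanishing_ideal (Y i) \<subseteq> vanishing_ideal (Y (Suc i))" by auto
    then have "zero_locus (vanishing_ideal (Y (Suc i))) \<subseteq> zero_locus (vanishing_ideal (Y i))"
      by (auto simp: zero_locus_def)
    moreover have "zariski_closed (Y i)" "zariski_closed (Y (Suc i))"
      using assms(1)[of i] assms(1)[of "Suc i"] that by (auto simp: irreducible_closed_def)
    ultimately have "Y (Suc i) \<subseteq> Y i" by (simp add: zero_locus_vanishing_ideal)
    then show False using assms(2)[OF that] by auto
  qed
  then obtain f where f: "\<And>i. i < 5 \<Longrightarrow> f i \<in> vanishing_ideal (Y i) \<and> f i \<notin> vanishing_ideal (Y (Suc i))"
    by metis
  obtain dg where dg: "\<And>i. deg_le (dg i) (f i)" using choice[of "\<lambda>i n. deg_le n (f i)"] deg_le_exists by blast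
  define e where "e = (\<Sum>i<5::nat. dg i)"
  have e: "deg_le e (f i)" if "i < 5" for i
  proof -
    have "dg i \<le> e" unfolding e_def by (rule member_le_sum) (use that in auto)
    then show ?thesis by (rule deg_le_mono[OF dg])
  qed
  \<comment> \<open>With this \<open>M\<close>, the bound
    \<open>Suc D \<le> (5 * e + 1) * (M + 1)\<close> gives
    \<open>(Suc D)^4 \<le> M * (M + 1)^4\<close>, which is less than
    \<open>(M + 1)^5\<close>.\<close>
  define M where "M = (5 * e + 1)^4"
  define A where "A = {..<5::nat} \<rightarrow>\<^sub>E {..M}"
  define D where "D = 5 * (M * e)"
  define F where "F \<alpha> = (\<Prod>i<5. f i ^ \<alpha> i)" for \<alpha> :: "nat \<Rightarrow> nat"
  have A: "finite A" "card A = (M + 1)^5" "A \<subseteq> extensional {..<5}"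
    unfolding A_def by (intro finite_PiE; simp) (simp add: card_PiE, simp add: PiE_def)
  have FD: "deg_le D (F \<alpha>)" if "\<alpha> \<in> A" for \<alpha>
  proof -
    have "deg_le (M * e) (f i ^ \<alpha> i)" if "i < 5" for i
      using \<open>\<alpha> \<in> A\<close> that by (intro deg_le_mono[OF deg_le_power[OF e]]) (auto simp: A_def)
    then show ?thesis using deg_le_prod[of "{..<5::nat}" "M * e" "\<lambda>i. f i ^ \<alpha> i"] by (simp add: F_def D_def)
  qed
  have "(Suc D)^4 < card A"
  proof -
    have "Suc D \<le> (5 * e + 1) * (M + 1)" by (simp add: D_def algebra_simps)
    then have "(Suc D)^4 \<le> ((5 * e + 1) * (M + 1))^4" by (rule power_mono) simp
    also have "\<dots> = M * (M + 1)^4" by (simp only: power_mult_distrib M_def)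
    also have "\<dots> < (M + 1) * (M + 1)^4" by simp
    also have "\<dots> = card A" by (simp only: A power_Suc[symmetric]) simp
    finally show ?thesis .
  qed
  then obtain c where c: "\<exists>\<alpha>\<in>A. c \<alpha> \<noteq> 0"
      "\<And>j. j < (Suc D)^4 \<Longrightarrow> (\<Sum>\<alpha>\<in>A. c \<alpha> * coeff (kron (Suc D) (F \<alpha>)) j) = 0"
    using exists_linear_dependence[OF A(1), of "(Suc D)^4" "\<lambda>\<alpha>. coeff (kron (Suc D) (F \<alpha>))"] by metis
  let ?G = "\<Sum>\<alpha>\<in>A. Const (c \<alpha>) * F \<alpha>"
  have G: "deg_le D ?G"
  proof (rule deg_le_sum)
    fix \<alpha> assume "\<alpha> \<in> A"
    then show "deg_le D (Const (c \<alpha>) * F \<alpha>)"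
      using deg_le_mult[OF deg_le_Const[of 0 "c \<alpha>"] FD] by simp
  qed
  have "coeff (kron (Suc D) ?G) j = 0" for j
  proof (cases "j < (Suc D)^4")
    case True
    have "coeff (kron (Suc D) ?G) j = (\<Sum>\<alpha>\<in>A. c \<alpha> * coeff (kron (Suc D) (F \<alpha>)) j)"
      by (simp add: kron_def coeff_sum)
    then show ?thesis using c(2)[OF True] by simp
  qed (simp add: coeff_kron_eq_0[OF G])
  then have "kron (Suc D) ?G = 0" by (simp add: poly_eq_iff)
  then have "?G \<in> vanishing_ideal Segre222"
    using kron_injective[OF G lessI] vanishing_ideal_Segre222 by simp
  moreover have "Y 5 \<subseteq> Segre222" using assms(1)[of 5] by simp
  ultimately have "?G \<in> vanishing_ideal (Y 5)" unfolding vanishing_ideal_def by blast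
  then have "c \<alpha> = 0" if "\<alpha> \<in> A" for \<alpha>
    unfolding F_def
    by (intro independent_monomials_on_chain[of 5 Y f A c]) (use assms f A that in auto)
  then show False using c(1) by blast
qed

lemma variety_dim_Segre222: "variety_dim Segre222 = 4"
proof -
  let ?S = "{d. \<exists>Y :: nat \<Rightarrow> (complex ^ idx) set.
     (\<forall>i \<le> d. irreducible_closed (Y i) \<and> Y i \<subseteq> Segre222) \<and> (\<forall>i < d. Y i \<subset> Y (Suc i))}"
  have "d \<le> 4" if d: "d \<in> ?S" for d
  proof (rule ccontr)
    assume "\<not> d \<le> 4"
    obtain Y :: "nat \<Rightarrow> (complex ^ idx) set" where
      Y: "\<forall>i \<le> d. irreducible_closed (Y i) \<and> Y i \<subseteq> Segre222" "\<forall>i < d. Y i \<subset> Y (Suc i)"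
      using d by blast
    show False by (rule Segre222_no_long_chain[of Y]) (use Y \<open>\<not> d \<le> 4\<close> in auto)
  qed
  moreover have "4 \<in> ?S" using Segre222_chain by blast
  ultimately show ?thesis unfolding variety_dim_def by (intro cSup_eq_maximum) blast+
qed

lemma codim_Segre222: "codim Segre222 = 4"
  by (simp add: codim_def variety_dim_Segre222)

section \<open>Minors and spans of rows\<close>

abbreviation detf :: "nat \<Rightarrow> (nat \<Rightarrow> nat \<Rightarrow> 'r) \<Rightarrow> 'r :: comm_ring_1" where
  "detf m f \<equiv> Determinant.det (Matrix.mat m m (\<lambda>(i, j). f i j))"

lemma detf_cong: "(\<And>i j. i < m \<Longrightarrow> j < m \<Longrightarrow> f i j = g i j) \<Longrightarrow> detf m f = detf m g"
  by (rule arg_cong[where f = Determinant.det]) (auto intro!: eq_matI)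

lemma hom_detf:
  assumes "comm_ring_hom h"
  shows "h (detf m f) = detf m (\<lambda>i j. h (f i j))"
proof -
  interpret comm_ring_hom h by (rule assms)
  have "map_mat h (Matrix.mat m m (\<lambda>(i, j). f i j)) = Matrix.mat m m (\<lambda>(i, j). h (f i j))"
    by (auto intro!: eq_matI)
  then show ?thesis by (metis hom_det)
qed

text \<open>The cofactors \<open>C\<close> of the border column do not involve its entries, hence
  not \<open>k\<close>; the first of them is the unbordered minor.\<close>

lemma detf_border:
  "\<exists>C. (\<forall>k. detf (Suc m) (\<lambda>a b. case b of 0 \<Rightarrow> B a k | Suc b' \<Rightarrow> D a b') = (\<Sum>a<Suc m. B a k * C a)) \<and>
    C 0 = detf m (\<lambda>a b. D (Suc a) b)"
proof (intro exI conjI allI)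
  let ?C = "\<lambda>i. (-1) ^ i * detf m (\<lambda>a b. D (if a < i then a else Suc a) b)"
  show "?C 0 = detf m (\<lambda>a b. D (Suc a) b)" by simp
  fix k
  let ?f = "\<lambda>a b. case b of 0 \<Rightarrow> B a k | Suc b' \<Rightarrow> D a b'"
  let ?M = "Matrix.mat (Suc m) (Suc m) (\<lambda>(i, j). ?f i j)"
  have "detf (Suc m) ?f = (\<Sum>i<Suc m. ?M $$ (i, 0) * cofactor ?M i 0)"
    by (rule laplace_expansion_column) auto
  also have "\<dots> = (\<Sum>a<Suc m. B a k * ?C a)"
  proof (intro sum.cong refl)
    fix i assume i: "i \<in> {..<Suc m}"
    have "mat_delete ?M i 0 = Matrix.mat m m (\<lambda>(a, b). D (if a < i then a else Suc a) b)"
      by (rule eq_matI) (auto simp: mat_delete_def)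
    then show "?M $$ (i, 0) * cofactor ?M i 0 = B i k * ?C i"
      using i by (simp add: cofactor_def)
  qed
  finally show "detf (Suc m) ?f = (\<Sum>a<Suc m. B a k * ?C a)" .
qed

lemma detf_eq_0_if_rows_dependent:
  fixes f :: "nat \<Rightarrow> nat \<Rightarrow> 'a :: field"
  assumes "\<exists>a<m. x a \<noteq> 0" "\<And>b. b < m \<Longrightarrow> (\<Sum>a<m. x a * f a b) = 0"
  shows "detf m f = 0"
proof -
  let ?M = "Matrix.mat m m (\<lambda>(i, j). f i j)"
  have "transpose_mat ?M *\<^sub>v Matrix.vec m x = 0\<^sub>v m"
    by (rule eq_vecI) (use assms(2) in \<open>auto simp: scalar_prod_def mult.commute atLeast0LessThan\<close>)
  moreover have "Matrix.vec m x \<noteq> 0\<^sub>v m"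
    using assms(1) by (auto simp: vec_eq_iff)
  ultimately have "Determinant.det (transpose_mat ?M) = 0"
    by (subst det_0_iff_vec_prod_zero_field[of _ m]) (auto intro!: exI[of _ "Matrix.vec m x"])
  then show ?thesis by (simp add: det_transpose[of _ m])
qed

lemma detf_eq_0_if_columns_eq:
  assumes "i < m" "j < m" "i \<noteq> j" "\<And>a. a < m \<Longrightarrow> f a i = f a j"
  shows "detf m f = 0"
  by (rule det_identical_columns[OF _ assms(3,1,2)]) (use assms in \<open>auto intro!: eq_vecI\<close>)

lemma detf_0 [simp]: "detf 0 f = 1"
  by simp

lemma detf_border_eq_0_if_repeated_column:
  assumes "k \<in> \<kappa> ` {..<m}"
  shows "detf (Suc m) (\<lambda>a b. A a (case b of 0 \<Rightarrow> k | Suc b' \<Rightarrow> \<kappa> b')) = 0"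
proof -
  obtain b where "b < m" "k = \<kappa> b" using assms by auto
  then show ?thesis by (intro detf_eq_0_if_columns_eq[of 0 _ "Suc b"]) auto
qed

lemma in_minors:
  assumes "inj_on \<rho> {..<m}" "\<rho> ` {..<m} \<subseteq> {..<s}" "inj_on \<kappa> {..<m}"
  shows "detf m (\<lambda>i j. A (\<rho> i) (\<kappa> j)) \<in> minors m s A"
  using assms unfolding minors_def by blast

lemma inj_on_case_nat:
  assumes "inj_on \<rho> {..<m}" "i \<notin> \<rho> ` {..<m}"
  shows "inj_on (case_nat i \<rho>) {..<Suc m}"
  using assms by (auto simp: inj_on_def split: nat.splits)

text \<open>The minor is bordered by row \<open>i\<close> and an arbitrary column \<open>k\<close>.
  The bordered determinant vanishes, by hypothesis or because a column is repeated, and its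
  expansion along column \<open>k\<close> solves for row \<open>i\<close> with coefficients
  independent of \<open>k\<close>.\<close>

lemma rows_in_span_of_minor:
  fixes A :: "nat \<Rightarrow> 'n \<Rightarrow> 'a :: field"
  assumes \<rho>: "inj_on \<rho> {..<m}" "\<rho> ` {..<m} \<subseteq> {..<s}" and \<kappa>: "inj_on \<kappa> {..<m}"
    and nz: "detf m (\<lambda>i j. A (\<rho> i) (\<kappa> j)) \<noteq> 0"
    and zero: "minors (Suc m) s A \<subseteq> {0}" and i: "i < s"
  shows "\<exists>c. \<forall>k. A i k = (\<Sum>j<m. c j * A (\<rho> j) k)"
proof (cases "i \<in> \<rho> ` {..<m}")
  case True
  then obtain j where "j < m" "i = \<rho> j" by auto
  then have *: "A i k = (\<Sum>j'<m. of_bool (j' = j) * A (\<rho> j') k)" for k by (simp add: of_bool_def if_distrib[of "\<lambda>x. x * _"] cong: if_cong)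
  show ?thesis by (rule exI[of _ "\<lambda>j'. of_bool (j' = j)"], rule allI, rule *)
next
  case False
  obtain C where C: "\<And>k. detf (Suc m) (\<lambda>a b. case b of 0 \<Rightarrow> A (case_nat i \<rho> a) k | Suc b' \<Rightarrow> A (case_nat i \<rho> a) (\<kappa> b')) =
      (\<Sum>a<Suc m. A (case_nat i \<rho> a) k * C a)" "C 0 = detf m (\<lambda>a b. A (case_nat i \<rho> (Suc a)) (\<kappa> b))"
    using detf_border[of m "\<lambda>a k. A (case_nat i \<rho> a) k" "\<lambda>a b'. A (case_nat i \<rho> a) (\<kappa> b')"] by blast
  have C0: "C 0 \<noteq> 0" using C(2) nz by simp
  have "(\<Sum>a<Suc m. A (case_nat i \<rho> a) k * C a) = 0" for k
  proof -
    have "detf (Suc m) (\<lambda>a b. A (case_nat i \<rho> a) (case_nat k \<kappa> b)) = 0"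
    proof (cases "k \<in> \<kappa> ` {..<m}")
      case True then show ?thesis by (rule detf_border_eq_0_if_repeated_column)
    next
      case k: False
      have "detf (Suc m) (\<lambda>a b. A (case_nat i \<rho> a) (case_nat k \<kappa> b)) \<in> minors (Suc m) s A"
        by (intro in_minors inj_on_case_nat \<rho> \<kappa> False k) (use \<rho>(2) i in \<open>auto simp: image_subset_iff split: nat.splits\<close>)
      then show ?thesis using zero by auto
    qed
    moreover have "detf (Suc m) (\<lambda>a b. A (case_nat i \<rho> a) (case_nat k \<kappa> b)) =
       detf (Suc m) (\<lambda>a b. case b of 0 \<Rightarrow> A (case_nat i \<rho> a) k | Suc b' \<Rightarrow> A (case_nat i \<rho> a) (\<kappa> b'))"
      by (intro detf_cong) (auto split: nat.splits)
    ultimately show ?thesis using C(1)[of k] by simp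
  qed
  then have "A i k * C 0 + (\<Sum>j<m. A (\<rho> j) k * C (Suc j)) = 0" for k
    by (simp add: sum.lessThan_Suc_shift del: sum.lessThan_Suc)
  then have *: "A i k = (\<Sum>j<m. (- C (Suc j) / C 0) * A (\<rho> j) k)" for k
  proof -
    have "A i k * C 0 = (\<Sum>j<m. - C (Suc j) * A (\<rho> j) k)"
      using \<open>\<And>k. A i k * C 0 + (\<Sum>j<m. A (\<rho> j) k * C (Suc j)) = 0\<close>[of k]
      by (simp add: sum_negf eq_neg_iff_add_eq_0 mult.commute)
    then have "A i k = (\<Sum>j<m. - C (Suc j) * A (\<rho> j) k) / C 0" using C0 by (simp add: field_simps)
    then show ?thesis by (simp add: sum_divide_distrib)
  qed
  show ?thesis by (rule exI[of _ "\<lambda>j. - C (Suc j) / C 0"], rule allI, rule *)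
qed

text \<open>If all \<open>m\<close>-minors vanished, a nonzero minor just below the first size at
  which all vanish would provide fewer than \<open>m\<close> rows spanning every row, and the
  \<open>m\<close> vectors \<open>g i\<close> would be dependent.\<close>

lemma exists_nonzero_minor:
  fixes A :: "nat \<Rightarrow> 'n \<Rightarrow> 'a :: field"
  assumes span: "\<And>i. i < m \<Longrightarrow> \<exists>c. \<forall>k. g i k = (\<Sum>j<s. c j * A j k)"
    and indep: "\<And>x. (\<And>k. (\<Sum>i<m. x i * g i k) = 0) \<Longrightarrow> \<forall>i<m. x i = 0"
  shows "\<exists>d \<in> minors m s A. d \<noteq> 0"
proof (rule ccontr)
  assume "\<not> ?thesis"
  then have "minors m s A \<subseteq> {0}" by auto
  define n where "n = (LEAST n. minors n s A \<subseteq> {0})"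
  have n: "minors n s A \<subseteq> {0}" "n \<le> m"
    unfolding n_def using LeastI[of "\<lambda>n. minors n s A \<subseteq> {0}" m] Least_le[of "\<lambda>n. minors n s A \<subseteq> {0}" m]
      \<open>minors m s A \<subseteq> {0}\<close> by blast+
  \<comment> \<open>The empty minor is 1, so the least size at which all minors vanish is
    positive.\<close>
  have "detf 0 (\<lambda>i j. A (id i) ((\<lambda>_. undefined) j)) \<in> minors 0 s A" by (rule in_minors) auto
  then have "\<not> minors 0 s A \<subseteq> {0}" by auto
  then obtain n' where n': "n = Suc n'" using n(1) by (cases n) auto
  have "\<not> minors n' s A \<subseteq> {0}" using n' not_less_Least[of n' "\<lambda>n. minors n s A \<subseteq> {0}"] unfolding n_def by auto
  then obtain \<rho> \<kappa> where \<rho>: "inj_on \<rho> {..<n'}" "\<rho> ` {..<n'} \<subseteq> {..<s}" and \<kappa>: "inj_on \<kappa> {..<n'}"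
    and nz: "detf n' (\<lambda>i j. A (\<rho> i) (\<kappa> j)) \<noteq> 0" unfolding minors_def by auto
  have "\<exists>c. \<forall>k. A i k = (\<Sum>j<n'. c j * A (\<rho> j) k)" if "i < s" for i
    using rows_in_span_of_minor[OF \<rho> \<kappa> nz n(1)[unfolded n'] that] .
  then obtain c where c: "\<And>i k. i < s \<Longrightarrow> A i k = (\<Sum>j<n'. c i j * A (\<rho> j) k)" by metis
  obtain e where e: "\<And>i k. i < m \<Longrightarrow> g i k = (\<Sum>l<s. e i l * A l k)" using span by metis
  define h where "h i j = (\<Sum>l<s. e i l * c l j)" for i j
  have g: "g i k = (\<Sum>j<n'. h i j * A (\<rho> j) k)" if "i < m" for i k
  proof -
    have "g i k = (\<Sum>l<s. e i l * (\<Sum>j<n'. c l j * A (\<rho> j) k))" using e[OF that] c by simp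
    also have "\<dots> = (\<Sum>j<n'. \<Sum>l<s. e i l * c l j * A (\<rho> j) k)"
      by (subst sum.swap) (simp add: sum_distrib_left mult.assoc)
    finally show ?thesis by (simp add: h_def sum_distrib_right)
  qed
  have "n' < card {..<m}" using n(2) n' by simp
  then obtain x where x: "\<exists>a\<in>{..<m}. x a \<noteq> 0" "\<And>j. j < n' \<Longrightarrow> (\<Sum>a<m. x a * h a j) = 0"
    using exists_linear_dependence[of "{..<m}" n' h] by blast
  have "(\<Sum>i<m. x i * g i k) = 0" for k
  proof -
    have "(\<Sum>i<m. x i * g i k) = (\<Sum>i<m. x i * (\<Sum>j<n'. h i j * A (\<rho> j) k))" using g by simp
    also have "\<dots> = (\<Sum>j<n'. (\<Sum>i<m. x i * h i j) * A (\<rho> j) k)"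
      by (simp add: sum_distrib_left sum_distrib_right mult.assoc) (rule sum.swap)
    also have "\<dots> = 0" using x(2) by simp
    finally show ?thesis .
  qed
  then show False using indep[of x] x(1) by auto
qed

section \<open>Tangent vectors of the Segre variety\<close>

text \<open>The vector field on the space of tensors given by the elementary matrix \<open>E\<^sub>l\<^sub>m\<close> acting on the
  factor \<open>s\<close>; these twelve fields span the tangent spaces of the Segre variety away from \<open>0\<close>.\<close>

definition tf :: "tfactor \<Rightarrow> 2 \<Rightarrow> 2 \<Rightarrow> (idx \<Rightarrow> 'r) \<Rightarrow> idx \<Rightarrow> 'r :: comm_ring_1" where
  "tf s l m z p = (if slot s p = l then z (upd s p m) else 0)"

definition contr :: "tfactor \<Rightarrow> 2 \<Rightarrow> 2 \<Rightarrow> (idx \<Rightarrow> 'r) \<Rightarrow> (idx \<Rightarrow> 'r) \<Rightarrow> 'r :: comm_ring_1" where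
  "contr s l m y z = (\<Sum>p\<in>UNIV. y p * tf s l m z p)"

definition ortho :: "(idx \<Rightarrow> 'r :: comm_ring_1) \<Rightarrow> (idx \<Rightarrow> 'r) \<Rightarrow> bool" where
  "ortho y z \<longleftrightarrow> (\<forall>s l m. contr s l m y z = 0)"

lemma sum_idx: "(\<Sum>p\<in>(UNIV :: idx set). f p) = f (1,1,1) + f (1,1,2) + f (1,2,1) + f (1,2,2)
    + f (2,1,1) + f (2,1,2) + f (2,2,1) + f (2,2,2)"
proof -
  have "(\<Sum>p\<in>(UNIV :: idx set). f p) = (\<Sum>i\<in>UNIV. \<Sum>j\<in>UNIV. \<Sum>k\<in>UNIV. f (i, j, k))"
    by (simp add: sum.cartesian_product flip: UNIV_Times_UNIV)
  then show ?thesis by (simp add: UNIV_2 add.assoc)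
qed

lemma contr_sum: "contr s l m (\<lambda>p. \<Sum>a\<in>A. x a * y a p) z = (\<Sum>a\<in>A. x a * contr s l m (y a) z)"
  unfolding contr_def sum_distrib_left sum_distrib_right by (subst sum.swap) (simp add: mult.assoc)

lemma ortho_sum:
  assumes "\<And>a. a \<in> A \<Longrightarrow> ortho (y a) z"
  shows "ortho (\<lambda>p. \<Sum>a\<in>A. x a * y a p) z"
  using assms by (simp add: ortho_def contr_sum)

text \<open>Around an index \<open>p\<close>, the four indices that differ from \<open>p\<close> in at least two factors.\<close>

definition flip2 :: "2 \<Rightarrow> 2" where "flip2 x = (if x = 1 then 2 else 1)"

lemma flip2_simps [simp]: "flip2 1 = 2" "flip2 2 = 1"
  by (simp_all add: flip2_def)

fun far :: "idx \<Rightarrow> nat \<Rightarrow> idx" where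
  "far (a, b, c) n = (if n = 0 then (flip2 a, flip2 b, c) else if n = 1 then (flip2 a, b, flip2 c)
     else if n = 2 then (a, flip2 b, flip2 c) else (flip2 a, flip2 b, flip2 c))"

lemma lt4: "(i::nat) < 4 \<longleftrightarrow> i = 0 \<or> i = 1 \<or> i = 2 \<or> i = 3"
  by linarith

text \<open>Where \<open>z p\<close> is nonzero, the fields that move one slot of \<open>p\<close>
  determine \<open>y\<close> at the three neighbours of \<open>p\<close>, and a diagonal field then
  determines \<open>y p\<close>. Conormal vectors are thus governed by four entries, in accordance
  with codimension 4.\<close>

lemma ortho_determined_by_far:
  fixes y z :: "idx \<Rightarrow> 'a :: field"
  assumes o: "ortho y z" and nz: "z p \<noteq> 0" and far: "\<And>i. i < 4 \<Longrightarrow> y (far p i) = 0"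
  shows "y q = 0"
proof -
  have far': "y (far p 0) = 0" "y (far p 1) = 0" "y (far p 2) = 0" "y (far p 3) = 0"
    using far by auto
  have c: "\<And>s l m. (\<Sum>q\<in>UNIV. y q * tf s l m z q) = 0" using o by (simp add: ortho_def contr_def)
  obtain a b d where p: "p = (a, b, d)" by (cases p)
  note c1 = c[of S1 "flip2 a" a] and c2 = c[of S2 "flip2 b" b] and c3 = c[of S3 "flip2 d" d] and c4 = c[of S1 a a]
  obtain i j k where q: "q = (i, j, k)" by (cases q)
  have a: "a = 1 \<or> a = 2" and b: "b = 1 \<or> b = 2" and d: "d = 1 \<or> d = 2"
   and i: "i = 1 \<or> i = 2" and j: "j = 1 \<or> j = 2" and k: "k = 1 \<or> k = 2" by (rule exhaust_2)+
  show ?thesis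
    using a b d i j k nz far' c1 c2 c3 c4 unfolding q p sum_idx
    by (elim disjE) (simp_all add: tf_def)
qed

lemma minors_ortho_eq_0:
  fixes y :: "nat \<Rightarrow> idx \<Rightarrow> 'a :: field"
  assumes "\<And>a. a < 5 \<Longrightarrow> ortho (y a) z" "z p \<noteq> 0"
  shows "detf 5 (\<lambda>a b. y a (\<kappa> b)) = 0"
proof -
  obtain x where x: "\<exists>a\<in>{..<5}. x a \<noteq> 0" "\<And>j. j < 4 \<Longrightarrow> (\<Sum>a<5. x a * y a (far p j)) = 0"
    using exists_linear_dependence[of "{..<5::nat}" 4 "\<lambda>a j. y a (far p j)"] by auto
  have "(\<Sum>a<5. x a * y a q) = 0" for q
    by (rule ortho_determined_by_far[where z = z and p = p])
      (use assms x in \<open>auto intro!: ortho_sum\<close>)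
  then show ?thesis using x(1) by (intro detf_eq_0_if_rows_dependent[of _ x]) auto
qed

lemma partial_diff: "partial k (p - q) = partial k p - partial k q"
  using partial_add[of k "p - q" q] by simp

definition grad :: "idx cpoly \<Rightarrow> complex ^ idx \<Rightarrow> idx \<Rightarrow> complex" where
  "grad f z p = cpoly_eval (($) z) (partial p f)"

text \<open>Adding \<open>\<tau>\<close> times the field amounts to a matrix acting on one factor,
  so a whole line stays in the variety and tangency needs no limits.\<close>

lemma tf_in_Segre222:
  assumes "z \<in> Segre222"
  shows "(\<chi> p. z $ p + \<tau> * tf s l m (($) z) p) \<in> Segre222"
proof -
  obtain a b c where z: "z = tensor3 a b c" using assms by (rule Segre222E)
  let ?h = "\<lambda>x :: complex ^ 2. \<chi> i. x $ i + \<tau> * (if i = l then x $ m else 0)"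
  have "(\<chi> p. z $ p + \<tau> * tf s l m (($) z) p) =
      (case s of S1 \<Rightarrow> tensor3 (?h a) b c | S2 \<Rightarrow> tensor3 a (?h b) c | S3 \<Rightarrow> tensor3 a b (?h c))"
    by (cases s) (auto simp: Finite_Cartesian_Product.vec_eq_iff z tf_def algebra_simps)
  then show ?thesis by (cases s) simp_all
qed

lemma dir_deriv_tangent:
  assumes "f \<in> vanishing_ideal Segre222" "z \<in> Segre222"
  shows "dir_deriv (($) z) (tf s l m (($) z)) f = 0"
proof (rule dir_deriv_eq_0)
  fix \<tau>
  have "cpoly_eval (($) (\<chi> p. z $ p + \<tau> * tf s l m (($) z) p)) f = 0"
    using tf_in_Segre222[OF assms(2), of \<tau> s l m] assms(1) unfolding vanishing_ideal_def by blast
  moreover have "($) (\<chi> p. z $ p + \<tau> * tf s l m (($) z) p) = (\<lambda>p. z $ p + \<tau> * tf s l m (($) z) p)"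
    by (intro ext) (rule vec_lambda_beta)
  ultimately show "cpoly_eval (\<lambda>v. z $ v + \<tau> * tf s l m (($) z) v) f = 0" by simp
qed

lemma ortho_grad:
  assumes "f \<in> vanishing_ideal Segre222" "z \<in> Segre222"
  shows "ortho (grad f z) (($) z)"
  using dir_deriv_tangent[OF assms] by (simp add: ortho_def contr_def grad_def dir_deriv_def)

text \<open>All coordinate axes lie in the variety, which makes the origin a singular point.\<close>

lemma grad_0:
  assumes "f \<in> vanishing_ideal Segre222"
  shows "grad f 0 p = 0"
proof -
  have "dir_deriv (($) 0) (\<lambda>q. of_bool (q = p)) f = 0"
  proof (rule dir_deriv_eq_0)
    fix \<tau>
    obtain i j k where p: "p = (i, j, k)" by (cases p)
    have "(\<lambda>q. 0 $ q + \<tau> * of_bool (q = p)) = ($) (tensor3 (axis i \<tau>) (axis j 1) (axis k 1))"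
      by (intro ext) (auto simp: p axis_def split: if_splits)
    then show "cpoly_eval (\<lambda>q. 0 $ q + \<tau> * of_bool (q = p)) f = 0"
      using assms tensor3_in_Segre222 unfolding vanishing_ideal_def by simp
  qed
  then show ?thesis by (simp add: dir_deriv_def grad_def)
qed

text \<open>At a point of the variety the product rule loses the term with the value of
  \<open>f\<close>, so the functions with gradient in the row span form an ideal, and it contains
  the generators. Hence the rank of the Jacobian can be tested on convenient equations.\<close>

lemma grad_in_row_span:
  assumes "z \<in> Segre222" "f \<in> vanishing_ideal Segre222"
    and gen: "ideal_gen (set fs) = vanishing_ideal Segre222"
  shows "\<exists>c. \<forall>k. grad f z k = (\<Sum>j<length fs. c j * grad (fs ! j) z k)"
proof -
  let ?P = "\<lambda>f. \<exists>c. \<forall>k. grad f z k = (\<Sum>j<length fs. c j * grad (fs ! j) z k)"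
  let ?L = "{f \<in> vanishing_ideal Segre222. ?P f}"
  have "is_ideal ?L"
    unfolding is_ideal_def
  proof (intro conjI ballI allI)
    have "?P 0" by (rule exI[of _ "\<lambda>_. 0"]) (simp add: grad_def partial_def)
    then show "0 \<in> ?L" using is_idealD(1)[OF is_ideal_vanishing_ideal] by simp
    fix f assume f: "f \<in> ?L"
    then obtain c where c: "\<And>k. grad f z k = (\<Sum>j<length fs. c j * grad (fs ! j) z k)" by auto
    have f0: "cpoly_eval (($) z) f = 0" using f assms(1) by (auto simp: vanishing_ideal_def)
    show "f + g \<in> ?L" if g: "g \<in> ?L" for g
    proof -
      obtain d where d: "\<And>k. grad g z k = (\<Sum>j<length fs. d j * grad (fs ! j) z k)" using g by auto
      have *: "grad (f + g) z k = (\<Sum>j<length fs. (c j + d j) * grad (fs ! j) z k)" for k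
      proof -
        have "grad (f + g) z k = grad f z k + grad g z k" by (simp add: grad_def partial_add)
        then show ?thesis unfolding c d by (simp add: distrib_right sum.distrib)
      qed
      have "?P (f + g)" by (rule exI[of _ "\<lambda>j. c j + d j"], rule allI, rule *)
      then show ?thesis using f g is_idealD(2)[OF is_ideal_vanishing_ideal] by blast
    qed
    show "r * f \<in> ?L" for r
    proof -
      have *: "grad (r * f) z k = (\<Sum>j<length fs. (cpoly_eval (($) z) r * c j) * grad (fs ! j) z k)" for k
      proof -
        have "grad (r * f) z k = cpoly_eval (($) z) r * grad f z k" by (simp add: grad_def partial_mult f0)
        then show ?thesis unfolding c by (simp add: sum_distrib_left mult.assoc)
      qed
      have "?P (r * f)" by (rule exI[of _ "\<lambda>j. cpoly_eval (($) z) r * c j"], rule allI, rule *)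
      then show ?thesis using f is_idealD(3)[OF is_ideal_vanishing_ideal] by blast
    qed
  qed
  moreover have "set fs \<subseteq> ?L"
  proof
    fix f assume f: "f \<in> set fs"
    then obtain i where i: "i < length fs" "f = fs ! i" by (metis in_set_conv_nth)
    have *: "grad f z k = (\<Sum>j<length fs. of_bool (j = i) * grad (fs ! j) z k)" for k
      using i by (simp add: of_bool_def if_distrib[of "\<lambda>x. x * _"] cong: if_cong)
    have "?P f" by (rule exI[of _ "\<lambda>j. of_bool (j = i)"], rule allI, rule *)
    then show "f \<in> ?L" using f ideal_gen_superset[of "set fs"] gen by auto
  qed
  ultimately have "ideal_gen (set fs) \<subseteq> ?L" by (rule ideal_gen_minimal)
  then show ?thesis using assms(2) gen by auto
qed

abbreviation segs :: "idx cpoly list" where "segs \<equiv> ideal_gens Segre222"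

lemma segs_vanish: "i < length segs \<Longrightarrow> segs ! i \<in> vanishing_ideal Segre222"
  using ideal_gens_Segre222 ideal_gen_superset by (metis nth_mem subsetD)

lemma exists_nonzero_jacobian_minor:
  assumes z: "z \<in> Segre222" "z \<noteq> 0"
  shows "\<exists>d \<in> minors 4 (length segs) (\<lambda>i. grad (segs ! i) z). d \<noteq> 0"
proof -
  obtain a b c where nz: "z $ (a, b, c) \<noteq> 0"
    using z(2) by (auto simp: Finite_Cartesian_Product.vec_eq_iff)
  \<comment> \<open>Each quadric contains the product of the variables at \<open>(a, b, c)\<close>
    and at one far index, so at the far indices the gradients form a triangular matrix with
    \<open>z $ (a, b, c)\<close> on the diagonal. For index 2 the first slots agree, and slot 2 is
    exchanged instead.\<close>
  define Q where "Q = (\<lambda>i::nat. quadric (if i = 2 then S2 else S1) (a, b, c) (far (a, b, c) i))"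
  have Q: "Q i \<in> vanishing_ideal Segre222" for i
    unfolding Q_def vanishing_ideal_Segre222 using quadric_in_quadrics ideal_gen_superset by blast
  show ?thesis
  proof (rule exists_nonzero_minor[where g = "\<lambda>i. grad (Q i) z"])
    show "\<exists>c. \<forall>k. grad (Q i) z k = (\<Sum>j<length segs. c j * grad (segs ! j) z k)" for i
      by (rule grad_in_row_span[OF z(1) Q ideal_gens_Segre222])
    fix x :: "nat \<Rightarrow> complex"
    assume x: "\<And>k. (\<Sum>i<4. x i * grad (Q i) z k) = 0"
    have sum4: "(\<Sum>i<4. x i * grad (Q i) z k) = x 0 * grad (Q 0) z k + x 1 * grad (Q 1) z k
        + x 2 * grad (Q 2) z k + x 3 * grad (Q 3) z k" for k
      by (simp add: numeral_eq_Suc)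
    have ne: "flip2 x \<noteq> x" "x \<noteq> flip2 x" for x by (simp_all add: flip2_def)
    note s = x[unfolded sum4]
    have 3: "x 3 = 0" using s[of "far (a, b, c) 3"] nz
      by (simp add: grad_def Q_def quadric_def partial_diff partial_mult ne)
    show "\<forall>i<4. x i = 0"
      using s[of "far (a, b, c) 0"] s[of "far (a, b, c) 1"] s[of "far (a, b, c) 2"] nz 3
      by (simp add: grad_def Q_def quadric_def partial_diff partial_mult ne lt4)
  qed
qed

section \<open>The hyperdeterminant\<close>

text \<open>\<open>q11\<close>, \<open>q12\<close>, \<open>q22\<close> are the coefficients of the
  determinant on the pencil spanned by the two slices of \<open>y\<close> in the third slot;
  \<open>hdet\<close> is the discriminant of this binary quadratic form.\<close>

definition q11 :: "(idx \<Rightarrow> 'r) \<Rightarrow> 'r :: comm_ring_1" where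
  "q11 y = y (1,1,1) * y (2,2,1) - y (1,2,1) * y (2,1,1)"
definition q22 :: "(idx \<Rightarrow> 'r) \<Rightarrow> 'r :: comm_ring_1" where
  "q22 y = y (1,1,2) * y (2,2,2) - y (1,2,2) * y (2,1,2)"
definition q12 :: "(idx \<Rightarrow> 'r) \<Rightarrow> 'r :: comm_ring_1" where
  "q12 y = y (1,1,1) * y (2,2,2) + y (1,1,2) * y (2,2,1) - y (1,2,1) * y (2,1,2) - y (1,2,2) * y (2,1,1)"
definition hdet :: "(idx \<Rightarrow> 'r) \<Rightarrow> 'r :: comm_ring_1" where
  "hdet y = q12 y ^ 2 - 4 * q11 y * q22 y"

text \<open>Cayley's hyperdeterminant annihilates, modulo the contractions of \<open>y\<close> with \<open>w\<close>, every
  coordinate of \<open>w\<close>.  The identities behind this polarize \<open>det\<close> on the pencil of slices of \<open>y\<close>.\<close>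

lemma hdet_mult_in_ideal:
  fixes y w :: "idx \<Rightarrow> 'r :: comm_ring_1"
  assumes L: "is_ideal L" and E: "\<And>s l m. contr s l m y w \<in> L"
  shows "hdet y * w p \<in> L"
proof -
  note add = is_idealD(2)[OF L] and mult = is_idealD(3)[OF L] and diff = is_idealD(6)[OF L]
  define \<sigma> :: "2 \<Rightarrow> 'r" where "\<sigma> x = (if x = 1 then -1 else 1)" for x
  \<comment> \<open>The combination cancels all entries of \<open>w\<close> except the two whose
    first two indices are opposite to \<open>a\<close> and \<open>\<eta>\<close>.\<close>
  define R where "R k \<eta> a = \<sigma> a * (y (2, \<eta>, k) * contr S1 1 (flip2 a) y w - y (1, \<eta>, k) * contr S1 2 (flip2 a) y w)
    + (y (a, \<eta>, 1) * contr S3 k 1 y w + y (a, \<eta>, 2) * contr S3 k 2 y w)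
    - (y (a, 1, k) * contr S2 \<eta> 1 y w + y (a, 2, k) * contr S2 \<eta> 2 y w)" for k \<eta> a
  have R: "R k \<eta> a \<in> L" for k \<eta> a
    unfolding R_def by (intro add mult diff E)
  have e1: "2 * q11 y * w (flip2 a, flip2 \<eta>, 1) + q12 y * w (flip2 a, flip2 \<eta>, 2) = \<sigma> \<eta> * \<sigma> a * R 1 \<eta> a" for \<eta> a
    using exhaust_2[of a] exhaust_2[of \<eta>]
    by (elim disjE) (simp_all add: R_def \<sigma>_def q11_def q12_def contr_def sum_idx tf_def algebra_simps)
  have e2: "q12 y * w (flip2 a, flip2 \<eta>, 1) + 2 * q22 y * w (flip2 a, flip2 \<eta>, 2) = \<sigma> \<eta> * \<sigma> a * R 2 \<eta> a" for \<eta> a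
    using exhaust_2[of a] exhaust_2[of \<eta>]
    by (elim disjE) (simp_all add: R_def \<sigma>_def q22_def q12_def contr_def sum_idx tf_def algebra_simps)
  obtain i j k where p: "p = (i, j, k)" by (cases p)
  have flip: "flip2 (flip2 x) = x" for x using exhaust_2[of x] by auto
  have h1: "2 * q11 y * w (i, j, 1) + q12 y * w (i, j, 2) \<in> L"
    using e1[of "flip2 i" "flip2 j"] mult[OF R] by (simp add: flip)
  have h2: "q12 y * w (i, j, 1) + 2 * q22 y * w (i, j, 2) \<in> L"
    using e2[of "flip2 i" "flip2 j"] mult[OF R] by (simp add: flip)
  \<comment> \<open>Cramer's rule for the system \<open>h1\<close>, \<open>h2\<close> in two entries
    of \<open>w\<close>, whose determinant is \<open>- hdet y\<close>.\<close>
  have "hdet y * w (i, j, 1) = q12 y * (q12 y * w (i, j, 1) + 2 * q22 y * w (i, j, 2))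
      - 2 * q22 y * (2 * q11 y * w (i, j, 1) + q12 y * w (i, j, 2))"
    by (simp add: hdet_def algebra_simps power2_eq_square)
  then have "hdet y * w (i, j, 1) \<in> L" using diff[OF mult[OF h2] mult[OF h1]] by metis
  moreover have "hdet y * w (i, j, 2) = q12 y * (2 * q11 y * w (i, j, 1) + q12 y * w (i, j, 2))
      - 2 * q11 y * (q12 y * w (i, j, 1) + 2 * q22 y * w (i, j, 2))"
    by (simp add: hdet_def algebra_simps power2_eq_square)
  then have "hdet y * w (i, j, 2) \<in> L" using diff[OF mult[OF h1] mult[OF h2]] by metis
  ultimately show ?thesis using exhaust_2[of k] p by auto
qed

lemma hdet_ortho:
  fixes y w :: "idx \<Rightarrow> complex"
  assumes "ortho y w" "hdet y \<noteq> 0"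
  shows "w p = 0"
  using hdet_mult_in_ideal[of "{0}" y w p] assms by (simp add: is_ideal_def ortho_def)

lemma hom_contr:
  assumes "comm_ring_hom h"
  shows "h (contr s l m y z) = contr s l m (\<lambda>p. h (y p)) (\<lambda>p. h (z p))"
proof -
  interpret comm_ring_hom h by (rule assms)
  show ?thesis by (auto simp: contr_def tf_def hom_sum hom_mult intro!: sum.cong)
qed

lemma hom_hdet:
  assumes "comm_ring_hom h"
  shows "h (hdet y) = hdet (\<lambda>p. h (y p))"
proof -
  interpret comm_ring_hom h by (rule assms)
  have "h 4 = 4" using hom_numeral by blast
  then show ?thesis by (simp add: hdet_def q11_def q22_def q12_def hom_add hom_mult hom_minus hom_power)
qed

section \<open>Regular and critical points\<close>

lemma comm_ring_hom_eval: "comm_ring_hom (cpoly_eval x)"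
  by (rule cpoly_hom_comm_ring_hom[OF comm_ring_hom_ident])

lemma comm_ring_hom_rename: "comm_ring_hom (rename \<sigma>)"
  by (rule cpoly_hom_comm_ring_hom[OF comm_ring_hom_Const])

lemma singular_ideal_Segre222: "singular_ideal Segre222 =
    vanishing_ideal Segre222 \<oplus>\<^sub>i ideal_gen (minors 4 (length segs) (jacobian segs))"
  by (simp add: singular_ideal_def codim_Segre222)

lemma eval_jacobian: "cpoly_eval (($) z) (jacobian segs i k) = grad (segs ! i) z k"
  by (simp add: jacobian_def grad_def)

lemma singular_ideal_at_0:
  assumes "f \<in> singular_ideal Segre222"
  shows "cpoly_eval (($) 0) f = 0"
proof -
  have "minors 4 (length segs) (jacobian segs) \<subseteq> {f. cpoly_eval (($) 0) f = 0}"
  proof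
    fix d assume "d \<in> minors 4 (length segs) (jacobian segs)"
    then obtain \<rho> \<kappa> where d: "d = detf 4 (\<lambda>i j. jacobian segs (\<rho> i) (\<kappa> j))" and \<rho>: "\<rho> ` {..<4} \<subseteq> {..<length segs}"
      unfolding minors_def by auto
    have "grad (segs ! \<rho> i) 0 k = 0" if "i < 4" for i k
      using \<rho> that by (intro grad_0 segs_vanish) auto
    then have "cpoly_eval (($) 0) d = detf 4 (\<lambda>i j. 0)"
      unfolding d hom_detf[OF comm_ring_hom_eval] eval_jacobian by (intro detf_cong)
    also have "\<dots> = 0" by (rule detf_eq_0_if_rows_dependent[of _ "\<lambda>_. 1"]) (auto intro: exI[of _ 0])
    finally show "d \<in> {f. cpoly_eval (($) 0) f = 0}" by simp
  qed
  moreover have "vanishing_ideal Segre222 \<subseteq> {f. cpoly_eval (($) 0) f = 0}"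
    using Segre222_if_quadrics[of 0] by (auto simp: vanishing_ideal_def)
  ultimately have "singular_ideal Segre222 \<subseteq> {f. cpoly_eval (($) 0) f = 0}"
    unfolding singular_ideal_Segre222
    by (intro ideal_sum_minimal is_ideal_zeros ideal_gen_minimal)
  then show ?thesis using assms by blast
qed

lemma minors_in_singular_ideal: "minors 4 (length segs) (jacobian segs) \<subseteq> singular_ideal Segre222"
  unfolding singular_ideal_Segre222
  using ideal_sum_superset(2)[OF is_ideal_vanishing_ideal is_ideal_ideal_gen] ideal_gen_superset by blast

lemma exists_nonvanishing_minor:
  assumes "z \<in> Segre222" "z \<noteq> 0"
  obtains d where "d \<in> minors 4 (length segs) (jacobian segs)" "cpoly_eval (($) z) d \<noteq> 0"
proof -
  obtain d where d: "d \<in> minors 4 (length segs) (\<lambda>i. grad (segs ! i) z)" "d \<noteq> 0"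
    using exists_nonzero_jacobian_minor[OF assms] by blast
  then obtain \<rho> \<kappa> where *: "d = detf 4 (\<lambda>i j. grad (segs ! \<rho> i) z (\<kappa> j))" "inj_on \<rho> {..<4}"
    "\<rho> ` {..<4} \<subseteq> {..<length segs}" "inj_on \<kappa> {..<4}"
    unfolding minors_def by auto
  have "detf 4 (\<lambda>i j. jacobian segs (\<rho> i) (\<kappa> j)) \<in> minors 4 (length segs) (jacobian segs)"
    by (rule in_minors) fact+
  moreover have "cpoly_eval (($) z) (detf 4 (\<lambda>i j. jacobian segs (\<rho> i) (\<kappa> j))) \<noteq> 0"
    unfolding hom_detf[OF comm_ring_hom_eval] eval_jacobian using d(2) *(1) by simp
  ultimately show thesis using that by blast
qed

lemma regular_points_Segre222: "regular_points Segre222 = Segre222 - {0}"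
proof -
  have "0 \<in> zero_locus (singular_ideal Segre222)"
    using singular_ideal_at_0 by (auto simp: zero_locus_def)
  moreover have "z \<notin> zero_locus (singular_ideal Segre222)" if z: "z \<in> Segre222" "z \<noteq> 0" for z
  proof -
    obtain d where "d \<in> minors 4 (length segs) (jacobian segs)" "cpoly_eval (($) z) d \<noteq> 0"
      using exists_nonvanishing_minor[OF z] .
    then show ?thesis using minors_in_singular_ideal unfolding zero_locus_def by blast
  qed
  ultimately show ?thesis unfolding regular_points_def by auto
qed

text \<open>All pairings here are bilinear: \<open>v\<close> and \<open>w\<close> stand for the
  conjugates of \<open>u\<close> and \<open>z\<close>, and the Hermitian condition is recovered for
  \<open>v = cnjv u\<close> and \<open>w = cnjv z\<close>.\<close>

definition Sol :: "complex ^ idx \<Rightarrow> complex ^ idx \<Rightarrow> ((complex ^ idx) \<times> (complex ^ idx)) set" where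
  "Sol u v = {(z, w). z \<in> Segre222 \<and> z \<noteq> 0 \<and> w \<in> Segre222 \<and> w \<noteq> 0 \<and>
     ortho (($) (v - w)) (($) z) \<and> ortho (($) (u - z)) (($) w)}"

section \<open>Conjugation, and critical points as solutions\<close>

definition cnjv :: "complex ^ 'n \<Rightarrow> complex ^ 'n" where "cnjv x = (\<chi> i. cnj (x $ i))"

lemma cnjv_nth [simp]: "cnjv x $ i = cnj (x $ i)"
  by (simp add: cnjv_def)

lemma cnjv_simps [simp]: "cnjv (cnjv x) = x" "cnjv x = 0 \<longleftrightarrow> x = 0" "cnjv (x - y) = cnjv x - cnjv y"
  by (simp_all add: Finite_Cartesian_Product.vec_eq_iff)

lemma cnjv_in_Segre222 [simp]: "cnjv z \<in> Segre222 \<longleftrightarrow> z \<in> Segre222"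
proof -
  have "cnjv z \<in> Segre222" if z: "z \<in> Segre222" for z
  proof -
    obtain a b c where z: "z = tensor3 a b c" using z by (rule Segre222E)
    have "cnjv z = tensor3 (cnjv a) (cnjv b) (cnjv c)"
      by (auto simp: z Finite_Cartesian_Product.vec_eq_iff)
    then show ?thesis by simp
  qed
  then show ?thesis by (metis cnjv_simps(1))
qed

lemma comm_ring_hom_cnj: "comm_ring_hom cnj"
  by unfold_locales auto

lemma ortho_cnjv [simp]: "ortho (($) (cnjv y)) (($) (cnjv z)) \<longleftrightarrow> ortho (($) y) (($) z)"
proof -
  have "contr s l m (($) (cnjv y)) (($) (cnjv z)) = cnj (contr s l m (($) y) (($) z))" for s l m
  proof -
    have "($) (cnjv x) = (\<lambda>p. cnj (x $ p))" for x :: "complex ^ idx" by (intro ext) (rule cnjv_nth)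
    then show ?thesis by (simp only: hom_contr[OF comm_ring_hom_cnj])
  qed
  then show ?thesis by (simp add: ortho_def)
qed

lemma Sol_cnjv: "(z, w) \<in> Sol u v \<longleftrightarrow> (cnjv w, cnjv z) \<in> Sol (cnjv v) (cnjv u)"
  unfolding Sol_def by (auto simp flip: cnjv_simps(3))

text \<open>\<open>tangent_space\<close> tests gradients only, so \<open>y\<close> has to be a
  combination of gradients. Adding \<open>y\<close> as a row to the Jacobian keeps all 5-minors
  zero, since every row is orthogonal to the fields at \<open>z\<close>; a nonzero 4-minor of
  gradients then spans \<open>y\<close>.\<close>

lemma ortho_tangent:
  assumes z: "z \<in> Segre222" "z \<noteq> 0" and y: "ortho y (($) z)" and t: "t \<in> tangent_space Segre222 z"
  shows "(\<Sum>k\<in>UNIV. y k * t $ k) = 0"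
proof -
  define A where "A i = (case i of 0 \<Rightarrow> y | Suc j \<Rightarrow> grad (segs ! j) z)" for i
  obtain \<rho> \<kappa> where \<rho>: "inj_on \<rho> {..<4}" "\<rho> ` {..<4} \<subseteq> {..<length segs}" and \<kappa>: "inj_on \<kappa> {..<4}"
    and nz: "detf 4 (\<lambda>i j. grad (segs ! \<rho> i) z (\<kappa> j)) \<noteq> 0"
    using exists_nonzero_jacobian_minor[OF z] unfolding minors_def by auto
  obtain p where p: "z $ p \<noteq> 0" using z(2) by (auto simp: Finite_Cartesian_Product.vec_eq_iff)
  have oA: "ortho (A i) (($) z)" if "i < Suc (length segs)" for i
    using that y ortho_grad[OF segs_vanish z(1)] by (auto simp: A_def split: nat.splits)
  have "minors (Suc 4) (Suc (length segs)) A \<subseteq> {0}"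
  proof
    fix d assume "d \<in> minors (Suc 4) (Suc (length segs)) A"
    then obtain \<rho>' \<kappa>' where d: "d = detf 5 (\<lambda>i j. A (\<rho>' i) (\<kappa>' j))" "\<rho>' ` {..<5} \<subseteq> {..<Suc (length segs)}"
      unfolding minors_def by auto
    have "detf 5 (\<lambda>i j. A (\<rho>' i) (\<kappa>' j)) = 0"
      by (rule minors_ortho_eq_0[where z = "($) z" and p = p]) (use d(2) oA p in auto)
    then show "d \<in> {0}" using d by simp
  qed
  then have "\<exists>c. \<forall>k. A 0 k = (\<Sum>j<4. c j * A ((Suc \<circ> \<rho>) j) k)"
  proof (rule rows_in_span_of_minor[rotated 4])
    show "inj_on (Suc \<circ> \<rho>) {..<4}" "(Suc \<circ> \<rho>) ` {..<4} \<subseteq> {..<Suc (length segs)}"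
      using \<rho> by (auto simp: inj_on_def)
    show "detf 4 (\<lambda>i j. A ((Suc \<circ> \<rho>) i) (\<kappa> j)) \<noteq> 0" using nz by (simp add: A_def)
  qed (use \<kappa> in auto)
  then obtain c where c: "\<And>k. y k = (\<Sum>j<4. c j * grad (segs ! \<rho> j) z k)" by (auto simp: A_def)
  have "(\<Sum>k\<in>UNIV. y k * t $ k) = (\<Sum>j<4. c j * (\<Sum>k\<in>UNIV. grad (segs ! \<rho> j) z k * t $ k))"
    unfolding c sum_distrib_left sum_distrib_right by (subst sum.swap) (simp add: mult.assoc)
  also have "\<dots> = 0"
  proof (intro sum.neutral ballI)
    fix j :: nat assume "j \<in> {..<4}"
    then have "segs ! \<rho> j \<in> vanishing_ideal Segre222" using \<rho>(2) by (intro segs_vanish) auto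
    then show "c j * (\<Sum>k\<in>UNIV. grad (segs ! \<rho> j) z k * t $ k) = 0"
      using t by (simp add: tangent_space_def grad_def)
  qed
  finally show ?thesis .
qed

lemma critical_points_Segre222: "critical_points Segre222 u = {z. (z, cnjv z) \<in> Sol u (cnjv u)}"
proof -
  have "(\<forall>t \<in> tangent_space Segre222 z. hinner (u - z) t = 0) \<longleftrightarrow> ortho (($) (cnjv (u - z))) (($) z)"
    if z: "z \<in> Segre222" "z \<noteq> 0" for z
  proof
    assume L: "\<forall>t \<in> tangent_space Segre222 z. hinner (u - z) t = 0"
    have "contr s l m (($) (cnjv (u - z))) (($) z) = 0" for s l m
    proof -
      let ?t = "\<chi> p. tf s l m (($) z) p"
      have "?t \<in> tangent_space Segre222 z"
        using dir_deriv_tangent[OF _ z(1)] by (simp add: tangent_space_def dir_deriv_def)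
      then have "cnj (hinner (u - z) ?t) = 0" using L by simp
      then show ?thesis by (simp add: hinner_def contr_def)
    qed
    then show "ortho (($) (cnjv (u - z))) (($) z)" by (simp add: ortho_def)
  next
    assume R: "ortho (($) (cnjv (u - z))) (($) z)"
    show "\<forall>t \<in> tangent_space Segre222 z. hinner (u - z) t = 0"
    proof
      fix t assume "t \<in> tangent_space Segre222 z"
      from ortho_tangent[OF z R this] have "cnj (\<Sum>k\<in>UNIV. cnjv (u - z) $ k * t $ k) = cnj 0" by simp
      then show "hinner (u - z) t = 0" by (simp add: hinner_def)
    qed
  qed
  moreover have "ortho (($) (u - z)) (($) (cnjv z)) \<longleftrightarrow> ortho (($) (cnjv (u - z))) (($) z)" for z
    by (metis ortho_cnjv cnjv_simps(1))
  ultimately show ?thesis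
    unfolding critical_points_def regular_points_Segre222 Sol_def by auto
qed

section \<open>The Hermitian critical ideal\<close>

lemma star_simps:
  "star 0 = 0" "star 1 = 1" "star (- p) = - star p" "star (p - q) = star p - star q"
  "star (p + q) = star p + star q" "star (p * q) = star p * star q" "star (p ^ n) = star p ^ n"
  "star (sum f A) = (\<Sum>a\<in>A. star (f a))" "star (Const c) = Const (cnj c)" "star (Var x) = Var (swap_hvar x)"
  unfolding star_def by (rule cpoly_hom_ring_simps[OF comm_ring_hom_Const_cnj])+

lemma comm_ring_hom_star: "comm_ring_hom star"
  unfolding star_def by (rule cpoly_hom_comm_ring_hom[OF comm_ring_hom_Const_cnj])

lemma swap_hvar_swap [simp]: "swap_hvar (swap_hvar x) = x"
  by (cases x) auto

lemma star_star [simp]: "star (star p) = p"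
  by (induction p rule: cpoly_induct) (simp_all add: star_simps)

lemma surj_star: "surj star"
  by (metis star_star surjI)

lemma cpoly_eval_star:
  "cpoly_eval (hvar_assign z w u v) (star g) = cnj (cpoly_eval (hvar_assign (cnjv w) (cnjv z) (cnjv v) (cnjv u)) g)"
proof (induction g rule: cpoly_induct)
  case (Var x)
  then show ?case by (cases x) (simp_all add: star_simps)
qed (simp_all add: star_simps)

abbreviation I_ext :: "idx hvar cpoly set" where "I_ext \<equiv> extend_ideal (vanishing_ideal Segre222)"
abbreviation I_min :: "idx hvar cpoly set" where "I_min \<equiv> critical_minors_ideal Segre222"
abbreviation S_ext :: "idx hvar cpoly set" where "S_ext \<equiv> extend_ideal (singular_ideal Segre222)"

lemma is_ideal_exts: "is_ideal I_ext" "is_ideal I_min" "is_ideal S_ext" "is_ideal (I_ext \<oplus>\<^sub>i I_min)"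
proof -
  show 1: "is_ideal I_ext" "is_ideal I_min" "is_ideal S_ext"
    unfolding extend_ideal_def critical_minors_ideal_def by (rule is_ideal_ideal_gen)+
  show "is_ideal (I_ext \<oplus>\<^sub>i I_min)" by (rule is_ideal_ideal_sum[OF 1(1,2)])
qed

lemma rename_in_extend_ideal: "f \<in> I \<Longrightarrow> rename Zv f \<in> extend_ideal I"
  unfolding extend_ideal_def by (intro subsetD[OF ideal_gen_superset] imageI)

abbreviation Zp :: "idx \<Rightarrow> idx hvar cpoly" where "Zp p \<equiv> Var (Zv p)"
abbreviation VW :: "idx \<Rightarrow> idx hvar cpoly" where "VW p \<equiv> Var (Vv p) - Var (Wv p)"

text \<open>Pairing the bordered minors with a tangent field (Laplace expansion along the bordering
  column) leaves the contraction times the minor, modulo the ideal of \<open>X\<close>.\<close>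

lemma contr_mult_minor:
  assumes "d \<in> minors 4 (length segs) (jacobian segs)"
  shows "contr s l m VW Zp * rename Zv d \<in> I_ext \<oplus>\<^sub>i I_min"
proof -
  obtain \<rho> \<kappa> where d: "d = detf 4 (\<lambda>i j. jacobian segs (\<rho> i) (\<kappa> j))" and \<rho>: "inj_on \<rho> {..<4}"
    "\<rho> ` {..<4} \<subseteq> {..<length segs}" and \<kappa>: "inj_on \<kappa> {..<4}"
    using assms unfolding minors_def by auto
  define B where "B a k = stacked_jacobian segs (case_nat 0 (Suc \<circ> \<rho>) a) k" for a k
  obtain C where C: "\<And>k. detf (Suc 4) (\<lambda>a b. case b of 0 \<Rightarrow> B a k | Suc b' \<Rightarrow> B a (\<kappa> b')) = (\<Sum>a<Suc 4. B a k * C a)"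
    "C 0 = detf 4 (\<lambda>a b. B (Suc a) (\<kappa> b))"
    using detf_border[of 4 B "\<lambda>a b'. B a (\<kappa> b')"] by blast
  have C0: "C 0 = rename Zv d"
    unfolding C(2) d hom_detf[OF comm_ring_hom_rename] by (simp add: B_def stacked_jacobian_def)
  let ?t = "tf s l m Zp"
  have min: "(\<Sum>a<Suc 4. B a k * C a) \<in> I_min" for k
  proof -
    have "detf (Suc 4) (\<lambda>a b. B a (case_nat k \<kappa> b)) \<in> I_min"
    proof (cases "k \<in> \<kappa> ` {..<4}")
      case True
      then have "detf (Suc 4) (\<lambda>a b. B a (case_nat k \<kappa> b)) = 0" by (rule detf_border_eq_0_if_repeated_column)
      then show ?thesis using is_idealD(1)[OF is_ideal_exts(2)] by metis
    next
      case False
      have "detf (Suc 4) (\<lambda>i j. stacked_jacobian segs (case_nat 0 (Suc \<circ> \<rho>) i) (case_nat k \<kappa> j))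
          \<in> minors (Suc 4) (Suc (length segs)) (stacked_jacobian segs)"
      proof (rule in_minors)
        show "inj_on (case_nat 0 (Suc \<circ> \<rho>)) {..<Suc 4}"
          using \<rho> by (intro inj_on_case_nat) (auto simp: inj_on_def)
        show "case_nat 0 (Suc \<circ> \<rho>) ` {..<Suc 4} \<subseteq> {..<Suc (length segs)}"
          using \<rho>(2) by (auto simp: image_subset_iff split: nat.splits)
        show "inj_on (case_nat k \<kappa>) {..<Suc 4}" by (rule inj_on_case_nat[OF \<kappa> False])
      qed
      then show ?thesis
        unfolding critical_minors_ideal_def codim_Segre222 B_def
        using ideal_gen_superset by (auto simp: numeral_eq_Suc)
    qed
    moreover have "detf (Suc 4) (\<lambda>a b. B a (case_nat k \<kappa> b)) =
        detf (Suc 4) (\<lambda>a b. case b of 0 \<Rightarrow> B a k | Suc b' \<Rightarrow> B a (\<kappa> b'))"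
      by (intro detf_cong) (auto split: nat.splits)
    ultimately show ?thesis using C(1)[of k] by simp
  qed
  have "(\<Sum>k\<in>UNIV. (\<Sum>a<Suc 4. B a k * C a) * ?t k) \<in> I_min"
    by (rule is_ideal_sum[OF is_ideal_exts(2)], rule is_idealD(4)[OF is_ideal_exts(2)], rule min)
  also have "(\<Sum>k\<in>UNIV. (\<Sum>a<Suc 4. B a k * C a) * ?t k) = (\<Sum>a<Suc 4. (\<Sum>k\<in>UNIV. B a k * ?t k) * C a)"
    unfolding sum_distrib_right by (subst sum.swap) (simp add: mult_ac)
  also have "\<dots> = contr s l m VW Zp * rename Zv d + (\<Sum>a<4. (\<Sum>k\<in>UNIV. B (Suc a) k * ?t k) * C (Suc a))"
    unfolding sum.lessThan_Suc_shift by (simp add: contr_def B_def stacked_jacobian_def C0)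
  finally have 1: "contr s l m VW Zp * rename Zv d + (\<Sum>a<4. (\<Sum>k\<in>UNIV. B (Suc a) k * ?t k) * C (Suc a)) \<in> I_min" .
  have 2: "(\<Sum>a<4. (\<Sum>k\<in>UNIV. B (Suc a) k * ?t k) * C (Suc a)) \<in> I_ext"
  proof (rule is_ideal_sum[OF is_ideal_exts(1)], rule is_idealD(4)[OF is_ideal_exts(1)])
    fix a :: nat assume "a \<in> {..<4}"
    then have f: "segs ! \<rho> a \<in> vanishing_ideal Segre222" using \<rho> by (intro segs_vanish) auto
    let ?g = "\<Sum>k\<in>UNIV. partial k (segs ! \<rho> a) * tf s l m Var k"
    have "cpoly_eval (($) z) (tf s l m Var k) = tf s l m (($) z) k" for z k
      by (simp add: tf_def)
    then have "?g \<in> vanishing_ideal Segre222"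
      using dir_deriv_tangent[OF f] by (simp add: vanishing_ideal_def dir_deriv_def)
    then have "rename Zv ?g \<in> I_ext" by (rule rename_in_extend_ideal)
    moreover have "rename Zv (tf s l m Var k) = ?t k" for k by (simp add: tf_def)
    ultimately show "(\<Sum>k\<in>UNIV. B (Suc a) k * ?t k) \<in> I_ext"
      by (simp add: B_def stacked_jacobian_def jacobian_def)
  qed
  have "contr s l m VW Zp * rename Zv d = - (\<Sum>a<4. (\<Sum>k\<in>UNIV. B (Suc a) k * ?t k) * C (Suc a)) +
      (contr s l m VW Zp * rename Zv d + (\<Sum>a<4. (\<Sum>k\<in>UNIV. B (Suc a) k * ?t k) * C (Suc a)))"
    by simp
  then show ?thesis
    unfolding ideal_sum_def using is_idealD(5)[OF is_ideal_exts(1) 2] 1 by blast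
qed

lemma I_ext_subset: "I_ext \<subseteq> I_ext \<oplus>\<^sub>i I_min" "I_min \<subseteq> I_ext \<oplus>\<^sub>i I_min"
  using ideal_sum_superset[OF is_ideal_exts(1,2)] by auto

text \<open>The admissible multipliers form an ideal; it contains the equations of the variety
  trivially and the Jacobian minors by \<open>contr_mult_minor\<close>.\<close>

lemma contr_mult_S_ext:
  assumes "g \<in> S_ext"
  shows "contr s l m VW Zp * g \<in> I_ext \<oplus>\<^sub>i I_min"
proof -
  let ?L = "{g. contr s l m VW Zp * g \<in> I_ext \<oplus>\<^sub>i I_min}"
  have L: "is_ideal ?L" by (rule is_ideal_quotient[OF is_ideal_exts(4)])
  have L': "is_ideal {f. rename Zv f \<in> ?L}" by (rule is_ideal_vimage[OF comm_ring_hom_rename L])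
  have "singular_ideal Segre222 \<subseteq> {f. rename Zv f \<in> ?L}"
    unfolding singular_ideal_Segre222
  proof (intro ideal_sum_minimal L' ideal_gen_minimal)
    show "vanishing_ideal Segre222 \<subseteq> {f. rename Zv f \<in> ?L}"
      using rename_in_extend_ideal I_ext_subset(1) is_idealD(3)[OF is_ideal_exts(4)] by blast
    show "minors 4 (length segs) (jacobian segs) \<subseteq> {f. rename Zv f \<in> ?L}"
      using contr_mult_minor by blast
  qed
  then have "S_ext \<subseteq> ?L" unfolding extend_ideal_def[of "singular_ideal _"] by (intro ideal_gen_minimal L) auto
  then show ?thesis using assms by blast
qed

lemma minus_eval_0_in_ideal:
  assumes "is_ideal J" "\<And>v. Var v \<in> J"
  shows "f - Const (cpoly_eval (\<lambda>_. 0) f) \<in> J"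
proof (induction f rule: cpoly_induct)
  case (Const a) then show ?case by (simp add: is_idealD(1)[OF assms(1)])
next
  case (Var v) then show ?case using assms(2)[of v] by (simp add: Const_def)
next
  case (add p q)
  have "p + q - Const (cpoly_eval (\<lambda>_. 0) (p + q)) =
      (p - Const (cpoly_eval (\<lambda>_. 0) p)) + (q - Const (cpoly_eval (\<lambda>_. 0) q))"
    by (simp add: Const_def single_add)
  then show ?case using is_idealD(2)[OF assms(1) add] by metis
next
  case (mult p q)
  have "p * q - Const (cpoly_eval (\<lambda>_. 0) (p * q)) =
      p * (q - Const (cpoly_eval (\<lambda>_. 0) q)) + Const (cpoly_eval (\<lambda>_. 0) q) * (p - Const (cpoly_eval (\<lambda>_. 0) p))"
    by (simp add: Const_def mult_single algebra_simps)
  then show ?case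
    using is_idealD(2)[OF assms(1) is_idealD(3)[OF assms(1) mult(2)] is_idealD(3)[OF assms(1) mult(1)]] by metis
qed

text \<open>The singular ideal vanishes at the origin, so \<open>a\<close> is a combination of the
  variables \<open>Zp p\<close> and \<open>hdet VW * a\<close> is one of contractions; the factor
  \<open>b\<close> moves contractions into the critical ideal.\<close>

lemma hdet_mult_S_ext:
  assumes "a \<in> S_ext" "b \<in> S_ext"
  shows "hdet VW * (a * b) \<in> I_ext \<oplus>\<^sub>i I_min"
proof -
  let ?E = "ideal_gen {contr s l m VW Zp | s l m. True}"
  let ?L = "{a. hdet VW * a \<in> ?E}"
  have L: "is_ideal ?L" by (rule is_ideal_quotient[OF is_ideal_ideal_gen])
  have "contr s l m VW Zp \<in> ?E" for s l m by (rule subsetD[OF ideal_gen_superset]) blast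
  then have Z: "Zp p \<in> ?L" for p
    unfolding mem_Collect_eq by (rule hdet_mult_in_ideal[OF is_ideal_ideal_gen])
  have "singular_ideal Segre222 \<subseteq> {f. rename Zv f \<in> ?L}"
  proof
    fix f assume f: "f \<in> singular_ideal Segre222"
    have "f - Const (cpoly_eval (\<lambda>_. 0) f) \<in> {f. rename Zv f \<in> ?L}"
      by (rule minus_eval_0_in_ideal[OF is_ideal_vimage[OF comm_ring_hom_rename L]]) (use Z in simp)
    moreover have "cpoly_eval (\<lambda>_. 0) f = 0"
    proof -
      have "($) 0 = (\<lambda>_ :: idx. 0 :: complex)" by (intro ext) (rule zero_index)
      then show ?thesis using singular_ideal_at_0[OF f] by simp
    qed
    ultimately show "f \<in> {f. rename Zv f \<in> ?L}" by (simp add: Const_def)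
  qed
  then have "S_ext \<subseteq> ?L" unfolding extend_ideal_def by (intro ideal_gen_minimal L) auto
  then have a: "hdet VW * a \<in> ?E" using assms(1) by blast
  have "?E \<subseteq> {e. b * e \<in> I_ext \<oplus>\<^sub>i I_min}"
    using contr_mult_S_ext[OF assms(2)]
    by (intro ideal_gen_minimal is_ideal_quotient is_ideal_exts) (auto simp: mult.commute)
  then have "b * (hdet VW * a) \<in> I_ext \<oplus>\<^sub>i I_min" using a by blast
  then show ?thesis by (simp add: mult_ac)
qed

abbreviation K_crit :: "idx hvar cpoly set" where
  "K_crit \<equiv> I_ext \<oplus>\<^sub>i star ` I_ext \<oplus>\<^sub>i I_min \<oplus>\<^sub>i star ` I_min"
abbreviation J_sing :: "idx hvar cpoly set" where "J_sing \<equiv> S_ext \<otimes>\<^sub>i star ` S_ext"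

lemma hermitian_critical_ideal_Segre222:
  "hermitian_critical_ideal Segre222 = saturation K_crit J_sing"
  unfolding hermitian_critical_ideal_def Let_def ..

lemma is_ideal_star: "is_ideal I \<Longrightarrow> is_ideal (star ` I)"
  by (rule is_ideal_image[OF comm_ring_hom_star surj_star])

lemma is_ideal_K: "is_ideal K_crit"
  by (intro is_ideal_ideal_sum is_ideal_star is_ideal_exts)

lemma I_subset_K: "I_ext \<oplus>\<^sub>i I_min \<subseteq> K_crit" "star ` (I_ext \<oplus>\<^sub>i I_min) \<subseteq> K_crit"
proof -
  have ideals: "is_ideal (star ` I_ext)" "is_ideal (star ` I_min)" "is_ideal (I_ext \<oplus>\<^sub>i star ` I_ext)"
    "is_ideal (I_ext \<oplus>\<^sub>i star ` I_ext \<oplus>\<^sub>i I_min)"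
    by (intro is_ideal_ideal_sum is_ideal_star is_ideal_exts)+
  note s1 = ideal_sum_superset[OF is_ideal_exts(1) ideals(1)]
  note s2 = ideal_sum_superset[OF ideals(3) is_ideal_exts(2)]
  note s3 = ideal_sum_superset[OF ideals(4) ideals(2)]
  show "I_ext \<oplus>\<^sub>i I_min \<subseteq> K_crit"
    using s1 s2 s3 by (intro ideal_sum_minimal is_ideal_K) blast+
  have "star ` I_ext \<subseteq> K_crit" "star ` I_min \<subseteq> K_crit" using s1 s2 s3 by blast+
  then have "star a + star b \<in> K_crit" if "a \<in> I_ext" "b \<in> I_min" for a b
    using that by (intro is_idealD(2)[OF is_ideal_K]) auto
  then show "star ` (I_ext \<oplus>\<^sub>i I_min) \<subseteq> K_crit"
    unfolding ideal_sum_def[of I_ext I_min] by (auto simp: star_simps)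
qed

lemma is_ideal_J: "is_ideal J_sing"
  by (simp add: ideal_mult_def is_ideal_ideal_gen)

lemma J_subset: "J_sing \<subseteq> S_ext" "J_sing \<subseteq> star ` S_ext"
proof -
  show "J_sing \<subseteq> S_ext"
    unfolding ideal_mult_def using is_idealD(4)[OF is_ideal_exts(3)]
    by (intro ideal_gen_minimal[OF is_ideal_exts(3)]) blast
  show "J_sing \<subseteq> star ` S_ext"
    unfolding ideal_mult_def using is_idealD(3)[OF is_ideal_star[OF is_ideal_exts(3)]]
    by (intro ideal_gen_minimal[OF is_ideal_star[OF is_ideal_exts(3)]]) blast
qed

text \<open>The exponent is 2 because \<open>hdet_mult_S_ext\<close> consumes two factors from the
  singular ideal.\<close>

lemma in_saturationI:
  assumes "\<And>a b. a \<in> J_sing \<Longrightarrow> b \<in> J_sing \<Longrightarrow> h * (a * b) \<in> K_crit"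
  shows "h \<in> saturation K_crit J_sing"
proof -
  have "ideal_power J_sing 2 \<subseteq> {g. h * g \<in> K_crit}"
    unfolding numeral_2_eq_2 ideal_power.simps ideal_mult_def[of J_sing]
  proof (rule ideal_gen_minimal[OF is_ideal_quotient[OF is_ideal_K]])
    have "ideal_gen {a * b |a b. a \<in> J_sing \<and> b \<in> UNIV} \<subseteq> J_sing"
      using is_idealD(4)[OF is_ideal_J] by (intro ideal_gen_minimal is_ideal_J) auto
    then show "{a * b |a b. a \<in> J_sing \<and> b \<in> ideal_gen {a * b |a b. a \<in> J_sing \<and> b \<in> UNIV}}
        \<subseteq> {g. h * g \<in> K_crit}"
      using assms by blast
  qed
  then show ?thesis unfolding saturation_def by blast
qed

text \<open>This excludes the origin after specialization: a solution with \<open>w = 0\<close>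
  would make \<open>hdet v\<close> vanish, one with \<open>z = 0\<close> would make
  \<open>hdet u\<close> vanish.\<close>

lemma hdet_in_saturation:
  "hdet VW \<in> saturation K_crit J_sing" "star (hdet VW) \<in> saturation K_crit J_sing"
proof -
  show "hdet VW \<in> saturation K_crit J_sing"
    using hdet_mult_S_ext J_subset(1) I_subset_K(1) by (intro in_saturationI) blast
  show "star (hdet VW) \<in> saturation K_crit J_sing"
  proof (rule in_saturationI)
    fix a b assume "a \<in> J_sing" "b \<in> J_sing"
    then obtain a' b' where ab: "a = star a'" "b = star b'" "a' \<in> S_ext" "b' \<in> S_ext"
      using J_subset(2) by blast
    have "star (hdet VW) * (a * b) = star (hdet VW * (a' * b'))"
      by (simp add: star_simps ab(1,2))
    then show "star (hdet VW) * (a * b) \<in> K_crit"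
      using hdet_mult_S_ext[OF ab(3,4)] I_subset_K(2) by auto
  qed
qed

lemma K_subset_saturation: "K_crit \<subseteq> saturation K_crit J_sing"
  unfolding saturation_def using is_idealD(4)[OF is_ideal_K] by (intro subsetI CollectI exI[of _ 0]) blast

lemma eval_VW: "(\<lambda>p. cpoly_eval (hvar_assign z w u v) (VW p)) = ($) (v - w)"
  "(\<lambda>p. cpoly_eval (hvar_assign z w u v) (Zp p)) = ($) z"
  by (intro ext, simp)+

lemma eval_contr_VW:
  "cpoly_eval (hvar_assign z w u v) (contr s l m VW Zp) = contr s l m (($) (v - w)) (($) z)"
  unfolding hom_contr[OF comm_ring_hom_eval] eval_VW ..

lemma eval_hdet_VW: "cpoly_eval (hvar_assign z w u v) (hdet VW) = hdet (($) (v - w))"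
  unfolding hom_hdet[OF comm_ring_hom_eval] eval_VW ..

lemma eval_rename_Zv: "cpoly_eval (hvar_assign z w u v) (rename Zv f) = cpoly_eval (($) z) f"
  by (simp add: cpoly_eval_rename)

text \<open>Every row of the stacked matrix is orthogonal to the tangent fields at \<open>z\<close>,
  and any five such vectors are dependent.\<close>

lemma I_vanishes_at_Sol:
  assumes "(z, w) \<in> Sol u v" "g \<in> I_ext \<oplus>\<^sub>i I_min"
  shows "cpoly_eval (hvar_assign z w u v) g = 0"
proof -
  have z: "z \<in> Segre222" "z \<noteq> 0" and o: "ortho (($) (v - w)) (($) z)" using assms(1) by (auto simp: Sol_def)
  obtain p where p: "z $ p \<noteq> 0" using z(2) by (auto simp: Finite_Cartesian_Product.vec_eq_iff)
  let ?pt = "hvar_assign z w u v"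
  have "I_ext \<subseteq> {g. cpoly_eval ?pt g = 0}"
    unfolding extend_ideal_def
    using z by (intro ideal_gen_minimal is_ideal_zeros) (auto simp: eval_rename_Zv vanishing_ideal_def)
  moreover have "I_min \<subseteq> {g. cpoly_eval ?pt g = 0}"
    unfolding critical_minors_ideal_def codim_Segre222
  proof (intro ideal_gen_minimal is_ideal_zeros subsetI CollectI)
    fix d assume "d \<in> minors (4 + 1) (length segs + 1) (stacked_jacobian segs)"
    then obtain \<rho> \<kappa> where d: "d = detf 5 (\<lambda>i j. stacked_jacobian segs (\<rho> i) (\<kappa> j))"
      and \<rho>: "\<rho> ` {..<5} \<subseteq> {..<Suc (length segs)}" unfolding minors_def by auto
    define y where "y i k = (case i of 0 \<Rightarrow> (v - w) $ k | Suc j \<Rightarrow> grad (segs ! j) z k)" for i k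
    have "cpoly_eval ?pt (stacked_jacobian segs i k) = y i k" for i k
      by (cases i) (simp_all add: stacked_jacobian_def y_def eval_rename_Zv eval_jacobian)
    then have "cpoly_eval ?pt d = detf 5 (\<lambda>i j. y (\<rho> i) (\<kappa> j))"
      unfolding d hom_detf[OF comm_ring_hom_eval] by simp
    also have "\<dots> = 0"
    proof (rule minors_ortho_eq_0[where z = "($) z" and p = p])
      fix a :: nat assume "a < 5"
      then have "\<rho> a < Suc (length segs)" using \<rho> by auto
      then show "ortho (y (\<rho> a)) (($) z)"
        using o ortho_grad[OF segs_vanish z(1)] unfolding y_def by (cases "\<rho> a") (auto simp del: vector_minus_component)
    qed (rule p)
    finally show "cpoly_eval ?pt d = 0" .
  qed
  ultimately have "I_ext \<oplus>\<^sub>i I_min \<subseteq> {g. cpoly_eval ?pt g = 0}"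
    by (intro ideal_sum_minimal is_ideal_zeros)
  then show ?thesis using assms(2) by blast
qed

lemma power_in_ideal_power: "a \<in> J \<Longrightarrow> a ^ n \<in> ideal_power J n"
proof (induction n)
  case (Suc n)
  then have "a * a ^ n \<in> {a * b |a b. a \<in> J \<and> b \<in> ideal_power J n}" by blast
  then show ?case using ideal_gen_superset unfolding ideal_power.simps ideal_mult_def by fastforce
qed simp

lemma Sol_subset_critical_solutions: "Sol u v \<subseteq> critical_solutions Segre222 u v"
proof clarify
  fix z w assume sol: "(z, w) \<in> Sol u v"
  let ?pt = "hvar_assign z w u v"
  have sol': "(cnjv w, cnjv z) \<in> Sol (cnjv v) (cnjv u)" using sol Sol_cnjv by blast
  have I0: "cpoly_eval ?pt g = 0" if "g \<in> I_ext \<oplus>\<^sub>i I_min" for g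
    using I_vanishes_at_Sol[OF sol that] .
  have I1: "cpoly_eval ?pt (star g) = 0" if "g \<in> I_ext \<oplus>\<^sub>i I_min" for g
    using I_vanishes_at_Sol[OF sol' that] by (simp add: cpoly_eval_star)
  have K: "K_crit \<subseteq> {g. cpoly_eval ?pt g = 0}"
    using I0 I1 I_ext_subset by (intro ideal_sum_minimal is_ideal_zeros) auto
  have S: "\<exists>g \<in> S_ext. cpoly_eval (hvar_assign z w u v) g \<noteq> 0" if zw: "(z, w) \<in> Sol u v" for z w u v
  proof -
    obtain d where d: "d \<in> minors 4 (length segs) (jacobian segs)" "cpoly_eval (($) z) d \<noteq> 0"
      using exists_nonvanishing_minor[of z] zw by (auto simp: Sol_def)
    then have "rename Zv d \<in> S_ext" using minors_in_singular_ideal by (intro rename_in_extend_ideal) auto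
    then show ?thesis using d(2) by (metis eval_rename_Zv)
  qed
  \<comment> \<open>Some element of \<open>J_sing\<close> is nonzero at the point, so the saturation
    imposes no further equations there.\<close>
  obtain a where a: "a \<in> S_ext" "cpoly_eval ?pt a \<noteq> 0" using S[OF sol] by blast
  obtain b where b: "b \<in> S_ext" "cpoly_eval ?pt (star b) \<noteq> 0" using S[OF sol'] by (auto simp: cpoly_eval_star)
  have ab: "a * star b \<in> J_sing"
    unfolding ideal_mult_def by (rule subsetD[OF ideal_gen_superset]) (use a b in blast)
  show "(z, w) \<in> critical_solutions Segre222 u v"
    unfolding critical_solutions_def hermitian_critical_ideal_Segre222
  proof (simp only: mem_Collect_eq prod.case, intro ballI)
    fix g assume "g \<in> saturation K_crit J_sing"
    then obtain n where "\<forall>h \<in> ideal_power J_sing n. g * h \<in> K_crit" unfolding saturation_def by blast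
    then have "g * (a * star b) ^ n \<in> K_crit" using power_in_ideal_power[OF ab] by blast
    then have "cpoly_eval ?pt (g * (a * star b) ^ n) = 0" using K by blast
    then show "cpoly_eval ?pt g = 0" using a b by simp
  qed
qed

lemma critical_solutions_subset_Sol:
  assumes u: "hdet (($) u) \<noteq> 0" and v: "hdet (($) v) \<noteq> 0"
  shows "critical_solutions Segre222 u v \<subseteq> Sol u v"
proof clarify
  fix z w assume "(z, w) \<in> critical_solutions Segre222 u v"
  then have sat: "cpoly_eval (hvar_assign z w u v) g = 0" if "g \<in> saturation K_crit J_sing" for g
    using that unfolding critical_solutions_def hermitian_critical_ideal_Segre222 by blast
  let ?pt = "hvar_assign z w u v" and ?pt' = "hvar_assign (cnjv w) (cnjv z) (cnjv v) (cnjv u)"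
  have I0: "cpoly_eval ?pt g = 0" if "g \<in> I_ext \<oplus>\<^sub>i I_min" for g
    using that I_subset_K(1) K_subset_saturation sat by blast
  have I1: "cpoly_eval ?pt' g = 0" if "g \<in> I_ext \<oplus>\<^sub>i I_min" for g
  proof -
    have "cpoly_eval ?pt (star g) = 0" using that I_subset_K(2) K_subset_saturation sat by blast
    then show ?thesis by (simp add: cpoly_eval_star)
  qed
  have h0: "hdet (($) (v - w)) = 0" using sat[OF hdet_in_saturation(1)] by (simp only: eval_hdet_VW)
  have "hdet (($) (cnjv u - cnjv z)) = 0"
    using sat[OF hdet_in_saturation(2)] by (simp only: cpoly_eval_star eval_hdet_VW complex_cnj_zero_iff)
  moreover have "($) (cnjv u - cnjv z) = (\<lambda>p. cnj ((u - z) $ p))" by (intro ext) simp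
  ultimately have "hdet (\<lambda>p. cnj ((u - z) $ p)) = 0" by simp
  then have "cnj (hdet (($) (u - z))) = 0" by (subst hom_hdet[OF comm_ring_hom_cnj])
  then have h1: "hdet (($) (u - z)) = 0" by simp
  have w: "w \<noteq> 0" using h0 v by auto
  have z: "z \<noteq> 0" using h1 u by auto
  \<comment> \<open>Applied at the point itself and, for the starred equations, at the conjugated
    point with \<open>z\<close> and \<open>w\<close> exchanged. A Jacobian minor that is nonzero at
    \<open>z\<close> is divided out.\<close>
  have one: "z \<in> Segre222 \<and> (z \<noteq> 0 \<longrightarrow> ortho (($) (v - w)) (($) z))"
    if I: "\<And>g. g \<in> I_ext \<oplus>\<^sub>i I_min \<Longrightarrow> cpoly_eval (hvar_assign z w u v) g = 0" for z w u v
  proof (intro conjI impI)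
    have "z \<in> zero_locus (vanishing_ideal Segre222)"
      unfolding zero_locus_def
    proof (intro CollectI ballI)
      fix f assume "f \<in> vanishing_ideal Segre222"
      then have "rename Zv f \<in> I_ext \<oplus>\<^sub>i I_min" using rename_in_extend_ideal I_ext_subset(1) by blast
      from I[OF this] show "cpoly_eval (($) z) f = 0" by (simp only: eval_rename_Zv)
    qed
    then show z: "z \<in> Segre222" using zero_locus_vanishing_ideal[OF zariski_closed_Segre222] by simp
    assume "z \<noteq> 0"
    then obtain d where d: "d \<in> minors 4 (length segs) (jacobian segs)" "cpoly_eval (($) z) d \<noteq> 0"
      using exists_nonvanishing_minor z by blast
    show "ortho (($) (v - w)) (($) z)"
      unfolding ortho_def
    proof (intro allI)
      fix s l m
      have "cpoly_eval (hvar_assign z w u v) (contr s l m VW Zp * rename Zv d) = 0"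
        by (rule I[OF contr_mult_minor[OF d(1)]])
      then show "contr s l m (($) (v - w)) (($) z) = 0"
        using d(2) by (simp only: cpoly_eval_simps eval_contr_VW eval_rename_Zv mult_eq_0_iff) simp
    qed
  qed
  have "z \<in> Segre222" "ortho (($) (v - w)) (($) z)" using one[OF I0] z by auto
  moreover have "w \<in> Segre222" "ortho (($) (u - z)) (($) w)"
    using one[OF I1] w by (simp_all flip: cnjv_simps(3))
  ultimately show "(z, w) \<in> Sol u v" using z w by (simp add: Sol_def)
qed

lemma critical_solutions_Segre222:
  "hdet (($) u) \<noteq> 0 \<Longrightarrow> hdet (($) v) \<noteq> 0 \<Longrightarrow> critical_solutions Segre222 u v = Sol u v"
  using Sol_subset_critical_solutions critical_solutions_subset_Sol by blast

section \<open>Trilinear form of the critical equations\<close>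

definition tri :: "(idx \<Rightarrow> complex) \<Rightarrow> complex ^ 2 \<Rightarrow> complex ^ 2 \<Rightarrow> complex ^ 2 \<Rightarrow> complex" where
  "tri y a b c = (\<Sum>p\<in>UNIV. y p * tensor3 a b c $ p)"

definition dot2 :: "complex ^ 2 \<Rightarrow> complex ^ 2 \<Rightarrow> complex" where
  "dot2 a b = a $ 1 * b $ 1 + a $ 2 * b $ 2"

lemma tri_linear:
  "tri y x b c = x $ 1 * tri y e1 b c + x $ 2 * tri y e2 b c"
  "tri y a x c = x $ 1 * tri y a e1 c + x $ 2 * tri y a e2 c"
  "tri y a b x = x $ 1 * tri y a b e1 + x $ 2 * tri y a b e2"
  by (simp_all add: tri_def sum_idx algebra_simps)

lemma tri_diff: "tri (($) (v - w)) a b c = tri (($) v) a b c - tri (($) w) a b c"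
  by (simp add: tri_def algebra_simps sum_subtractf)

lemma tri_tensor3: "tri (($) (tensor3 \<alpha> \<beta> \<gamma>)) a b c = dot2 \<alpha> a * dot2 \<beta> b * dot2 \<gamma> c"
  by (simp add: tri_def sum_idx dot2_def algebra_simps)

lemma contr_tensor3:
  "contr S1 l m y (($) (tensor3 a b c)) = a $ m * tri y (axis l 1) b c"
  "contr S2 l m y (($) (tensor3 a b c)) = b $ m * tri y a (axis l 1) c"
  "contr S3 l m y (($) (tensor3 a b c)) = c $ m * tri y a b (axis l 1)"
  using exhaust_2[of l]
  by (auto simp: contr_def tri_def sum_idx tf_def axis_def algebra_simps)

lemma tri_eq_0_iff:
  "(\<forall>x. tri y x b c = 0) \<longleftrightarrow> (\<forall>l. tri y (axis l 1) b c = 0)"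
  "(\<forall>x. tri y a x c = 0) \<longleftrightarrow> (\<forall>l. tri y a (axis l 1) c = 0)"
  "(\<forall>x. tri y a b x = 0) \<longleftrightarrow> (\<forall>l. tri y a b (axis l 1) = 0)"
  using tri_linear[of y] unfolding forall_2 e1_def e2_def by (metis add_0 mult_zero_right)+

lemma all_tfactor: "(\<forall>s. P s) \<longleftrightarrow> P S1 \<and> P S2 \<and> P S3"
  by (metis tfactor.exhaust)

lemma ortho_tensor3:
  assumes "tensor3 a b c \<noteq> 0"
  shows "ortho y (($) (tensor3 a b c)) \<longleftrightarrow>
    (\<forall>x. tri y x b c = 0) \<and> (\<forall>x. tri y a x c = 0) \<and> (\<forall>x. tri y a b x = 0)"
proof -
  have "a \<noteq> 0" "b \<noteq> 0" "c \<noteq> 0" using assms by (auto simp: tensor3_eq_0_iff)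
  then have nz: "\<exists>m. a $ m \<noteq> 0" "\<exists>m. b $ m \<noteq> 0" "\<exists>m. c $ m \<noteq> 0"
    by (auto simp: Finite_Cartesian_Product.vec_eq_iff)
  have "ortho y (($) (tensor3 a b c)) \<longleftrightarrow> (\<forall>l m. a $ m * tri y (axis l 1) b c = 0) \<and>
      (\<forall>l m. b $ m * tri y a (axis l 1) c = 0) \<and> (\<forall>l m. c $ m * tri y a b (axis l 1) = 0)"
    unfolding ortho_def all_tfactor contr_tensor3 ..
  then show ?thesis unfolding tri_eq_0_iff using nz by auto
qed

lemma Sol_tensor3_iff:
  "(tensor3 a b c, tensor3 \<alpha> \<beta> \<gamma>) \<in> Sol u v \<longleftrightarrow> tensor3 a b c \<noteq> 0 \<and> tensor3 \<alpha> \<beta> \<gamma> \<noteq> 0 \<and>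
    (\<forall>x. tri (($) v) x b c = dot2 \<alpha> x * dot2 \<beta> b * dot2 \<gamma> c) \<and>
    (\<forall>x. tri (($) v) a x c = dot2 \<alpha> a * dot2 \<beta> x * dot2 \<gamma> c) \<and>
    (\<forall>x. tri (($) v) a b x = dot2 \<alpha> a * dot2 \<beta> b * dot2 \<gamma> x) \<and>
    (\<forall>x. tri (($) u) x \<beta> \<gamma> = dot2 a x * dot2 b \<beta> * dot2 c \<gamma>) \<and>
    (\<forall>x. tri (($) u) \<alpha> x \<gamma> = dot2 a \<alpha> * dot2 b x * dot2 c \<gamma>) \<and>
    (\<forall>x. tri (($) u) \<alpha> \<beta> x = dot2 a \<alpha> * dot2 b \<beta> * dot2 c x)"
  by (cases "tensor3 a b c = 0 \<or> tensor3 \<alpha> \<beta> \<gamma> = 0")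
    (auto simp: Sol_def ortho_tensor3 tri_diff tri_tensor3)

section \<open>Solutions in normal form\<close>

definition diag_tensor :: "complex ^ idx" where "diag_tensor = tensor3 e1 e1 e1 + tensor3 e2 e2 e2"

lemma tri_diag: "tri (($) diag_tensor) a b c = a $ 1 * b $ 1 * c $ 1 + a $ 2 * b $ 2 * c $ 2"
  by (simp add: tri_def sum_idx diag_tensor_def)

abbreviation vec2 :: "complex \<Rightarrow> complex \<Rightarrow> complex ^ 2" where "vec2 x y \<equiv> x *s e1 + y *s e2"

definition pt3 :: "complex \<Rightarrow> complex \<Rightarrow> complex \<Rightarrow> complex ^ idx" where
  "pt3 s t r = tensor3 (vec2 1 s) (vec2 1 t) (vec2 1 r)"

context
  fixes u :: "complex ^ idx"
begin

text \<open>\<open>B1\<close>, \<open>B2\<close>, \<open>B3\<close> are the entries with a single 2,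
  in slot 1, 2, 3 respectively; \<open>A1\<close>, \<open>A2\<close>, \<open>A3\<close> are those
  with a single 1 in that slot.\<close>

abbreviation (input) "A1 \<equiv> u $ (1,2,2)"
abbreviation (input) "B1 \<equiv> u $ (2,1,1)"
abbreviation (input) "A2 \<equiv> u $ (2,1,2)"
abbreviation (input) "B2 \<equiv> u $ (1,2,1)"
abbreviation (input) "A3 \<equiv> u $ (2,2,1)"
abbreviation (input) "B3 \<equiv> u $ (1,1,2)"
abbreviation (input) "g0 \<equiv> u $ (1,1,1)"
abbreviation (input) "h0 \<equiv> u $ (2,2,2)"

text \<open>Contracting \<open>diag_tensor\<close> multiplies coordinates, so the partner of
  \<open>pt3 s t r\<close> is proportional to \<open>pt3 (t * r) (s * r) (s * t)\<close>. The
  \<open>U\<close> and \<open>V\<close> are the components of the contractions of \<open>u\<close>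
  with two of its factors.\<close>

definition "U1 s t r = g0 + B3 * (s * t) + B2 * (s * r) + A1 * (s * s * t * r)"
definition "V1 s t r = B1 + A2 * (s * t) + A3 * (s * r) + h0 * (s * s * t * r)"
definition "U2 s t r = g0 + B3 * (s * t) + B1 * (t * r) + A2 * (s * t * t * r)"
definition "V2 s t r = B2 + A1 * (s * t) + A3 * (t * r) + h0 * (s * t * t * r)"
definition "U3 s t r = g0 + B2 * (s * r) + B1 * (t * r) + A3 * (s * t * r * r)"
definition "V3 s t r = B3 + A1 * (s * r) + A2 * (t * r) + h0 * (s * t * r * r)"

lemma tri_normal:
  "tri (($) u) x (vec2 1 (s * r)) (vec2 1 (s * t)) = x $ 1 * U1 s t r + x $ 2 * V1 s t r"
  "tri (($) u) (vec2 1 (t * r)) x (vec2 1 (s * t)) = x $ 1 * U2 s t r + x $ 2 * V2 s t r"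
  "tri (($) u) (vec2 1 (t * r)) (vec2 1 (s * r)) x = x $ 1 * U3 s t r + x $ 2 * V3 s t r"
  by (simp_all add: tri_def sum_idx U1_def V1_def U2_def V2_def U3_def V3_def algebra_simps)

text \<open>The inequations between products say that all six coordinate slices of \<open>u\<close>
  are invertible 2x2 matrices.\<close>

definition good_slices :: bool where
  "good_slices \<longleftrightarrow> A1 \<noteq> 0 \<and> B1 \<noteq> 0 \<and> A2 \<noteq> 0 \<and> B2 \<noteq> 0 \<and> A3 \<noteq> 0 \<and> B3 \<noteq> 0 \<and>
     g0 * A1 \<noteq> B3 * B2 \<and> B1 * h0 \<noteq> A2 * A3 \<and> g0 * A2 \<noteq> B1 * B3 \<and> B2 * h0 \<noteq> A1 * A3 \<and>
     g0 * A3 \<noteq> B1 * B2 \<and> B3 * h0 \<noteq> A1 * A2"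

lemma kernel2:
  fixes x y :: complex
  assumes "m * x + n * y = 0" "p * x + q * y = 0" "x \<noteq> 0 \<or> y \<noteq> 0"
  shows "m * q = n * p"
proof -
  have "(m * q - n * p) * x = q * (m * x + n * y) - n * (p * x + q * y)"
    "(m * q - n * p) * y = m * (p * x + q * y) - p * (m * x + n * y)" by (simp_all add: algebra_simps)
  then have "m * q - n * p = 0" using assms by (metis mult_zero_right diff_self add_0 mult_eq_0_iff)
  then show ?thesis by simp
qed

text \<open>A common form for the three slots. If the pairing of \<open>z\<close> and
  \<open>w\<close> in one slot is 0, the other two factors of \<open>z\<close> are supported on one
  coordinate, so the factor of \<open>w\<close> in that slot is a multiple of a basis vector, and a
  slice of \<open>u\<close> annihilates another factor of \<open>w\<close>. Invertible slices forbid
  this.\<close>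

lemma pairing_nonzero:
  fixes a1 :: complex
  assumes "a1 * c1 = 0" "a2 * c2 = 0" "a1 * b1 = 0" "a2 * b2 = 0" "a1 \<noteq> 0 \<or> a2 \<noteq> 0"
    and "b1 * c1 = \<alpha>1 * P" "b2 * c2 = \<alpha>2 * P" "b1 \<noteq> 0 \<or> b2 \<noteq> 0" "c1 \<noteq> 0 \<or> c2 \<noteq> 0" "\<gamma>1 \<noteq> 0 \<or> \<gamma>2 \<noteq> 0"
    and "\<alpha>1 * (m1 * \<gamma>1 + m2 * \<gamma>2) + \<alpha>2 * (n1 * \<gamma>1 + n2 * \<gamma>2) = 0"
    and "\<alpha>1 * (m3 * \<gamma>1 + m4 * \<gamma>2) + \<alpha>2 * (n3 * \<gamma>1 + n4 * \<gamma>2) = 0"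
    and "m1 * m4 \<noteq> m2 * m3" "n1 * n4 \<noteq> n2 * n3"
  shows False
proof (cases "a1 = 0")
  case True
  then have "c2 = 0" "b2 = 0" using assms by auto
  then have "b1 * c1 \<noteq> 0" "\<alpha>2 * P = 0" using assms by auto
  then have "\<alpha>2 = 0" "\<alpha>1 \<noteq> 0" using assms by auto
  then show False using kernel2[of m1 \<gamma>1 m2 \<gamma>2 m3 m4] assms by auto
next
  case False
  then have "c1 = 0" "b1 = 0" using assms by auto
  then have "b2 * c2 \<noteq> 0" "\<alpha>1 * P = 0" using assms by auto
  then have "\<alpha>1 = 0" "\<alpha>2 \<noteq> 0" using assms by auto
  then show False using kernel2[of n1 \<gamma>1 n2 \<gamma>2 n3 n4] assms by auto
qed

lemma pt3_scale: "m *s pt3 s t r = tensor3 (vec2 m (m * s)) (vec2 1 t) (vec2 1 r)"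
  by (simp add: pt3_def Finite_Cartesian_Product.vec_eq_iff algebra_simps)

lemma pt3_nth: "pt3 s t r $ (1,1,1) = 1" "pt3 s t r $ (2,1,1) = s" "pt3 s t r $ (1,2,1) = t" "pt3 s t r $ (1,1,2) = r"
  by (simp_all add: pt3_def)

lemma pt3_scale_eq_0: "m *s pt3 s t r = 0 \<longleftrightarrow> m = 0"
proof
  assume A: "m *s pt3 s t r = 0"
  have "(m *s pt3 s t r) $ (1,1,1) = 0" unfolding A by simp
  then show "m = 0" by (simp add: pt3_nth)
qed simp

lemma Sol_normal_iff:
  assumes "m \<noteq> 0" "n \<noteq> 0" "s \<noteq> 0" "t \<noteq> 0" "r \<noteq> 0"
  defines "D \<equiv> 1 + s * t * r"
  shows "(m *s pt3 s t r, n *s pt3 (t * r) (s * r) (s * t)) \<in> Sol u diag_tensor \<longleftrightarrow>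
    n * D^2 = 1 \<and> U1 s t r = m * D^2 \<and> V1 s t r = m * s * D^2 \<and> U2 s t r = m * D^2 \<and> V2 s t r = m * t * D^2 \<and>
    U3 s t r = m * D^2 \<and> V3 s t r = m * r * D^2"
proof -
  have nz: "tensor3 (vec2 m (m * s)) (vec2 1 t) (vec2 1 r) \<noteq> 0"
    "tensor3 (vec2 n (n * (t * r))) (vec2 1 (s * r)) (vec2 1 (s * t)) \<noteq> 0"
    using pt3_scale_eq_0 assms unfolding pt3_scale[symmetric] by blast+
  have sc: "tri (($) u) (vec2 n (n * (t * r))) b c = n * tri (($) u) (vec2 1 (t * r)) b c" for b c
    by (simp add: tri_def sum_idx algebra_simps)
  have all2: "(\<forall>x :: complex ^ 2. x $ 1 * p + x $ 2 * q = x $ 1 * p' + x $ 2 * q') \<longleftrightarrow> p = p' \<and> q = q'" for p q p' q'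
  proof
    assume L: "\<forall>x :: complex ^ 2. x $ 1 * p + x $ 2 * q = x $ 1 * p' + x $ 2 * q'"
    show "p = p' \<and> q = q'" using L[rule_format, of e1] L[rule_format, of e2] by simp
  qed simp
  have v1: "(\<forall>x. tri (($) diag_tensor) x (vec2 1 t) (vec2 1 r) = dot2 (vec2 n (n * (t * r))) x * dot2 (vec2 1 (s * r)) (vec2 1 t) * dot2 (vec2 1 (s * t)) (vec2 1 r))
      \<longleftrightarrow> n * D^2 = 1"
  proof -
    have "(\<forall>x. tri (($) diag_tensor) x (vec2 1 t) (vec2 1 r) = dot2 (vec2 n (n * (t * r))) x * dot2 (vec2 1 (s * r)) (vec2 1 t) * dot2 (vec2 1 (s * t)) (vec2 1 r))
      \<longleftrightarrow> (\<forall>x :: complex ^ 2. x $ 1 * 1 + x $ 2 * (t * r) = x $ 1 * (n * D^2) + x $ 2 * (t * r * (n * D^2)))"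
      by (intro all_cong1) (simp add: tri_diag dot2_def D_def algebra_simps power2_eq_square)
    then show ?thesis unfolding all2 using assms by auto
  qed
  have v2: "(\<forall>x. tri (($) diag_tensor) (vec2 m (m * s)) x (vec2 1 r) = dot2 (vec2 n (n * (t * r))) (vec2 m (m * s)) * dot2 (vec2 1 (s * r)) x * dot2 (vec2 1 (s * t)) (vec2 1 r))
      \<longleftrightarrow> n * D^2 = 1"
  proof -
    have "(\<forall>x. tri (($) diag_tensor) (vec2 m (m * s)) x (vec2 1 r) = dot2 (vec2 n (n * (t * r))) (vec2 m (m * s)) * dot2 (vec2 1 (s * r)) x * dot2 (vec2 1 (s * t)) (vec2 1 r))
      \<longleftrightarrow> (\<forall>x :: complex ^ 2. x $ 1 * m + x $ 2 * (m * s * r) = x $ 1 * (m * (n * D^2)) + x $ 2 * (m * s * r * (n * D^2)))"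
      by (intro all_cong1) (simp add: tri_diag dot2_def D_def algebra_simps power2_eq_square)
    then show ?thesis unfolding all2 using assms by auto
  qed
  have v3: "(\<forall>x. tri (($) diag_tensor) (vec2 m (m * s)) (vec2 1 t) x = dot2 (vec2 n (n * (t * r))) (vec2 m (m * s)) * dot2 (vec2 1 (s * r)) (vec2 1 t) * dot2 (vec2 1 (s * t)) x)
      \<longleftrightarrow> n * D^2 = 1"
  proof -
    have "(\<forall>x. tri (($) diag_tensor) (vec2 m (m * s)) (vec2 1 t) x = dot2 (vec2 n (n * (t * r))) (vec2 m (m * s)) * dot2 (vec2 1 (s * r)) (vec2 1 t) * dot2 (vec2 1 (s * t)) x)
      \<longleftrightarrow> (\<forall>x :: complex ^ 2. x $ 1 * m + x $ 2 * (m * s * t) = x $ 1 * (m * (n * D^2)) + x $ 2 * (m * s * t * (n * D^2)))"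
      by (intro all_cong1) (simp add: tri_diag dot2_def D_def algebra_simps power2_eq_square)
    then show ?thesis unfolding all2 using assms by auto
  qed
  have u1: "(\<forall>x. tri (($) u) x (vec2 1 (s * r)) (vec2 1 (s * t)) = dot2 (vec2 m (m * s)) x * dot2 (vec2 1 t) (vec2 1 (s * r)) * dot2 (vec2 1 r) (vec2 1 (s * t)))
     \<longleftrightarrow> U1 s t r = m * D^2 \<and> V1 s t r = m * s * D^2"
    unfolding tri_normal all2[symmetric]
    by (intro all_cong1) (simp add: dot2_def D_def algebra_simps power2_eq_square)
  have u2: "(\<forall>x. tri (($) u) (vec2 n (n * (t * r))) x (vec2 1 (s * t)) = dot2 (vec2 m (m * s)) (vec2 n (n * (t * r))) * dot2 (vec2 1 t) x * dot2 (vec2 1 r) (vec2 1 (s * t)))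
     \<longleftrightarrow> U2 s t r = m * D^2 \<and> V2 s t r = m * t * D^2"
  proof -
    have "(\<forall>x. tri (($) u) (vec2 n (n * (t * r))) x (vec2 1 (s * t)) = dot2 (vec2 m (m * s)) (vec2 n (n * (t * r))) * dot2 (vec2 1 t) x * dot2 (vec2 1 r) (vec2 1 (s * t)))
     \<longleftrightarrow> (\<forall>x :: complex ^ 2. x $ 1 * (n * U2 s t r) + x $ 2 * (n * V2 s t r) = x $ 1 * (n * (m * D^2)) + x $ 2 * (n * (m * t * D^2)))"
      unfolding sc tri_normal
      by (intro all_cong1) (simp add: dot2_def D_def algebra_simps power2_eq_square)
    then show ?thesis unfolding all2 using assms by simp
  qed
  have u3: "(\<forall>x. tri (($) u) (vec2 n (n * (t * r))) (vec2 1 (s * r)) x = dot2 (vec2 m (m * s)) (vec2 n (n * (t * r))) * dot2 (vec2 1 t) (vec2 1 (s * r)) * dot2 (vec2 1 r) x)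
     \<longleftrightarrow> U3 s t r = m * D^2 \<and> V3 s t r = m * r * D^2"
  proof -
    have "(\<forall>x. tri (($) u) (vec2 n (n * (t * r))) (vec2 1 (s * r)) x = dot2 (vec2 m (m * s)) (vec2 n (n * (t * r))) * dot2 (vec2 1 t) (vec2 1 (s * r)) * dot2 (vec2 1 r) x)
     \<longleftrightarrow> (\<forall>x :: complex ^ 2. x $ 1 * (n * U3 s t r) + x $ 2 * (n * V3 s t r) = x $ 1 * (n * (m * D^2)) + x $ 2 * (n * (m * r * D^2)))"
      unfolding sc tri_normal
      by (intro all_cong1) (simp add: dot2_def D_def algebra_simps power2_eq_square)
    then show ?thesis unfolding all2 using assms by simp
  qed
  show ?thesis
    unfolding pt3_scale Sol_tensor3_iff v1 v2 v3 u1 u2 u3 using nz by auto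
qed

text \<open>Generically no coordinate of a solution vanishes, so all of them lie in the affine chart.\<close>

lemma Sol_in_chart:
  assumes good: "good_slices" and sol: "(z, w) \<in> Sol u diag_tensor"
  obtains m n s t r where "m \<noteq> 0" "n \<noteq> 0" "s \<noteq> 0" "t \<noteq> 0" "r \<noteq> 0"
    "z = m *s pt3 s t r" "w = n *s pt3 (t * r) (s * r) (s * t)"
proof -
  obtain a b c where z: "z = tensor3 a b c" using sol Segre222E unfolding Sol_def by blast
  obtain \<alpha> \<beta> \<gamma> where w: "w = tensor3 \<alpha> \<beta> \<gamma>" using sol Segre222E unfolding Sol_def by blast
  note S = sol[unfolded z w Sol_tensor3_iff]
  define p1 p2 p3 where "p1 = dot2 \<alpha> a" and "p2 = dot2 \<beta> b" and "p3 = dot2 \<gamma> c"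
  have comm: "dot2 a \<alpha> = p1" "dot2 b \<beta> = p2" "dot2 c \<gamma> = p3" by (simp_all add: p1_def p2_def p3_def dot2_def)
  have nz: "a $ 1 \<noteq> 0 \<or> a $ 2 \<noteq> 0" "b $ 1 \<noteq> 0 \<or> b $ 2 \<noteq> 0" "c $ 1 \<noteq> 0 \<or> c $ 2 \<noteq> 0"
    "\<alpha> $ 1 \<noteq> 0 \<or> \<alpha> $ 2 \<noteq> 0" "\<beta> $ 1 \<noteq> 0 \<or> \<beta> $ 2 \<noteq> 0" "\<gamma> $ 1 \<noteq> 0 \<or> \<gamma> $ 2 \<noteq> 0"
    using S by (auto simp: tensor3_eq_0_iff vec2_eq_iff)
  have dot: "dot2 x e1 = x $ 1" "dot2 x e2 = x $ 2" for x by (simp_all add: dot2_def)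
  have v1: "b $ 1 * c $ 1 = \<alpha> $ 1 * p2 * p3" "b $ 2 * c $ 2 = \<alpha> $ 2 * p2 * p3"
   and v2: "a $ 1 * c $ 1 = \<beta> $ 1 * p1 * p3" "a $ 2 * c $ 2 = \<beta> $ 2 * p1 * p3"
   and v3: "a $ 1 * b $ 1 = \<gamma> $ 1 * p1 * p2" "a $ 2 * b $ 2 = \<gamma> $ 2 * p1 * p2"
  proof -
    have "tri (($) diag_tensor) x b c = dot2 \<alpha> x * p2 * p3" for x using S by (simp add: p2_def p3_def)
    from this[of e1] this[of e2] show "b $ 1 * c $ 1 = \<alpha> $ 1 * p2 * p3" "b $ 2 * c $ 2 = \<alpha> $ 2 * p2 * p3"
      by (simp_all add: tri_diag dot)
    have "tri (($) diag_tensor) a x c = p1 * dot2 \<beta> x * p3" for x using S by (simp add: p1_def p3_def)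
    from this[of e1] this[of e2] show "a $ 1 * c $ 1 = \<beta> $ 1 * p1 * p3" "a $ 2 * c $ 2 = \<beta> $ 2 * p1 * p3"
      by (simp_all add: tri_diag dot)
    have "tri (($) diag_tensor) a b x = p1 * p2 * dot2 \<gamma> x" for x using S by (simp add: p1_def p2_def)
    from this[of e1] this[of e2] show "a $ 1 * b $ 1 = \<gamma> $ 1 * p1 * p2" "a $ 2 * b $ 2 = \<gamma> $ 2 * p1 * p2"
      by (simp_all add: tri_diag dot)
  qed
  have u1: "tri (($) u) x \<beta> \<gamma> = dot2 a x * p2 * p3"
    and u2: "tri (($) u) \<alpha> x \<gamma> = p1 * dot2 b x * p3"
    and u3: "tri (($) u) \<alpha> \<beta> x = p1 * p2 * dot2 c x" for x
    using S unfolding comm by simp_all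
  have u: "tri (($) u) a b c = a $ 1 * b $ 1 * c $ 1 * g0 + a $ 1 * b $ 1 * c $ 2 * B3 + a $ 1 * b $ 2 * c $ 1 * B2
      + a $ 1 * b $ 2 * c $ 2 * A1 + a $ 2 * b $ 1 * c $ 1 * B1 + a $ 2 * b $ 1 * c $ 2 * A2
      + a $ 2 * b $ 2 * c $ 1 * A3 + a $ 2 * b $ 2 * c $ 2 * h0" for a b c
    by (simp add: tri_def sum_idx mult_ac)
  note G = good[unfolded good_slices_def]
  have p1: "p1 \<noteq> 0"
  proof
    assume 0: "p1 = 0"
    show False
      by (rule pairing_nonzero[of "a $ 1" "c $ 1" "a $ 2" "c $ 2" "b $ 1" "b $ 2" "\<alpha> $ 1" "p2 * p3" "\<alpha> $ 2" "\<gamma> $ 1" "\<gamma> $ 2"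
          g0 B3 B1 A2 B2 A1 A3 h0])
        (use G v1 v2 v3 nz u2[of e1] u2[of e2] in \<open>auto simp: 0 u algebra_simps\<close>)
  qed
  have p2: "p2 \<noteq> 0"
  proof
    assume 0: "p2 = 0"
    show False
      by (rule pairing_nonzero[of "b $ 1" "c $ 1" "b $ 2" "c $ 2" "a $ 1" "a $ 2" "\<beta> $ 1" "p1 * p3" "\<beta> $ 2" "\<gamma> $ 1" "\<gamma> $ 2"
          g0 B3 B2 A1 B1 A2 A3 h0])
        (use G v1 v2 v3 nz u1[of e1] u1[of e2] in \<open>auto simp: 0 u algebra_simps\<close>)
  qed
  have p3: "p3 \<noteq> 0"
  proof
    assume 0: "p3 = 0"
    show False
      by (rule pairing_nonzero[of "c $ 1" "b $ 1" "c $ 2" "b $ 2" "a $ 1" "a $ 2" "\<gamma> $ 1" "p1 * p2" "\<gamma> $ 2" "\<beta> $ 1" "\<beta> $ 2"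
          g0 B2 B3 A1 B1 A3 A2 h0])
        (use G v1 v2 v3 nz u1[of e1] u1[of e2] in \<open>auto simp: 0 u algebra_simps\<close>)
  qed
  have a1: "a $ 1 \<noteq> 0"
  proof
    assume "a $ 1 = 0"
    then have "\<beta> $ 1 = 0" "\<gamma> $ 1 = 0" using v2(1) v3(1) p1 p2 p3 by auto
    then show False using u1[of e1] \<open>a $ 1 = 0\<close> G nz by (auto simp: u dot)
  qed
  have a2: "a $ 2 \<noteq> 0"
  proof
    assume "a $ 2 = 0"
    then have "\<beta> $ 2 = 0" "\<gamma> $ 2 = 0" using v2(2) v3(2) p1 p2 p3 by auto
    then show False using u1[of e2] \<open>a $ 2 = 0\<close> G nz by (auto simp: u dot)
  qed
  have b1: "b $ 1 \<noteq> 0"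
  proof
    assume "b $ 1 = 0"
    then have "\<alpha> $ 1 = 0" "\<gamma> $ 1 = 0" using v1(1) v3(1) p1 p2 p3 by auto
    then show False using u2[of e1] \<open>b $ 1 = 0\<close> G nz by (auto simp: u dot)
  qed
  have b2: "b $ 2 \<noteq> 0"
  proof
    assume "b $ 2 = 0"
    then have "\<alpha> $ 2 = 0" "\<gamma> $ 2 = 0" using v1(2) v3(2) p1 p2 p3 by auto
    then show False using u2[of e2] \<open>b $ 2 = 0\<close> G nz by (auto simp: u dot)
  qed
  have c1: "c $ 1 \<noteq> 0"
  proof
    assume "c $ 1 = 0"
    then have "\<alpha> $ 1 = 0" "\<beta> $ 1 = 0" using v1(1) v2(1) p1 p2 p3 by auto
    then show False using u3[of e1] \<open>c $ 1 = 0\<close> G nz by (auto simp: u dot)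
  qed
  have c2: "c $ 2 \<noteq> 0"
  proof
    assume "c $ 2 = 0"
    then have "\<alpha> $ 2 = 0" "\<beta> $ 2 = 0" using v1(2) v2(2) p1 p2 p3 by auto
    then show False using u3[of e2] \<open>c $ 2 = 0\<close> G nz by (auto simp: u dot)
  qed
  have al: "\<alpha> $ 1 \<noteq> 0" "\<beta> $ 1 \<noteq> 0" "\<gamma> $ 1 \<noteq> 0" using v1(1) v2(1) v3(1) a1 b1 c1 by auto
  let ?s = "a $ 2 / a $ 1" and ?t = "b $ 2 / b $ 1" and ?r = "c $ 2 / c $ 1"
  have ratio: "y2 / y1 = (x2 / x1) * (x2' / x1')"
    if "x1 * x1' = y1 * p * q" "x2 * x2' = y2 * p * q" "x1 \<noteq> 0" "x1' \<noteq> 0" "y1 \<noteq> 0" "p \<noteq> 0" "q \<noteq> 0"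
    for x1 x2 x1' x2' y1 y2 p q :: complex
  proof -
    have "(x2 / x1) * (x2' / x1') = (x2 * x2') / (x1 * x1')" by simp
    also have "\<dots> = y2 / y1" unfolding that(1,2) using that by simp
    finally show ?thesis by simp
  qed
  have r1: "\<alpha> $ 2 = \<alpha> $ 1 * (?t * ?r)" using ratio[OF v1 b1 c1 al(1) p2 p3] al by (simp add: field_simps)
  have r2: "\<beta> $ 2 = \<beta> $ 1 * (?s * ?r)" using ratio[OF v2 a1 c1 al(2) p1 p3] al by (simp add: field_simps)
  have r3: "\<gamma> $ 2 = \<gamma> $ 1 * (?s * ?t)" using ratio[OF v3 a1 b1 al(3) p1 p2] al by (simp add: field_simps)
  have norm: "tensor3 x y z = (x $ 1 * y $ 1 * z $ 1) *s pt3 s t r"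
    if "x $ 2 = x $ 1 * s" "y $ 2 = y $ 1 * t" "z $ 2 = z $ 1 * r" for x y z s t r
    using that by (auto simp: pt3_def Finite_Cartesian_Product.vec_eq_iff forall_2)
  show thesis
  proof (rule that[of "a $ 1 * b $ 1 * c $ 1" "\<alpha> $ 1 * \<beta> $ 1 * \<gamma> $ 1" ?s ?t ?r])
    show "z = (a $ 1 * b $ 1 * c $ 1) *s pt3 ?s ?t ?r"
      unfolding z by (rule norm) (use a1 b1 c1 in auto)
    show "w = (\<alpha> $ 1 * \<beta> $ 1 * \<gamma> $ 1) *s pt3 (?t * ?r) (?s * ?r) (?s * ?t)"
      unfolding w by (rule norm[OF r1 r2 r3])
  qed (use a1 a2 b1 b2 c1 c2 al in auto)
qed

definition chart_sols :: "(complex \<times> complex \<times> complex) set" where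
  "chart_sols = {(s, t, r). s \<noteq> 0 \<and> t \<noteq> 0 \<and> r \<noteq> 0 \<and> 1 + s * t * r \<noteq> 0 \<and>
     s * U1 s t r = V1 s t r \<and> t * U2 s t r = V2 s t r \<and> r * U3 s t r = V3 s t r}"

text \<open>The value of \<open>u\<close> on all three factors of \<open>w\<close> can be computed
  from each of the three contractions, which forces their multipliers to agree. If they were 0,
  \<open>u\<close> would be orthogonal to the fields at a nonzero tensor, against
  \<open>hdet_ortho\<close>.\<close>

lemma chart_sols_nonzero:
  assumes h: "hdet (($) u) \<noteq> 0" and c: "(s, t, r) \<in> chart_sols"
  shows "U1 s t r = U2 s t r" "U1 s t r = U3 s t r" "U1 s t r \<noteq> 0"
proof -
  have D: "1 + s * t * r \<noteq> 0" and e: "V1 s t r = s * U1 s t r" "V2 s t r = t * U2 s t r" "V3 s t r = r * U3 s t r"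
    using c by (auto simp: chart_sols_def)
  have "U1 s t r + (t * r) * V1 s t r = U2 s t r + (s * r) * V2 s t r"
    "U1 s t r + (t * r) * V1 s t r = U3 s t r + (s * t) * V3 s t r"
    by (simp_all add: U1_def V1_def U2_def V2_def U3_def V3_def algebra_simps)
  then have "(1 + s * t * r) * U1 s t r = (1 + s * t * r) * U2 s t r"
    "(1 + s * t * r) * U1 s t r = (1 + s * t * r) * U3 s t r"
    unfolding e by (simp_all add: algebra_simps)
  then show eq: "U1 s t r = U2 s t r" "U1 s t r = U3 s t r" using D by simp_all
  show "U1 s t r \<noteq> 0"
  proof
    assume "U1 s t r = 0"
    then have 0: "U1 s t r = 0" "V1 s t r = 0" "U2 s t r = 0" "V2 s t r = 0" "U3 s t r = 0" "V3 s t r = 0"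
      using eq e by auto
    have nz: "pt3 (t * r) (s * r) (s * t) \<noteq> 0" using pt3_scale_eq_0[of 1] by simp
    have "ortho (($) u) (($) (pt3 (t * r) (s * r) (s * t)))"
      unfolding pt3_def ortho_tensor3[OF nz[unfolded pt3_def]] tri_normal 0 by simp
    then have "pt3 (t * r) (s * r) (s * t) $ (1,1,1) = 0" by (rule hdet_ortho[OF _ h])
    then show False by (simp add: pt3_nth)
  qed
qed

lemma bij_betw_chart_sols:
  assumes good: "good_slices" and h: "hdet (($) u) \<noteq> 0"
  shows "bij_betw (\<lambda>(s, t, r). ((U1 s t r / (1 + s * t * r)^2) *s pt3 s t r, (1 / (1 + s * t * r)^2) *s pt3 (t * r) (s * r) (s * t)))
    chart_sols (Sol u diag_tensor)"
  unfolding bij_betw_def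
proof
  let ?\<Phi> = "\<lambda>(s, t, r). ((U1 s t r / (1 + s * t * r)^2) *s pt3 s t r, (1 / (1 + s * t * r)^2) *s pt3 (t * r) (s * r) (s * t))"
  show "inj_on ?\<Phi> chart_sols"
  proof (rule inj_onI)
    fix x y assume xy: "x \<in> chart_sols" "y \<in> chart_sols" and E: "?\<Phi> x = ?\<Phi> y"
    obtain s t r s' t' r' where x: "x = (s, t, r)" and y: "y = (s', t', r')" by (cases x; cases y)
    have eq: "(U1 s t r / (1 + s * t * r)^2) *s pt3 s t r = (U1 s' t' r' / (1 + s' * t' * r')^2) *s pt3 s' t' r'"
      using arg_cong[OF E, of fst] unfolding x y prod.case fst_conv .
    note c = xy[unfolded x y]
    define m m' where "m = U1 s t r / (1 + s * t * r)^2" and "m' = U1 s' t' r' / (1 + s' * t' * r')^2"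
    have m: "m \<noteq> 0" using chart_sols_nonzero(3)[OF h c(1)] c(1) by (simp add: m_def chart_sols_def)
    have "m *s pt3 s t r = m' *s pt3 s' t' r'" using eq by (simp add: m_def m'_def)
    then have e: "(m *s pt3 s t r) $ p = (m' *s pt3 s' t' r') $ p" for p by simp
    show "x = y"
      using m e[of "(1,1,1)"] e[of "(2,1,1)"] e[of "(1,2,1)"] e[of "(1,1,2)"] by (simp add: pt3_nth x y)
  qed
  show "?\<Phi> ` chart_sols = Sol u diag_tensor"
  proof (intro equalityI subsetI)
    fix x assume "x \<in> ?\<Phi> ` chart_sols"
    then obtain s t r where c: "(s, t, r) \<in> chart_sols" and x: "x = ?\<Phi> (s, t, r)" by auto
    note nz = chart_sols_nonzero[OF h c]
    have c': "s \<noteq> 0" "t \<noteq> 0" "r \<noteq> 0" "1 + s * t * r \<noteq> 0"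
     "V1 s t r = s * U1 s t r" "V2 s t r = t * U2 s t r" "V3 s t r = r * U3 s t r"
      using c by (auto simp: chart_sols_def)
    show "x \<in> Sol u diag_tensor"
      unfolding x prod.case
      by (subst Sol_normal_iff) (use c' nz in auto)
  next
    fix x assume "x \<in> Sol u diag_tensor"
    then obtain z w where x: "x = (z, w)" "(z, w) \<in> Sol u diag_tensor" by (cases x) auto
    obtain m n s t r where mn: "m \<noteq> 0" "n \<noteq> 0" "s \<noteq> 0" "t \<noteq> 0" "r \<noteq> 0"
      "z = m *s pt3 s t r" "w = n *s pt3 (t * r) (s * r) (s * t)"
      using Sol_in_chart[OF good x(2)] .
    have *: "n * (1 + s * t * r)^2 = 1" "U1 s t r = m * (1 + s * t * r)^2" "V1 s t r = m * s * (1 + s * t * r)^2"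
      "U2 s t r = m * (1 + s * t * r)^2" "V2 s t r = m * t * (1 + s * t * r)^2"
      "U3 s t r = m * (1 + s * t * r)^2" "V3 s t r = m * r * (1 + s * t * r)^2"
      using x(2) Sol_normal_iff[of m n s t r] mn by auto
    have D: "1 + s * t * r \<noteq> 0" using *(1) by auto
    have "(s, t, r) \<in> chart_sols" using mn D * by (simp add: chart_sols_def)
    moreover have "x = ?\<Phi> (s, t, r)" using * D mn by (simp add: x(1) eq_divide_eq)
    ultimately show "x \<in> ?\<Phi> ` chart_sols" by blast
  qed
qed

end

section \<open>Elimination\<close>

text \<open>For \<open>D = 1 + s t r \<noteq> 0\<close> the chart equations say that \<open>A\<^sub>1 s - B\<^sub>1 / s = A\<^sub>2 t - B\<^sub>2 / t = A\<^sub>3 r - B\<^sub>3 / r\<close>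
  together with one equation that is bilinear in \<open>t, r\<close>.  Eliminating \<open>r\<close> and then reducing modulo the
  quadratic equation for \<open>t\<close> leaves \<open>X + s y t = 0\<close> with polynomials \<open>X, y\<close> in \<open>s\<close> whose coefficients are
  \<open>xc\<^sub>i, yc\<^sub>i\<close>; the norm of this linear form is the polynomial with coefficients \<open>qc\<^sub>i\<close>.\<close>

definition "xc0 u = B1 u * B1 u * A2 u * B2 u - B1 u * A2 u * A3 u * g0 u"
definition "xc1 u = A2 u * A3 u * g0 u * g0 u + A2 u * A2 u * B2 u * A3 u + A1 u * B1 u * A2 u * A3 u - A2 u * A3 u * A3 u * B3 u - B1 u * A2 u * B2 u * h0 u - B1 u * A2 u * B2 u * g0 u"
definition "xc2 u = B1 u * B2 u * B3 u * h0 u - A1 u * A2 u * A3 u * g0 u"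
definition "xc3 u = B2 u * A3 u * B3 u * B3 u + A1 u * A2 u * B2 u * h0 u + A1 u * A2 u * B2 u * g0 u - B2 u * B3 u * h0 u * h0 u - A2 u * B2 u * B2 u * B3 u - A1 u * B1 u * B2 u * B3 u"
definition "xc4 u = A1 u * B2 u * B3 u * h0 u - A1 u * A1 u * A2 u * B2 u"
definition "yc0 u = B1 u * A2 u * g0 u * h0 u + B1 u * A2 u * A3 u * B3 u + B1 u * A2 u * A2 u * B2 u - B1 u * B1 u * B3 u * h0 u - 2 * A2 u * A2 u * A3 u * g0 u"
definition "yc1 u = 2 * A2 u * A3 u * B3 u * g0 u + 2 * A1 u * A2 u * A2 u * A3 u + B1 u * B3 u * h0 u * h0 u + A1 u * B1 u * B1 u * B3 u - B1 u * A3 u * B3 u * B3 u - B1 u * A2 u * B2 u * B3 u - A1 u * B1 u * A2 u * h0 u - A1 u * B1 u * A2 u * g0 u - 2 * A2 u * A3 u * B3 u * h0 u"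
definition "yc2 u = 2 * A2 u * B2 u * B3 u * h0 u + A1 u * A1 u * B1 u * A2 u - A1 u * A2 u * g0 u * h0 u - A1 u * A2 u * A3 u * B3 u - A1 u * A2 u * A2 u * B2 u"
definition "yc3 u = A1 u * A3 u * B3 u * B3 u + A1 u * A1 u * A2 u * h0 u + A1 u * A1 u * A2 u * g0 u - A1 u * B3 u * h0 u * h0 u - A1 u * A2 u * B2 u * B3 u - A1 u * A1 u * B1 u * B3 u"
definition "yc4 u = A1 u * A1 u * B3 u * h0 u - A1 u * A1 u * A1 u * A2 u"
definition "qc0 u = A2 u * xc0 u * xc0 u - B1 u * xc0 u * yc0 u"
definition "qc1 u = 2 * A2 u * xc0 u * xc1 u - B1 u * xc0 u * yc1 u - B1 u * xc1 u * yc0 u"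
definition "qc2 u = 2 * A2 u * xc0 u * xc2 u + A2 u * xc1 u * xc1 u + A1 u * xc0 u * yc0 u - B1 u * xc0 u * yc2 u - B1 u * xc1 u * yc1 u - B1 u * xc2 u * yc0 u - B2 u * yc0 u * yc0 u"
definition "qc3 u = 2 * A2 u * xc0 u * xc3 u + 2 * A2 u * xc1 u * xc2 u + A1 u * xc0 u * yc1 u + A1 u * xc1 u * yc0 u - B1 u * xc0 u * yc3 u - B1 u * xc1 u * yc2 u - B1 u * xc2 u * yc1 u - B1 u * xc3 u * yc0 u - 2 * B2 u * yc0 u * yc1 u"
definition "qc4 u = 2 * A2 u * xc0 u * xc4 u + 2 * A2 u * xc1 u * xc3 u + A2 u * xc2 u * xc2 u + A1 u * xc0 u * yc2 u + A1 u * xc1 u * yc1 u + A1 u * xc2 u * yc0 u - B1 u * xc0 u * yc4 u - B1 u * xc1 u * yc3 u - B1 u * xc2 u * yc2 u - B1 u * xc3 u * yc1 u - B1 u * xc4 u * yc0 u - 2 * B2 u * yc0 u * yc2 u - B2 u * yc1 u * yc1 u"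
definition "qc5 u = 2 * A2 u * xc1 u * xc4 u + 2 * A2 u * xc2 u * xc3 u + A1 u * xc0 u * yc3 u + A1 u * xc1 u * yc2 u + A1 u * xc2 u * yc1 u + A1 u * xc3 u * yc0 u - B1 u * xc1 u * yc4 u - B1 u * xc2 u * yc3 u - B1 u * xc3 u * yc2 u - B1 u * xc4 u * yc1 u - 2 * B2 u * yc0 u * yc3 u - 2 * B2 u * yc1 u * yc2 u"
definition "qc6 u = 2 * A2 u * xc2 u * xc4 u + A2 u * xc3 u * xc3 u + A1 u * xc0 u * yc4 u + A1 u * xc1 u * yc3 u + A1 u * xc2 u * yc2 u + A1 u * xc3 u * yc1 u + A1 u * xc4 u * yc0 u - B1 u * xc2 u * yc4 u - B1 u * xc3 u * yc3 u - B1 u * xc4 u * yc2 u - 2 * B2 u * yc0 u * yc4 u - 2 * B2 u * yc1 u * yc3 u - B2 u * yc2 u * yc2 u"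
definition "qc7 u = 2 * A2 u * xc3 u * xc4 u + A1 u * xc1 u * yc4 u + A1 u * xc2 u * yc3 u + A1 u * xc3 u * yc2 u + A1 u * xc4 u * yc1 u - B1 u * xc3 u * yc4 u - B1 u * xc4 u * yc3 u - 2 * B2 u * yc1 u * yc4 u - 2 * B2 u * yc2 u * yc3 u"
definition "qc8 u = A2 u * xc4 u * xc4 u + A1 u * xc2 u * yc4 u + A1 u * xc3 u * yc3 u + A1 u * xc4 u * yc2 u - B1 u * xc4 u * yc4 u - 2 * B2 u * yc2 u * yc4 u - B2 u * yc3 u * yc3 u"

definition "Xp u = [:xc0 u, xc1 u, xc2 u, xc3 u, xc4 u:]"
definition "Yp u = [:yc0 u, yc1 u, yc2 u, yc3 u, yc4 u:]"
definition "Qp u = [:qc0 u, qc1 u, qc2 u, qc3 u, qc4 u, qc5 u, qc6 u, qc7 u, qc8 u:]"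
text \<open>Substituting \<open>t = - X / (s y)\<close> turns the bilinear equation into
  \<open>N + s M r = 0\<close> and \<open>1 + s t r\<close> into \<open>W / (s y M)\<close>; so
  \<open>y\<close>, \<open>M\<close> and \<open>W\<close> must not vanish at the roots of
  \<open>Q\<close>.\<close>

definition "Mp u = [:- A3 u, B2 u:] * Yp u - [:- h0 u, A1 u:] * Xp u"
definition "Np u = [:- B1 u, g0 u:] * Yp u - [:- A2 u, B3 u:] * Xp u"
definition "Wp u = [:0, 1:] * Yp u * Mp u + Xp u * Np u"

lemmas xy_defs = xc0_def xc1_def xc2_def xc3_def xc4_def yc0_def yc1_def yc2_def yc3_def yc4_def
lemmas qc_defs = qc0_def qc1_def qc2_def qc3_def qc4_def qc5_def qc6_def qc7_def qc8_def

text \<open>The norm of \<open>X + s y t\<close>, cleared of its denominator, has formal degree 10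
  in \<open>s\<close>. The two top coefficients cancel because \<open>xc3 : yc3\<close> and
  \<open>xc4 : yc4\<close> both are in the ratio \<open>B2 : A1\<close>; this is where the number 8
  comes from.\<close>

lemma poly_Qp: "poly (Qp u) s = A2 u * poly (Xp u) s ^ 2 + (A1 u * s ^ 2 - B1 u) * poly (Xp u) s * poly (Yp u) s
    - B2 u * s ^ 2 * poly (Yp u) s ^ 2"
proof -
  have 3: "A1 u * xc3 u = B2 u * yc3 u" and 4: "A1 u * xc4 u = B2 u * yc4 u"
    by (simp_all add: xc3_def yc3_def xc4_def yc4_def algebra_simps)
  have "A2 u * poly (Xp u) s ^ 2 + (A1 u * s ^ 2 - B1 u) * poly (Xp u) s * poly (Yp u) s
    - B2 u * s ^ 2 * poly (Yp u) s ^ 2 = poly (Qp u) s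
    + s ^ 9 * ((A1 u * xc3 u - B2 u * yc3 u) * yc4 u + (A1 u * xc4 u - B2 u * yc4 u) * yc3 u)
    + s ^ 10 * ((A1 u * xc4 u - B2 u * yc4 u) * yc4 u)"
    unfolding Xp_def Yp_def Qp_def qc_defs by (simp add: algebra_simps power_numeral_reduce)
  then show ?thesis using 3 4 by simp
qed

text \<open>\<open>C0 + C1 t + C2 t^2\<close> is the quadratic equation for \<open>r\<close> after
  clearing denominators in \<open>r = - (E0 + E1 t) / (E2 + E3 t)\<close>. Reducing
  \<open>t^2\<close> by its own quadratic equation leaves a linear form from which powers of
  \<open>s\<close> split off.\<close>

lemma elimination_identity:
  fixes u s t
  defines "T \<equiv> A1 u * s ^ 2 - B1 u" and "E0 \<equiv> g0 u * s - B1 u" and "E1 \<equiv> s * (B3 u * s - A2 u)"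
    and "E2 \<equiv> s * (B2 u * s - A3 u)" and "E3 \<equiv> s ^ 2 * (A1 u * s - h0 u)"
  defines "C0 \<equiv> s * A3 u * E0 ^ 2 + T * E0 * E2 - s * B3 u * E2 ^ 2"
    and "C1 \<equiv> 2 * s * A3 u * E0 * E1 + T * (E0 * E3 + E1 * E2) - 2 * s * B3 u * E2 * E3"
    and "C2 \<equiv> s * A3 u * E1 ^ 2 + T * E1 * E3 - s * B3 u * E3 ^ 2"
  shows "s * (A2 u * C0 + B2 u * C2) = s ^ 3 * poly (Xp u) s" (is ?X)
    "s * A2 u * C1 + T * C2 = s ^ 4 * poly (Yp u) s" (is ?Y)
  unfolding T_def E0_def E1_def E2_def E3_def C0_def C1_def C2_def Xp_def Yp_def xy_defs
  by (simp_all add: algebra_simps power_numeral_reduce)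

text \<open>Cross differences of the chart equations are divisible by \<open>1 + s t r\<close>,
  which separates \<open>t\<close> from \<open>r\<close> in two of the three equations.\<close>

lemma chart_sols_iff:
  "(s, t, r) \<in> chart_sols u \<longleftrightarrow> s \<noteq> 0 \<and> t \<noteq> 0 \<and> r \<noteq> 0 \<and> 1 + s * t * r \<noteq> 0 \<and>
    s * U1 u s t r = V1 u s t r \<and>
    t * (A1 u * s ^ 2 - B1 u) = s * (A2 u * t ^ 2 - B2 u) \<and> r * (A1 u * s ^ 2 - B1 u) = s * (A3 u * r ^ 2 - B3 u)"
proof -
  define D where "D = 1 + s * t * r"
  have transfer: "p = 0 \<longleftrightarrow> q = 0" if "x * f - y * p = D' * q" "f = 0" "y \<noteq> 0" "D' \<noteq> 0"
    for x f y p D' q :: complex using that by auto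
  have 1: "t * (s * U1 u s t r - V1 u s t r) - s * (t * U2 u s t r - V2 u s t r) =
      D * (t * (A1 u * s ^ 2 - B1 u) - s * (A2 u * t ^ 2 - B2 u))"
    by (simp add: D_def U1_def V1_def U2_def V2_def algebra_simps power2_eq_square)
  have 2: "r * (s * U1 u s t r - V1 u s t r) - s * (r * U3 u s t r - V3 u s t r) =
      D * (r * (A1 u * s ^ 2 - B1 u) - s * (A3 u * r ^ 2 - B3 u))"
    by (simp add: D_def U1_def V1_def U3_def V3_def algebra_simps power2_eq_square)
  have 3: "t * U2 u s t r - V2 u s t r = 0 \<longleftrightarrow> t * (A1 u * s ^ 2 - B1 u) - s * (A2 u * t ^ 2 - B2 u) = 0"
    if "s * U1 u s t r - V1 u s t r = 0" "s \<noteq> 0" "D \<noteq> 0"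
    by (rule transfer[OF 1 that])
  have 4: "r * U3 u s t r - V3 u s t r = 0 \<longleftrightarrow> r * (A1 u * s ^ 2 - B1 u) - s * (A3 u * r ^ 2 - B3 u) = 0"
    if "s * U1 u s t r - V1 u s t r = 0" "s \<noteq> 0" "D \<noteq> 0"
    by (rule transfer[OF 2 that])
  show ?thesis
    using 3 4 unfolding chart_sols_def D_def[symmetric] mem_Collect_eq prod.case right_minus_eq by blast
qed

definition good_roots :: "complex ^ idx \<Rightarrow> bool" where
  "good_roots u \<longleftrightarrow> (\<forall>s. poly (Qp u) s = 0 \<longrightarrow>
     s \<noteq> 0 \<and> poly (Yp u) s \<noteq> 0 \<and> poly (Mp u) s \<noteq> 0 \<and> poly (Wp u) s \<noteq> 0)"

text \<open>A root \<open>s\<close> determines \<open>t\<close> from the linear form and then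
  \<open>r\<close> from the bilinear equation; \<open>good_roots\<close> keeps the denominators and
  \<open>1 + s t r\<close> away from 0.\<close>

lemma bij_betw_roots:
  assumes nz: "good_slices u" and roots: "good_roots u"
  shows "bij_betw fst (chart_sols u) {s. poly (Qp u) s = 0}"
proof -
  have A: "A2 u \<noteq> 0" "B2 u \<noteq> 0" "B3 u \<noteq> 0" using nz by (auto simp: good_slices_def)
  define T where "T s = A1 u * s ^ 2 - B1 u" for s
  define E0 where "E0 s = g0 u * s - B1 u" for s
  define E1 where "E1 s = s * (B3 u * s - A2 u)" for s
  define E2 where "E2 s = s * (B2 u * s - A3 u)" for s
  define E3 where "E3 s = s ^ 2 * (A1 u * s - h0 u)" for s
  define X where "X s = poly (Xp u) s" for s
  define y where "y s = poly (Yp u) s" for s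
  define C where "C s t = s * A3 u * (E0 s + E1 s * t) ^ 2 + T s * (E0 s + E1 s * t) * (E2 s + E3 s * t)
      - s * B3 u * (E2 s + E3 s * t) ^ 2" for s t
  have F1: "s * U1 u s t r - V1 u s t r = (E0 s + E1 s * t) + (E2 s + E3 s * t) * r" for s t r
    by (simp add: U1_def V1_def E0_def E1_def E2_def E3_def algebra_simps power2_eq_square)
  have C: "s * A2 u * C s t = s ^ 3 * (X s + s * y s * t)" if "s * A2 u * t ^ 2 = T s * t + s * B2 u" for s t
  proof -
    define c0 c1 c2 where "c0 = s * A3 u * E0 s ^ 2 + T s * E0 s * E2 s - s * B3 u * E2 s ^ 2"
      and "c1 = 2 * s * A3 u * E0 s * E1 s + T s * (E0 s * E3 s + E1 s * E2 s) - 2 * s * B3 u * E2 s * E3 s"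
      and "c2 = s * A3 u * E1 s ^ 2 + T s * E1 s * E3 s - s * B3 u * E3 s ^ 2"
    have "C s t = c0 + c1 * t + c2 * t ^ 2"
      by (simp add: C_def c0_def c1_def c2_def algebra_simps power2_eq_square)
    then have "s * A2 u * C s t = s * A2 u * (c0 + c1 * t) + c2 * (s * A2 u * t ^ 2)" by (simp add: algebra_simps)
    also have "\<dots> = s * (A2 u * c0 + B2 u * c2) + (s * A2 u * c1 + T s * c2) * t"
      unfolding that by (simp add: algebra_simps)
    also have "s * (A2 u * c0 + B2 u * c2) = s ^ 3 * X s"
      using elimination_identity(1)[of s u] unfolding c0_def c2_def T_def E0_def E1_def E2_def E3_def X_def .
    also have "s * A2 u * c1 + T s * c2 = s ^ 4 * y s"
      using elimination_identity(2)[of s u] unfolding c1_def c2_def T_def E0_def E1_def E2_def E3_def y_def .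
    finally show ?thesis by (simp add: algebra_simps power_numeral_reduce)
  qed
  have Q: "poly (Qp u) s = A2 u * X s ^ 2 + T s * X s * y s - B2 u * s ^ 2 * y s ^ 2" for s
    unfolding poly_Qp X_def y_def T_def ..
  have M: "poly (Mp u) s = (B2 u * s - A3 u) * y s - (A1 u * s - h0 u) * X s" for s
    by (simp add: Mp_def X_def y_def algebra_simps)
  have N: "poly (Np u) s = E0 s * y s - (B3 u * s - A2 u) * X s" for s
    by (simp add: Np_def X_def y_def E0_def algebra_simps)
  have W: "poly (Wp u) s = s * y s * poly (Mp u) s + X s * poly (Np u) s" for s
    by (simp add: Wp_def X_def y_def)
  have fwd: "poly (Qp u) s = 0 \<and> X s + s * y s * t = 0 \<and> (E0 s + E1 s * t) + (E2 s + E3 s * t) * r = 0"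
    if c: "(s, t, r) \<in> chart_sols u" for s t r
  proof -
    have s: "s \<noteq> 0" and f: "s * U1 u s t r = V1 u s t r" and qt: "s * A2 u * t ^ 2 = T s * t + s * B2 u"
      and qr: "s * A3 u * r ^ 2 = T s * r + s * B3 u"
      using c unfolding chart_sols_iff by (auto simp: T_def algebra_simps)
    have NM: "(E0 s + E1 s * t) + (E2 s + E3 s * t) * r = 0" using f F1 by (metis right_minus_eq)
    have NN: "E0 s + E1 s * t = - ((E2 s + E3 s * t) * r)" using NM by (simp add: eq_neg_iff_add_eq_0)
    have "C s t = (E2 s + E3 s * t) ^ 2 * (s * A3 u * r ^ 2 - (T s * r + s * B3 u))"
      unfolding C_def NN by (simp add: algebra_simps power2_eq_square)
    then have "C s t = 0" using qr by simp
    then have Xy: "X s + s * y s * t = 0" using C[OF qt] s by simp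
    then have X: "X s = - (s * y s * t)" by (simp add: eq_neg_iff_add_eq_0)
    have "poly (Qp u) s = s * y s ^ 2 * (s * A2 u * t ^ 2 - (T s * t + s * B2 u))"
      unfolding Q X by (simp add: algebra_simps power2_eq_square)
    then have "poly (Qp u) s = 0" using qt by simp
    then show ?thesis using Xy NM by blast
  qed
  have uniq: "t = - X s / (s * y s)" "r = - poly (Np u) s / (s * poly (Mp u) s)"
    if c: "(s, t, r) \<in> chart_sols u" for s t r
  proof -
    have s: "s \<noteq> 0" using c by (auto simp: chart_sols_def)
    have yM: "y s \<noteq> 0" "poly (Mp u) s \<noteq> 0" using fwd[OF c] roots by (auto simp: good_roots_def y_def)
    have Xt: "X s = - (s * y s * t)" using fwd[OF c] by (simp add: eq_neg_iff_add_eq_0)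
    then show t: "t = - X s / (s * y s)" using s yM by simp
    have "y s * ((E0 s + E1 s * t) + (E2 s + E3 s * t) * r) = poly (Np u) s + s * poly (Mp u) s * r"
      unfolding N M Xt E1_def E2_def E3_def by (simp add: algebra_simps power2_eq_square)
    then have "poly (Np u) s + s * poly (Mp u) s * r = 0" using fwd[OF c] by simp
    then have "s * poly (Mp u) s * r = - poly (Np u) s" by (simp add: eq_neg_iff_add_eq_0 add.commute)
    then show "r = - poly (Np u) s / (s * poly (Mp u) s)" using s yM by (simp add: field_simps)
  qed
  show ?thesis
    unfolding bij_betw_def
  proof
    show "inj_on fst (chart_sols u)"
    proof (rule inj_onI)
      fix p q assume pq: "p \<in> chart_sols u" "q \<in> chart_sols u" "fst p = fst q"
      obtain s t r t' r' where p: "p = (s, t, r)" and q: "q = (s, t', r')" using pq(3) by (cases p; cases q) auto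
      show "p = q" using uniq[OF pq(1)[unfolded p]] uniq[OF pq(2)[unfolded q]] unfolding p q by simp
    qed
    show "fst ` chart_sols u = {s. poly (Qp u) s = 0}"
    proof (intro equalityI subsetI)
      fix s assume "s \<in> {s. poly (Qp u) s = 0}"
      then have Q0: "poly (Qp u) s = 0" by simp
      then have nz: "s \<noteq> 0" "y s \<noteq> 0" "poly (Mp u) s \<noteq> 0" "poly (Wp u) s \<noteq> 0"
        using roots by (auto simp: good_roots_def y_def)
      define t where "t = - X s / (s * y s)"
      define r where "r = - poly (Np u) s / (s * poly (Mp u) s)"
      have X: "X s = - (s * y s * t)" using nz by (simp add: t_def)
      have "s * y s ^ 2 * (s * A2 u * t ^ 2 - (T s * t + s * B2 u)) = poly (Qp u) s"
        unfolding Q X by (simp add: algebra_simps power2_eq_square)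
      then have qt: "s * A2 u * t ^ 2 = T s * t + s * B2 u" using Q0 nz by simp
      then have "s * A2 u * C s t = 0" using C[OF qt] X by simp
      then have C0: "C s t = 0" using A nz by simp
      have Mt: "y s * (E2 s + E3 s * t) = s * poly (Mp u) s"
        unfolding M X E2_def E3_def by (simp add: algebra_simps power2_eq_square)
      then have M0: "E2 s + E3 s * t \<noteq> 0" using nz by auto
      have Nr: "poly (Np u) s = - (s * poly (Mp u) s * r)" using nz by (simp add: r_def)
      have "y s * ((E0 s + E1 s * t) + (E2 s + E3 s * t) * r) = poly (Np u) s + s * poly (Mp u) s * r"
        unfolding N M X E1_def E2_def E3_def by (simp add: algebra_simps power2_eq_square)
      then have NM: "(E0 s + E1 s * t) + (E2 s + E3 s * t) * r = 0" using Nr nz by simp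
      have NN: "E0 s + E1 s * t = - ((E2 s + E3 s * t) * r)" using NM by (simp add: eq_neg_iff_add_eq_0)
      have "C s t = (E2 s + E3 s * t) ^ 2 * (s * A3 u * r ^ 2 - (T s * r + s * B3 u))"
        unfolding C_def NN by (simp add: algebra_simps power2_eq_square)
      then have qr: "s * A3 u * r ^ 2 = T s * r + s * B3 u" using C0 M0 by simp
      have "poly (Wp u) s = s * y s * poly (Mp u) s * (1 + s * t * r)"
        unfolding W X Nr by (simp add: algebra_simps)
      then have D: "1 + s * t * r \<noteq> 0" using nz by auto
      have "t \<noteq> 0" "r \<noteq> 0" using qt qr A nz by auto
      moreover have "s * U1 u s t r = V1 u s t r" using F1[of s t r] NM by simp
      moreover have "t * (A1 u * s ^ 2 - B1 u) = s * (A2 u * t ^ 2 - B2 u)"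
        "r * (A1 u * s ^ 2 - B1 u) = s * (A3 u * r ^ 2 - B3 u)"
        using qt qr by (simp_all add: T_def algebra_simps)
      ultimately have "(s, t, r) \<in> chart_sols u" unfolding chart_sols_iff using nz D by blast
      then show "s \<in> fst ` chart_sols u" by force
    qed (use fwd in auto)
  qed
qed

lemma card_Sol_diag:
  assumes "good_slices u" "hdet (($) u) \<noteq> 0" "good_roots u" "qc8 u \<noteq> 0"
    and sqf: "\<And>s. poly (Qp u) s = 0 \<Longrightarrow> poly (pderiv (Qp u)) s \<noteq> 0"
  shows "finite (Sol u diag_tensor)" "card (Sol u diag_tensor) = 8"
proof -
  have deg: "degree (Qp u) = 8" using assms(4) by (simp add: Qp_def)
  then have Q0: "Qp u \<noteq> 0" by auto
  have "rsquarefree (Qp u)" unfolding rsquarefree_roots using sqf by blast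
  then have "Qp u = Polynomial.smult (lead_coeff (Qp u)) (\<Prod>s | poly (Qp u) s = 0. [:- s, 1:])"
    by (rule complex_poly_decompose_rsquarefree[symmetric])
  then have "degree (Qp u) = degree (\<Prod>s | poly (Qp u) s = 0. [:- s, 1:])"
    using Q0 by (metis degree_smult_eq leading_coeff_0_iff)
  also have "\<dots> = card {s. poly (Qp u) s = 0}"
    by (subst degree_prod_eq_sum_degree) auto
  finally have "card {s. poly (Qp u) s = 0} = degree (Qp u)" by simp
  moreover have "finite {s. poly (Qp u) s = 0}" by (rule poly_roots_finite[OF Q0])
  ultimately have "finite (chart_sols u)" "card (chart_sols u) = 8"
    using bij_betw_finite[OF bij_betw_roots[OF assms(1,3)]] bij_betw_same_card[OF bij_betw_roots[OF assms(1,3)]] deg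
    by simp_all
  then show "finite (Sol u diag_tensor)" "card (Sol u diag_tensor) = 8"
    using bij_betw_finite[OF bij_betw_chart_sols[OF assms(1,2)]]
      bij_betw_same_card[OF bij_betw_chart_sols[OF assms(1,2)]] by simp_all
qed

section \<open>Polynomial functions and a resultant\<close>

text \<open>Stated for any ring of functions, so that the polynomial dependence of
  \<open>gen_poly\<close> is verified once and then applies to functions of a point together with a
  square root.\<close>

definition fn_ring :: "('x \<Rightarrow> complex) set \<Rightarrow> bool" where
  "fn_ring F \<longleftrightarrow> (\<forall>c. (\<lambda>_. c) \<in> F) \<and> (\<forall>f\<in>F. \<forall>g\<in>F. (\<lambda>x. f x + g x) \<in> F) \<and> (\<forall>f\<in>F. \<forall>g\<in>F. (\<lambda>x. f x * g x) \<in> F)"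

context
  fixes F :: "('x \<Rightarrow> complex) set"
  assumes F: "fn_ring F"
begin

lemma fn_const: "(\<lambda>_. c) \<in> F"
  and fn_add: "f \<in> F \<Longrightarrow> g \<in> F \<Longrightarrow> (\<lambda>x. f x + g x) \<in> F"
  and fn_mult: "f \<in> F \<Longrightarrow> g \<in> F \<Longrightarrow> (\<lambda>x. f x * g x) \<in> F"
  using F unfolding fn_ring_def by blast+

lemma fn_uminus: "f \<in> F \<Longrightarrow> (\<lambda>x. - f x) \<in> F"
  using fn_mult[OF fn_const[of "-1"]] by fastforce

lemma fn_diff: "f \<in> F \<Longrightarrow> g \<in> F \<Longrightarrow> (\<lambda>x. f x - g x) \<in> F"
  using fn_add[OF _ fn_uminus] by fastforce

lemma fn_sum: "(\<And>a. a \<in> A \<Longrightarrow> f a \<in> F) \<Longrightarrow> (\<lambda>x. \<Sum>a\<in>A. f a x) \<in> F"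
  by (induction A rule: infinite_finite_induct) (auto intro: fn_const fn_add)

lemma fn_prod: "(\<And>a. a \<in> A \<Longrightarrow> f a \<in> F) \<Longrightarrow> (\<lambda>x. \<Prod>a\<in>A. f a x) \<in> F"
  by (induction A rule: infinite_finite_induct) (auto intro: fn_const fn_mult)

lemma fn_power: "f \<in> F \<Longrightarrow> (\<lambda>x. f x ^ n) \<in> F"
  by (induction n) (auto intro: fn_const fn_mult)

lemma fn_detf:
  assumes "\<And>i j. i < n \<Longrightarrow> j < n \<Longrightarrow> (\<lambda>x. f x i j) \<in> F"
  shows "(\<lambda>x. detf n (f x)) \<in> F"
proof -
  have "(\<lambda>x. \<Sum>p | p permutes {0..<n}. signof p * (\<Prod>i = 0..<n. f x i (p i))) \<in> F"
    using assms by (intro fn_sum fn_mult fn_const fn_prod) (auto simp: permutes_in_image)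
  moreover have "detf n (f x) = (\<Sum>p | p permutes {0..<n}. signof p * (\<Prod>i = 0..<n. f x i (p i)))" for x
    by (subst det_def'[of _ n]) (auto intro!: sum.cong prod.cong simp: permutes_in_image)
  ultimately show ?thesis by simp
qed

lemmas fn_intros = fn_const fn_add fn_mult fn_diff fn_uminus fn_power

definition fn_coeffs :: "('x \<Rightarrow> complex poly) \<Rightarrow> bool" where
  "fn_coeffs p \<longleftrightarrow> (\<forall>i. (\<lambda>x. coeff (p x) i) \<in> F)"

lemma fn_coeffs_intros:
  "fn_coeffs (\<lambda>_. 0)"
  "f \<in> F \<Longrightarrow> fn_coeffs p \<Longrightarrow> fn_coeffs (\<lambda>x. pCons (f x) (p x))"
  "fn_coeffs p \<Longrightarrow> fn_coeffs q \<Longrightarrow> fn_coeffs (\<lambda>x. p x + q x)"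
  "fn_coeffs p \<Longrightarrow> fn_coeffs q \<Longrightarrow> fn_coeffs (\<lambda>x. p x - q x)"
  "fn_coeffs p \<Longrightarrow> fn_coeffs q \<Longrightarrow> fn_coeffs (\<lambda>x. p x * q x)"
  "fn_coeffs p \<Longrightarrow> fn_coeffs (\<lambda>x. pderiv (p x))"
proof -
  show "fn_coeffs (\<lambda>x. pCons (f x) (p x))" if "f \<in> F" "fn_coeffs p"
    unfolding fn_coeffs_def
  proof
    fix i show "(\<lambda>x. coeff (pCons (f x) (p x)) i) \<in> F"
      using that by (cases i) (auto simp: fn_coeffs_def)
  qed
qed (auto simp: fn_coeffs_def coeff_mult coeff_pderiv intro!: fn_intros fn_sum)

end

text \<open>The columns of the matrix are the coefficient vectors of \<open>s\<^sup>j Q\<close> (\<open>j < m\<close>) and \<open>s\<^sup>j R\<close> (\<open>j < n\<close>).\<close>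

definition sylv :: "nat \<Rightarrow> nat \<Rightarrow> complex poly \<Rightarrow> complex poly \<Rightarrow> complex" where
  "sylv n m Q R = detf (n + m) (\<lambda>i j. if j < m then coeff (monom 1 j * Q) i else coeff (monom 1 (j - m) * R) i)"

text \<open>The vector of powers of the common root annihilates every column.\<close>

lemma sylv_eq_0_if_common_root:
  assumes "degree Q \<le> n" "degree R \<le> m" "0 < n + m" "poly Q s = 0" "poly R s = 0"
  shows "sylv n m Q R = 0"
  unfolding sylv_def
proof (rule detf_eq_0_if_rows_dependent[of _ "\<lambda>i. s ^ i"])
  show "\<exists>a<n + m. s ^ a \<noteq> 0" using assms(3) by (intro exI[of _ 0]) auto
  fix j assume j: "j < n + m"
  have eval: "(\<Sum>i<n + m. s ^ i * coeff p i) = poly p s" if "degree p < n + m" for p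
  proof -
    have "poly p s = (\<Sum>i\<le>degree p. coeff p i * s ^ i)" by (rule poly_altdef)
    also have "\<dots> = (\<Sum>i<n + m. coeff p i * s ^ i)"
      using that by (intro sum.mono_neutral_left) (auto simp: coeff_eq_0)
    finally show ?thesis by (simp add: mult.commute)
  qed
  have deg: "degree (monom 1 k * p) < n + m" if "degree p \<le> d" "k + d < n + m" for k d and p :: "complex poly"
    using degree_mult_le[of "monom 1 k" p] that by (simp add: degree_monom_eq)
  show "(\<Sum>i<n + m. s ^ i * (if j < m then coeff (monom 1 j * Q) i else coeff (monom 1 (j - m) * R) i)) = 0"
  proof (cases "j < m")
    case True
    then show ?thesis using eval[OF deg[OF assms(1), of j]] assms(4) by simp
  next
    case False
    then show ?thesis using eval[OF deg[OF assms(2), of "j - m"]] assms(5) j by simp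
  qed
qed

text \<open>A certificate of coprimality that multiplication verifies when the multipliers are
  explicit.\<close>

definition bezout :: "complex poly \<Rightarrow> complex poly \<Rightarrow> bool" where
  "bezout Q R \<longleftrightarrow> (\<exists>U V. U * Q + V * R = 1)"

lemma bezoutI:
  assumes "U * Q + V * R = [:c:]" "c \<noteq> 0"
  shows "bezout Q R"
proof -
  have "Polynomial.smult (1 / c) (U * Q + V * R) = 1" using assms by (simp add: one_pCons)
  then have "Polynomial.smult (1 / c) U * Q + Polynomial.smult (1 / c) V * R = 1" by (simp add: smult_add_right)
  then show ?thesis unfolding bezout_def by blast
qed

lemma bezout_mult:
  assumes "bezout Q R" "bezout Q R'"
  shows "bezout Q (R * R')"
proof -
  obtain U V U' V' where "U * Q + V * R = 1" "U' * Q + V' * R' = 1" using assms unfolding bezout_def by blast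
  then have "(U * Q + V * R) * (U' * Q + V' * R') = 1" by simp
  moreover have "(U * Q + V * R) * (U' * Q + V' * R') =
      (U * U' * Q + U * V' * R' + V * R * U') * Q + (V * V') * (R * R')" by (simp add: algebra_simps)
  ultimately have "(U * U' * Q + U * V' * R' + V * R * U') * Q + (V * V') * (R * R') = 1" by simp
  then show ?thesis unfolding bezout_def by blast
qed

text \<open>A kernel vector of the matrix is a relation \<open>a * Q + b * R = 0\<close> with
  \<open>degree b < n\<close>. Coprimality makes \<open>Q\<close>, of exact degree \<open>n\<close>,
  divide \<open>b\<close>, so \<open>b\<close> and then \<open>a\<close> are 0.\<close>

lemma sylv_nonzero:
  assumes "degree Q = n" "Q \<noteq> 0" "0 < n" "bezout Q R" "degree R \<le> m"
  shows "sylv n m Q R \<noteq> 0"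
proof
  assume 0: "sylv n m Q R = 0"
  define M where "M = Matrix.mat (n + m) (n + m)
    (\<lambda>(i, j). if j < m then coeff (monom 1 j * Q) i else coeff (monom 1 (j - m) * R) i)"
  obtain v where v: "v \<in> carrier_vec (n + m)" "v \<noteq> 0\<^sub>v (n + m)" "M *\<^sub>v v = 0\<^sub>v (n + m)"
    using 0 det_0_iff_vec_prod_zero_field[of M "n + m"] by (auto simp: sylv_def M_def)
  define a where "a = (\<Sum>j<m. monom (vec_index v j) j)"
  define b where "b = (\<Sum>j<n. monom (vec_index v (m + j)) j)"
  have co: "coeff (\<Sum>j<k. monom (f j) j) i = (if i < k then f i else 0)" for k i and f :: "nat \<Rightarrow> complex"
    by (simp add: coeff_sum)
  have "coeff (a * Q + b * R) i = 0" for i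
  proof (cases "i < n + m")
    case True
    have "0 = vec_index (M *\<^sub>v v) i" using v(3) True by simp
    also have "\<dots> = (\<Sum>j<n + m. M $$ (i, j) * vec_index v j)"
      using True v(1) by (simp add: M_def scalar_prod_def atLeast0LessThan)
    also have "\<dots> = (\<Sum>j<m. M $$ (i, j) * vec_index v j) + (\<Sum>j<n. M $$ (i, m + j) * vec_index v (m + j))"
    proof -
      have "(\<Sum>j<m + k. f j) = (\<Sum>j<m. f j) + (\<Sum>j<k. f (m + j))" for k and f :: "nat \<Rightarrow> complex"
        by (induction k) (auto simp: add.assoc)
      then show ?thesis by (simp only: add.commute[of n m])
    qed
    also have "\<dots> = coeff (a * Q + b * R) i"
    proof -
      have 1: "a * Q = (\<Sum>j<m. Polynomial.smult (vec_index v j) (monom 1 j * Q))"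
        unfolding a_def sum_distrib_right by (intro sum.cong refl) (simp add: smult_monom flip: mult_smult_left)
      have 2: "b * R = (\<Sum>j<n. Polynomial.smult (vec_index v (m + j)) (monom 1 j * R))"
        unfolding b_def sum_distrib_right by (intro sum.cong refl) (simp add: smult_monom flip: mult_smult_left)
      show ?thesis unfolding coeff_add 1 2 coeff_sum using True
        by (intro arg_cong2[where f = "(+)"] sum.cong) (auto simp: M_def)
    qed
    finally show ?thesis by simp
  next
    case False
    have "coeff (a * Q) i = 0" "coeff (b * R) i = 0"
      using False assms(1,5) by (auto simp: coeff_mult a_def b_def co intro!: sum.neutral coeff_eq_0)
    then show ?thesis by simp
  qed
  then have ab: "a * Q + b * R = 0" by (simp add: poly_eq_iff)
  obtain U V where UV: "U * Q + V * R = 1" using assms(4) unfolding bezout_def by blast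
  have "b = b * (U * Q + V * R)" unfolding UV by simp
  also have "\<dots> = b * U * Q + V * (b * R)" by (simp add: algebra_simps)
  also have "b * R = - (a * Q)" using ab by (simp add: eq_neg_iff_add_eq_0 add.commute)
  finally have "b = (b * U - V * a) * Q" by (simp add: algebra_simps)
  then have "Q dvd b" by (metis dvd_triv_right)
  moreover have "degree b \<le> n - 1" unfolding b_def by (rule degree_le) (auto simp: co)
  then have "degree b < n" using assms(3) by linarith
  ultimately have b: "b = 0" using assms(1) dvd_imp_degree_le[of Q b] by auto
  then have a: "a = 0" using ab assms(2) by simp
  have "vec_index v j = 0" if "j < n + m" for j
  proof (cases "j < m")
    case True
    then show ?thesis using co[of "\<lambda>j. vec_index v j" m j] a by (simp add: a_def)
  next
    case False
    then have "j - m < n" "m + (j - m) = j" using that by auto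
    then show ?thesis using co[of "\<lambda>j. vec_index v (m + j)" n "j - m"] b by (simp add: b_def)
  qed
  then have "v = 0\<^sub>v (n + m)" using v(1) by (intro eq_vecI) auto
  then show False using v(2) by blast
qed

section \<open>The generic condition\<close>

text \<open>The product collects everything that must be nonzero at the roots of \<open>Q\<close>,
  so one resultant expresses simple roots and \<open>good_roots\<close> together. Its degree bound
  is 27 = 7 + 1 + 4 + 5 + 10.\<close>

definition "Rp u = pderiv (Qp u) * [:0, 1:] * Yp u * Mp u * Wp u"

definition "gen_poly u = A1 u * B1 u * A2 u * B2 u * A3 u * B3 u *
   (g0 u * A1 u - B3 u * B2 u) * (B1 u * h0 u - A2 u * A3 u) * (g0 u * A2 u - B1 u * B3 u) * (B2 u * h0 u - A1 u * A3 u) *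
   (g0 u * A3 u - B1 u * B2 u) * (B3 u * h0 u - A1 u * A2 u) * hdet (($) u) * qc8 u * sylv 8 27 (Qp u) (Rp u)"

lemma degree_polys: "degree (Qp u) \<le> 8" "degree (Rp u) \<le> 27"
proof -
  show Q: "degree (Qp u) \<le> 8" by (intro degree_le) (auto simp: Qp_def coeff_pCons split: nat.splits)
  have mono: "degree (p * q) \<le> a + b" if "degree p \<le> a" "degree q \<le> b" for p q :: "complex poly" and a b
    using degree_mult_le[of p q] that by linarith
  have XY: "degree (Xp u) \<le> 4" "degree (Yp u) \<le> 4"
    by (intro degree_le; auto simp: Xp_def Yp_def coeff_pCons split: nat.splits)+
  have lin: "degree [:a, b:] \<le> 1" for a b :: complex by simp
  have MN: "degree (Mp u) \<le> 1 + 4" "degree (Np u) \<le> 1 + 4"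
    unfolding Mp_def Np_def by (intro degree_diff_le mono lin XY)+
  have "degree ([:0, 1:] * Yp u * Mp u) \<le> 10" "degree (Xp u * Np u) \<le> 10"
    by (rule order_trans[OF mono[OF mono[OF lin XY(2)] MN(1)]], simp,
        rule order_trans[OF mono[OF XY(1) MN(2)]], simp)
  then have W: "degree (Wp u) \<le> 10" unfolding Wp_def by (rule degree_add_le)
  have "degree (pderiv (Qp u)) \<le> 7" using Q by (simp add: degree_pderiv)
  then show "degree (Rp u) \<le> 27" unfolding Rp_def
    by (intro order_trans[OF mono[OF mono[OF mono[OF mono[OF _ lin] XY(2)] MN(1)] W]]) simp_all
qed

lemma card_Sol_diag_generic:
  assumes "gen_poly u \<noteq> 0"
  shows "finite (Sol u diag_tensor)" "card (Sol u diag_tensor) = 8"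
proof -
  have "sylv 8 27 (Qp u) (Rp u) \<noteq> 0" using assms by (auto simp: gen_poly_def)
  then have nc: "poly (Rp u) s \<noteq> 0" if "poly (Qp u) s = 0" for s
    using sylv_eq_0_if_common_root[OF degree_polys _ that] by fastforce
  then have "good_roots u" by (fastforce simp: good_roots_def Rp_def)
  moreover have "poly (pderiv (Qp u)) s \<noteq> 0" if "poly (Qp u) s = 0" for s
    using nc[OF that] by (auto simp: Rp_def)
  moreover have "good_slices u" "hdet (($) u) \<noteq> 0" "qc8 u \<noteq> 0"
    using assms by (auto simp: good_slices_def gen_poly_def)
  ultimately show "finite (Sol u diag_tensor)" "card (Sol u diag_tensor) = 8"
    using card_Sol_diag by blast+
qed

lemma gen_poly_nonzeroI:
  assumes "good_slices u" "hdet (($) u) \<noteq> 0" "qc8 u \<noteq> 0"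
    and "bezout (Qp u) [:0, 1:]" "bezout (Qp u) (pderiv (Qp u))" "bezout (Qp u) (Yp u)"
      "bezout (Qp u) (Mp u)" "bezout (Qp u) (Wp u)"
  shows "gen_poly u \<noteq> 0"
proof -
  have "degree (Qp u) = 8" using assms(3) by (simp add: Qp_def)
  moreover from this have "Qp u \<noteq> 0" by auto
  moreover have "bezout (Qp u) (Rp u)" unfolding Rp_def by (intro bezout_mult assms)
  ultimately have "sylv 8 27 (Qp u) (Rp u) \<noteq> 0"
    by (intro sylv_nonzero degree_polys) simp_all
  then show ?thesis using assms(1-3) by (simp add: gen_poly_def good_slices_def)
qed

lemma fn_gen_poly:
  assumes F: "fn_ring F" and u: "\<And>p. (\<lambda>x. u x $ p) \<in> F"
  shows "(\<lambda>x. gen_poly (u x)) \<in> F"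
proof -
  note fn = fn_intros[OF F] and cf = fn_coeffs_intros[OF F]
  have X: "(\<lambda>x. xc0 (u x)) \<in> F" "(\<lambda>x. xc1 (u x)) \<in> F" "(\<lambda>x. xc2 (u x)) \<in> F" "(\<lambda>x. xc3 (u x)) \<in> F" "(\<lambda>x. xc4 (u x)) \<in> F"
    and Y: "(\<lambda>x. yc0 (u x)) \<in> F" "(\<lambda>x. yc1 (u x)) \<in> F" "(\<lambda>x. yc2 (u x)) \<in> F" "(\<lambda>x. yc3 (u x)) \<in> F" "(\<lambda>x. yc4 (u x)) \<in> F"
    unfolding xy_defs by (intro fn u)+
  have Q: "(\<lambda>x. qc0 (u x)) \<in> F" "(\<lambda>x. qc1 (u x)) \<in> F" "(\<lambda>x. qc2 (u x)) \<in> F" "(\<lambda>x. qc3 (u x)) \<in> F" "(\<lambda>x. qc4 (u x)) \<in> F"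
    "(\<lambda>x. qc5 (u x)) \<in> F" "(\<lambda>x. qc6 (u x)) \<in> F" "(\<lambda>x. qc7 (u x)) \<in> F" "(\<lambda>x. qc8 (u x)) \<in> F"
    unfolding qc_defs by (intro fn u X Y)+
  have P: "fn_coeffs F (\<lambda>x. Xp (u x))" "fn_coeffs F (\<lambda>x. Yp (u x))" "fn_coeffs F (\<lambda>x. Qp (u x))"
    unfolding Xp_def Yp_def Qp_def by (intro cf X Y Q)+
  have MN: "fn_coeffs F (\<lambda>x. Mp (u x))" "fn_coeffs F (\<lambda>x. Np (u x))"
    unfolding Mp_def Np_def by (intro cf P fn u)+
  have W: "fn_coeffs F (\<lambda>x. Wp (u x))" unfolding Wp_def by (intro cf P MN fn)
  have R: "fn_coeffs F (\<lambda>x. Rp (u x))" unfolding Rp_def by (intro cf P MN W fn)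
  have const: "fn_coeffs F (\<lambda>_. p)" for p by (simp add: fn_coeffs_def[OF F] fn_const[OF F])
  have "(\<lambda>x. sylv 8 27 (Qp (u x)) (Rp (u x))) \<in> F"
    unfolding sylv_def
  proof (rule fn_detf[OF F])
    fix i j
    have "fn_coeffs F (\<lambda>x. monom 1 j * Qp (u x))" "fn_coeffs F (\<lambda>x. monom 1 (j - 27) * Rp (u x))"
      by (intro cf const P R)+
    then show "(\<lambda>x. if j < 27 then coeff (monom 1 j * Qp (u x)) i else coeff (monom 1 (j - 27) * Rp (u x)) i) \<in> F"
      by (cases "j < 27") (simp_all add: fn_coeffs_def[OF F])
  qed
  moreover have "(\<lambda>x. hdet (($) (u x))) \<in> F"
    unfolding hdet_def q11_def q12_def q22_def by (intro fn u)
  ultimately show ?thesis unfolding gen_poly_def by (intro fn u Q)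
qed


section \<open>Two integral tensors that satisfy the generic condition\<close>

definition ubp :: "complex ^ idx" where
  "ubp = (\<chi> p. if p = (1,2,2) then 2 else if p = (2,1,1) then 2 else if p = (2,1,2) then 1
    else if p = (1,2,1) then 1 else if p = (2,2,1) then 1 else if p = (1,1,2) then -1 else 0)"

lemma ubp_nth [simp]: "ubp $ (1,2,2) = 2" "ubp $ (2,1,1) = 2" "ubp $ (2,1,2) = 1" "ubp $ (1,2,1) = 1"
  "ubp $ (2,2,1) = 1" "ubp $ (1,1,2) = -1" "ubp $ (1,1,1) = 0" "ubp $ (2,2,2) = 0"
  by (simp_all add: ubp_def)

lemma ubp_polys:
  "Qp ubp = [:16, 80, 20, -176, 8, 176, 20, -80, 16:]"
  "Xp ubp = [:4, 6, 0, 6, -4:]"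
  "Yp ubp = [:0, -4, 8, 12, -8:]"
  "Mp ubp = [:0, -4, -24, -4, 8:]"
  "Np ubp = [:4, 18, -10, -18, 18, -4:]"
  "Wp ubp = [:16, 96, 68, -92, 120, -264, -412, 388, 32, -48:]"
proof -
  show X: "Xp ubp = [:4, 6, 0, 6, -4:]" and Y: "Yp ubp = [:0, -4, 8, 12, -8:]"
    by (simp_all add: Xp_def Yp_def xy_defs)
  show "Qp ubp = [:16, 80, 20, -176, 8, 176, 20, -80, 16:]"
    by (simp add: Qp_def qc_defs xy_defs)
  show M: "Mp ubp = [:0, -4, -24, -4, 8:]" and N: "Np ubp = [:4, 18, -10, -18, 18, -4:]"
    by (simp_all add: Mp_def Np_def X Y)
  show "Wp ubp = [:16, 96, 68, -92, 120, -264, -412, 388, 32, -48:]"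
    by (simp add: Wp_def X Y M N)
qed

text \<open>The multipliers are those of the extended Euclidean algorithm, with denominators cleared
  into the constant \<open>c\<close>.\<close>

lemma ubp_good: "gen_poly ubp \<noteq> 0"
proof (rule gen_poly_nonzeroI)
  show "good_slices ubp" by (simp add: good_slices_def)
  show "hdet (($) ubp) \<noteq> 0" by (simp add: hdet_def q11_def q12_def q22_def)
  show "qc8 ubp \<noteq> 0" by (simp add: qc_defs xy_defs)
  show "bezout (Qp ubp) ([:0, 1:])"
    by (rule bezoutI[where U = "[:1:]"
        and V = "[:-80, -20, 176, -8, -176, -20, 80, -16:]" and c = "16"])
      (simp_all add: ubp_polys pderiv_pCons)
  show "bezout (Qp ubp) (pderiv (Qp ubp))"
    by (rule bezoutI[where U = "[:-11090476, 25803290, 13861464, -42974450, -21263484, 35904832, -7527168:]"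
        and V = "[:2853308, 4503164, -9222713, -2925528, 9043271, 3184268, -5076164, 940896:]" and c = "50817024"])
      (simp_all add: ubp_polys pderiv_pCons)
  show "bezout (Qp ubp) (Yp ubp)"
    by (rule bezoutI[where U = "[:8, -11, -10, 8:]"
        and V = "[:116, 12, -203, 8, 193, 0, -76, 16:]" and c = "128"])
      (simp_all add: ubp_polys pderiv_pCons)
  show "bezout (Qp ubp) (Mp ubp)"
    by (rule bezoutI[where U = "[:144, -2996, -757, 1050:]"
        and V = "[:-9104, -7604, 22472, 3891, -22124, -5021, 10964, -2100:]" and c = "2304"])
      (simp_all add: ubp_polys pderiv_pCons)
  show "bezout (Qp ubp) (Wp ubp)"
    by (rule bezoutI[where U = "[:448112, 830020, -996988, 1050577, -705167, -3967155, 2800673, 353544, -360828:]"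
        and V = "[:-425072, -520148, 1214192, 307383, -1202744, -352229, 639044, -120276:]" and c = "368640"])
      (simp_all add: ubp_polys pderiv_pCons)
qed

text \<open>\<open>ubp\<close> and \<open>ubm\<close> are the normal forms of one tensor for the two
  signs of the square root. Up to sign, the polynomials of \<open>ubm\<close> are those of
  \<open>ubp\<close> at \<open>-s\<close>, and so are the certificates.\<close>

definition ubm :: "complex ^ idx" where
  "ubm = (\<chi> p. if p = (1,2,2) then -2 else if p = (2,1,1) then -2 else if p = (2,1,2) then -1
    else if p = (1,2,1) then -1 else if p = (2,2,1) then 1 else if p = (1,1,2) then -1 else 0)"

lemma ubm_nth [simp]: "ubm $ (1,2,2) = -2" "ubm $ (2,1,1) = -2" "ubm $ (2,1,2) = -1" "ubm $ (1,2,1) = -1"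
  "ubm $ (2,2,1) = 1" "ubm $ (1,1,2) = -1" "ubm $ (1,1,1) = 0" "ubm $ (2,2,2) = 0"
  by (simp_all add: ubm_def)

lemma ubm_polys:
  "Qp ubm = [:-16, 80, -20, -176, -8, 176, -20, -80, -16:]"
  "Xp ubm = [:4, -6, 0, -6, -4:]"
  "Yp ubm = [:0, 4, 8, -12, -8:]"
  "Mp ubm = [:0, 4, -24, 4, 8:]"
  "Np ubm = [:-4, 18, 10, -18, -18, -4:]"
  "Wp ubm = [:-16, 96, -68, -92, -120, -264, 412, 388, -32, -48:]"
proof -
  show X: "Xp ubm = [:4, -6, 0, -6, -4:]" and Y: "Yp ubm = [:0, 4, 8, -12, -8:]"
    by (simp_all add: Xp_def Yp_def xy_defs)
  show "Qp ubm = [:-16, 80, -20, -176, -8, 176, -20, -80, -16:]"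
    by (simp add: Qp_def qc_defs xy_defs)
  show M: "Mp ubm = [:0, 4, -24, 4, 8:]" and N: "Np ubm = [:-4, 18, 10, -18, -18, -4:]"
    by (simp_all add: Mp_def Np_def X Y)
  show "Wp ubm = [:-16, 96, -68, -92, -120, -264, 412, 388, -32, -48:]"
    by (simp add: Wp_def X Y M N)
qed

lemma ubm_good: "gen_poly ubm \<noteq> 0"
proof (rule gen_poly_nonzeroI)
  show "good_slices ubm" by (simp add: good_slices_def)
  show "hdet (($) ubm) \<noteq> 0" by (simp add: hdet_def q11_def q12_def q22_def)
  show "qc8 ubm \<noteq> 0" by (simp add: qc_defs xy_defs)
  show "bezout (Qp ubm) ([:0, 1:])"
    by (rule bezoutI[where U = "[:-1:]"
        and V = "[:80, -20, -176, -8, 176, -20, -80, -16:]" and c = "16"])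
      (simp_all add: ubm_polys pderiv_pCons)
  show "bezout (Qp ubm) (pderiv (Qp ubm))"
    by (rule bezoutI[where U = "[:11090476, 25803290, -13861464, -42974450, 21263484, 35904832, 7527168:]"
        and V = "[:2853308, -4503164, -9222713, 2925528, 9043271, -3184268, -5076164, -940896:]" and c = "50817024"])
      (simp_all add: ubm_polys pderiv_pCons)
  show "bezout (Qp ubm) (Yp ubm)"
    by (rule bezoutI[where U = "[:-8, -11, 10, 8:]"
        and V = "[:116, -12, -203, -8, 193, 0, -76, -16:]" and c = "128"])
      (simp_all add: ubm_polys pderiv_pCons)
  show "bezout (Qp ubm) (Mp ubm)"
    by (rule bezoutI[where U = "[:-144, -2996, 757, 1050:]"
        and V = "[:-9104, 7604, 22472, -3891, -22124, 5021, 10964, 2100:]" and c = "2304"])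
      (simp_all add: ubm_polys pderiv_pCons)
  show "bezout (Qp ubm) (Wp ubm)"
    by (rule bezoutI[where U = "[:-448112, 830020, 996988, 1050577, 705167, -3967155, -2800673, 353544, 360828:]"
        and V = "[:425072, -520148, -1214192, 307383, 1202744, -352229, -639044, -120276:]" and c = "368640"])
      (simp_all add: ubm_polys pderiv_pCons)
qed


section \<open>Change of coordinates\<close>

text \<open>The rows of \<open>P\<close> are vectors: \<open>app P\<close> multiplies by
  \<open>P\<close>, \<open>comb P\<close> by its transpose.\<close>

definition comb :: "complex ^ 2 ^ 2 \<Rightarrow> complex ^ 2 \<Rightarrow> complex ^ 2" where
  "comb P a = a $ 1 *s P $ 1 + a $ 2 *s P $ 2"
definition app :: "complex ^ 2 ^ 2 \<Rightarrow> complex ^ 2 \<Rightarrow> complex ^ 2" where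
  "app P a = vec2 (dot2 (P $ 1) a) (dot2 (P $ 2) a)"
definition act :: "complex ^ 2 ^ 2 \<Rightarrow> complex ^ 2 ^ 2 \<Rightarrow> complex ^ 2 ^ 2 \<Rightarrow> complex ^ idx \<Rightarrow> complex ^ idx" where
  "act P Q R y = (\<chi> p. case p of (i, j, k) \<Rightarrow> tri (($) y) (P $ i) (Q $ j) (R $ k))"
definition trn :: "complex ^ 2 ^ 2 \<Rightarrow> complex ^ 2 ^ 2" where
  "trn P = (\<chi> i j. P $ j $ i)"

text \<open>\<open>P'\<close> is the inverse transpose of \<open>P\<close>.\<close>

definition dual :: "complex ^ 2 ^ 2 \<Rightarrow> complex ^ 2 ^ 2 \<Rightarrow> bool" where
  "dual P P' \<longleftrightarrow> (\<forall>a. comb P' (app P a) = a) \<and> (\<forall>a. app P (comb P' a) = a)"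

lemma app_nth: "app P a $ i = dot2 (P $ i) a"
  using exhaust_2[of i] by (auto simp: app_def)

lemma dot2_comb: "dot2 a (comb P b) = dot2 (app P a) b" "dot2 (comb P b) a = dot2 b (app P a)"
  by (simp_all add: comb_def app_def dot2_def algebra_simps)

lemma dot2_eqI:
  assumes "\<And>a. dot2 a x = dot2 a y"
  shows "x = y"
  using assms[of e1] assms[of e2] by (simp add: vec2_eq_iff dot2_def)

lemma comb_trn: "comb (trn P) = app P" "app (trn P) = comb P"
  by (auto simp: fun_eq_iff vec2_eq_iff comb_def app_def trn_def dot2_def algebra_simps)

lemma dual_simps:
  assumes "dual P P'"
  shows "comb P' (app P a) = a" "app P (comb P' a) = a" "comb P (app P' a) = a" "app P' (comb P a) = a"
    "dot2 (app P a) (app P' b) = dot2 a b" "dot2 (app P' a) (app P b) = dot2 a b"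
proof -
  show 1: "comb P' (app P a) = a" "app P (comb P' a) = a" for a using assms by (auto simp: dual_def)
  show 2: "comb P (app P' a) = a" for a
    by (rule dot2_eqI) (metis dot2_comb 1)
  show 3: "app P' (comb P a) = a" for a
    by (rule dot2_eqI) (metis dot2_comb 1)
  show "dot2 (app P a) (app P' b) = dot2 a b" by (metis dot2_comb(1) 2)
  show "dot2 (app P' a) (app P b) = dot2 a b" by (metis dot2_comb(1) 1(1))
qed

lemma dual_sym: "dual P P' \<Longrightarrow> dual P' P"
  unfolding dual_def[of P' P] using dual_simps(3,4) by blast

lemma dual_trn: "dual P P' \<Longrightarrow> dual (trn P') (trn P)"
  unfolding dual_def[of "trn P'"] comb_trn using dual_simps(1,2) by blast

lemma exists_dual:
  assumes "P $ 1 $ 1 * P $ 2 $ 2 \<noteq> P $ 1 $ 2 * P $ 2 $ 1"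
  shows "\<exists>P'. dual P P'"
proof
  define d where "d = P $ 1 $ 1 * P $ 2 $ 2 - P $ 1 $ 2 * P $ 2 $ 1"
  let ?P' = "(\<chi> i. if i = 1 then vec2 (P $ 2 $ 2 / d) (- P $ 2 $ 1 / d) else vec2 (- P $ 1 $ 2 / d) (P $ 1 $ 1 / d)) :: complex ^ 2 ^ 2"
  have d: "d \<noteq> 0" using assms by (simp add: d_def)
  have 1: "comb ?P' (app P a) = a" for a
    using d by (simp add: vec2_eq_iff comb_def app_def dot2_def field_simps) (simp add: d_def algebra_simps)
  have 2: "app P (comb ?P' a) = a" for a
    using d by (simp add: vec2_eq_iff comb_def app_def dot2_def field_simps) (simp add: d_def algebra_simps)
  show "dual P ?P'" unfolding dual_def using 1 2 by blast
qed

lemma tri_lincomb: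
  "tri y (r *s x + q *s x') b c = r * tri y x b c + q * tri y x' b c"
  "tri y a (r *s x + q *s x') c = r * tri y a x c + q * tri y a x' c"
  "tri y a b (r *s x + q *s x') = r * tri y a b x + q * tri y a b x'"
  by (simp_all add: tri_def sum_idx algebra_simps)

lemma act_nth: "act P Q R y $ (i, j, k) = tri (($) y) (P $ i) (Q $ j) (R $ k)"
  by (simp add: act_def)

lemma tri_act: "tri (($) (act P Q R y)) a b c = tri (($) y) (comb P a) (comb Q b) (comb R c)"
  unfolding comb_def tri_lincomb tri_def[of "($) (act P Q R y)"] sum_idx
  by (simp add: act_nth algebra_simps)

lemma tri_axis: "tri y (axis i 1) (axis j 1) (axis k 1) = y (i, j, k)"
  using exhaust_2[of i] exhaust_2[of j] exhaust_2[of k]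
  by (elim disjE) (simp_all add: tri_def sum_idx axis_def)

lemma tri_eqI:
  assumes "\<And>a b c. tri (($) y) a b c = tri (($) y') a b c"
  shows "y = y'"
proof (subst Finite_Cartesian_Product.vec_eq_iff, intro allI)
  fix p :: idx obtain i j k where p: "p = (i, j, k)" by (cases p)
  show "y $ p = y' $ p"
    using assms[of "axis i 1" "axis j 1" "axis k 1"] by (simp only: tri_axis p)
qed

lemma act_tensor3: "act P Q R (tensor3 a b c) = tensor3 (app P a) (app Q b) (app R c)"
  by (auto simp: Finite_Cartesian_Product.vec_eq_iff act_def tri_tensor3 app_nth) (simp_all add: dot2_def mult.commute)

lemma act_inverse:
  assumes "dual P P'" "dual Q Q'" "dual R R'"
  shows "act (trn P') (trn Q') (trn R') (act P Q R y) = y"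
  by (rule tri_eqI) (simp add: tri_act comb_trn dual_simps[OF assms(1)] dual_simps[OF assms(2)] dual_simps[OF assms(3)])

lemma app_eq_0:
  assumes "dual P P'"
  shows "app P a = 0 \<longleftrightarrow> a = 0"
proof
  assume "app P a = 0"
  then have "comb P' 0 = a" using dual_simps(1)[OF assms, of a] by simp
  then show "a = 0" by (simp add: comb_def)
qed (simp add: app_def dot2_def)

text \<open>The equations pair \<open>u - z\<close> with \<open>w\<close> and \<open>v - w\<close>
  with \<open>z\<close> bilinearly, so \<open>u\<close> and \<open>z\<close> move by the given
  matrices, \<open>v\<close> and \<open>w\<close> by their inverse transposes.\<close>

lemma Sol_act:
  assumes P: "dual P P'" and Q: "dual Q Q'" and R: "dual R R'" and sol: "(z, w) \<in> Sol u v"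
  shows "(act P Q R z, act P' Q' R' w) \<in> Sol (act P Q R u) (act P' Q' R' v)"
proof -
  obtain a b c where z: "z = tensor3 a b c" using sol Segre222E unfolding Sol_def by blast
  obtain \<alpha> \<beta> \<gamma> where w: "w = tensor3 \<alpha> \<beta> \<gamma>" using sol Segre222E unfolding Sol_def by blast
  note S = sol[unfolded z w Sol_tensor3_iff]
  note d = dual_simps[OF P] dual_simps[OF Q] dual_simps[OF R]
  note d0 = app_eq_0[OF P] app_eq_0[OF Q] app_eq_0[OF R]
    app_eq_0[OF dual_sym[OF P]] app_eq_0[OF dual_sym[OF Q]] app_eq_0[OF dual_sym[OF R]]
  have c: "dot2 (app M x) y = dot2 x (comb M y)" for M x y by (simp add: dot2_comb)
  show ?thesis
    unfolding z w act_tensor3 Sol_tensor3_iff tri_act d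
    using S by (simp add: tensor3_eq_0_iff d0 c d)
qed

lemma bij_betw_act:
  assumes P: "dual P P'" and Q: "dual Q Q'" and R: "dual R R'"
  shows "bij_betw (\<lambda>(z, w). (act P Q R z, act P' Q' R' w)) (Sol u v) (Sol (act P Q R u) (act P' Q' R' v))"
proof (rule bij_betw_byWitness[where f' = "\<lambda>(z, w). (act (trn P') (trn Q') (trn R') z, act (trn P) (trn Q) (trn R) w)"])
  note inv1 = act_inverse[OF P Q R] and inv2 = act_inverse[OF dual_sym[OF P] dual_sym[OF Q] dual_sym[OF R]]
  note dt = dual_trn[OF P] dual_trn[OF Q] dual_trn[OF R]
  have tt: "trn (trn M) = M" for M by (simp add: trn_def Finite_Cartesian_Product.vec_eq_iff)
  note inv3 = act_inverse[OF dt, unfolded tt] and inv4 = act_inverse[OF dt[THEN dual_sym], unfolded tt]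
  show "\<forall>x\<in>Sol u v. (\<lambda>(z, w). (act (trn P') (trn Q') (trn R') z, act (trn P) (trn Q) (trn R) w))
      ((\<lambda>(z, w). (act P Q R z, act P' Q' R' w)) x) = x"
    by (auto simp: inv1 inv2)
  show "\<forall>x\<in>Sol (act P Q R u) (act P' Q' R' v). (\<lambda>(z, w). (act P Q R z, act P' Q' R' w))
      ((\<lambda>(z, w). (act (trn P') (trn Q') (trn R') z, act (trn P) (trn Q) (trn R) w)) x) = x"
    by (auto simp: inv3 inv4)
  show "(\<lambda>(z, w). (act P Q R z, act P' Q' R' w)) ` Sol u v \<subseteq> Sol (act P Q R u) (act P' Q' R' v)"
    using Sol_act[OF P Q R] by auto
  show "(\<lambda>(z, w). (act (trn P') (trn Q') (trn R') z, act (trn P) (trn Q) (trn R) w)) `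
      Sol (act P Q R u) (act P' Q' R' v) \<subseteq> Sol u v"
    using Sol_act[OF dt, of _ _ "act P Q R u" "act P' Q' R' v"] by (auto simp: inv1 inv2)
qed

lemma contr_scale: "contr s l m (\<lambda>p. k * y p) z = k * contr s l m y z" "contr s l m y (\<lambda>p. k * z p) = k * contr s l m y z"
  by (auto simp: contr_def tf_def sum_distrib_left mult_ac intro!: sum.cong)

lemma ortho_scale:
  fixes k :: complex
  assumes "k \<noteq> 0"
  shows "ortho (($) (k *s y)) (($) z) \<longleftrightarrow> ortho (($) y) (($) z)" "ortho (($) y) (($) (k *s z)) \<longleftrightarrow> ortho (($) y) (($) z)"
proof -
  have "($) (k *s x) = (\<lambda>p. k * x $ p)" for x :: "complex ^ idx" by (intro ext) simp
  then show "ortho (($) (k *s y)) (($) z) \<longleftrightarrow> ortho (($) y) (($) z)" "ortho (($) y) (($) (k *s z)) \<longleftrightarrow> ortho (($) y) (($) z)"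
    using assms by (simp_all add: ortho_def contr_scale)
qed

lemma scale_in_Segre222: "z \<in> Segre222 \<Longrightarrow> k *s z \<in> Segre222"
  by (metis Segre222E tensor3_in_Segre222 tensor3_scale(1))

lemma Sol_scale:
  assumes "k \<noteq> 0" "(z, w) \<in> Sol u v"
  shows "(z, k *s w) \<in> Sol u (k *s v)"
proof -
  have "k *s v - k *s w = k *s (v - w)" by (simp add: vector_ssub_ldistrib)
  then have "ortho (($) (k *s v - k *s w)) (($) z)"
    using assms(2) ortho_scale(1)[OF assms(1), of "v - w" z] by (simp only: Sol_def mem_Collect_eq prod.case)
  then show ?thesis using assms by (simp add: Sol_def scale_in_Segre222 ortho_scale)
qed

lemma bij_betw_Sol_scale:
  assumes "k \<noteq> 0"
  shows "bij_betw (\<lambda>(z, w). (z, k *s w)) (Sol u v) (Sol u (k *s v))"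
proof (rule bij_betw_byWitness[where f' = "\<lambda>(z, w). (z, inverse k *s w)"])
  have k: "inverse k \<noteq> 0" using assms by simp
  show "(\<lambda>(z, w). (z, inverse k *s w)) ` Sol u (k *s v) \<subseteq> Sol u v"
    using Sol_scale[OF k, of _ _ u "k *s v"] assms by (auto simp: vector_smult_assoc)
qed (use assms Sol_scale[OF assms] in \<open>auto simp: vector_smult_assoc\<close>)

section \<open>Reduction to the diagonal tensor\<close>

text \<open>In the dual frames the two summands become \<open>e1 e1 e1\<close> and
  \<open>e2 e2 e2\<close>; the scalar in front of \<open>v\<close> only rescales
  \<open>w\<close>.\<close>

lemma card_Sol_if_decomposed:
  assumes P: "dual P P'" and Q: "dual Q Q'" and R: "dual R R'" and k: "k \<noteq> 0"
    and v: "k *s v = tensor3 (P $ 1) (Q $ 1) (R $ 1) + tensor3 (P $ 2) (Q $ 2) (R $ 2)"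
    and gen: "gen_poly (act P Q R u) \<noteq> 0"
  shows "finite (Sol u v)" "card (Sol u v) = 8"
proof -
  have "act P' Q' R' (k *s v) = diag_tensor"
  proof (rule tri_eqI)
    fix a b c
    have add: "tri (($) (x + y)) a b c = tri (($) x) a b c + tri (($) y) a b c" for x y a b c
      by (simp add: tri_def algebra_simps sum.distrib)
    have e: "dot2 (M $ i) (comb M' x) = x $ i" if "dual M M'" for M M' x i
      unfolding app_nth[symmetric] dual_simps(2)[OF that] ..
    show "tri (($) (act P' Q' R' (k *s v))) a b c = tri (($) diag_tensor) a b c"
      unfolding tri_act v add tri_tensor3 e[OF P] e[OF Q] e[OF R] tri_diag ..
  qed
  then have "bij_betw (\<lambda>(z, w). (act P Q R z, act P' Q' R' w)) (Sol u (k *s v)) (Sol (act P Q R u) diag_tensor)"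
    using bij_betw_act[OF P Q R, of u "k *s v"] by simp
  from bij_betw_trans[OF bij_betw_Sol_scale[OF k] this]
  show "finite (Sol u v)" "card (Sol u v) = 8"
    using bij_betw_finite bij_betw_same_card card_Sol_diag_generic[OF gen] by metis+
qed

text \<open>With \<open>d\<^sup>2 = hdet v\<close>, the pencil of slices of \<open>v\<close> contains the rank one matrices \<open>rk1 v d\<close> and
  \<open>rk1 v (- d)\<close>; these give a decomposition of a multiple of \<open>v\<close> into two rank one tensors.\<close>

definition rk1 :: "complex ^ idx \<Rightarrow> complex \<Rightarrow> 2 \<Rightarrow> 2 \<Rightarrow> complex" where
  "rk1 v d i j = (d - q12 (($) v)) * v $ (i, j, 1) + 2 * q11 (($) v) * v $ (i, j, 2)"

definition nfP :: "complex ^ idx \<Rightarrow> complex \<Rightarrow> complex ^ 2 ^ 2" where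
  "nfP v d = (\<chi> i j. if i = 1 then rk1 v d j 1 else rk1 v (- d) j 1)"
definition nfQ :: "complex ^ idx \<Rightarrow> complex \<Rightarrow> complex ^ 2 ^ 2" where
  "nfQ v d = (\<chi> i j. if i = 1 then rk1 v d 1 j else rk1 v (- d) 1 j)"
definition nfR :: "complex ^ idx \<Rightarrow> complex \<Rightarrow> complex ^ 2 ^ 2" where
  "nfR v d = (\<chi> i j. if i = 1 then rk1 v (- d) 1 1 * (if j = 1 then 2 * q11 (($) v) else q12 (($) v) + d)
     else rk1 v d 1 1 * (if j = 1 then - 2 * q11 (($) v) else d - q12 (($) v)))"
definition nfk :: "complex ^ idx \<Rightarrow> complex \<Rightarrow> complex" where
  "nfk v d = 4 * d * q11 (($) v) * rk1 v d 1 1 * rk1 v (- d) 1 1"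

text \<open>The determinant of this member of the pencil is \<open>q11\<close> times
  \<open>d^2 - hdet\<close>.\<close>

lemma rk1_rank:
  assumes "d ^ 2 = hdet (($) v)"
  shows "rk1 v d i j * rk1 v d 1 1 = rk1 v d i 1 * rk1 v d 1 j"
proof -
  have "rk1 v d 2 2 * rk1 v d 1 1 - rk1 v d 2 1 * rk1 v d 1 2 = q11 (($) v) * (d ^ 2 - hdet (($) v))"
    by (simp add: rk1_def hdet_def q11_def q12_def q22_def algebra_simps power2_eq_square)
  then have "rk1 v d 2 2 * rk1 v d 1 1 = rk1 v d 2 1 * rk1 v d 1 2" using assms by simp
  then show ?thesis using exhaust_2[of i] exhaust_2[of j] by (auto simp: mult.commute)
qed

lemma normal_form_decomposition:
  assumes "d ^ 2 = hdet (($) v)"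
  shows "nfk v d *s v = tensor3 (nfP v d $ 1) (nfQ v d $ 1) (nfR v d $ 1) + tensor3 (nfP v d $ 2) (nfQ v d $ 2) (nfR v d $ 2)"
proof (subst Finite_Cartesian_Product.vec_eq_iff, intro allI)
  fix p :: idx obtain i j k where p: "p = (i, j, k)" by (cases p)
  define q q' where "q = q11 (($) v)" and "q' = q12 (($) v)"
  have m: "(- d) ^ 2 = hdet (($) v)" using assms by simp
  have 1: "rk1 v d i 1 * rk1 v d 1 j = rk1 v d i j * rk1 v d 1 1" using rk1_rank[OF assms] by simp
  have 2: "rk1 v (- d) i 1 * rk1 v (- d) 1 j = rk1 v (- d) i j * rk1 v (- d) 1 1" using rk1_rank[OF m] by simp
  \<comment> \<open>Both slices of \<open>v\<close> are recovered from the two rank one members of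
    the pencil.\<close>
  have lin: "4 * d * q * v $ (i, j, k) = rk1 v d i j * (if k = 1 then 2 * q else q' + d)
      + rk1 v (- d) i j * (if k = 1 then - 2 * q else d - q')"
    using exhaust_2[of k] by (elim disjE) (simp_all add: rk1_def q_def q'_def algebra_simps)
  have "(nfk v d *s v) $ p = rk1 v d 1 1 * rk1 v (- d) 1 1 * (4 * d * q * v $ (i, j, k))"
    by (simp add: p nfk_def q_def)
  also have "\<dots> = (rk1 v d i j * rk1 v d 1 1) * (rk1 v (- d) 1 1 * (if k = 1 then 2 * q else q' + d))
     + (rk1 v (- d) i j * rk1 v (- d) 1 1) * (rk1 v d 1 1 * (if k = 1 then - 2 * q else d - q'))"
    unfolding lin by (simp add: algebra_simps)
  also have "\<dots> = (tensor3 (nfP v d $ 1) (nfQ v d $ 1) (nfR v d $ 1) + tensor3 (nfP v d $ 2) (nfQ v d $ 2) (nfR v d $ 2)) $ p"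
    unfolding 1[symmetric] 2[symmetric] by (simp add: p nfP_def nfQ_def nfR_def q_def q'_def)
  finally show "(nfk v d *s v) $ p = \<dots>" .
qed

definition mdet :: "complex ^ 2 ^ 2 \<Rightarrow> complex" where
  "mdet P = P $ 1 $ 1 * P $ 2 $ 2 - P $ 1 $ 2 * P $ 2 $ 1"

definition gen_cond :: "complex ^ idx \<Rightarrow> complex ^ idx \<Rightarrow> complex \<Rightarrow> complex" where
  "gen_cond u v d = nfk v d * mdet (nfP v d) * mdet (nfQ v d) * mdet (nfR v d) *
     gen_poly (act (nfP v d) (nfQ v d) (nfR v d) u) * hdet (($) u) * hdet (($) v)"

lemma card_Sol_if_gen_cond:
  assumes "gen_cond u v d \<noteq> 0" "d ^ 2 = hdet (($) v)"
  shows "finite (Sol u v)" "card (Sol u v) = 8"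
proof -
  have "\<exists>P'. dual (nfP v d) P'" "\<exists>P'. dual (nfQ v d) P'" "\<exists>P'. dual (nfR v d) P'"
    by (intro exists_dual; use assms(1) in \<open>auto simp: gen_cond_def mdet_def\<close>)+
  then obtain P' Q' R' where "dual (nfP v d) P'" "dual (nfQ v d) Q'" "dual (nfR v d) R'" by blast
  moreover have "nfk v d \<noteq> 0" "gen_poly (act (nfP v d) (nfQ v d) (nfR v d) u) \<noteq> 0"
    using assms(1) by (auto simp: gen_cond_def)
  ultimately show "finite (Sol u v)" "card (Sol u v) = 8"
    using card_Sol_if_decomposed normal_form_decomposition[OF assms(2)] by blast+
qed

section \<open>The Zariski open set\<close>

definition PF :: "(('v \<Rightarrow> complex) \<Rightarrow> complex) set" where
  "PF = {h. \<exists>p. \<forall>x. h x = cpoly_eval x p}"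

lemma fn_ring_PF: "fn_ring PF"
  unfolding fn_ring_def PF_def
proof (intro conjI ballI allI)
  show "(\<lambda>_. c) \<in> {h. \<exists>p. \<forall>x. h x = cpoly_eval x p}" for c
    by (auto intro!: exI[of _ "Const c"])
  fix f g :: "('v \<Rightarrow> complex) \<Rightarrow> complex"
  assume "f \<in> {h. \<exists>p. \<forall>x. h x = cpoly_eval x p}" "g \<in> {h. \<exists>p. \<forall>x. h x = cpoly_eval x p}"
  then obtain p q where "\<forall>x. f x = cpoly_eval x p" "\<forall>x. g x = cpoly_eval x q" by auto
  then show "(\<lambda>x. f x + g x) \<in> {h. \<exists>p. \<forall>x. h x = cpoly_eval x p}" "(\<lambda>x. f x * g x) \<in> {h. \<exists>p. \<forall>x. h x = cpoly_eval x p}"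
    by (simp_all, intro exI[of _ "p + q"] allI, simp, intro exI[of _ "p * q"] allI, simp)
qed

lemma PF_var: "(\<lambda>x. x i) \<in> PF"
  unfolding PF_def by (auto intro!: exI[of _ "Var i"])

text \<open>Functions of \<open>x\<close> and a square root \<open>d\<close> of \<open>D x\<close> that are polynomial in \<open>x\<close> and \<open>d\<close>.\<close>

definition PFsqrt :: "(('v \<Rightarrow> complex) \<Rightarrow> complex) \<Rightarrow> (('v \<Rightarrow> complex) \<times> complex \<Rightarrow> complex) set" where
  "PFsqrt D = {h. \<exists>A \<in> PF. \<exists>B \<in> PF. \<forall>x d. d ^ 2 = D x \<longrightarrow> h (x, d) = A x + d * B x}"

lemma PFsqrtI:
  "A \<in> PF \<Longrightarrow> B \<in> PF \<Longrightarrow> (\<And>x d. d ^ 2 = D x \<Longrightarrow> h (x, d) = A x + d * B x) \<Longrightarrow> h \<in> PFsqrt D"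
  unfolding PFsqrt_def by blast

lemma fn_ring_PFsqrt:
  assumes D: "D \<in> PF"
  shows "fn_ring (PFsqrt D)"
  unfolding fn_ring_def
proof (intro conjI ballI allI)
  note fn = fn_intros[OF fn_ring_PF]
  show "(\<lambda>_. c) \<in> PFsqrt D" for c
    by (rule PFsqrtI[of "\<lambda>_. c" "\<lambda>_. 0"]) (simp_all add: fn)
  fix f g assume "f \<in> PFsqrt D" "g \<in> PFsqrt D"
  then obtain A B A' B' where AB: "A \<in> PF" "B \<in> PF" "\<And>x d. d ^ 2 = D x \<Longrightarrow> f (x, d) = A x + d * B x"
    and AB': "A' \<in> PF" "B' \<in> PF" "\<And>x d. d ^ 2 = D x \<Longrightarrow> g (x, d) = A' x + d * B' x"
    unfolding PFsqrt_def by blast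
  have add: "f (x, d) + g (x, d) = (A x + A' x) + d * (B x + B' x)" if "d ^ 2 = D x" for x d
    using AB(3)[OF that] AB'(3)[OF that] by (simp add: algebra_simps)
  have PF_add: "(\<lambda>x. A x + A' x) \<in> PF" "(\<lambda>x. B x + B' x) \<in> PF" by (intro fn AB AB')+
  show "(\<lambda>x. f x + g x) \<in> PFsqrt D" by (rule PFsqrtI[OF PF_add add])
  have mult: "f (x, d) * g (x, d) = (A x * A' x + D x * (B x * B' x)) + d * (A x * B' x + B x * A' x)"
    if "d ^ 2 = D x" for x d
    unfolding AB(3)[OF that] AB'(3)[OF that] that[symmetric] by (simp add: algebra_simps power2_eq_square)
  have PF_mult: "(\<lambda>x. A x * A' x + D x * (B x * B' x)) \<in> PF" "(\<lambda>x. A x * B' x + B x * A' x) \<in> PF"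
    by (intro fn AB AB' D)+
  show "(\<lambda>x. f x * g x) \<in> PFsqrt D" by (rule PFsqrtI[OF PF_mult mult])
qed

lemma PF_in_PFsqrt: "f \<in> PF \<Longrightarrow> (\<lambda>x. f (fst x)) \<in> PFsqrt D"
  by (rule PFsqrtI[of f "\<lambda>_. 0"]) (simp_all add: fn_const[OF fn_ring_PF])

lemma snd_in_PFsqrt: "snd \<in> PFsqrt D"
  by (rule PFsqrtI[of "\<lambda>_. 0" "\<lambda>_. 1"]) (simp_all add: fn_const[OF fn_ring_PF])

text \<open>The norm \<open>A^2 - D * B^2\<close> from the double cover: multiplying the values at
  both square roots removes the root, so a condition on \<open>(u, v, d)\<close> yields a polynomial
  condition on \<open>(u, v)\<close>.\<close>

lemma norm_exists:
  assumes "h \<in> PFsqrt D" "D \<in> PF"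
  obtains G where "G \<in> PF" "\<And>x d. d ^ 2 = D x \<Longrightarrow> G x = h (x, d) * h (x, - d)"
proof -
  obtain A B where AB: "A \<in> PF" "B \<in> PF" "\<And>x d. d ^ 2 = D x \<Longrightarrow> h (x, d) = A x + d * B x"
    using assms(1) unfolding PFsqrt_def by blast
  show thesis
  proof (rule that)
    show "(\<lambda>x. A x ^ 2 - D x * B x ^ 2) \<in> PF" by (intro fn_intros[OF fn_ring_PF] AB assms)
    fix x d assume d: "d ^ 2 = D x"
    then have "(- d) ^ 2 = D x" by simp
    then show "A x ^ 2 - D x * B x ^ 2 = h (x, d) * h (x, - d)"
      unfolding AB(3)[OF d] AB(3)[OF \<open>(- d) ^ 2 = D x\<close>] d[symmetric] by (simp add: algebra_simps power2_eq_square)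
  qed
qed

definition upart :: "('n + 'n \<Rightarrow> complex) \<Rightarrow> complex ^ 'n" where "upart x = (\<chi> p. x (Inl p))"
definition vpart :: "('n + 'n \<Rightarrow> complex) \<Rightarrow> complex ^ 'n" where "vpart x = (\<chi> p. x (Inr p))"

lemma part_simps [simp]: "upart (case_sum (($) u) (($) v)) = u" "vpart (case_sum (($) u) (($) v)) = v"
  by (simp_all add: upart_def vpart_def)

lemma gen_cond_PFsqrt:
  defines "D \<equiv> \<lambda>x :: idx + idx \<Rightarrow> complex. hdet (($) (vpart x))"
  shows "D \<in> PF" "(\<lambda>x. gen_cond (upart (fst x)) (vpart (fst x)) (snd x)) \<in> PFsqrt D"
proof -
  have c: "(\<lambda>x. upart x $ p) \<in> PF" "(\<lambda>x. vpart x $ p) \<in> PF" for p :: idx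
    by (simp_all add: upart_def vpart_def PF_var)
  show D: "D \<in> PF"
    unfolding D_def hdet_def q11_def q12_def q22_def by (intro fn_intros[OF fn_ring_PF] c)
  let ?F = "PFsqrt D"
  note R = fn_ring_PFsqrt[OF D]
  note fn = fn_intros[OF R]
  have u: "(\<lambda>x. upart (fst x) $ p) \<in> ?F" and v: "(\<lambda>x. vpart (fst x) $ p) \<in> ?F" for p
    using PF_in_PFsqrt[OF c(1)] PF_in_PFsqrt[OF c(2)] by auto
  have d: "(\<lambda>x. snd x) \<in> ?F" by (rule snd_in_PFsqrt)
  have q: "(\<lambda>x. q11 (($) (vpart (fst x)))) \<in> ?F" "(\<lambda>x. q12 (($) (vpart (fst x)))) \<in> ?F"
     "(\<lambda>x. hdet (($) (vpart (fst x)))) \<in> ?F" "(\<lambda>x. hdet (($) (upart (fst x)))) \<in> ?F"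
    unfolding hdet_def q11_def q12_def q22_def by (intro fn u v)+
  have rk: "(\<lambda>x. rk1 (vpart (fst x)) (snd x) i j) \<in> ?F" "(\<lambda>x. rk1 (vpart (fst x)) (- snd x) i j) \<in> ?F" for i j
    unfolding rk1_def by (intro fn q v d)+
  have P: "(\<lambda>x. nfP (vpart (fst x)) (snd x) $ i $ j) \<in> ?F" for i j
    unfolding nfP_def using rk by (cases "i = 1") simp_all
  have Q: "(\<lambda>x. nfQ (vpart (fst x)) (snd x) $ i $ j) \<in> ?F" for i j
    unfolding nfQ_def using rk by (cases "i = 1") simp_all
  have R': "(\<lambda>x. nfR (vpart (fst x)) (snd x) $ i $ j) \<in> ?F" for i j
  proof -
    have "(\<lambda>x. rk1 (vpart (fst x)) (- snd x) 1 1 * (2 * q11 (($) (vpart (fst x))))) \<in> ?F"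
      "(\<lambda>x. rk1 (vpart (fst x)) (- snd x) 1 1 * (q12 (($) (vpart (fst x))) + snd x)) \<in> ?F"
      "(\<lambda>x. rk1 (vpart (fst x)) (snd x) 1 1 * (- 2 * q11 (($) (vpart (fst x))))) \<in> ?F"
      "(\<lambda>x. rk1 (vpart (fst x)) (snd x) 1 1 * (snd x - q12 (($) (vpart (fst x))))) \<in> ?F"
      by (intro fn rk q d)+
    then show ?thesis unfolding nfR_def by (cases "i = 1"; cases "j = 1") simp_all
  qed
  have "(\<lambda>x. act (nfP (vpart (fst x)) (snd x)) (nfQ (vpart (fst x)) (snd x)) (nfR (vpart (fst x)) (snd x)) (upart (fst x)) $ p) \<in> ?F" for p
  proof -
    obtain i j k where p: "p = (i, j, k)" by (cases p)
    show ?thesis unfolding p act_def tri_def vec_lambda_beta prod.case sum_idx tensor3_nth by (intro fn u P Q R')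
  qed
  from fn_gen_poly[OF R this]
  show "(\<lambda>x. gen_cond (upart (fst x)) (vpart (fst x)) (snd x)) \<in> ?F"
    unfolding gen_cond_def nfk_def mdet_def by (intro fn rk q d P Q R')
qed

text \<open>A point at which both values of the square root give a nondegenerate normal form.\<close>

definition ustar :: "complex ^ idx" where
  "ustar = (\<chi> p. if p = (1,1,1) then (3) / 64 else if p = (1,1,2) then (-1) / 64 else if p = (1,2,1) then (1) / 64 else if p = (1,2,2) then (1) / 64 else if p = (2,1,1) then (1) / 64 else if p = (2,1,2) then (-1) / 64 else if p = (2,2,1) then (-3) / 64 else (-1) / 64)"

lemma ustar_nth [simp]: "ustar $ (1,1,1) = (3) / 64" "ustar $ (1,1,2) = (-1) / 64" "ustar $ (1,2,1) = (1) / 64" "ustar $ (1,2,2) = (1) / 64" "ustar $ (2,1,1) = (1) / 64" "ustar $ (2,1,2) = (-1) / 64" "ustar $ (2,2,1) = (-3) / 64" "ustar $ (2,2,2) = (-1) / 64"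
  by (simp_all add: ustar_def)

definition vstar :: "complex ^ idx" where
  "vstar = (\<chi> p. if p = (1,1,1) \<or> p = (2,2,1) \<or> p = (1,2,2) \<or> p = (2,1,2) then 1 else 0)"

lemma vstar_nth [simp]: "vstar $ (1,1,1) = 1" "vstar $ (2,2,1) = 1" "vstar $ (1,2,2) = 1" "vstar $ (2,1,2) = 1"
  "vstar $ (1,1,2) = 0" "vstar $ (2,2,2) = 0" "vstar $ (1,2,1) = 0" "vstar $ (2,1,1) = 0"
  by (simp_all add: vstar_def)

text \<open>\<open>ustar\<close> is the preimage of \<open>ubp\<close> under the normal form of
  \<open>vstar\<close> at \<open>d = 2\<close>; the same tensor is sent to \<open>ubm\<close> at
  \<open>d = - 2\<close>. Both values are needed, as the norm is their product.\<close>

lemma gen_cond_star: "gen_cond ustar vstar 2 \<noteq> 0" "gen_cond ustar vstar (- 2) \<noteq> 0" "hdet (($) vstar) = 4"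
proof -
  have q: "q11 (($) vstar) = 1" "q12 (($) vstar) = 0" "q22 (($) vstar) = - 1"
    by (simp_all add: q11_def q12_def q22_def)
  show h: "hdet (($) vstar) = 4" by (simp add: hdet_def q)
  have hu: "hdet (($) ustar) \<noteq> 0" by (simp add: hdet_def q11_def q12_def q22_def power2_eq_square)
  have rk: "rk1 vstar d 1 1 = d" "rk1 vstar d 1 2 = 2" "rk1 vstar d 2 1 = 2" "rk1 vstar d 2 2 = d" for d
    by (simp_all add: rk1_def q)
  have nf: "nfP vstar d $ 1 $ 1 = d" "nfP vstar d $ 1 $ 2 = 2" "nfP vstar d $ 2 $ 1 = - d" "nfP vstar d $ 2 $ 2 = 2"
    "nfQ vstar d $ 1 $ 1 = d" "nfQ vstar d $ 1 $ 2 = 2" "nfQ vstar d $ 2 $ 1 = - d" "nfQ vstar d $ 2 $ 2 = 2"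
    "nfR vstar d $ 1 $ 1 = - 2 * d" "nfR vstar d $ 1 $ 2 = - d * d" "nfR vstar d $ 2 $ 1 = - 2 * d" "nfR vstar d $ 2 $ 2 = d * d"
    for d by (simp_all add: nfP_def nfQ_def nfR_def rk q)
  have ext8: "x = y" if "x $ (1,1,1) = y $ (1,1,1)" "x $ (1,1,2) = y $ (1,1,2)" "x $ (1,2,1) = y $ (1,2,1)" "x $ (1,2,2) = y $ (1,2,2)"
      "x $ (2,1,1) = y $ (2,1,1)" "x $ (2,1,2) = y $ (2,1,2)" "x $ (2,2,1) = y $ (2,2,1)" "x $ (2,2,2) = y $ (2,2,2)"
    for x y :: "complex ^ idx"
    using that by (auto simp: Finite_Cartesian_Product.vec_eq_iff forall_2)
  have "act (nfP vstar 2) (nfQ vstar 2) (nfR vstar 2) ustar = ubp"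
    by (rule ext8) (simp_all add: act_nth tri_def sum_idx nf)
  then show "gen_cond ustar vstar 2 \<noteq> 0"
    using ubp_good hu h by (simp add: gen_cond_def nfk_def mdet_def nf rk q)
  have "act (nfP vstar (- 2)) (nfQ vstar (- 2)) (nfR vstar (- 2)) ustar = ubm"
    by (rule ext8) (simp_all add: act_nth tri_def sum_idx nf)
  then show "gen_cond ustar vstar (- 2) \<noteq> 0"
    using ubm_good hu h by (simp add: gen_cond_def nfk_def mdet_def nf rk q)
qed

lemma exists_generic:
  obtains G :: "(idx + idx \<Rightarrow> complex) \<Rightarrow> complex" where "G \<in> PF" "\<exists>x. G x \<noteq> 0"
    "\<And>u v. G (case_sum (($) u) (($) v)) \<noteq> 0 \<Longrightarrow>
      finite (Sol u v) \<and> card (Sol u v) = 8 \<and> hdet (($) u) \<noteq> 0 \<and> hdet (($) v) \<noteq> 0"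
proof -
  obtain G where G: "G \<in> PF" "\<And>x d. d ^ 2 = hdet (($) (vpart x)) \<Longrightarrow>
      G x = gen_cond (upart x) (vpart x) d * gen_cond (upart x) (vpart x) (- d)"
    using norm_exists[OF gen_cond_PFsqrt(2,1)] by (auto simp: fst_conv snd_conv)
  show thesis
  proof (rule that[OF G(1)])
    have "G (case_sum (($) ustar) (($) vstar)) = gen_cond ustar vstar 2 * gen_cond ustar vstar (- 2)"
      using G(2)[of 2 "case_sum (($) ustar) (($) vstar)"] by (simp add: gen_cond_star(3))
    then show "\<exists>x. G x \<noteq> 0" using gen_cond_star(1,2) by (intro exI[of _ "case_sum (($) ustar) (($) vstar)"]) simp
    fix u v :: "complex ^ idx"
    assume nz: "G (case_sum (($) u) (($) v)) \<noteq> 0"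
    define d where "d = csqrt (hdet (($) v))"
    have d: "d ^ 2 = hdet (($) v)" by (simp add: d_def)
    then have "gen_cond u v d \<noteq> 0" using G(2)[of d "case_sum (($) u) (($) v)"] nz by auto
    then show "finite (Sol u v) \<and> card (Sol u v) = 8 \<and> hdet (($) u) \<noteq> 0 \<and> hdet (($) v) \<noteq> 0"
      using card_Sol_if_gen_cond[OF _ d] by (auto simp: gen_cond_def)
  qed
qed

section \<open>Restriction to lines, and the virtual degree\<close>

lemma PF_line:
  assumes "h \<in> PF"
  shows "\<exists>q. \<forall>\<tau>. h (\<lambda>i. x i + \<tau> * y i) = poly q \<tau>"
proof -
  obtain p where p: "\<And>x. h x = cpoly_eval x p" using assms by (auto simp: PF_def)
  have "h (\<lambda>i. x i + \<tau> * y i) = poly (cpoly_hom (\<lambda>a. [:a:]) (\<lambda>i. [:x i, y i:]) p) \<tau>" for \<tau>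
    unfolding p cpoly_eval_curve[symmetric] by simp
  then show ?thesis by blast
qed

text \<open>On the line through \<open>x\<close> and \<open>y\<close> both functions are nonzero
  univariate polynomials, and so is their product. Hence any two nonempty Zariski open sets meet,
  which makes the number in \<open>vHDdeg\<close> unique.\<close>

lemma PF_common_nonzero:
  assumes "f \<in> PF" "g \<in> PF" "f x \<noteq> 0" "g y \<noteq> 0"
  shows "\<exists>z. f z \<noteq> 0 \<and> g z \<noteq> 0"
proof -
  let ?l = "\<lambda>\<tau> i. x i + \<tau> * (y i - x i)"
  obtain p q where pq: "\<And>\<tau>. f (?l \<tau>) = poly p \<tau>" "\<And>\<tau>. g (?l \<tau>) = poly q \<tau>"
    using PF_line[OF assms(1), of x "\<lambda>i. y i - x i"] PF_line[OF assms(2), of x "\<lambda>i. y i - x i"] by blast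
  have "poly p 0 \<noteq> 0" "poly q 1 \<noteq> 0" using assms(3,4) by (simp_all flip: pq)
  then have "p * q \<noteq> 0" by auto
  then obtain \<tau> where "poly (p * q) \<tau> \<noteq> 0" using poly_all_0_iff_0 by blast
  then show ?thesis by (intro exI[of _ "?l \<tau>"]) (simp add: pq)
qed

lemma vHDdeg_Segre222: "vHDdeg Segre222 = 8"
proof -
  obtain G :: "(idx + idx \<Rightarrow> complex) \<Rightarrow> complex" where G: "G \<in> PF" "\<exists>x. G x \<noteq> 0"
    "\<And>u v. G (case_sum (($) u) (($) v)) \<noteq> 0 \<Longrightarrow>
      finite (Sol u v) \<and> card (Sol u v) = 8 \<and> hdet (($) u) \<noteq> 0 \<and> hdet (($) v) \<noteq> 0"
    using exists_generic by blast
  obtain p where p: "\<And>x. G x = cpoly_eval x p" using G(1) by (auto simp: PF_def)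
  have split: "case_sum (($) (upart x)) (($) (vpart x)) = x" for x :: "idx + idx \<Rightarrow> complex"
    by (auto simp: fun_eq_iff upart_def vpart_def split: sum.splits)
  have crit: "finite (critical_solutions Segre222 u v) \<and> card (critical_solutions Segre222 u v) = 8"
    if "G (case_sum (($) u) (($) v)) \<noteq> 0" for u v
    using G(3)[OF that] critical_solutions_Segre222 by simp
  let ?P = "\<lambda>m. \<exists>\<U>. zariski_open_pairs \<U> \<and> \<U> \<noteq> {} \<and>
     (\<forall>(u, v) \<in> \<U>. finite (critical_solutions Segre222 u v) \<and> card (critical_solutions Segre222 u v) = m)"
  show ?thesis
    unfolding vHDdeg_def
  proof (rule the_equality)
    let ?U = "{(u, v). G (case_sum (($) u) (($) v)) \<noteq> 0}"
    show "?P 8"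
    proof (intro exI[of _ ?U] conjI)
      show "zariski_open_pairs ?U"
        unfolding zariski_open_pairs_def p by (intro exI[of _ "{p}"]) auto
      obtain x where "G x \<noteq> 0" using G(2) by blast
      then have "(upart x, vpart x) \<in> ?U" by (simp add: split)
      then show "?U \<noteq> {}" by blast
      show "\<forall>(u, v) \<in> ?U. finite (critical_solutions Segre222 u v) \<and> card (critical_solutions Segre222 u v) = 8"
        using crit by simp
    qed
  next
    fix m assume "?P m"
    then obtain \<U> where U: "zariski_open_pairs \<U>" "\<U> \<noteq> {}"
      and card_U: "\<forall>(u, v) \<in> \<U>. finite (critical_solutions Segre222 u v) \<and> card (critical_solutions Segre222 u v) = m"
      by (elim exE conjE) blast
    obtain F where F: "\<U> = {(u, v). \<exists>f \<in> F. cpoly_eval (case_sum (($) u) (($) v)) f \<noteq> 0}"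
      using U(1) by (auto simp: zariski_open_pairs_def)
    obtain u v f where f: "f \<in> F" "cpoly_eval (case_sum (($) u) (($) v)) f \<noteq> 0" using U(2) F by auto
    have PF_f: "(\<lambda>x. cpoly_eval x f) \<in> PF" unfolding PF_def by (intro CollectI exI[of _ f] allI refl)
    obtain y where y: "G y \<noteq> 0" using G(2) by blast
    have "\<exists>z. cpoly_eval z f \<noteq> 0 \<and> G z \<noteq> 0"
      using PF_common_nonzero[where f = "\<lambda>x. cpoly_eval x f" and g = G and x = "case_sum (($) u) (($) v)" and y = y]
        PF_f G(1) f(2) y by simp
    then obtain x where x: "cpoly_eval x f \<noteq> 0" "G x \<noteq> 0" by blast
    have "(upart x, vpart x) \<in> \<U>" using x(1) f(1) unfolding F by (auto simp: split)
    then have "card (critical_solutions Segre222 (upart x) (vpart x)) = m" using card_U by fastforce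
    then show "m = 8" using crit[of "upart x" "vpart x"] x(2) by (simp add: split)
  qed
qed

section \<open>Hermitian Distance degrees: the upper bound\<close>

lemma poly_eq_0_if_small_reals:
  assumes "\<epsilon> > 0" "\<And>t :: real. \<bar>t\<bar> < \<epsilon> \<Longrightarrow> poly q (of_real t :: complex) = 0"
  shows "q = 0"
proof (rule ccontr)
  assume "q \<noteq> 0"
  then have "finite {x. poly q x = 0}" by (rule poly_roots_finite)
  moreover have "complex_of_real ` {0<..<\<epsilon>} \<subseteq> {x. poly q x = 0}" using assms(2) by auto
  ultimately have "finite (complex_of_real ` {0<..<\<epsilon>})" by (rule finite_subset[rotated])
  then have "finite {0<..<\<epsilon>}" by (rule finite_imageD) (auto intro: inj_onI)
  then show False using infinite_Ioo[OF assms(1)] by blast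
qed

text \<open>The pairs \<open>(u, cnjv u)\<close> form a maximal totally real subspace, on no open
  part of which a nonzero polynomial vanishes. The point \<open>y\<close> is reached from the base
  point along \<open>e\<close> and \<open>f\<close> with complex parameters; vanishing for small
  real parameters extends to complex ones, in one parameter after the other.\<close>

lemma PF_nonzero_at_conjugates:
  fixes G :: "('n::finite + 'n \<Rightarrow> complex) \<Rightarrow> complex"
  assumes G: "G \<in> PF" "G y \<noteq> 0" and U: "open U" "u0 \<in> U"
  shows "\<exists>u \<in> U. G (case_sum (($) u) (($) (cnjv u))) \<noteq> 0"
proof (rule ccontr)
  assume A: "\<not> ?thesis"
  define a where "a p = y (Inl p) - u0 $ p" for p
  define b where "b p = y (Inr p) - cnj (u0 $ p)" for p
  \<comment> \<open>\<open>e\<close> and \<open>f\<close> solve \<open>a = e + \<i> f\<close> and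
    \<open>b = cnj e + \<i> cnj f\<close>, so the parameters \<open>1\<close> and
    \<open>\<i>\<close> lead to \<open>y\<close>.\<close>
  define e :: "complex ^ 'n" where "e = (\<chi> p. (a p + cnj (b p)) / 2)"
  define f :: "complex ^ 'n" where "f = (\<chi> p. (a p - cnj (b p)) / (2 * \<i>))"
  define L where "L \<tau>1 \<tau>2 = case_sum (\<lambda>p. u0 $ p + \<tau>1 * e $ p + \<tau>2 * f $ p) (\<lambda>p. cnj (u0 $ p) + \<tau>1 * cnj (e $ p) + \<tau>2 * cnj (f $ p))"
    for \<tau>1 \<tau>2
  have L1i: "L 1 \<i> = y"
    by (auto simp: fun_eq_iff L_def e_def f_def a_def b_def field_simps split: sum.splits)
  obtain \<epsilon> where eps: "\<epsilon> > 0" "ball u0 \<epsilon> \<subseteq> U" using U open_contains_ball by blast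
  define \<delta> where "\<delta> = \<epsilon> / (norm e + norm f + 1)"
  have pos: "norm e + norm f + 1 > 0" by (smt (verit) norm_ge_zero)
  then have \<delta>: "\<delta> > 0" using eps by (simp add: \<delta>_def)
  have small: "G (L (of_real s) (of_real t)) = 0" if st: "\<bar>s\<bar> < \<delta>" "\<bar>t\<bar> < \<delta>" for s t :: real
  proof -
    define u where "u = u0 + s *\<^sub>R e + t *\<^sub>R f"
    have "norm (s *\<^sub>R e + t *\<^sub>R f) \<le> \<bar>s\<bar> * norm e + \<bar>t\<bar> * norm f"
      using norm_triangle_ineq[of "s *\<^sub>R e" "t *\<^sub>R f"] by simp
    also have "\<dots> \<le> \<delta> * norm e + \<delta> * norm f" using st by (intro add_mono mult_right_mono) auto
    also have "\<dots> < \<delta> * (norm e + norm f + 1)" using \<delta> by (simp add: algebra_simps)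
    also have "\<dots> = \<epsilon>" using pos by (simp add: \<delta>_def)
    finally have "dist u0 u < \<epsilon>" by (simp add: u_def dist_norm norm_minus_commute algebra_simps)
    then have "u \<in> U" using eps by auto
    moreover have "case_sum (($) u) (($) (cnjv u)) = L (of_real s) (of_real t)"
    proof -
      have "(r *\<^sub>R x) $ p = of_real r * x $ p" for r and x :: "complex ^ 'n" and p
        unfolding vector_scaleR_component by (rule scaleR_conv_of_real)
      then show ?thesis by (auto simp: fun_eq_iff L_def u_def split: sum.splits)
    qed
    ultimately show ?thesis using A by auto
  qed
  have step1: "G (L 1 (of_real t)) = 0" if t: "\<bar>t\<bar> < \<delta>" for t :: real
  proof -
    obtain q where q: "\<And>\<tau>. G (\<lambda>i. L 0 (of_real t) i + \<tau> * (case_sum (($) e) (($) (cnjv e))) i) = poly q \<tau>"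
      using PF_line[OF G(1)] by blast
    have eq: "(\<lambda>i. L 0 (of_real t) i + \<tau> * (case_sum (($) e) (($) (cnjv e))) i) = L \<tau> (of_real t)" for \<tau>
      by (auto simp: fun_eq_iff L_def split: sum.splits)
    have qL: "poly q \<tau> = G (L \<tau> (of_real t))" for \<tau> using q[of \<tau>] unfolding eq by (rule sym)
    have "q = 0"
    proof (rule poly_eq_0_if_small_reals[OF \<delta>])
      fix s :: real assume "\<bar>s\<bar> < \<delta>"
      then show "poly q (of_real s) = 0" unfolding qL using t by (rule small)
    qed
    then show ?thesis using qL[of 1] by simp
  qed
  obtain q where q: "\<And>\<tau>. G (\<lambda>i. L 1 0 i + \<tau> * (case_sum (($) f) (($) (cnjv f))) i) = poly q \<tau>"
    using PF_line[OF G(1)] by blast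
  have eq: "(\<lambda>i. L 1 0 i + \<tau> * (case_sum (($) f) (($) (cnjv f))) i) = L 1 \<tau>" for \<tau>
    by (auto simp: fun_eq_iff L_def split: sum.splits)
  have qL: "poly q \<tau> = G (L 1 \<tau>)" for \<tau> using q[of \<tau>] unfolding eq by (rule sym)
  have "q = 0"
  proof (rule poly_eq_0_if_small_reals[OF \<delta>])
    fix s :: real assume "\<bar>s\<bar> < \<delta>"
    then show "poly q (of_real s) = 0" unfolding qL by (rule step1)
  qed
  then have "G y = 0" using qL[of \<i>] by (simp add: L1i)
  then show False using G(2) by simp
qed

lemma even_card_free_involution:
  assumes "finite S" "\<And>x. x \<in> S \<Longrightarrow> f x \<in> S \<and> f (f x) = x \<and> f x \<noteq> x"
  shows "even (card S)"
  using assms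
proof (induction "card S" arbitrary: S rule: less_induct)
  case less
  show ?case
  proof (cases "S = {}")
    case False
    then obtain x where x: "x \<in> S" by blast
    have fx: "f x \<in> S" "f (f x) = x" "f x \<noteq> x" using less(3)[OF x] by auto
    let ?S = "S - {x, f x}"
    have card: "card S = card ?S + 2"
      using less(2) x fx card_Diff_subset[of "{x, f x}" S] card_mono[of S "{x, f x}"] by simp
    moreover have "even (card ?S)"
    proof (rule less(1))
      show "card ?S < card S" using card by simp
      show "finite ?S" using less(2) by simp
      fix y assume y: "y \<in> ?S"
      then show "f y \<in> ?S \<and> f (f y) = y \<and> f y \<noteq> y" using less(3)[of y] fx by auto
    qed
    ultimately show ?thesis by simp
  qed simp
qed

section \<open>The conjugation involution, and nearest points\<close>

definition conj_swap :: "(complex ^ 'n) \<times> (complex ^ 'n) \<Rightarrow> (complex ^ 'n) \<times> (complex ^ 'n)" where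
  "conj_swap p = (cnjv (snd p), cnjv (fst p))"

lemma conj_swap_Sol: "p \<in> Sol u (cnjv u) \<Longrightarrow> conj_swap p \<in> Sol u (cnjv u)"
  using Sol_cnjv[of "fst p" "snd p" u "cnjv u"] by (simp add: conj_swap_def)

lemma conj_swap_conj_swap [simp]: "conj_swap (conj_swap p) = p"
  by (simp add: conj_swap_def)

lemma bij_betw_critical_points:
  "bij_betw fst {p \<in> Sol u (cnjv u). conj_swap p = p} (critical_points Segre222 u)"
  unfolding critical_points_Segre222
  by (rule bij_betw_byWitness[where f' = "\<lambda>z. (z, cnjv z)"]) (auto simp: conj_swap_def)

lemma norm_vec_squared: "(norm (x :: complex ^ 'n::finite))\<^sup>2 = (\<Sum>p\<in>UNIV. (cmod (x $ p))\<^sup>2)"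
  by (simp add: norm_vec_def L2_set_def sum_nonneg)

text \<open>Moving along \<open>t\<close> by a small multiple of the inner product
  \<open>\<beta>\<close> would shorten \<open>y\<close>; the factor \<open>k\<close> is small enough
  for the linear gain to outweigh the quadratic term.\<close>

lemma minimizer_orthogonal:
  fixes y t :: "complex ^ 'n::finite"
  assumes "\<And>\<tau>. norm y \<le> norm (y - \<tau> *s t)"
  shows "(\<Sum>p\<in>UNIV. y $ p * cnj (t $ p)) = 0"
proof (rule ccontr)
  define \<beta> where "\<beta> = (\<Sum>p\<in>UNIV. y $ p * cnj (t $ p))"
  assume "(\<Sum>p\<in>UNIV. y $ p * cnj (t $ p)) \<noteq> 0"
  then have \<beta>: "\<beta> \<noteq> 0" by (simp add: \<beta>_def)
  define k where "k = 1 / (1 + (norm t)\<^sup>2)"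
  have k: "k > 0" "k * (norm t)\<^sup>2 < 1" by (auto simp: k_def field_simps add_pos_nonneg)
  let ?\<tau> = "of_real k * \<beta>"
  have cs: "(cmod (x - w))\<^sup>2 = (cmod x)\<^sup>2 - 2 * Re (x * cnj w) + (cmod w)\<^sup>2" for x w
    unfolding cmod_power2 by (simp add: power2_eq_square algebra_simps)
  have "(norm (y - ?\<tau> *s t))\<^sup>2 = (norm y)\<^sup>2 - 2 * Re (\<Sum>p\<in>UNIV. y $ p * cnj (?\<tau> * t $ p)) + (cmod ?\<tau>)\<^sup>2 * (norm t)\<^sup>2"
    unfolding norm_vec_squared
    by (simp add: cs sum.distrib sum_subtractf sum_distrib_left norm_mult power_mult_distrib)
  also have "(\<Sum>p\<in>UNIV. y $ p * cnj (?\<tau> * t $ p)) = cnj ?\<tau> * \<beta>"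
  proof -
    have "(\<Sum>p\<in>UNIV. y $ p * cnj (x * t $ p)) = cnj x * \<beta>" for x
      by (simp add: \<beta>_def sum_distrib_left mult_ac)
    then show ?thesis .
  qed
  also have "Re (cnj ?\<tau> * \<beta>) = k * (cmod \<beta>)\<^sup>2"
    unfolding cmod_power2 by (simp add: power2_eq_square algebra_simps)
  also have "(cmod ?\<tau>)\<^sup>2 = k\<^sup>2 * (cmod \<beta>)\<^sup>2" by (simp add: norm_mult power_mult_distrib)
  finally have eq: "(norm (y - ?\<tau> *s t))\<^sup>2 = (norm y)\<^sup>2 - k * (cmod \<beta>)\<^sup>2 * (2 - k * (norm t)\<^sup>2)"
    by (simp add: algebra_simps power2_eq_square)
  have "k * (cmod \<beta>)\<^sup>2 * (2 - k * (norm t)\<^sup>2) > 0" using k \<beta> by (intro mult_pos_pos) auto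
  moreover have "(norm y)\<^sup>2 \<le> (norm (y - ?\<tau> *s t))\<^sup>2" using assms by (intro power_mono) auto
  ultimately show False using eq by linarith
qed

lemma closed_Segre222: "closed Segre222"
proof -
  have "Segre222 = (\<Inter>s. \<Inter>p. \<Inter>q. {z. z $ p * z $ q = z $ upd s p (slot s q) * z $ upd s q (slot s p)})"
  proof (intro equalityI subsetI)
    fix z assume "z \<in> Segre222"
    then have "z \<in> zero_locus quadrics" by (simp add: zero_locus_quadrics)
    then have "cpoly_eval (($) z) (quadric s p q) = 0" for s p q
      using quadric_in_quadrics by (auto simp: zero_locus_def)
    then show "z \<in> (\<Inter>s. \<Inter>p. \<Inter>q. {z. z $ p * z $ q = z $ upd s p (slot s q) * z $ upd s q (slot s p)})"
      by (simp add: quadric_def)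
  qed (auto intro!: Segre222_if_quadrics)
  also have "closed \<dots>" by (intro closed_INT ballI closed_Collect_eq continuous_intros)
  finally show ?thesis .
qed

text \<open>The cone is closed, so a nearest point \<open>z\<close> exists. It is nonzero, since
  otherwise \<open>u\<close> would be orthogonal to all coordinate tensors. The tangent fields give
  lines inside the variety, and minimality along them yields orthogonality.\<close>

lemma exists_critical_point:
  assumes "u \<noteq> 0"
  shows "critical_points Segre222 u \<noteq> {}"
proof -
  obtain z where z: "z \<in> Segre222" "\<And>y. y \<in> Segre222 \<Longrightarrow> dist u z \<le> dist u y"
    using distance_attains_inf[OF closed_Segre222, of u] tensor3_in_Segre222 by blast
  have orth: "(\<Sum>p\<in>UNIV. (u - z) $ p * cnj (t $ p)) = 0" if t: "\<And>\<tau>. z + \<tau> *s t \<in> Segre222" for t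
  proof (rule minimizer_orthogonal)
    fix \<tau> show "norm (u - z) \<le> norm (u - z - \<tau> *s t)"
      using z(2)[OF t[of \<tau>]] by (simp add: dist_norm diff_diff_eq)
  qed
  have "z \<noteq> 0"
  proof
    assume z0: "z = 0"
    have "u $ p = 0" for p
    proof -
      obtain i j k where p: "p = (i, j, k)" by (cases p)
      have "z + \<tau> *s tensor3 (axis i 1) (axis j 1) (axis k 1) \<in> Segre222" for \<tau>
        by (simp add: z0 scale_in_Segre222)
      from orth[OF this] have "(\<Sum>q\<in>UNIV. u $ q * cnj (tensor3 (axis i 1) (axis j 1) (axis k 1) $ q)) = 0" by (simp add: z0)
      moreover have "(\<Sum>q\<in>UNIV. u $ q * cnj (tensor3 (axis i 1) (axis j 1) (axis k 1) $ q)) = (\<Sum>q\<in>UNIV. if q = p then u $ q else 0)"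
        by (intro sum.cong refl) (auto simp: p axis_def split: if_splits)
      ultimately show ?thesis by simp
    qed
    then show False using assms by (auto simp: Finite_Cartesian_Product.vec_eq_iff)
  qed
  have "contr s l m (($) (cnjv (u - z))) (($) z) = 0" for s l m
  proof -
    let ?t = "\<chi> p. tf s l m (($) z) p"
    have "z + \<tau> *s ?t \<in> Segre222" for \<tau>
    proof -
      have "z + \<tau> *s ?t = (\<chi> p. z $ p + \<tau> * tf s l m (($) z) p)"
        by (simp add: Finite_Cartesian_Product.vec_eq_iff)
      then show ?thesis by (simp only: tf_in_Segre222[OF z(1)])
    qed
    from orth[OF this] have "cnj (\<Sum>p\<in>UNIV. (u - z) $ p * cnj (?t $ p)) = 0" by simp
    then show ?thesis by (simp add: contr_def)
  qed
  then have o: "ortho (($) (cnjv (u - z))) (($) z)" by (simp add: ortho_def)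
  then have "ortho (($) (u - z)) (($) (cnjv z))" by (metis ortho_cnjv cnjv_simps(1))
  then have "(z, cnjv z) \<in> Sol u (cnjv u)" using z \<open>z \<noteq> 0\<close> o by (simp add: Sol_def)
  then show ?thesis unfolding critical_points_Segre222 by blast
qed

lemma HDdeg_subset: "HDdeg Segre222 \<subseteq> {2, 4, 6, 8}"
proof
  fix m assume "m \<in> HDdeg Segre222"
  then obtain \<U> where U: "open \<U>" "\<U> \<noteq> {}" "\<And>u. u \<in> \<U> \<Longrightarrow> finite (critical_points Segre222 u) \<and> card (critical_points Segre222 u) = m"
    unfolding HDdeg_def by blast
  obtain G :: "(idx + idx \<Rightarrow> complex) \<Rightarrow> complex" where G: "G \<in> PF" "\<exists>x. G x \<noteq> 0"
    "\<And>u v. G (case_sum (($) u) (($) v)) \<noteq> 0 \<Longrightarrow>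
      finite (Sol u v) \<and> card (Sol u v) = 8 \<and> hdet (($) u) \<noteq> 0 \<and> hdet (($) v) \<noteq> 0"
    using exists_generic by blast
  obtain u where u: "u \<in> \<U>" "G (case_sum (($) u) (($) (cnjv u))) \<noteq> 0"
    using PF_nonzero_at_conjugates[OF G(1) _ U(1)] G(2) U(2) by blast
  let ?S = "Sol u (cnjv u)" and ?F = "{p \<in> Sol u (cnjv u). conj_swap p = p}"
  have S: "finite ?S" "card ?S = 8" "hdet (($) u) \<noteq> 0" using G(3)[OF u(2)] by auto
  have m: "card ?F = m" using bij_betw_same_card[OF bij_betw_critical_points] U(3)[OF u(1)] by simp
  have "u \<noteq> 0"
  proof
    assume "u = 0"
    then have "hdet (($) u) = 0" by (simp add: hdet_def q11_def q12_def q22_def)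
    then show False using S(3) by simp
  qed
  then have "m \<noteq> 0" using exists_critical_point U(3)[OF u(1)] by (metis card_0_eq)
  have "even (card (?S - ?F))"
    by (rule even_card_free_involution[where f = conj_swap]) (use S conj_swap_Sol in auto)
  moreover have "card (?S - ?F) = 8 - m" "m \<le> 8"
    using card_Diff_subset[of ?F ?S] card_mono[of ?S ?F] S m by auto
  ultimately have "even (8 - m)" "m \<le> 8" by simp_all
  then have "even m" by presburger
  then have "m = 2 \<or> m = 4 \<or> m = 6 \<or> m = 8" using \<open>m \<noteq> 0\<close> \<open>m \<le> 8\<close> by presburger
  then show "m \<in> {2, 4, 6, 8}" by blast
qed

section \<open>Persistence of nondegenerate solutions\<close>

text \<open>Both parameters vary independently, as an open mapping argument permits; the conjugate
  pairs are specialized afterwards.\<close>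

definition persistent :: "complex ^ idx \<Rightarrow> complex ^ idx \<Rightarrow> (complex ^ idx) \<times> (complex ^ idx) \<Rightarrow> bool" where
  "persistent u v p \<longleftrightarrow> (\<forall>\<epsilon>>0. eventually (\<lambda>x. \<exists>q \<in> Sol (fst x) (snd x). dist q p < \<epsilon>) (nhds (u, v)))"

text \<open>The equations with \<open>v\<close> determine \<open>\<alpha>\<close>,
  \<open>\<beta>\<close>, \<open>\<gamma>\<close> from \<open>a\<close>, \<open>b\<close>,
  \<open>c\<close> up to scale, which leaves three equations in \<open>s\<close>, \<open>t\<close>,
  \<open>r\<close>. The multipliers agree because the value of \<open>u\<close> on
  \<open>\<alpha>\<close>, \<open>\<beta>\<close>, \<open>\<gamma>\<close> can be computed in three
  ways.\<close>

lemma Sol_from_fixed_point: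
  fixes u v :: "complex ^ idx" and s t r :: complex
  defines "a \<equiv> vec2 1 s" and "b \<equiv> vec2 1 t" and "c \<equiv> vec2 1 r"
  defines "\<alpha> \<equiv> vec2 (tri (($) v) e1 b c) (tri (($) v) e2 b c)"
    and "\<beta> \<equiv> vec2 (tri (($) v) a e1 c) (tri (($) v) a e2 c)"
    and "\<gamma> \<equiv> vec2 (tri (($) v) a b e1) (tri (($) v) a b e2)"
  defines "\<theta> \<equiv> tri (($) v) a b c" and "k \<equiv> tri (($) u) e1 \<beta> \<gamma>"
  assumes nz: "\<theta> \<noteq> 0" "k \<noteq> 0"
    and F: "tri (($) u) e2 \<beta> \<gamma> = s * k" "tri (($) u) \<alpha> e2 \<gamma> = t * tri (($) u) \<alpha> e1 \<gamma>"
      "tri (($) u) \<alpha> \<beta> e2 = r * tri (($) u) \<alpha> \<beta> e1"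
  shows "((k / \<theta>\<^sup>2) *s tensor3 a b c, (1 / \<theta>\<^sup>2) *s tensor3 \<alpha> \<beta> \<gamma>) \<in> Sol u v"
proof -
  have v: "dot2 \<alpha> x = tri (($) v) x b c" "dot2 \<beta> x = tri (($) v) a x c" "dot2 \<gamma> x = tri (($) v) a b x" for x
    by (simp_all add: \<alpha>_def \<beta>_def \<gamma>_def dot2_def tri_linear(1)[of _ x] tri_linear(2)[of _ _ x] tri_linear(3)[of _ _ _ x])
  have th: "dot2 \<alpha> a = \<theta>" "dot2 \<beta> b = \<theta>" "dot2 \<gamma> c = \<theta>" by (simp_all add: v \<theta>_def)
  have comm: "dot2 x y = dot2 y x" for x y by (simp add: dot2_def mult.commute)
  have abc: "a $ 1 = 1" "a $ 2 = s" "b $ 1 = 1" "b $ 2 = t" "c $ 1 = 1" "c $ 2 = r" by (simp_all add: a_def b_def c_def)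
  define k2 k3 where "k2 = tri (($) u) \<alpha> e1 \<gamma>" and "k3 = tri (($) u) \<alpha> \<beta> e1"
  have u1: "tri (($) u) x \<beta> \<gamma> = dot2 a x * k" for x
    using F(1) by (subst tri_linear(1)) (simp add: dot2_def abc k_def algebra_simps)
  have u2: "tri (($) u) \<alpha> x \<gamma> = dot2 b x * k2" for x
    using F(2) by (subst tri_linear(2)) (simp add: dot2_def abc k2_def algebra_simps)
  have u3: "tri (($) u) \<alpha> \<beta> x = dot2 c x * k3" for x
    using F(3) by (subst tri_linear(3)) (simp add: dot2_def abc k3_def algebra_simps)
  have "dot2 a \<alpha> * k = dot2 b \<beta> * k2" "dot2 a \<alpha> * k = dot2 c \<gamma> * k3"
    by (rule trans[OF u1[of \<alpha>, symmetric] u2[of \<beta>]], rule trans[OF u1[of \<alpha>, symmetric] u3[of \<gamma>]])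
  then have "\<theta> * k = \<theta> * k2" "\<theta> * k = \<theta> * k3"
    using th by (simp_all only: comm[of a \<alpha>] comm[of b \<beta>] comm[of c \<gamma>])
  then have k: "k2 = k" "k3 = k" using nz by auto
  have sc: "dot2 (q *s x) y = q * dot2 x y" "dot2 x (q *s y) = q * dot2 x y" for q x y
    by (simp_all add: dot2_def algebra_simps)
  have ts: "tri y (q *s x) z w = q * tri y x z w" for y q x z w
    by (simp add: tri_def sum_idx algebra_simps)
  have nz3: "a \<noteq> 0" "b \<noteq> 0" "c \<noteq> 0" using abc by auto
  have nz4: "\<alpha> \<noteq> 0" "\<beta> \<noteq> 0" "\<gamma> \<noteq> 0" using th nz by (auto simp: dot2_def)
  have "(tensor3 ((k / \<theta>\<^sup>2) *s a) b c, tensor3 ((1 / \<theta>\<^sup>2) *s \<alpha>) \<beta> \<gamma>) \<in> Sol u v"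
    unfolding Sol_tensor3_iff tensor3_eq_0_iff
    using nz nz3 nz4
    by (simp add: u1 u2 u3 k ts sc v[symmetric] th comm[of a \<alpha>] comm[of b \<beta>] comm[of c \<gamma>] power2_eq_square)
  then show ?thesis by (simp only: tensor3_scale)
qed

section \<open>Linearization at a solution in normal position\<close>

lemma isCont_tendsto_nhds: "isCont f x \<Longrightarrow> (f \<longlongrightarrow> f x) (nhds x)"
  by (simp add: isCont_def tendsto_at_iff_tendsto_nhds)

lemma has_derivative_affine2:
  fixes X Y P Q R M :: "'a::real_normed_vector \<Rightarrow> complex"
  assumes "(X has_derivative X') (at p)" "(Y has_derivative Y') (at p)" "(P has_derivative P') (at p)"
    "(Q has_derivative Q') (at p)" "(R has_derivative R') (at p)" "(M has_derivative M') (at p)"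
    and "X p = 0" "Y p = 0"
  shows "((\<lambda>x. P x + Q x * X x + R x * Y x + M x * X x * Y x) has_derivative (\<lambda>h. P' h + Q p * X' h + R p * Y' h)) (at p)"
  by (rule has_derivative_eq_rhs, (rule derivative_intros assms)+) (simp add: assms fun_eq_iff)

text \<open>The common shape of the three fixed point equations. At the base point the second
  components vanish, so few terms of the derivative survive.\<close>

lemma has_derivative_fixed_point:
  fixes S A B C D A2 B2 C2 D2 x1 x2 y1 y2 :: "'a::real_normed_vector \<Rightarrow> complex"
  assumes "(S has_derivative S') (at p)" "(A has_derivative A') (at p)" "(B has_derivative B') (at p)"
    "(C has_derivative C') (at p)" "(D has_derivative D') (at p)"
    "(A2 has_derivative A2') (at p)" "(B2 has_derivative B2') (at p)"
    "(C2 has_derivative C2') (at p)" "(D2 has_derivative D2') (at p)"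
    "(x1 has_derivative x1') (at p)" "(x2 has_derivative x2') (at p)"
    "(y1 has_derivative y1') (at p)" "(y2 has_derivative y2') (at p)"
    and "S p = 0" "A p = 0" "x2 p = 0" "y2 p = 0"
  shows "((\<lambda>x. (A x * x1 x * y1 x + B x * x1 x * y2 x + C x * x2 x * y1 x + D x * x2 x * y2 x)
     - S x * (A2 x * x1 x * y1 x + B2 x * x1 x * y2 x + C2 x * x2 x * y1 x + D2 x * x2 x * y2 x)) has_derivative
     (\<lambda>h. A' h * x1 p * y1 p + B p * x1 p * y2' h + C p * x2' h * y1 p - S' h * (A2 p * x1 p * y1 p))) (at p)"
  by (rule has_derivative_eq_rhs, (rule derivative_intros assms)+) (simp add: assms fun_eq_iff algebra_simps)

type_synonym pspace = "(complex \<times> complex \<times> complex) \<times> ((complex ^ idx) \<times> (complex ^ idx))"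

text \<open>\<open>Th\<close> sends a chart point with parameters to the residuals of the fixed
  point equations with the same parameters. Its derivative is injective by \<open>inj\<close>, hence
  an isomorphism, so \<open>Th\<close> is open at the base point and nearby parameters are attained
  with residual 0. Carrying the parameters along lets an open mapping theorem do the work of an
  implicit function theorem.\<close>

lemma persistent_normal_form:
  fixes u v :: "complex ^ idx"
  assumes u0: "u $ (2,1,1) = 0" "u $ (1,2,1) = 0" "u $ (1,1,2) = 0" "u $ (1,1,1) \<noteq> 0"
    and v0: "v $ (2,1,1) = 0" "v $ (1,2,1) = 0" "v $ (1,1,2) = 0" "v $ (1,1,1) \<noteq> 0"
    and inj: "\<And>s t r. u $ (2,2,1) * (v $ (2,2,1) * s + v $ (1,2,2) * r) + u $ (2,1,2) * (v $ (2,1,2) * s + v $ (1,2,2) * t) = u $ (1,1,1) * v $ (1,1,1) * s \<Longrightarrow>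
       u $ (2,2,1) * (v $ (2,2,1) * t + v $ (2,1,2) * r) + u $ (1,2,2) * (v $ (2,1,2) * s + v $ (1,2,2) * t) = u $ (1,1,1) * v $ (1,1,1) * t \<Longrightarrow>
       u $ (2,1,2) * (v $ (2,2,1) * t + v $ (2,1,2) * r) + u $ (1,2,2) * (v $ (2,2,1) * s + v $ (1,2,2) * r) = u $ (1,1,1) * v $ (1,1,1) * r \<Longrightarrow>
       s = 0 \<and> t = 0 \<and> r = 0"
  shows "persistent u v (u $ (1,1,1) *s tensor3 e1 e1 e1, v $ (1,1,1) *s tensor3 e1 e1 e1)"
  unfolding persistent_def
proof (intro allI impI)
  fix \<epsilon> :: real assume \<epsilon>: "\<epsilon> > 0"
  define s t r where "s = (\<lambda>x :: pspace. fst (fst x))" and "t = (\<lambda>x :: pspace. fst (snd (fst x)))"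
    and "r = (\<lambda>x :: pspace. snd (snd (fst x)))"
  define U V where "U p = (\<lambda>x :: pspace. fst (snd x) $ p)" and "V p = (\<lambda>x :: pspace. snd (snd x) $ p)" for p
  define al1 al2 where "al1 = (\<lambda>x. V (1,1,1) x + V (1,1,2) x * r x + V (1,2,1) x * t x + V (1,2,2) x * r x * t x)"
    and "al2 = (\<lambda>x. V (2,1,1) x + V (2,1,2) x * r x + V (2,2,1) x * t x + V (2,2,2) x * r x * t x)"
  define be1 be2 where "be1 = (\<lambda>x. V (1,1,1) x + V (1,1,2) x * r x + V (2,1,1) x * s x + V (2,1,2) x * r x * s x)"
    and "be2 = (\<lambda>x. V (1,2,1) x + V (1,2,2) x * r x + V (2,2,1) x * s x + V (2,2,2) x * r x * s x)"
  define ga1 ga2 where "ga1 = (\<lambda>x. V (1,1,1) x + V (1,2,1) x * t x + V (2,1,1) x * s x + V (2,2,1) x * t x * s x)"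
    and "ga2 = (\<lambda>x. V (1,1,2) x + V (1,2,2) x * t x + V (2,1,2) x * s x + V (2,2,2) x * t x * s x)"
  note abg = al1_def al2_def be1_def be2_def ga1_def ga2_def
  define F1 where "F1 = (\<lambda>x. (U (2,1,1) x * be1 x * ga1 x + U (2,1,2) x * be1 x * ga2 x + U (2,2,1) x * be2 x * ga1 x + U (2,2,2) x * be2 x * ga2 x)
     - s x * (U (1,1,1) x * be1 x * ga1 x + U (1,1,2) x * be1 x * ga2 x + U (1,2,1) x * be2 x * ga1 x + U (1,2,2) x * be2 x * ga2 x))"
  define F2 where "F2 = (\<lambda>x. (U (1,2,1) x * al1 x * ga1 x + U (1,2,2) x * al1 x * ga2 x + U (2,2,1) x * al2 x * ga1 x + U (2,2,2) x * al2 x * ga2 x)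
     - t x * (U (1,1,1) x * al1 x * ga1 x + U (1,1,2) x * al1 x * ga2 x + U (2,1,1) x * al2 x * ga1 x + U (2,1,2) x * al2 x * ga2 x))"
  define F3 where "F3 = (\<lambda>x. (U (1,1,2) x * al1 x * be1 x + U (1,2,2) x * al1 x * be2 x + U (2,1,2) x * al2 x * be1 x + U (2,2,2) x * al2 x * be2 x)
     - r x * (U (1,1,1) x * al1 x * be1 x + U (1,2,1) x * al1 x * be2 x + U (2,1,1) x * al2 x * be1 x + U (2,2,1) x * al2 x * be2 x))"
  define Th where "Th = (\<lambda>x :: pspace. ((F1 x, F2 x, F3 x), snd x))"
  define x0 :: pspace where "x0 = ((0, 0, 0), (u, v))"
  have at0: "s x0 = 0" "t x0 = 0" "r x0 = 0" "U p x0 = u $ p" "V p x0 = v $ p" for p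
    by (simp_all add: s_def t_def r_def U_def V_def x0_def)
  have abg0: "al1 x0 = v $ (1,1,1)" "al2 x0 = 0" "be1 x0 = v $ (1,1,1)" "be2 x0 = 0" "ga1 x0 = v $ (1,1,1)" "ga2 x0 = 0"
    by (simp_all add: abg at0 v0)
  have ds: "(s has_derivative s) (at x0)" "(t has_derivative t) (at x0)" "(r has_derivative r) (at x0)"
    unfolding s_def t_def r_def by (auto intro!: derivative_eq_intros)
  have dU: "(U p has_derivative U p) (at x0)" and dV: "(V p has_derivative V p) (at x0)" for p
    unfolding U_def V_def
    by (auto intro!: bounded_linear.has_derivative[OF bounded_linear_vec_nth] derivative_eq_intros)
  note d2 = has_derivative_affine2[where p = x0]
  have dabg: "(al1 has_derivative (\<lambda>h. V (1,1,1) h + V (1,1,2) x0 * r h + V (1,2,1) x0 * t h)) (at x0)"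
    "(al2 has_derivative (\<lambda>h. V (2,1,1) h + V (2,1,2) x0 * r h + V (2,2,1) x0 * t h)) (at x0)"
    "(be1 has_derivative (\<lambda>h. V (1,1,1) h + V (1,1,2) x0 * r h + V (2,1,1) x0 * s h)) (at x0)"
    "(be2 has_derivative (\<lambda>h. V (1,2,1) h + V (1,2,2) x0 * r h + V (2,2,1) x0 * s h)) (at x0)"
    "(ga1 has_derivative (\<lambda>h. V (1,1,1) h + V (1,2,1) x0 * t h + V (2,1,1) x0 * s h)) (at x0)"
    "(ga2 has_derivative (\<lambda>h. V (1,1,2) h + V (1,2,2) x0 * t h + V (2,1,2) x0 * s h)) (at x0)"
    unfolding abg by (rule d2[OF _ _ dV dV dV dV]; rule ds at0)+
  note dF = has_derivative_fixed_point[where p = x0]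
  note dF1 = dF[OF ds(1) dU dU dU dU dU dU dU dU dabg(3,4,5,6), of "(2,1,1)" "(2,1,2)" "(2,2,1)" "(2,2,2)" "(1,1,1)" "(1,1,2)" "(1,2,1)" "(1,2,2)", folded F1_def, unfolded at0 abg0 u0 v0, OF refl refl refl refl]
  note dF2 = dF[OF ds(2) dU dU dU dU dU dU dU dU dabg(1,2,5,6), of "(1,2,1)" "(1,2,2)" "(2,2,1)" "(2,2,2)" "(1,1,1)" "(1,1,2)" "(2,1,1)" "(2,1,2)", folded F2_def, unfolded at0 abg0 u0 v0, OF refl refl refl refl]
  note dF3 = dF[OF ds(3) dU dU dU dU dU dU dU dU dabg(1,2,3,4), of "(1,1,2)" "(1,2,2)" "(2,1,2)" "(2,2,2)" "(1,1,1)" "(1,2,1)" "(2,1,1)" "(2,2,1)", folded F3_def, unfolded at0 abg0 u0 v0, OF refl refl refl refl]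
  have dsnd: "(snd has_derivative snd) (at x0)" by (auto intro!: derivative_eq_intros)
  note dTh = has_derivative_Pair[OF has_derivative_Pair[OF dF1 has_derivative_Pair[OF dF2 dF3]] dsnd, folded Th_def]
  obtain L where L: "(Th has_derivative L) (at x0)" and L_eq: "\<And>h. L h =
     ((U (2,1,1) h * v $ (1,1,1) * v $ (1,1,1) + u $ (2,1,2) * v $ (1,1,1) * (V (1,1,2) h + v $ (1,2,2) * t h + v $ (2,1,2) * s h)
        + u $ (2,2,1) * (V (1,2,1) h + v $ (1,2,2) * r h + v $ (2,2,1) * s h) * v $ (1,1,1) - s h * (u $ (1,1,1) * v $ (1,1,1) * v $ (1,1,1)),
       U (1,2,1) h * v $ (1,1,1) * v $ (1,1,1) + u $ (1,2,2) * v $ (1,1,1) * (V (1,1,2) h + v $ (1,2,2) * t h + v $ (2,1,2) * s h)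
        + u $ (2,2,1) * (V (2,1,1) h + v $ (2,1,2) * r h + v $ (2,2,1) * t h) * v $ (1,1,1) - t h * (u $ (1,1,1) * v $ (1,1,1) * v $ (1,1,1)),
       U (1,1,2) h * v $ (1,1,1) * v $ (1,1,1) + u $ (1,2,2) * v $ (1,1,1) * (V (1,2,1) h + v $ (1,2,2) * r h + v $ (2,2,1) * s h)
        + u $ (2,1,2) * (V (2,1,1) h + v $ (2,1,2) * r h + v $ (2,2,1) * t h) * v $ (1,1,1) - r h * (u $ (1,1,1) * v $ (1,1,1) * v $ (1,1,1))),
      snd h)"
    using dTh by blast
  have lin: "linear L" using L has_derivative_linear by blast
  have "inj L"
  proof (rule linear_injective_0[OF lin, THEN iffD2], intro allI impI)
    fix h assume h: "L h = 0"
    then have snd0: "snd h = 0" and e: "fst (fst (L h)) = 0" "fst (snd (fst (L h))) = 0" "snd (snd (fst (L h))) = 0"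
      by (simp_all add: L_eq zero_prod_def)
    have UV: "U p h = 0" "V p h = 0" for p using snd0 by (simp_all add: U_def V_def)
    define l where "l = v $ (1,1,1)"
    have l: "l \<noteq> 0" using v0 by (simp add: l_def)
    have "s h = 0 \<and> t h = 0 \<and> r h = 0"
    proof (rule inj)
      have "l * (u $ (2,2,1) * (v $ (2,2,1) * s h + v $ (1,2,2) * r h) + u $ (2,1,2) * (v $ (2,1,2) * s h + v $ (1,2,2) * t h)) =
          l * (u $ (1,1,1) * v $ (1,1,1) * s h)"
        using e(1) by (simp add: L_eq UV l_def algebra_simps)
      then show "u $ (2,2,1) * (v $ (2,2,1) * s h + v $ (1,2,2) * r h) + u $ (2,1,2) * (v $ (2,1,2) * s h + v $ (1,2,2) * t h) =
          u $ (1,1,1) * v $ (1,1,1) * s h" by (rule mult_left_cancel[OF l, THEN iffD1])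
      have "l * (u $ (2,2,1) * (v $ (2,2,1) * t h + v $ (2,1,2) * r h) + u $ (1,2,2) * (v $ (2,1,2) * s h + v $ (1,2,2) * t h)) =
          l * (u $ (1,1,1) * v $ (1,1,1) * t h)"
        using e(2) by (simp add: L_eq UV l_def algebra_simps)
      then show "u $ (2,2,1) * (v $ (2,2,1) * t h + v $ (2,1,2) * r h) + u $ (1,2,2) * (v $ (2,1,2) * s h + v $ (1,2,2) * t h) =
          u $ (1,1,1) * v $ (1,1,1) * t h" by (rule mult_left_cancel[OF l, THEN iffD1])
      have "l * (u $ (2,1,2) * (v $ (2,2,1) * t h + v $ (2,1,2) * r h) + u $ (1,2,2) * (v $ (2,2,1) * s h + v $ (1,2,2) * r h)) =
          l * (u $ (1,1,1) * v $ (1,1,1) * r h)"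
        using e(3) by (simp add: L_eq UV l_def algebra_simps)
      then show "u $ (2,1,2) * (v $ (2,2,1) * t h + v $ (2,1,2) * r h) + u $ (1,2,2) * (v $ (2,2,1) * s h + v $ (1,2,2) * r h) =
          u $ (1,1,1) * v $ (1,1,1) * r h" by (rule mult_left_cancel[OF l, THEN iffD1])
    qed
    then show "h = 0" using snd0 by (simp add: s_def t_def r_def prod_eq_iff)
  qed
  then obtain L' where L': "linear L'" "\<And>x. L (L' x) = x"
    using linear_injective_isomorphism[OF lin] by blast
  define a where "a = (\<lambda>x. vec2 1 (s x))"
  define b where "b = (\<lambda>x. vec2 1 (t x))"
  define c where "c = (\<lambda>x. vec2 1 (r x))"
  define th where "th = (\<lambda>x. al1 x + s x * al2 x)"
  define k where "k = (\<lambda>x. U (1,1,1) x * be1 x * ga1 x + U (1,1,2) x * be1 x * ga2 x + U (1,2,1) x * be2 x * ga1 x + U (1,2,2) x * be2 x * ga2 x)"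
  define Z where "Z = (\<lambda>x. (k x / (th x)\<^sup>2) *s tensor3 (a x) (b x) (c x))"
  define W where "W = (\<lambda>x. (1 / (th x)\<^sup>2) *s tensor3 (vec2 (al1 x) (al2 x)) (vec2 (be1 x) (be2 x)) (vec2 (ga1 x) (ga2 x)))"
  have cs: "isCont s x" "isCont t x" "isCont r x" "isCont (U p) x" "isCont (V p) x" for x p
    unfolding s_def t_def r_def U_def V_def by (intro continuous_intros)+
  have cabg: "isCont al1 x" "isCont al2 x" "isCont be1 x" "isCont be2 x" "isCont ga1 x" "isCont ga2 x" for x
    unfolding abg by (intro continuous_intros cs)+
  have cth: "isCont th x" "isCont k x" for x unfolding th_def k_def by (intro continuous_intros cs cabg)+
  have th0: "th x0 = v $ (1,1,1)" and k0: "k x0 = u $ (1,1,1) * (v $ (1,1,1))\<^sup>2"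
    by (simp_all add: th_def k_def at0 abg0 power2_eq_square)
  have "(\<lambda>x. Z x $ p) \<midarrow>x0\<rightarrow> Z x0 $ p" "(\<lambda>x. W x $ p) \<midarrow>x0\<rightarrow> W x0 $ p" for p
  proof -
    obtain i j l where p: "p = (i, j, l)" by (cases p)
    have "isCont (\<lambda>x. Z x $ p) x0" "isCont (\<lambda>x. W x $ p) x0"
      unfolding Z_def W_def a_def b_def c_def p vector_smult_component tensor3_nth vector_add_component
      by (intro continuous_intros cs cabg cth; use th0 v0 in simp)+
    then show "(\<lambda>x. Z x $ p) \<midarrow>x0\<rightarrow> Z x0 $ p" "(\<lambda>x. W x $ p) \<midarrow>x0\<rightarrow> W x0 $ p" by (simp_all add: isCont_def)
  qed
  then have "Z \<midarrow>x0\<rightarrow> Z x0" "W \<midarrow>x0\<rightarrow> W x0" by (auto intro: vec_tendstoI)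
  then have "(\<lambda>x. (Z x, W x)) \<midarrow>x0\<rightarrow> (Z x0, W x0)" by (rule tendsto_Pair)
  then have cZW: "isCont (\<lambda>x. (Z x, W x)) x0" by (simp add: isCont_def)
  have ZW0: "(Z x0, W x0) = (u $ (1,1,1) *s tensor3 e1 e1 e1, v $ (1,1,1) *s tensor3 e1 e1 e1)"
  proof -
    have "Z x0 = u $ (1,1,1) *s tensor3 e1 e1 e1"
      using v0 by (simp add: Z_def a_def b_def c_def at0 th0 k0)
    moreover have "W x0 = v $ (1,1,1) *s tensor3 e1 e1 e1"
      using v0 by (simp add: W_def abg0 th0 tensor3_scale vector_smult_assoc power2_eq_square)
    ultimately show ?thesis by simp
  qed
  have "eventually (\<lambda>x. th x \<noteq> 0 \<and> k x \<noteq> 0 \<and> dist (Z x, W x) (Z x0, W x0) < \<epsilon>) (nhds x0)"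
  proof (intro eventually_conj)
    show "eventually (\<lambda>x. th x \<noteq> 0) (nhds x0)"
      by (rule tendsto_imp_eventually_ne[OF isCont_tendsto_nhds[OF cth(1)]]) (use th0 v0 in simp)
    show "eventually (\<lambda>x. k x \<noteq> 0) (nhds x0)"
      by (rule tendsto_imp_eventually_ne[OF isCont_tendsto_nhds[OF cth(2)]]) (use k0 v0 u0 in simp)
    show "eventually (\<lambda>x. dist (Z x, W x) (Z x0, W x0) < \<epsilon>) (nhds x0)"
      using tendstoD[OF isCont_tendsto_nhds[OF cZW] \<epsilon>] .
  qed
  then obtain S where S: "open S" "x0 \<in> S" "\<And>x. x \<in> S \<Longrightarrow> th x \<noteq> 0 \<and> k x \<noteq> 0 \<and> dist (Z x, W x) (Z x0, W x0) < \<epsilon>"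
    unfolding eventually_nhds by blast
  have "isCont Th x" for x
    unfolding Th_def F1_def F2_def F3_def by (intro continuous_intros cs cabg)
  then have cont: "continuous_on S Th" by (intro continuous_at_imp_continuous_on ballI)
  have "Th x0 \<in> interior (Th ` S)"
  proof (rule sussmann_open_mapping[OF S(1) cont S(2) L, of L'])
    show "bounded_linear L'" using L'(1) by (rule linear_linear[THEN iffD2])
    show "L \<circ> L' = id" using L'(2) by (simp add: fun_eq_iff)
    show "x0 \<in> interior S" using S by (simp add: interior_open)
  qed simp
  moreover have "Th x0 = ((0, 0, 0), (u, v))"
    by (simp add: Th_def F1_def F2_def F3_def at0 abg0 u0) (simp add: x0_def)
  ultimately obtain \<eta> where \<eta>: "\<eta> > 0" "ball ((0, 0, 0), (u, v)) \<eta> \<subseteq> Th ` S"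
    unfolding mem_interior by auto
  have "eventually (\<lambda>y. dist y (u, v) < \<eta>) (nhds (u, v))" using \<eta>(1) by (rule eventually_nhds_ball[unfolded mem_ball, THEN eventually_mono]) (simp add: dist_commute)
  then show "eventually (\<lambda>y. \<exists>q \<in> Sol (fst y) (snd y). dist q (u $ (1,1,1) *s tensor3 e1 e1 e1, v $ (1,1,1) *s tensor3 e1 e1 e1) < \<epsilon>) (nhds (u, v))"
  proof (rule eventually_mono)
    fix y assume "dist y (u, v) < \<eta>"
    then have "((0, 0, 0), y) \<in> ball ((0, 0, 0), (u, v)) \<eta>" by (simp add: dist_Pair_Pair dist_commute)
    then have "((0, 0, 0), y) \<in> Th ` S" by (rule subsetD[OF \<eta>(2)])
    then obtain x where x: "x \<in> S" "Th x = ((0, 0, 0), y)" by (elim imageE) simp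
    have y: "snd x = y" and F0: "F1 x = 0" "F2 x = 0" "F3 x = 0" using x(2) by (auto simp: Th_def)
    have tv: "tri (($) (snd y)) e1 (b x) (c x) = al1 x" "tri (($) (snd y)) e2 (b x) (c x) = al2 x"
      "tri (($) (snd y)) (a x) e1 (c x) = be1 x" "tri (($) (snd y)) (a x) e2 (c x) = be2 x"
      "tri (($) (snd y)) (a x) (b x) e1 = ga1 x" "tri (($) (snd y)) (a x) (b x) e2 = ga2 x"
      by (simp_all add: tri_def sum_idx abg a_def b_def c_def V_def y algebra_simps)
    have tth: "tri (($) (snd y)) (a x) (b x) (c x) = th x"
      by (simp add: th_def tri_linear(1)[of _ "a x"] tv) (simp add: a_def)
    have tu: "tri (($) (fst y)) x' (vec2 p1 p2) (vec2 q1 q2) =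
        x' $ 1 * (U (1,1,1) x * p1 * q1 + U (1,1,2) x * p1 * q2 + U (1,2,1) x * p2 * q1 + U (1,2,2) x * p2 * q2)
        + x' $ 2 * (U (2,1,1) x * p1 * q1 + U (2,1,2) x * p1 * q2 + U (2,2,1) x * p2 * q1 + U (2,2,2) x * p2 * q2)"
      for x' p1 p2 q1 q2 by (simp add: tri_def sum_idx U_def y algebra_simps)
    have tu': "tri (($) (fst y)) (vec2 p1 p2) x' (vec2 q1 q2) =
        x' $ 1 * (U (1,1,1) x * p1 * q1 + U (1,1,2) x * p1 * q2 + U (2,1,1) x * p2 * q1 + U (2,1,2) x * p2 * q2)
        + x' $ 2 * (U (1,2,1) x * p1 * q1 + U (1,2,2) x * p1 * q2 + U (2,2,1) x * p2 * q1 + U (2,2,2) x * p2 * q2)"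
      for x' p1 p2 q1 q2 by (simp add: tri_def sum_idx U_def y algebra_simps)
    have tu'': "tri (($) (fst y)) (vec2 p1 p2) (vec2 q1 q2) x' =
        x' $ 1 * (U (1,1,1) x * p1 * q1 + U (1,2,1) x * p1 * q2 + U (2,1,1) x * p2 * q1 + U (2,2,1) x * p2 * q2)
        + x' $ 2 * (U (1,1,2) x * p1 * q1 + U (1,2,2) x * p1 * q2 + U (2,1,2) x * p2 * q1 + U (2,2,2) x * p2 * q2)"
      for x' p1 p2 q1 q2 by (simp add: tri_def sum_idx U_def y algebra_simps)
    have kx: "tri (($) (fst y)) e1 (vec2 (be1 x) (be2 x)) (vec2 (ga1 x) (ga2 x)) = k x"
      unfolding tu by (simp add: k_def)
    note sol = Sol_from_fixed_point[where u = "fst y" and v = "snd y" and s = "s x" and t = "t x" and r = "r x",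
        folded a_def b_def c_def, unfolded a_def[symmetric, THEN fun_cong] b_def[symmetric, THEN fun_cong] c_def[symmetric, THEN fun_cong] tv tth kx]
    have "(Z x, W x) \<in> Sol (fst y) (snd y)"
      unfolding Z_def W_def
    proof (rule sol)
      show "th x \<noteq> 0" "k x \<noteq> 0" using S(3)[OF x(1)] by auto
      show "tri (($) (fst y)) e2 (vec2 (be1 x) (be2 x)) (vec2 (ga1 x) (ga2 x)) = s x * k x"
        unfolding tu using F0(1) by (simp add: F1_def k_def)
      show "tri (($) (fst y)) (vec2 (al1 x) (al2 x)) e2 (vec2 (ga1 x) (ga2 x)) =
          t x * tri (($) (fst y)) (vec2 (al1 x) (al2 x)) e1 (vec2 (ga1 x) (ga2 x))"
        unfolding tu' using F0(2) by (simp add: F2_def)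
      show "tri (($) (fst y)) (vec2 (al1 x) (al2 x)) (vec2 (be1 x) (be2 x)) e2 =
          r x * tri (($) (fst y)) (vec2 (al1 x) (al2 x)) (vec2 (be1 x) (be2 x)) e1"
        unfolding tu'' using F0(3) by (simp add: F3_def)
    qed
    then show "\<exists>q \<in> Sol (fst y) (snd y). dist q (u $ (1,1,1) *s tensor3 e1 e1 e1, v $ (1,1,1) *s tensor3 e1 e1 e1) < \<epsilon>"
      using S(3)[OF x(1)] unfolding ZW0[symmetric] by blast
  qed
qed

lemma isCont_act: "isCont (act P Q R) y"
proof -
  have "(\<lambda>y. act P Q R y $ p) \<midarrow>y\<rightarrow> act P Q R y $ p" for p
  proof -
    obtain i j k where p: "p = (i, j, k)" by (cases p)
    have "isCont (\<lambda>y. act P Q R y $ p) y" unfolding p act_nth tri_def by (intro continuous_intros)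
    then show ?thesis by (simp add: isCont_def)
  qed
  then show ?thesis unfolding isCont_def by (rule vec_tendstoI)
qed

lemma persistent_act:
  assumes P: "dual P P'" and Q: "dual Q Q'" and R: "dual R R'"
    and pers: "persistent (act P Q R u) (act P' Q' R' v) (z, w)"
  shows "persistent u v (act (trn P') (trn Q') (trn R') z, act (trn P) (trn Q) (trn R) w)"
  unfolding persistent_def
proof (intro allI impI)
  fix \<epsilon> :: real assume "\<epsilon> > 0"
  let ?f = "\<lambda>x. (act (trn P') (trn Q') (trn R') (fst x), act (trn P) (trn Q) (trn R) (snd x))"
  let ?g = "\<lambda>x. (act P Q R (fst x), act P' Q' R' (snd x))"
  have c1: "isCont ?f (z, w)" and c2: "isCont ?g (u, v)"
    by (intro continuous_intros isCont_o2[OF _ isCont_act])+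
  obtain \<delta> where \<delta>: "\<delta> > 0" "\<And>q. dist q (z, w) < \<delta> \<Longrightarrow> dist (?f q) (?f (z, w)) < \<epsilon>"
    using c1 \<open>\<epsilon> > 0\<close> unfolding continuous_at_eps_delta by blast
  have "eventually (\<lambda>x. \<exists>q \<in> Sol (fst x) (snd x). dist q (z, w) < \<delta>) (nhds (?g (u, v)))"
    using pers \<delta>(1) by (simp add: persistent_def)
  then have "eventually (\<lambda>x. \<exists>q \<in> Sol (fst (?g x)) (snd (?g x)). dist q (z, w) < \<delta>) (nhds (u, v))"
    using isCont_tendsto_nhds[OF c2]
    by (rule eventually_compose_filterlim[where f = ?g and P = "\<lambda>x. \<exists>q \<in> Sol (fst x) (snd x). dist q (z, w) < \<delta>"])
  then show "eventually (\<lambda>x. \<exists>q \<in> Sol (fst x) (snd x).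
      dist q (act (trn P') (trn Q') (trn R') z, act (trn P) (trn Q) (trn R) w) < \<epsilon>) (nhds (u, v))"
  proof (rule eventually_mono)
    fix x assume "\<exists>q \<in> Sol (fst (?g x)) (snd (?g x)). dist q (z, w) < \<delta>"
    then obtain q where q: "q \<in> Sol (act P Q R (fst x)) (act P' Q' R' (snd x))" "dist q (z, w) < \<delta>" by auto
    have tt: "trn (trn M) = M" for M by (simp add: trn_def Finite_Cartesian_Product.vec_eq_iff)
    have "?f q \<in> Sol (act (trn P') (trn Q') (trn R') (act P Q R (fst x))) (act (trn P) (trn Q) (trn R) (act P' Q' R' (snd x)))"
      by (rule Sol_act[OF dual_trn[OF P] dual_trn[OF Q] dual_trn[OF R]]) (use q(1) in simp)
    then have "?f q \<in> Sol (fst x) (snd x)"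
      by (simp only: act_inverse[OF P Q R] act_inverse[OF dual_sym[OF P] dual_sym[OF Q] dual_sym[OF R]])
    then show "\<exists>q \<in> Sol (fst x) (snd x). dist q (act (trn P') (trn Q') (trn R') z, act (trn P) (trn Q) (trn R) w) < \<epsilon>"
      using \<delta>(2)[OF q(2)] by auto
  qed
qed

section \<open>The number of real solutions near a symmetric configuration\<close>

lemma dist_cnjv: "dist (cnjv x) (cnjv y) = dist x y"
  by (simp add: dist_vec_def dist_norm flip: complex_cnj_diff)

lemma dist_conj_swap: "dist (conj_swap p) (conj_swap q) = dist p q"
  by (simp add: conj_swap_def dist_prod_def dist_cnjv add.commute)

lemma isCont_cnjv: "isCont cnjv x"
  unfolding isCont_def by (rule vec_tendstoI) (auto intro!: tendsto_intros)

lemma continuous_on_PF_conjugates: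
  fixes G :: "('n::finite + 'n \<Rightarrow> complex) \<Rightarrow> complex"
  assumes "G \<in> PF"
  shows "continuous_on UNIV (\<lambda>u. G (case_sum (($) u) (($) (cnjv u))))"
proof -
  obtain p where p: "\<And>x. G x = cpoly_eval x p" using assms by (auto simp: PF_def)
  have "continuous_on UNIV (\<lambda>u :: complex ^ 'n. cpoly_eval (case_sum (($) u) (($) (cnjv u))) p)"
  proof (induction p rule: cpoly_induct)
    case (Var v)
    then show ?case by (cases v) (auto intro!: continuous_intros)
  qed (auto intro!: continuous_intros)
  then show ?thesis by (simp add: p)
qed

lemma finite_pos_lower_bound:
  fixes D :: "real set"
  assumes "finite D" "\<And>d. d \<in> D \<Longrightarrow> d > 0"
  shows "\<exists>\<epsilon>>0. \<forall>d\<in>D. 2 * \<epsilon> \<le> d"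
  using assms by (intro exI[of _ "Min (insert 1 D) / 2"]) simp

text \<open>For generic \<open>y\<close> near \<open>u\<close> there are exactly eight solutions,
  and each point of \<open>B\<close> has one nearby; separation makes this a bijection. It respects
  being fixed by the involution, because the involution is an isometry.\<close>

lemma HDdeg_of_persistent:
  assumes B: "finite B" "card B = 8" and pers: "\<And>p. p \<in> B \<Longrightarrow> persistent u (cnjv u) p"
  shows "card {p \<in> B. conj_swap p = p} \<in> HDdeg Segre222"
proof -
  obtain G where G: "G \<in> PF" "\<exists>x. G x \<noteq> 0" and gen: "\<And>u v. G (case_sum (($) u) (($) v)) \<noteq> 0 \<Longrightarrow>
      finite (Sol u v) \<and> card (Sol u v) = 8 \<and> hdet (($) u) \<noteq> 0 \<and> hdet (($) v) \<noteq> 0"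
    using exists_generic by blast
  \<comment> \<open>The distances to be kept apart: between distinct points of \<open>B\<close>, and
    between a point and its image under the involution if it moves.\<close>
  let ?D = "(\<lambda>(p, q). dist p q) ` {x \<in> B \<times> B. fst x \<noteq> snd x} \<union> (\<lambda>p. dist (conj_swap p) p) ` {p \<in> B. conj_swap p \<noteq> p}"
  have "finite ?D" using B(1) by simp
  moreover have "d > 0" if "d \<in> ?D" for d using that by auto
  ultimately obtain \<epsilon> where \<epsilon>: "\<epsilon> > 0" and \<epsilon>D: "\<And>d. d \<in> ?D \<Longrightarrow> 2 * \<epsilon> \<le> d"
    using finite_pos_lower_bound[of ?D] by meson
  have sep: "p = q" if "p \<in> B" "q \<in> B" "dist p q < 2 * \<epsilon>" for p q
  proof (rule ccontr)
    assume "p \<noteq> q"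
    then have "dist p q \<in> ?D" using that by force
    then show False using \<epsilon>D[of "dist p q"] that(3) by simp
  qed
  have sepc: "conj_swap p = p" if "p \<in> B" "dist (conj_swap p) p < 2 * \<epsilon>" for p
  proof (rule ccontr)
    assume "conj_swap p \<noteq> p"
    then have "dist (conj_swap p) p \<in> ?D" using that by blast
    then show False using \<epsilon>D[of "dist (conj_swap p) p"] that(2) by simp
  qed
  have "isCont (\<lambda>y. (y, cnjv y)) u" by (intro continuous_intros isCont_cnjv)
  note lim = isCont_tendsto_nhds[OF this]
  have "eventually (\<lambda>y. \<exists>q \<in> Sol y (cnjv y). dist q p < \<epsilon>) (nhds u)" if "p \<in> B" for p
  proof -
    have "eventually (\<lambda>x. \<exists>q \<in> Sol (fst x) (snd x). dist q p < \<epsilon>) (nhds (u, cnjv u))"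
      using pers[OF that] \<epsilon> by (simp add: persistent_def)
    from eventually_compose_filterlim[OF this lim] show ?thesis by simp
  qed
  then have "eventually (\<lambda>y. \<forall>p \<in> B. \<exists>q \<in> Sol y (cnjv y). dist q p < \<epsilon>) (nhds u)"
    using B(1) by (simp add: eventually_ball_finite)
  then obtain W where W: "open W" "u \<in> W" "\<And>y. y \<in> W \<Longrightarrow> \<forall>p \<in> B. \<exists>q \<in> Sol y (cnjv y). dist q p < \<epsilon>"
    unfolding eventually_nhds by blast
  let ?O = "{y. G (case_sum (($) y) (($) (cnjv y))) \<noteq> 0}"
  have "open ?O"
    by (intro open_Collect_neq continuous_on_PF_conjugates G(1) continuous_intros)
  moreover have "W \<inter> ?O \<noteq> {}"
  proof -
    obtain x where "G x \<noteq> 0" using G(2) by blast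
    from PF_nonzero_at_conjugates[OF G(1) this W(1,2)] show ?thesis by auto
  qed
  moreover have "finite (critical_points Segre222 y) \<and>
      card (critical_points Segre222 y) = card {p \<in> B. conj_swap p = p}" if y: "y \<in> W \<inter> ?O" for y
  proof -
    let ?S = "Sol y (cnjv y)"
    have fin: "finite ?S" and card: "card ?S = 8" using gen y by auto
    have "\<forall>p \<in> B. \<exists>q. q \<in> ?S \<and> dist q p < \<epsilon>" using W(3) y by blast
    from bchoice[OF this] obtain f where "\<forall>p \<in> B. f p \<in> ?S \<and> dist (f p) p < \<epsilon>" by (elim exE)
    then have f: "\<And>p. p \<in> B \<Longrightarrow> f p \<in> ?S \<and> dist (f p) p < \<epsilon>" by (rule bspec)
    have inj: "inj_on f B"
    proof (rule inj_onI)
      fix p q assume pq: "p \<in> B" "q \<in> B" "f p = f q"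
      have "dist p q < 2 * \<epsilon>"
        using dist_triangle2[of p q "f p"] f[OF pq(1)] f[OF pq(2)] pq(3) by (simp add: dist_commute)
      then show "p = q" using sep pq by blast
    qed
    have im: "f ` B = ?S"
      using card_image[OF inj] B(2) card f by (intro card_subset_eq fin) auto
    have "conj_swap (f p) = f p \<longleftrightarrow> conj_swap p = p" if p: "p \<in> B" for p
    proof
      assume A: "conj_swap (f p) = f p"
      have "dist (conj_swap p) p \<le> dist (conj_swap p) (conj_swap (f p)) + dist (f p) p"
        using dist_triangle[of "conj_swap p" p "f p"] A by simp
      also have "\<dots> < 2 * \<epsilon>" using f[OF p] by (simp add: dist_conj_swap dist_commute)
      finally show "conj_swap p = p" using sepc p by blast
    next
      assume A: "conj_swap p = p"
      have "conj_swap (f p) \<in> ?S" using f[OF p] conj_swap_Sol by blast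
      then have "conj_swap (f p) \<in> f ` B" unfolding im .
      then obtain q where q: "conj_swap (f p) = f q" "q \<in> B" by (rule imageE)
      have "dist p q \<le> dist (conj_swap p) (conj_swap (f p)) + dist (f q) q"
        using dist_triangle[of p q "f q"] A q(1) by simp
      also have "\<dots> < 2 * \<epsilon>" using f[OF p] f[OF q(2)] by (simp add: dist_conj_swap dist_commute)
      finally have "p = q" using sep p q(2) by blast
      then show "conj_swap (f p) = f p" using q(1) by simp
    qed
    then have "f ` {p \<in> B. conj_swap p = p} = {p \<in> ?S. conj_swap p = p}"
      unfolding im[symmetric] by blast
    moreover have "inj_on f {p \<in> B. conj_swap p = p}" using inj by (rule inj_on_subset) auto
    ultimately have "card {p \<in> ?S. conj_swap p = p} = card {p \<in> B. conj_swap p = p}"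
      using card_image by fastforce
    moreover have "finite {p \<in> ?S. conj_swap p = p}" using fin by simp
    ultimately show ?thesis
      using bij_betw_finite[OF bij_betw_critical_points[of y]] bij_betw_same_card[OF bij_betw_critical_points[of y]]
      by simp
  qed
  ultimately show ?thesis using W(1) unfolding HDdeg_def by blast
qed

text \<open>Besides \<open>l \<noteq> 0\<close>: neither \<open>l\<close> nor \<open>- l\<close> is
  an eigenvalue of the symmetric 3x3 matrix with zero diagonal and off-diagonal entries
  \<open>a\<close>, \<open>b\<close>, \<open>c\<close>.\<close>

definition nondeg :: "'a::field \<Rightarrow> 'a \<Rightarrow> 'a \<Rightarrow> 'a \<Rightarrow> bool" where
  "nondeg l a b c \<longleftrightarrow> l \<noteq> 0 \<and> l * (l\<^sup>2 - a\<^sup>2 - b\<^sup>2 - c\<^sup>2) \<noteq> 2 * a * b * c \<and> l * (l\<^sup>2 - a\<^sup>2 - b\<^sup>2 - c\<^sup>2) \<noteq> - (2 * a * b * c)"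

lemma nondeg_of_real:
  assumes "nondeg l a b (c :: real)"
  shows "nondeg (of_real l :: complex) (of_real a) (of_real b) (of_real c)"
proof -
  have "of_real (l * (l\<^sup>2 - a\<^sup>2 - b\<^sup>2 - c\<^sup>2)) \<noteq> (of_real (2 * a * b * c) :: complex)"
    "of_real (l * (l\<^sup>2 - a\<^sup>2 - b\<^sup>2 - c\<^sup>2)) \<noteq> (of_real (- (2 * a * b * c)) :: complex)"
    using assms unfolding of_real_eq_iff nondeg_def by simp_all
  then show ?thesis using assms by (simp add: nondeg_def)
qed

text \<open>The system is multiplied by the adjugate of \<open>l - H\<close>, where \<open>H\<close>
  is the symmetric matrix with zero diagonal; its determinant is the difference of the two sides of
  the first hypothesis.\<close>

lemma symmetric_kernel:
  fixes l a b c x y z :: complex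
  assumes "l * (l\<^sup>2 - a\<^sup>2 - b\<^sup>2 - c\<^sup>2) \<noteq> 2 * a * b * c"
    and "c * y + b * z = l * x" "c * x + a * z = l * y" "b * x + a * y = l * z"
  shows "x = 0 \<and> y = 0 \<and> z = 0"
proof -
  have "(l * (l\<^sup>2 - a\<^sup>2 - b\<^sup>2 - c\<^sup>2) - 2 * a * b * c) * x = 0" "(l * (l\<^sup>2 - a\<^sup>2 - b\<^sup>2 - c\<^sup>2) - 2 * a * b * c) * y = 0"
    "(l * (l\<^sup>2 - a\<^sup>2 - b\<^sup>2 - c\<^sup>2) - 2 * a * b * c) * z = 0"
  proof -
    define X Y Z where "X = l * x - (c * y + b * z)" and "Y = l * y - (c * x + a * z)" and "Z = l * z - (b * x + a * y)"
    have "(l * (l\<^sup>2 - a\<^sup>2 - b\<^sup>2 - c\<^sup>2) - 2 * a * b * c) * x = (l * l - a * a) * X + (c * l + a * b) * Y + (a * c + b * l) * Z"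
      "(l * (l\<^sup>2 - a\<^sup>2 - b\<^sup>2 - c\<^sup>2) - 2 * a * b * c) * y = (c * l + a * b) * X + (l * l - b * b) * Y + (a * l + b * c) * Z"
      "(l * (l\<^sup>2 - a\<^sup>2 - b\<^sup>2 - c\<^sup>2) - 2 * a * b * c) * z = (a * c + b * l) * X + (a * l + b * c) * Y + (l * l - c * c) * Z"
      unfolding X_def Y_def Z_def power2_eq_square by (simp_all add: algebra_simps)
    moreover have "X = 0" "Y = 0" "Z = 0" using assms(2-4) by (simp_all add: X_def Y_def Z_def)
    ultimately show "(l * (l\<^sup>2 - a\<^sup>2 - b\<^sup>2 - c\<^sup>2) - 2 * a * b * c) * x = 0" "(l * (l\<^sup>2 - a\<^sup>2 - b\<^sup>2 - c\<^sup>2) - 2 * a * b * c) * y = 0"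
      "(l * (l\<^sup>2 - a\<^sup>2 - b\<^sup>2 - c\<^sup>2) - 2 * a * b * c) * z = 0" by simp_all
  qed
  then show ?thesis using assms(1) by simp
qed

text \<open>With the symmetric matrix \<open>H\<close> of \<open>nondeg\<close>, the hypotheses say
  that \<open>H^2 - l^2\<close> kills the vector. It factors as \<open>(H - l) (H + l)\<close>, and
  both factors are injective.\<close>

lemma nondeg_inj:
  fixes l a b c s t r :: complex
  assumes nd: "nondeg l a b c"
    and h: "c * (c * s + a * r) + b * (b * s + a * t) = l * l * s"
      "c * (c * t + b * r) + a * (b * s + a * t) = l * l * t"
      "b * (c * t + b * r) + a * (c * s + a * r) = l * l * r"
  shows "s = 0 \<and> t = 0 \<and> r = 0"
proof -
  define x y z where "x = c * t + b * r + l * s" and "y = c * s + a * r + l * t" and "z = b * s + a * t + l * r"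
  have "x = 0 \<and> y = 0 \<and> z = 0"
  proof (rule symmetric_kernel)
    show "l * (l\<^sup>2 - a\<^sup>2 - b\<^sup>2 - c\<^sup>2) \<noteq> 2 * a * b * c" using nd by (simp add: nondeg_def)
    show "c * y + b * z = l * x" "c * x + a * z = l * y" "b * x + a * y = l * z"
      using h by (simp_all add: x_def y_def z_def algebra_simps)
  qed
  then have e: "c * t + b * r = - (l * s)" "c * s + a * r = - (l * t)" "b * s + a * t = - (l * r)"
    by (simp_all add: x_def y_def z_def eq_neg_iff_add_eq_0)
  show ?thesis
  proof (rule symmetric_kernel)
    show "(- l) * ((- l)\<^sup>2 - a\<^sup>2 - b\<^sup>2 - c\<^sup>2) \<noteq> 2 * a * b * c"
    proof -
      have e: "(- l) * ((- l)\<^sup>2 - a\<^sup>2 - b\<^sup>2 - c\<^sup>2) = - (l * (l\<^sup>2 - a\<^sup>2 - b\<^sup>2 - c\<^sup>2))" by simp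
      show ?thesis unfolding e minus_equation_iff[of "l * _"] using nd by (simp only: nondeg_def) auto
    qed
    show "c * t + b * r = - l * s" "c * s + a * r = - l * t" "b * s + a * t = - l * r" using e by simp_all
  qed
qed

text \<open>When \<open>U\<close> and \<open>V\<close> are proportional in the entries entering the
  linearization, a single symmetric matrix governs it and \<open>nondeg\<close> suffices. The factor
  \<open>\<kappa>\<close> allows for frames of \<open>u\<close> and \<open>v\<close> with different
  scales.\<close>

lemma persistent_symmetric:
  fixes u v U V :: "complex ^ idx" and \<kappa> :: complex
  assumes d: "dual P P'" "dual Q Q'" "dual R R'"
    and U: "U = act P Q R u" and V: "V = act P' Q' R' v"
    and U0: "U $ (2,1,1) = 0" "U $ (1,2,1) = 0" "U $ (1,1,2) = 0"
    and \<kappa>: "\<kappa> \<noteq> 0" and pp: "V $ (1,1,1) = \<kappa> * U $ (1,1,1)" "V $ (2,1,1) = 0" "V $ (1,2,1) = 0" "V $ (1,1,2) = 0"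
      "V $ (1,2,2) = \<kappa> * U $ (1,2,2)" "V $ (2,1,2) = \<kappa> * U $ (2,1,2)" "V $ (2,2,1) = \<kappa> * U $ (2,2,1)"
    and nd: "nondeg (U $ (1,1,1)) (U $ (1,2,2)) (U $ (2,1,2)) (U $ (2,2,1))"
  shows "persistent u v (U $ (1,1,1) *s tensor3 (P' $ 1) (Q' $ 1) (R' $ 1), (\<kappa> * U $ (1,1,1)) *s tensor3 (P $ 1) (Q $ 1) (R $ 1))"
proof -
  have "persistent U V (U $ (1,1,1) *s tensor3 e1 e1 e1, V $ (1,1,1) *s tensor3 e1 e1 e1)"
  proof (rule persistent_normal_form)
    show "U $ (1,1,1) \<noteq> 0" "V $ (1,1,1) \<noteq> 0" using nd \<kappa> pp(1) by (simp_all add: nondeg_def)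
    fix s t r
    define l a b c where "l = U $ (1,1,1)" and "a = U $ (1,2,2)" and "b = U $ (2,1,2)" and "c = U $ (2,2,1)"
    assume h: "U $ (2,2,1) * (V $ (2,2,1) * s + V $ (1,2,2) * r) + U $ (2,1,2) * (V $ (2,1,2) * s + V $ (1,2,2) * t) = U $ (1,1,1) * V $ (1,1,1) * s"
      "U $ (2,2,1) * (V $ (2,2,1) * t + V $ (2,1,2) * r) + U $ (1,2,2) * (V $ (2,1,2) * s + V $ (1,2,2) * t) = U $ (1,1,1) * V $ (1,1,1) * t"
      "U $ (2,1,2) * (V $ (2,2,1) * t + V $ (2,1,2) * r) + U $ (1,2,2) * (V $ (2,2,1) * s + V $ (1,2,2) * r) = U $ (1,1,1) * V $ (1,1,1) * r"
    have h': "\<kappa> * (c * (c * s + a * r) + b * (b * s + a * t)) = \<kappa> * (l * l * s)"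
      "\<kappa> * (c * (c * t + b * r) + a * (b * s + a * t)) = \<kappa> * (l * l * t)"
      "\<kappa> * (b * (c * t + b * r) + a * (c * s + a * r)) = \<kappa> * (l * l * r)"
      using h unfolding pp l_def[symmetric] a_def[symmetric] b_def[symmetric] c_def[symmetric]
      by (simp_all only: algebra_simps)
    show "s = 0 \<and> t = 0 \<and> r = 0"
      by (rule nondeg_inj[OF nd[folded l_def a_def b_def c_def]]; rule mult_left_cancel[OF \<kappa>, THEN iffD1]; rule h')
  qed (use U0 pp in simp_all)
  from persistent_act[OF d this[unfolded U V]]
  have "persistent u v (act (trn P') (trn Q') (trn R') (tensor3 (U $ (1,1,1) *s e1) e1 e1), act (trn P) (trn Q) (trn R) (tensor3 (V $ (1,1,1) *s e1) e1 e1))"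
    unfolding U V tensor3_scale .
  moreover have "app (trn M) (k *s e1) = k *s M $ 1" "app (trn M) e1 = M $ 1" for M k
    by (simp_all add: comb_trn comb_def)
  ultimately have "persistent u v (tensor3 (U $ (1,1,1) *s P' $ 1) (Q' $ 1) (R' $ 1), tensor3 (V $ (1,1,1) *s P $ 1) (Q $ 1) (R $ 1))"
    by (simp only: act_tensor3)
  then show ?thesis by (simp only: tensor3_scale pp(1))
qed

text \<open>Only indices with an even number of 2s occur. Each of the four basis tensors, with its
  coefficient, is therefore critical, and the other four solutions can be written down.\<close>

definition base_tensor :: "real \<Rightarrow> real \<Rightarrow> complex ^ idx" where
  "base_tensor x b = of_real x *s tensor3 e1 e1 e1 + tensor3 e1 e2 e2 + tensor3 e2 e1 e2 + of_real b *s tensor3 e2 e2 e1"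

lemma tri_base_tensor: "tri (($) (base_tensor x b)) p q r =
    of_real x * p $ 1 * q $ 1 * r $ 1 + p $ 1 * q $ 2 * r $ 2 + p $ 2 * q $ 1 * r $ 2 + of_real b * p $ 2 * q $ 2 * r $ 1"
  by (simp add: tri_def sum_idx base_tensor_def algebra_simps)

lemma cnjv_base_tensor: "cnjv (base_tensor x b) = base_tensor x b"
  by (auto simp: Finite_Cartesian_Product.vec_eq_iff forall_2 base_tensor_def)

definition mat2 :: "complex \<Rightarrow> complex \<Rightarrow> complex \<Rightarrow> complex \<Rightarrow> complex ^ 2 ^ 2" where
  "mat2 a b c d = (\<chi> i. if i = 1 then vec2 a b else vec2 c d)"

lemma mat2_nth [simp]: "mat2 a b c d $ 1 = vec2 a b" "mat2 a b c d $ 2 = vec2 c d"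
  by (simp_all add: mat2_def)

lemma dual_mat2:
  assumes "k * (1 + f * s) = 1"
  shows "dual (mat2 1 f (- s) 1) (mat2 k (k * s) (- (k * f)) k)"
proof -
  have "(a1 + f * a2) * k + (- s * a1 + a2) * (- (k * f)) = (k * (1 + f * s)) * a1"
    "(a1 + f * a2) * (k * s) + (- s * a1 + a2) * k = (k * (1 + f * s)) * a2"
    "(a1 * k + a2 * (- (k * f))) + f * (a1 * (k * s) + a2 * k) = (k * (1 + f * s)) * a1"
    "- s * (a1 * k + a2 * (- (k * f))) + (a1 * (k * s) + a2 * k) = (k * (1 + f * s)) * a2" for a1 a2
    by (simp_all add: algebra_simps)
  then have "(a1 + f * a2) * k + (- s * a1 + a2) * (- (k * f)) = a1"
    "(a1 + f * a2) * (k * s) + (- s * a1 + a2) * k = a2"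
    "(a1 * k + a2 * (- (k * f))) + f * (a1 * (k * s) + a2 * k) = a1"
    "- s * (a1 * k + a2 * (- (k * f))) + (a1 * (k * s) + a2 * k) = a2" for a1 a2
    unfolding assms mult_1 by blast+
  then show ?thesis by (simp add: dual_def vec2_eq_iff comb_def app_def dot2_def)
qed

lemma dual_id: "dual (mat2 1 0 0 1) (mat2 1 0 0 1)" and dual_flip: "dual (mat2 0 1 1 0) (mat2 0 1 1 0)"
  by (simp_all add: dual_def vec2_eq_iff comb_def app_def dot2_def)

text \<open>Swapping the coordinates in two slots moves each basis tensor to \<open>e1 e1 e1\<close>
  and preserves the shape of the family, so \<open>nondeg\<close> is required for four arrangements
  of the coefficients.\<close>

lemma persistent_basis:
  fixes x b :: real
  defines "B \<equiv> base_tensor x b"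
  assumes nd: "nondeg x 1 1 b" "nondeg 1 x b 1" "nondeg 1 b x 1" "nondeg b 1 1 x"
  shows "persistent B B (of_real x *s tensor3 e1 e1 e1, of_real x *s tensor3 e1 e1 e1)"
    "persistent B B (tensor3 e1 e2 e2, tensor3 e1 e2 e2)"
    "persistent B B (tensor3 e2 e1 e2, tensor3 e2 e1 e2)"
    "persistent B B (of_real b *s tensor3 e2 e2 e1, of_real b *s tensor3 e2 e2 e1)"
proof -
  let ?I = "mat2 1 0 0 1" and ?J = "mat2 0 1 1 0"
  note nd' = nd[THEN nondeg_of_real, unfolded of_real_1]
  note sm = act_nth tri_base_tensor B_def
  have "persistent B B (act ?I ?I ?I B $ (1,1,1) *s tensor3 (?I $ 1) (?I $ 1) (?I $ 1), (1 * act ?I ?I ?I B $ (1,1,1)) *s tensor3 (?I $ 1) (?I $ 1) (?I $ 1))"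
    by (rule persistent_symmetric[OF dual_id dual_id dual_id refl refl]) (use nd'(1) in \<open>simp_all add: sm\<close>)
  then show "persistent B B (of_real x *s tensor3 e1 e1 e1, of_real x *s tensor3 e1 e1 e1)" by (simp add: sm)
  have "persistent B B (act ?I ?J ?J B $ (1,1,1) *s tensor3 (?I $ 1) (?J $ 1) (?J $ 1), (1 * act ?I ?J ?J B $ (1,1,1)) *s tensor3 (?I $ 1) (?J $ 1) (?J $ 1))"
    by (rule persistent_symmetric[OF dual_id dual_flip dual_flip refl refl]) (use nd'(2) in \<open>simp_all add: sm\<close>)
  then show "persistent B B (tensor3 e1 e2 e2, tensor3 e1 e2 e2)" by (simp add: sm)
  have "persistent B B (act ?J ?I ?J B $ (1,1,1) *s tensor3 (?J $ 1) (?I $ 1) (?J $ 1), (1 * act ?J ?I ?J B $ (1,1,1)) *s tensor3 (?J $ 1) (?I $ 1) (?J $ 1))"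
    by (rule persistent_symmetric[OF dual_flip dual_id dual_flip refl refl]) (use nd'(3) in \<open>simp_all add: sm\<close>)
  then show "persistent B B (tensor3 e2 e1 e2, tensor3 e2 e1 e2)" by (simp add: sm)
  have "persistent B B (act ?J ?J ?I B $ (1,1,1) *s tensor3 (?J $ 1) (?J $ 1) (?I $ 1), (1 * act ?J ?J ?I B $ (1,1,1)) *s tensor3 (?J $ 1) (?J $ 1) (?I $ 1))"
    by (rule persistent_symmetric[OF dual_flip dual_flip dual_id refl refl]) (use nd'(4) in \<open>simp_all add: sm\<close>)
  then show "persistent B B (of_real b *s tensor3 e2 e2 e1, of_real b *s tensor3 e2 e2 e1)" by (simp add: sm)
qed

text \<open>The remaining critical points of \<open>base_tensor x b\<close> are proportional to \<open>pt3 s s (\<rho> s)\<close>, where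
  \<open>S = s\<^sup>2\<close> and \<open>\<rho>\<close> solve the linear-fractional system below and \<open>e = \<plusminus>1\<close>.\<close>

definition mixed :: "real \<Rightarrow> real \<Rightarrow> real \<Rightarrow> real \<Rightarrow> real \<Rightarrow> bool" where
  "mixed x b e S \<rho> \<longleftrightarrow> e * e = 1 \<and> S \<noteq> 0 \<and> x + \<rho> * S = e * (\<rho> + b) \<and> \<rho> * (x + b * S) = 2 * e \<and>
     1 + e * S \<noteq> 0 \<and> 1 + e * (\<rho> * \<rho> * S) \<noteq> 0 \<and>
     nondeg (x + 2 * \<rho> * S + b * S) (1 + x * \<rho> * S - e * S - b * e * \<rho> * S)
       (1 + x * \<rho> * S - e * S - b * e * \<rho> * S) (b + x * S - 2 * e * \<rho> * S)"

definition mixed_point :: "real \<Rightarrow> real \<Rightarrow> real \<Rightarrow> complex \<Rightarrow> (complex ^ idx) \<times> (complex ^ idx)" where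
  "mixed_point m e \<rho> s = (of_real m *s pt3 s s (of_real \<rho> * s),
     of_real m *s pt3 (of_real e * s) (of_real e * s) (of_real e * (of_real \<rho> * s)))"

definition mixed_scale :: "real \<Rightarrow> real \<Rightarrow> real \<Rightarrow> real \<Rightarrow> real \<Rightarrow> real" where
  "mixed_scale x b e S \<rho> = (x + 2 * \<rho> * S + b * S) / ((1 + e * S) * (1 + e * S) * (1 + e * (\<rho> * \<rho> * S)))"

lemma persistent_mixed_point:
  fixes x b e S \<rho> :: real and s :: complex
  assumes mx: "mixed x b e S \<rho>" and s: "s * s = of_real S"
  shows "persistent (base_tensor x b) (base_tensor x b) (mixed_point (mixed_scale x b e S \<rho>) e \<rho> s)"
proof -
  define X b' E r where "X = complex_of_real x" and "b' = complex_of_real b" and "E = complex_of_real e" and "r = complex_of_real \<rho>"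
  note rep = X_def[symmetric] b'_def[symmetric] E_def[symmetric] r_def[symmetric] s[symmetric]
  define k k3 where "k = inverse (1 + E * (s * s))" and "k3 = inverse (1 + E * (r * r * (s * s)))"
  have "complex_of_real (e * e) = of_real 1" "complex_of_real (x + \<rho> * S) = of_real (e * (\<rho> + b))"
    "complex_of_real (\<rho> * (x + b * S)) = of_real (2 * e)"
    using mx unfolding of_real_eq_iff mixed_def by blast+
  then have EE: "E * E = 1" and c1: "X + r * (s * s) = E * (r + b')" and c2: "r * (X + b' * (s * s)) = 2 * E"
    by (simp_all add: rep)
  have n: "complex_of_real (1 + e * S) \<noteq> 0" "complex_of_real (1 + e * (\<rho> * \<rho> * S)) \<noteq> 0"
    using mx unfolding of_real_eq_0_iff mixed_def by blast+
  then have n': "1 + E * (s * s) \<noteq> 0" "1 + E * (r * r * (s * s)) \<noteq> 0" by (simp_all add: rep)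
  then have kk: "k * (1 + E * s * s) = 1" "k3 * (1 + E * (r * s) * (r * s)) = 1"
    by (simp_all add: k_def k3_def ac_simps)
  have nz: "k \<noteq> 0" "k3 \<noteq> 0" using n' by (simp_all add: k_def k3_def)
  \<comment> \<open>Frames adapted to the solution: up to scale the first rows of \<open>P'\<close>
    and \<open>R'\<close> are the factors of \<open>z\<close>, those of \<open>P\<close> and
    \<open>R\<close> the factors of \<open>w\<close>. In these frames the solution lies over
    \<open>e1 e1 e1\<close>.\<close>
  define P P' R R' where "P = mat2 1 (E * s) (- s) 1" and "P' = mat2 k (k * s) (- (k * (E * s))) k"
    and "R = mat2 1 (E * (r * s)) (- (r * s)) 1" and "R' = mat2 k3 (k3 * (r * s)) (- (k3 * (E * (r * s)))) k3"
  have d: "dual P P'" "dual R R'" unfolding P_def P'_def R_def R'_def by (rule dual_mat2 kk)+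
  let ?B = "base_tensor x b"
  have Pn: "P $ 1 $ 1 = 1" "P $ 1 $ 2 = E * s" "P $ 2 $ 1 = - s" "P $ 2 $ 2 = 1"
    "R $ 1 $ 1 = 1" "R $ 1 $ 2 = E * (r * s)" "R $ 2 $ 1 = - (r * s)" "R $ 2 $ 2 = 1"
    "P' $ 1 $ 1 = k" "P' $ 1 $ 2 = k * s" "P' $ 2 $ 1 = - (k * (E * s))" "P' $ 2 $ 2 = k"
    "R' $ 1 $ 1 = k3" "R' $ 1 $ 2 = k3 * (r * s)" "R' $ 2 $ 1 = - (k3 * (E * (r * s)))" "R' $ 2 $ 2 = k3"
    by (simp_all add: P_def P'_def R_def R'_def)
  note entry = act_nth tri_base_tensor Pn X_def[symmetric] b'_def[symmetric]
  define \<kappa> l a c where "\<kappa> = k * k * k3" and "l = X + 2 * r * (s * s) + b' * (s * s)"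
    and "a = 1 + X * r * (s * s) - E * (s * s) - b' * E * r * (s * s)" and "c = b' + X * (s * s) - 2 * E * r * (s * s)"
  have "(E - 1) * (E + 1) = 0" using EE by (simp add: algebra_simps)
  then have E1: "E = 1 \<or> E = - 1" by (simp add: eq_neg_iff_add_eq_0)
  \<comment> \<open>The entries next to \<open>(1,1,1)\<close> turn out to be multiples of
    \<open>D1\<close> and \<open>D2\<close>, whose vanishing is the criticality contained in
    \<open>mixed\<close>.\<close>
  define D1 D2 where "D1 = X + r * (s * s) - E * (r + b')" and "D2 = r * (X + b' * (s * s)) - 2 * E"
  have D: "D1 = 0" "D2 = 0" unfolding D1_def D2_def c1 c2 by simp_all
  have U: "act P P R ?B $ (1,1,1) = l" "act P P R ?B $ (1,2,2) = a" "act P P R ?B $ (2,1,2) = a" "act P P R ?B $ (2,2,1) = c"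
    unfolding entry l_def a_def c_def using E1 by (auto simp: algebra_simps)
  have "act P P R ?B $ (2,1,1) = - (s * D1)" "act P P R ?B $ (1,2,1) = - (s * D1)" "act P P R ?B $ (1,1,2) = - (s * D2)"
    unfolding entry D1_def D2_def using E1 by (auto simp: algebra_simps)
  then have U0: "act P P R ?B $ (2,1,1) = 0" "act P P R ?B $ (1,2,1) = 0" "act P P R ?B $ (1,1,2) = 0" by (simp_all add: D)
  have V: "act P' P' R' ?B $ (1,1,1) = \<kappa> * l" "act P' P' R' ?B $ (1,2,2) = \<kappa> * a" "act P' P' R' ?B $ (2,1,2) = \<kappa> * a"
      "act P' P' R' ?B $ (2,2,1) = \<kappa> * c"
    unfolding entry l_def a_def c_def \<kappa>_def using E1 by (auto simp: algebra_simps)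
  have "act P' P' R' ?B $ (2,1,1) = - (\<kappa> * E * s * D1)" "act P' P' R' ?B $ (1,2,1) = - (\<kappa> * E * s * D1)"
      "act P' P' R' ?B $ (1,1,2) = - (\<kappa> * E * s * D2)"
    unfolding entry D1_def D2_def \<kappa>_def using E1 by (auto simp: algebra_simps)
  then have V0: "act P' P' R' ?B $ (2,1,1) = 0" "act P' P' R' ?B $ (1,2,1) = 0" "act P' P' R' ?B $ (1,1,2) = 0" by (simp_all add: D)
  have nd: "nondeg l a a c"
  proof -
    have "nondeg (complex_of_real (x + 2 * \<rho> * S + b * S)) (complex_of_real (1 + x * \<rho> * S - e * S - b * e * \<rho> * S))
       (complex_of_real (1 + x * \<rho> * S - e * S - b * e * \<rho> * S)) (complex_of_real (b + x * S - 2 * e * \<rho> * S))"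
      using mx unfolding mixed_def by (blast intro: nondeg_of_real)
    then show ?thesis by (simp add: rep l_def a_def c_def)
  qed
  have "persistent ?B ?B (act P P R ?B $ (1,1,1) *s tensor3 (P' $ 1) (P' $ 1) (R' $ 1), (\<kappa> * act P P R ?B $ (1,1,1)) *s tensor3 (P $ 1) (P $ 1) (R $ 1))"
    by (rule persistent_symmetric[OF d(1) d(1) d(2) refl refl]) (use nd nz in \<open>simp_all add: U U0 V V0 \<kappa>_def\<close>)
  then have pers: "persistent ?B ?B (l *s tensor3 (P' $ 1) (P' $ 1) (R' $ 1), (\<kappa> * l) *s tensor3 (P $ 1) (P $ 1) (R $ 1))"
    unfolding U(1) .
  have rows: "P' $ 1 = k *s vec2 1 s" "R' $ 1 = k3 *s vec2 1 (r * s)" "P $ 1 = vec2 1 (E * s)" "R $ 1 = vec2 1 (E * (r * s))"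
    by (simp_all only: vec2_eq_iff Pn) simp_all
  have scale: "complex_of_real (mixed_scale x b e S \<rho>) = l * \<kappa>"
    by (simp add: mixed_scale_def rep l_def \<kappa>_def k_def k3_def divide_inverse ac_simps)
  have "l *s tensor3 (P' $ 1) (P' $ 1) (R' $ 1) = of_real (mixed_scale x b e S \<rho>) *s pt3 s s (r * s)"
    "(\<kappa> * l) *s tensor3 (P $ 1) (P $ 1) (R $ 1) = of_real (mixed_scale x b e S \<rho>) *s pt3 (E * s) (E * s) (E * (r * s))"
    by (simp_all only: rows scale tensor3_scale vector_smult_assoc pt3_def \<kappa>_def ac_simps)
  then show ?thesis using pers by (simp only: mixed_point_def r_def E_def)
qed

lemma cnjv_scaled_pt3: "cnjv (of_real m *s pt3 s t r) = of_real m *s pt3 (cnj s) (cnj t) (cnj r)"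
  by (auto simp: Finite_Cartesian_Product.vec_eq_iff forall_2 pt3_def)

text \<open>For \<open>e = 1\<close> the condition means real \<open>s\<close>, so
  \<open>S > 0\<close>; for \<open>e = - 1\<close> imaginary \<open>s\<close>, so
  \<open>S < 0\<close>. These signs decide how many of the four mixed solutions are critical
  points.\<close>

lemma conj_swap_mixed_point:
  assumes "e * e = 1" "m \<noteq> 0"
  shows "conj_swap (mixed_point m e \<rho> s) = mixed_point m e \<rho> s \<longleftrightarrow> cnj s = of_real e * s"
proof
  assume "conj_swap (mixed_point m e \<rho> s) = mixed_point m e \<rho> s"
  then have "of_real m *s pt3 (cnj s) (cnj s) (cnj (of_real \<rho> * s)) = of_real m *s pt3 (of_real e * s) (of_real e * s) (of_real e * (of_real \<rho> * s))"
    by (simp add: conj_swap_def mixed_point_def cnjv_scaled_pt3)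
  then have "(of_real m *s pt3 (cnj s) (cnj s) (cnj (of_real \<rho> * s))) $ (2,1,1) = (of_real m *s pt3 (of_real e * s) (of_real e * s) (of_real e * (of_real \<rho> * s))) $ (2,1,1)"
    by (rule arg_cong)
  then show "cnj s = of_real e * s" using assms(2) by (simp add: pt3_nth)
next
  assume A: "cnj s = of_real e * s"
  have "complex_of_real (e * e) = 1" using assms(1) by simp
  then have E: "complex_of_real e * (of_real e * z) = z" for z by (simp flip: mult.assoc)
  have E': "complex_of_real e * (of_real \<rho> * (of_real e * z)) = of_real \<rho> * z" for z using E[of "of_real \<rho> * z"] by (simp add: ac_simps)
  show "conj_swap (mixed_point m e \<rho> s) = mixed_point m e \<rho> s"
    by (simp add: conj_swap_def mixed_point_def cnjv_scaled_pt3 A E E') (simp add: ac_simps)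
qed

lemma cnj_sqrt_real:
  assumes "s * s = complex_of_real S" "S \<noteq> 0"
  shows "cnj s = s \<longleftrightarrow> S > 0" "cnj s = - s \<longleftrightarrow> S < 0"
proof -
  have "cnj s * cnj s = cnj (s * s)" by simp
  also have "\<dots> = s * s" by (simp only: assms(1) complex_cnj_complex_of_real)
  finally have "cnj s * cnj s = s * s" .
  then have "(cnj s - s) * (cnj s + s) = 0" by (simp add: algebra_simps)
  then have or: "cnj s = s \<or> cnj s = - s" by (simp add: eq_neg_iff_add_eq_0)
  have pos: "S > 0" if "cnj s = s"
  proof -
    have "complex_of_real S = of_real ((cmod s)\<^sup>2)" using complex_norm_square[of s] that assms(1) by simp
    then have "S = (cmod s)\<^sup>2" unfolding of_real_eq_iff .
    then show ?thesis using assms(2) by (metis zero_less_power2 power_zero_numeral)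
  qed
  have neg: "S < 0" if "cnj s = - s"
  proof -
    have "complex_of_real (- S) = of_real ((cmod s)\<^sup>2)" using complex_norm_square[of s] that assms(1) by simp
    then have "- S = (cmod s)\<^sup>2" unfolding of_real_eq_iff .
    then show ?thesis using assms(2) by (metis zero_less_power2 power_zero_numeral neg_0_less_iff_less neg_equal_0_iff_equal)
  qed
  show "cnj s = s \<longleftrightarrow> S > 0" "cnj s = - s \<longleftrightarrow> S < 0" using or pos neg by force+
qed

lemma HDdeg_base_tensor:
  fixes x b S1 S2 \<rho>1 \<rho>2 :: real
  assumes nd: "nondeg x 1 1 b" "nondeg 1 x b 1" "nondeg 1 b x 1" "nondeg b 1 1 x"
    and mx: "mixed x b 1 S1 \<rho>1" "mixed x b (- 1) S2 \<rho>2" and S: "S1 \<noteq> S2"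
  shows "4 + (if S1 > 0 then 2 else 0) + (if S2 < 0 then 2 else 0) \<in> HDdeg Segre222"
proof -
  let ?B = "base_tensor x b"
  define s1 s2 where "s1 = csqrt (of_real S1)" and "s2 = csqrt (of_real S2)"
  have s: "s1 * s1 = of_real S1" "s2 * s2 = of_real S2" by (simp_all add: s1_def s2_def flip: power2_eq_square)
  then have s': "(- s1) * (- s1) = of_real S1" "(- s2) * (- s2) = of_real S2" by simp_all
  have S0: "S1 \<noteq> 0" "S2 \<noteq> 0" using mx by (simp_all add: mixed_def)
  have s0: "s1 \<noteq> 0" "s2 \<noteq> 0" using s S0 by auto
  have ss: "s1 \<noteq> s2" "s1 \<noteq> - s2"
  proof -
    have "s1 * s1 \<noteq> s2 * s2" using S unfolding s of_real_eq_iff .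
    then show "s1 \<noteq> s2" "s1 \<noteq> - s2" by auto
  qed
  define m1 m2 where "m1 = mixed_scale x b 1 S1 \<rho>1" and "m2 = mixed_scale x b (- 1) S2 \<rho>2"
  have m0: "m1 \<noteq> 0" "m2 \<noteq> 0" using mx by (auto simp: m1_def m2_def mixed_scale_def mixed_def nondeg_def)
  have xb: "x \<noteq> 0" "b \<noteq> 0" using nd by (auto simp: nondeg_def)
  let ?b1 = "of_real x *s tensor3 e1 e1 e1" and ?b2 = "tensor3 e1 e2 e2" and ?b3 = "tensor3 e2 e1 e2" and ?b4 = "of_real b *s tensor3 e2 e2 e1"
  let ?Q = "[mixed_point m1 1 \<rho>1 s1, mixed_point m1 1 \<rho>1 (- s1), mixed_point m2 (- 1) \<rho>2 s2, mixed_point m2 (- 1) \<rho>2 (- s2)]"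
  let ?L = "[(?b1, ?b1), (?b2, ?b2), (?b3, ?b3), (?b4, ?b4)] @ ?Q"
  \<comment> \<open>Invariants that separate the eight points: the ratio is nonzero exactly at the
    mixed points and tells them apart, and the flags tell the basis tensors apart, where division by
    0 gives 0.\<close>
  let ?key = "\<lambda>p :: (complex ^ idx) \<times> (complex ^ idx). (fst p $ (2,1,1) / fst p $ (1,1,1), fst p $ (1,1,1) = 0,
      fst p $ (1,1,1) = 0 \<and> fst p $ (1,2,2) \<noteq> 0, fst p $ (1,1,1) = 0 \<and> fst p $ (2,1,2) \<noteq> 0)"
  have "map ?key ?L = [(0, False, False, False), (0, True, True, False), (0, True, False, True), (0, True, False, False),
      (s1, False, False, False), (- s1, False, False, False), (s2, False, False, False), (- s2, False, False, False)]"
    using xb m0 by (simp add: mixed_point_def pt3_nth)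
  moreover have "- s1 \<noteq> s2" "s2 \<noteq> s1" "- s2 \<noteq> s1" using ss by auto
  ultimately have "distinct (map ?key ?L)" using s0 ss by simp
  then have dist: "distinct ?L" by (rule distinct_map[THEN iffD1, THEN conjunct1])
  have "card {p \<in> set ?L. conj_swap p = p} \<in> HDdeg Segre222"
  proof (rule HDdeg_of_persistent)
    show "card (set ?L) = 8" using distinct_card[OF dist] by simp
    have "\<forall>p \<in> set ?L. persistent ?B ?B p"
      using persistent_basis[OF nd] persistent_mixed_point[OF mx(1) s(1)] persistent_mixed_point[OF mx(1) s'(1)]
        persistent_mixed_point[OF mx(2) s(2)] persistent_mixed_point[OF mx(2) s'(2)]
      by (simp add: m1_def m2_def)
    then show "persistent ?B (cnjv ?B) p" if "p \<in> set ?L" for p unfolding cnjv_base_tensor using that by blast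
  qed simp
  also have "card {p \<in> set ?L. conj_swap p = p} = length (filter (\<lambda>p. conj_swap p = p) ?L)"
    using distinct_card[OF distinct_filter[OF dist]] unfolding set_filter .
  also have "\<dots> = 4 + (if S1 > 0 then 2 else 0) + (if S2 < 0 then 2 else 0)"
  proof -
    have cn: "cnjv ?b1 = ?b1" "cnjv ?b2 = ?b2" "cnjv ?b3 = ?b3" "cnjv ?b4 = ?b4"
      by (auto simp: Finite_Cartesian_Product.vec_eq_iff forall_2)
    have basis: "conj_swap (?b1, ?b1) = (?b1, ?b1)" "conj_swap (?b2, ?b2) = (?b2, ?b2)" "conj_swap (?b3, ?b3) = (?b3, ?b3)" "conj_swap (?b4, ?b4) = (?b4, ?b4)"
      by (simp_all only: conj_swap_def fst_conv snd_conv cn)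
    have e: "(1::real) * 1 = 1" "(- 1 :: real) * (- 1) = 1" by simp_all
    have fixed: "conj_swap (mixed_point m1 1 \<rho>1 s1) = mixed_point m1 1 \<rho>1 s1 \<longleftrightarrow> S1 > 0"
      "conj_swap (mixed_point m1 1 \<rho>1 (- s1)) = mixed_point m1 1 \<rho>1 (- s1) \<longleftrightarrow> S1 > 0"
      "conj_swap (mixed_point m2 (- 1) \<rho>2 s2) = mixed_point m2 (- 1) \<rho>2 s2 \<longleftrightarrow> S2 < 0"
      "conj_swap (mixed_point m2 (- 1) \<rho>2 (- s2)) = mixed_point m2 (- 1) \<rho>2 (- s2) \<longleftrightarrow> S2 < 0"
      using conj_swap_mixed_point[OF e(1) m0(1)] conj_swap_mixed_point[OF e(2) m0(2)]
        cnj_sqrt_real(1)[OF s(1) S0(1)] cnj_sqrt_real(1)[OF s'(1) S0(1)] cnj_sqrt_real(2)[OF s(2) S0(2)] cnj_sqrt_real(2)[OF s'(2) S0(2)]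
      by simp_all
    show ?thesis by (simp add: basis fixed)
  qed
  finally show ?thesis .
qed

text \<open>The signs needed are \<open>S1 < 0\<close> and \<open>S2 > 0\<close>. For
  \<open>b = 1\<close> and \<open>\<rho> = 1\<close> both equations in \<open>mixed\<close> become
  \<open>x + S = 2 * e\<close>, so \<open>S1 = 2 - x\<close> and \<open>S2 = - 2 - x\<close>, which
  never have these signs; hence the less symmetric parameters.\<close>

lemma HDdeg_4: "4 \<in> HDdeg Segre222"
proof -
  have "4 + (if (- 13 / 3 :: real) > 0 then 2 else 0) + (if (1 / 15 :: real) < 0 then 2 else 0) \<in> HDdeg Segre222"
    by (rule HDdeg_base_tensor[of "- 2 / 3" "- 2" _ "1 / 4" _ "5 / 2"]) (simp_all add: nondeg_def mixed_def power2_eq_square)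
  then show ?thesis by simp
qed

text \<open>On the symmetric branch \<open>b = 1\<close>, \<open>\<rho> = 1\<close>, any
  \<open>x > 2\<close> makes both \<open>S1\<close> and \<open>S2\<close> negative.\<close>

lemma HDdeg_6: "6 \<in> HDdeg Segre222"
proof -
  have "4 + (if (- 2 :: real) > 0 then 2 else 0) + (if (- 6 :: real) < 0 then 2 else 0) \<in> HDdeg Segre222"
    by (rule HDdeg_base_tensor[of 4 1 _ 1 _ 1]) (simp_all add: nondeg_def mixed_def power2_eq_square)
  then show ?thesis by simp
qed

text \<open>On the symmetric branch, \<open>- 2 < x < 2\<close> gives \<open>S1 > 0\<close> and
  \<open>S2 < 0\<close>; the values 0 and 1 of \<open>x\<close> would violate
  \<open>nondeg\<close>.\<close>

lemma HDdeg_8: "8 \<in> HDdeg Segre222"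
proof -
  have "4 + (if (3 / 2 :: real) > 0 then 2 else 0) + (if (- 5 / 2 :: real) < 0 then 2 else 0) \<in> HDdeg Segre222"
    by (rule HDdeg_base_tensor[of "1 / 2" 1 _ 1 _ 1]) (simp_all add: nondeg_def mixed_def power2_eq_square)
  then show ?thesis by simp
qed

theorem proposition4p7:
  shows "vHDdeg Segre222 = 8 \<and>
    {4, 6, 8} \<subseteq> HDdeg Segre222 \<and> HDdeg Segre222 \<subseteq> {2, 4, 6, 8}"
  using vHDdeg_Segre222 HDdeg_subset HDdeg_4 HDdeg_6 HDdeg_8 by simp

end
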